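(* Let $k$ be an analytic field which is non-trivially valued, and let $\psi\colon\mathcal{B}'\to\mathcal{B}$ and $\phi\colon\mathcal{A}\to\mathcal{B}$ be homomorphisms of strictly $k$-affinoid algebras such that $\psi$ is finite admissible, $\phi$ is surjective and $\psi(\mathcal{B}'^\circ)\subseteq\phi(\mathcal{A}^\circ)$. Then the algebra $\mathcal{A}'=\mathcal{A}\times_{\mathcal{B}}\mathcal{B}'$ with the norm induced from $\mathcal{A}\times\mathcal{B}'$ is $k$-affinoid.
   Context: An analytic field is a field complete with respect to a non-archimedean real valuation. $k$-affinoid algebras are in the sense of Berkovich: Banach $k$-algebras admitting an admissible surjection (quotient norm equivalent to the given norm) from some $k\{r_1^{-1}T_1,\dots,r_n^{-1}T_n\}$ with $r_i>0$; strictly $k$-affinoid means one can take all $r_i=1$. A homomorphism $\mathcal{C}\to\mathcal{D}$ of $k$-affinoid algebras is finite admissible if it makes $\mathcal{D}$ a finite Banach $\mathcal{C}$-module, i.e. there is an admissible surjection of Banach $\mathcal{C}$-modules $\mathcal{C}^n\to\mathcal{D}$. For a $k$-affinoid algebra $\mathcal{A}$ with spectral seminorm $\rho_{\mathcal{A}}$, $\mathcal{A}^\circ=\{a\in\mathcal{A}\mid\rho_{\mathcal{A}}(a)\le1\}$. $\mathcal{A}\times_{\mathcal{B}}\mathcal{B}'=\{(a,b')\in\mathcal{A}\times\mathcal{B}'\mid\phi(a)=\psi(b')\}$ is the fiber product of rings, and $\mathcal{A}\times\mathcal{B}'$ carries the maximum norm. *)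

theory Defs
  imports Complex_Main "HOL-Library.Multiset" "HOL-Library.FuncSet" "HOL-Algebra.Module"
begin

section \<open>Non-archimedean Banach algebras\<close>

text \<open>
  Norms are non-archimedean throughout, and only their values on carriers matter.
  Rings may be zero.
\<close>

locale nonarch_banach_group = abelian_group G for G (structure) and N :: "'a \<Rightarrow> real" +
  assumes norm_nonneg: "x \<in> carrier G \<Longrightarrow> 0 \<le> N x"
    and norm_eq_0_iff: "x \<in> carrier G \<Longrightarrow> N x = 0 \<longleftrightarrow> x = \<zero>"
    and norm_ultra: "\<lbrakk>x \<in> carrier G; y \<in> carrier G\<rbrakk> \<Longrightarrow> N (x \<ominus> y) \<le> max (N x) (N y)"
    and norm_complete:
      "\<lbrakk>\<And>n::nat. s n \<in> carrier G;
        \<And>e. 0 < e \<Longrightarrow> \<exists>n0. \<forall>m\<ge>n0. \<forall>n\<ge>n0. N (s m \<ominus> s n) < e\<rbrakk>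
       \<Longrightarrow> \<exists>l\<in>carrier G. (\<lambda>n. N (s n \<ominus> l)) \<longlonglongrightarrow> 0"

locale analytic_field = field K + nonarch_banach_group K v
  for K (structure) and v :: "'k \<Rightarrow> real" +
  assumes val_mult: "\<lbrakk>x \<in> carrier K; y \<in> carrier K\<rbrakk> \<Longrightarrow> v (x \<otimes> y) = v x * v y"

record ('k, 'a) normed_module = "('k, 'a) module" +
  nrm :: "'a \<Rightarrow> real"

text \<open>
  Together with submultiplicativity, the condition on the norm of \<open>\<one>\<close> says that this norm is 1
  unless the algebra is zero.
\<close>

locale banach_algebra =
  K?: analytic_field K v + A?: algebra K A + A?: nonarch_banach_group A "nrm A"
  for K :: "'k ring" (structure) and v :: "'k \<Rightarrow> real"
    and A :: "('k, 'a) normed_module" (structure) +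
  assumes norm_one: "nrm A \<one>\<^bsub>A\<^esub> \<le> 1"
    and norm_mult: "\<lbrakk>x \<in> carrier A; y \<in> carrier A\<rbrakk> \<Longrightarrow> nrm A (x \<otimes>\<^bsub>A\<^esub> y) \<le> nrm A x * nrm A y"
    and norm_smult: "\<lbrakk>c \<in> carrier K; x \<in> carrier A\<rbrakk> \<Longrightarrow> nrm A (c \<odot>\<^bsub>A\<^esub> x) = v c * nrm A x"

definition banach_algebra_hom ::
    "'k ring \<Rightarrow> ('k, 'a) normed_module \<Rightarrow> ('k, 'b) normed_module \<Rightarrow> ('a \<Rightarrow> 'b) \<Rightarrow> bool" where
  "banach_algebra_hom K A B f \<longleftrightarrow>
     f \<in> ring_hom A B \<and>
     (\<forall>c\<in>carrier K. \<forall>x\<in>carrier A. f (c \<odot>\<^bsub>A\<^esub> x) = c \<odot>\<^bsub>B\<^esub> f x) \<and>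
     (\<exists>C. \<forall>x\<in>carrier A. nrm B (f x) \<le> C * nrm A x)"

definition spectral_seminorm :: "('k, 'a) normed_module \<Rightarrow> 'a \<Rightarrow> real" where
  "spectral_seminorm A a = lim (\<lambda>n. root n (nrm A (a [^]\<^bsub>A\<^esub> n)))"

definition spectral_unit_ball :: "('k, 'a) normed_module \<Rightarrow> 'a set" where
  "spectral_unit_ball A = {a \<in> carrier A. spectral_seminorm A a \<le> 1}"


section \<open>Admissible surjections\<close>

definition quotient_norm :: "('r, 'a) normed_module \<Rightarrow> ('a \<Rightarrow> 'b) \<Rightarrow> 'b \<Rightarrow> real" where
  "quotient_norm M f y = Inf (nrm M ` {x \<in> carrier M. f x = y})"

text \<open>The scalar rings of source and target play no role here, so they may differ.\<close>

definition admissible_surjection ::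
    "('r, 'a) normed_module \<Rightarrow> ('s, 'b) normed_module \<Rightarrow> ('a \<Rightarrow> 'b) \<Rightarrow> bool" where
  "admissible_surjection M N f \<longleftrightarrow>
     f ` carrier M = carrier N \<and>
     (\<exists>c C. 0 < c \<and> 0 < C \<and>
        (\<forall>y\<in>carrier N. c * quotient_norm M f y \<le> nrm N y \<and> nrm N y \<le> C * quotient_norm M f y))"


section \<open>Affinoid algebras\<close>

text \<open>
  The algebra \<open>K{r\<^sub>0\<inverse>T\<^sub>0,\<dots>,r\<^sub>n\<^sub>-\<^sub>1\<inverse>T\<^sub>n\<^sub>-\<^sub>1}\<close>. A monomial is the multiset of its variables, and a power
  series is the function giving its coefficients, zero on monomials with a variable of
  index \<open>\<ge> n\<close>. So \<open>\<Prod>i\<in>#m. r i\<close> is the weight \<open>r\<^sup>m\<close> of \<open>T\<^sup>m\<close>.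
\<close>

definition tate_algebra ::
    "'k ring \<Rightarrow> ('k \<Rightarrow> real) \<Rightarrow> nat \<Rightarrow> (nat \<Rightarrow> real) \<Rightarrow> ('k, nat multiset \<Rightarrow> 'k) normed_module" where
  "tate_algebra K v n r =
     \<lparr>carrier = {f. (\<forall>m. f m \<in> carrier K) \<and>
                    (\<forall>m. \<not> set_mset m \<subseteq> {..<n} \<longrightarrow> f m = \<zero>\<^bsub>K\<^esub>) \<and>
                    ((\<lambda>m. v (f m) * (\<Prod>i\<in>#m. r i)) \<longlongrightarrow> 0) cofinite},
      monoid.mult = (\<lambda>f g m. \<Oplus>\<^bsub>K\<^esub>p\<in>{p. p \<subseteq># m}. f p \<otimes>\<^bsub>K\<^esub> g (m - p)),
      one = (\<lambda>m. if m = {#} then \<one>\<^bsub>K\<^esub> else \<zero>\<^bsub>K\<^esub>),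
      zero = (\<lambda>m. \<zero>\<^bsub>K\<^esub>),
      add = (\<lambda>f g m. f m \<oplus>\<^bsub>K\<^esub> g m),
      smult = (\<lambda>c f m. c \<otimes>\<^bsub>K\<^esub> f m),
      nrm = (\<lambda>f. SUP m. v (f m) * (\<Prod>i\<in>#m. r i))\<rparr>"

definition affinoid_algebra ::
    "'k ring \<Rightarrow> ('k \<Rightarrow> real) \<Rightarrow> ('k, 'a) normed_module \<Rightarrow> bool" where
  "affinoid_algebra K v A \<longleftrightarrow>
     banach_algebra K v A \<and>
     (\<exists>n r f. (\<forall>i<n. 0 < r i) \<and>
        banach_algebra_hom K (tate_algebra K v n r) A f \<and>
        admissible_surjection (tate_algebra K v n r) A f)"

definition strictly_affinoid_algebra ::
    "'k ring \<Rightarrow> ('k \<Rightarrow> real) \<Rightarrow> ('k, 'a) normed_module \<Rightarrow> bool" where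
  "strictly_affinoid_algebra K v A \<longleftrightarrow>
     banach_algebra K v A \<and>
     (\<exists>n f. banach_algebra_hom K (tate_algebra K v n (\<lambda>_. 1)) A f \<and>
        admissible_surjection (tate_algebra K v n (\<lambda>_. 1)) A f)"


section \<open>Finite admissible homomorphisms\<close>

text \<open>
  \<open>C\<^sup>n\<close> as a \<open>C\<close>-module with the maximum norm (zero for \<open>n = 0\<close>); the multiplication is
  only there because the record type of modules has that field.
\<close>

definition free_module :: "('k, 'c) normed_module \<Rightarrow> nat \<Rightarrow> ('c, nat \<Rightarrow> 'c) normed_module" where
  "free_module C n =
     \<lparr>carrier = {..<n} \<rightarrow>\<^sub>E carrier C,
      monoid.mult = (\<lambda>x y. \<lambda>i\<in>{..<n}. x i \<otimes>\<^bsub>C\<^esub> y i),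
      one = (\<lambda>i\<in>{..<n}. \<one>\<^bsub>C\<^esub>),
      zero = (\<lambda>i\<in>{..<n}. \<zero>\<^bsub>C\<^esub>),
      add = (\<lambda>x y. \<lambda>i\<in>{..<n}. x i \<oplus>\<^bsub>C\<^esub> y i),
      smult = (\<lambda>c x. \<lambda>i\<in>{..<n}. c \<otimes>\<^bsub>C\<^esub> x i),
      nrm = (\<lambda>x. Max (insert 0 ((\<lambda>i. nrm C (x i)) ` {..<n})))\<rparr>"

text \<open>\<open>D\<close> as a \<open>C\<close>-module through \<open>h : C \<rightarrow> D\<close>.\<close>

definition module_via ::
    "('c \<Rightarrow> 'd) \<Rightarrow> ('k, 'd) normed_module \<Rightarrow> ('c, 'd) normed_module" where
  "module_via h D =
     \<lparr>carrier = carrier D, monoid.mult = monoid.mult D, one = one D, zero = zero D, add = add D,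
      smult = (\<lambda>c d. h c \<otimes>\<^bsub>D\<^esub> d), nrm = nrm D\<rparr>"

definition module_linear ::
    "('k, 'c) normed_module \<Rightarrow> ('c, 'a) normed_module \<Rightarrow> ('c, 'b) normed_module \<Rightarrow> ('a \<Rightarrow> 'b) \<Rightarrow> bool"
  where
  "module_linear C M N f \<longleftrightarrow>
     f \<in> carrier M \<rightarrow> carrier N \<and>
     (\<forall>x\<in>carrier M. \<forall>y\<in>carrier M. f (x \<oplus>\<^bsub>M\<^esub> y) = f x \<oplus>\<^bsub>N\<^esub> f y) \<and>
     (\<forall>c\<in>carrier C. \<forall>x\<in>carrier M. f (c \<odot>\<^bsub>M\<^esub> x) = c \<odot>\<^bsub>N\<^esub> f x)"

definition finite_admissible ::
    "('k, 'c) normed_module \<Rightarrow> ('k, 'd) normed_module \<Rightarrow> ('c \<Rightarrow> 'd) \<Rightarrow> bool" where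
  "finite_admissible C D h \<longleftrightarrow>
     (\<exists>n f. module_linear C (free_module C n) (module_via h D) f \<and>
        admissible_surjection (free_module C n) (module_via h D) f)"


section \<open>Fiber products\<close>

definition product_algebra ::
    "('k, 'a) normed_module \<Rightarrow> ('k, 'b) normed_module \<Rightarrow> ('k, 'a \<times> 'b) normed_module" where
  "product_algebra A B =
     \<lparr>carrier = carrier A \<times> carrier B,
      monoid.mult = (\<lambda>(a, b) (a', b'). (a \<otimes>\<^bsub>A\<^esub> a', b \<otimes>\<^bsub>B\<^esub> b')),
      one = (\<one>\<^bsub>A\<^esub>, \<one>\<^bsub>B\<^esub>),
      zero = (\<zero>\<^bsub>A\<^esub>, \<zero>\<^bsub>B\<^esub>),
      add = (\<lambda>(a, b) (a', b'). (a \<oplus>\<^bsub>A\<^esub> a', b \<oplus>\<^bsub>B\<^esub> b')),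
      smult = (\<lambda>c (a, b). (c \<odot>\<^bsub>A\<^esub> a, c \<odot>\<^bsub>B\<^esub> b)),
      nrm = (\<lambda>(a, b). max (nrm A a) (nrm B b))\<rparr>"

definition fiber_product ::
    "('k, 'a) normed_module \<Rightarrow> ('k, 'b) normed_module \<Rightarrow> ('a \<Rightarrow> 'c) \<Rightarrow> ('b \<Rightarrow> 'c)
      \<Rightarrow> ('k, 'a \<times> 'b) normed_module" where
  "fiber_product A B \<phi> \<psi> =
     (product_algebra A B)\<lparr>carrier := {(a, b) \<in> carrier A \<times> carrier B. \<phi> a = \<psi> b}\<rparr>"

end

theory Submission
  imports Defs "HOL-Algebra.Ring_Divisibility" "HOL-Library.Multiset_Order"
begin

text \<open>
 Write \<open>T\<^sub>n\<close> for the Tate algebra in \<open>n\<close> variables and \<open>A'\<close> for the fiber product. The aim is a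
 homomorphism \<open>T\<^sub>m\<^sub>+\<^sub>n \<rightarrow> A'\<close> over which \<open>A'\<close> is finite with bounded coefficients; scaling the module
 generators into the unit ball and adding a variable for each turns it into an admissible surjection.

 Let \<open>T\<^sub>m \<rightarrow> B'\<close> be an admissible surjection, sending the variables to \<open>b\<^sub>i\<close>. The condition on unit
 balls gives \<open>a\<^sub>i\<close> in the unit ball of \<open>A\<close> with the same image as \<open>b\<^sub>i\<close> in \<open>B\<close>, and \<open>(a\<^sub>i, b\<^sub>i)\<close> is the
 image of the \<open>i\<close>-th variable. This needs the \<open>a\<^sub>i\<close> to be power-bounded. The remaining variables must make
 \<open>A\<close> finite. Take topological generators \<open>s\<^sub>j\<close> of \<open>A\<close> over \<open>K\<close>. As \<open>B\<close> is finite over \<open>T\<^sub>m\<close>, the image of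
 \<open>s\<^sub>j\<close> in \<open>B\<close> is almost integral: some monic polynomial in it, with coefficients of norm at most 1, is as
 small as desired. A small element of \<open>B\<close> is a combination of monomials in the images of the \<open>s\<^sub>j\<close> with
 small coefficients, so \<open>s\<^sub>j\<^sup>N = w\<^sub>j + l\<^sub>j + r\<^sub>j\<close>, where \<open>w\<^sub>j\<close> is in the kernel of \<open>\<phi>\<close>, \<open>l\<^sub>j\<close> has degree below \<open>N\<close>
 in \<open>s\<^sub>j\<close>, and \<open>r\<^sub>j\<close> has coefficients of norm at most 1/2. The pairs \<open>(w\<^sub>j, 0)\<close> are the images of the
 remaining variables: the relations rewrite high powers of the \<open>s\<^sub>j\<close>, up to an error that shrinks, so \<open>A\<close> is
 finite over \<open>T\<^sub>m\<^sub>+\<^sub>n\<close> (\<open>finite_by_monomial_reduction\<close>). The kernel of \<open>\<phi>\<close> is finitely generated with bounds over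
 \<open>A\<close>, hence over \<open>T\<^sub>m\<^sub>+\<^sub>n\<close>, and \<open>A'\<close> is generated by it and \<open>1\<close> since \<open>T\<^sub>m\<close> maps onto \<open>B'\<close>.

 Power-boundedness and almost integrality of an element \<open>s\<close> of spectral seminorm at most 1 in an algebra
 finite over \<open>T\<^sub>n\<close> are proved together (\<open>finite_over_tate\<close>), modulo an ideal. Both pass from two larger
 ideals to \<open>J\<close> when \<open>J\<close> is not prime, so the ideal may be taken prime by Noetherian induction. If it meets
 \<open>T\<^sub>n\<close>, a change of coordinates lowers \<open>n\<close>. Otherwise the quotient is a domain containing \<open>T\<^sub>n\<close>. The
 coordinates of the powers of \<open>s\<close> satisfy a linear recurrence over \<open>T\<^sub>n\<close>, and since the norm of \<open>T\<^sub>n\<close> is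
 multiplicative, growth at rate at most 1 forces these coordinates to be bounded. The Noetherian property of
 the reduction of \<open>T\<^sub>n\<close> then yields a power of \<open>s\<close> close to a combination of earlier ones.
\<close>

section \<open>Non-archimedean norms\<close>

text \<open>
 Operations of an explicitly given structure, with the structure as a subscript.
\<close>

abbreviation (input) mult_in ("(_ \<otimes>\<^sub>_ _)" [70, 1000, 71] 70) where "x \<otimes>\<^sub>R y \<equiv> x \<otimes>\<^bsub>R\<^esub> y"
abbreviation (input) add_in ("(_ \<oplus>\<^sub>_ _)" [65, 1000, 66] 65) where "x \<oplus>\<^sub>R y \<equiv> x \<oplus>\<^bsub>R\<^esub> y"
abbreviation (input) minus_in ("(_ \<ominus>\<^sub>_ _)" [65, 1000, 66] 65) where "x \<ominus>\<^sub>R y \<equiv> x \<ominus>\<^bsub>R\<^esub> y"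
abbreviation (input) uminus_in ("(\<ominus>\<^sub>_ _)" [1000, 81] 80) where "\<ominus>\<^sub>R x \<equiv> \<ominus>\<^bsub>R\<^esub> x"
abbreviation (input) zero_in ("\<zero>\<^sub>_" [1000] 1000) where "\<zero>\<^sub>R \<equiv> \<zero>\<^bsub>R\<^esub>"
abbreviation (input) one_in ("\<one>\<^sub>_" [1000] 1000) where "\<one>\<^sub>R \<equiv> \<one>\<^bsub>R\<^esub>"
abbreviation (input) pow_in ("(_ [^]\<^sub>_ _)" [76, 1000, 75] 75) where "x [^]\<^sub>R n \<equiv> x [^]\<^bsub>R\<^esub> n"
abbreviation (input) smult_in ("(_ \<odot>\<^sub>_ _)" [70, 1000, 71] 70) where "c \<odot>\<^sub>A x \<equiv> c \<odot>\<^bsub>A\<^esub> x"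

context nonarch_banach_group
begin

lemma norm_zero [simp]: "N \<zero> = 0"
 using norm_eq_0_iff by blast

lemma norm_minus [simp]: "x \<in> carrier G ==> N (\<ominus> x) = N x"
proof -
 have le: "N (\<ominus> x) <= N x" if "x \<in> carrier G" for x
  using norm_ultra[of \<zero> x] norm_nonneg[of x] that by (simp add: minus_eq)
 assume x: "x \<in> carrier G"
 show ?thesis using le[OF x] le[of "\<ominus> x"] x by simp
qed

lemma norm_add: "[|x \<in> carrier G; y \<in> carrier G|] ==> N (x \<oplus> y) <= max (N x) (N y)"
 using norm_ultra[of x "\<ominus> y"] by (simp add: minus_eq)

lemma norm_add_le: "[|x \<in> carrier G; y \<in> carrier G; N x <= c; N y <= c|] ==> N (x \<oplus> y) <= c"
 using norm_add[of x y] by linarith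

lemma norm_diff_le: "[|x \<in> carrier G; y \<in> carrier G; N x <= c; N y <= c|] ==> N (x \<ominus> y) <= c"
 using norm_ultra[of x y] by linarith

lemma norm_diff_commute: "[|x \<in> carrier G; y \<in> carrier G|] ==> N (x \<ominus> y) = N (y \<ominus> x)"
 using norm_minus[of "y \<ominus> x"] by (simp add: minus_eq minus_add a_comm)

lemma diff_add_diff:
 "[|x \<in> carrier G; y \<in> carrier G; z \<in> carrier G|] ==> (x \<ominus> y) \<oplus> (y \<ominus> z) = x \<ominus> z"
 by (simp add: minus_eq a_assoc r_neg1)

lemma diff_add_cancel [simp]: "[|x \<in> carrier G; y \<in> carrier G|] ==> (x \<ominus> y) \<oplus> y = x"
 by (simp add: minus_eq a_assoc l_neg)

lemma diff_self [simp]: "x \<in> carrier G ==> x \<ominus> x = \<zero>"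
 by (simp add: minus_eq r_neg)

lemma diff_zero [simp]: "x \<in> carrier G ==> x \<ominus> \<zero> = x"
 by (simp add: minus_eq)

lemma diff_eq_zero_iff: "[|x \<in> carrier G; y \<in> carrier G|] ==> x \<ominus> y = \<zero> \<longleftrightarrow> x = y"
 by (metis diff_add_cancel diff_self l_zero)

lemma diff_add_eq:
 "[|x \<in> carrier G; y \<in> carrier G; z \<in> carrier G|] ==> x \<ominus> (y \<oplus> z) = (x \<ominus> y) \<ominus> z"
 by (simp add: minus_eq minus_add a_assoc)

lemma norm_diff_trans:
 "[|x \<in> carrier G; y \<in> carrier G; z \<in> carrier G; N (x \<ominus> y) <= c; N (y \<ominus> z) <= c|] ==> N (x \<ominus> z) <= c"
 using norm_add_le[of "x \<ominus> y" "y \<ominus> z" c] by (simp add: diff_add_diff)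

lemma norm_diff_trans_less:
 assumes "x \<in> carrier G" "y \<in> carrier G" "z \<in> carrier G" "N (x \<ominus> y) < c" "N (y \<ominus> z) < c"
 shows "N (x \<ominus> z) < c"
 using norm_add[of "x \<ominus> y" "y \<ominus> z"] assms by (simp add: diff_add_diff)

lemma norm_add_eq:
 assumes "x \<in> carrier G" "y \<in> carrier G" "N y < N x"
 shows "N (x \<oplus> y) = N x"
proof (rule antisym)
 show "N (x \<oplus> y) <= N x" using norm_add[of x y] assms by simp
 have "(x \<oplus> y) \<ominus> y = x" using assms by (simp add: minus_eq a_assoc r_neg)
 thus "N x <= N (x \<oplus> y)" using norm_ultra[of "x \<oplus> y" y] assms by auto
qed

lemma eq_zero_if_norm_small:
 assumes "x \<in> carrier G" "!!e. 0 < e ==> N x < e"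
 shows "x = \<zero>"
 using assms norm_eq_0_iff norm_nonneg by (metis less_eq_real_def less_irrefl)

lemma norm_finsum_le:
 assumes "f \<in> A \<rightarrow> carrier G" "0 <= c" "!!i. i \<in> A ==> N (f i) <= c"
 shows "N (finsum G f A) <= c"
 using assms
proof (induction A rule: infinite_finite_induct)
 case (insert a A)
 hence "finsum G f (insert a A) = f a \<oplus> finsum G f A" by (intro finsum_insert) auto
 moreover have "N (finsum G f A) <= c" using insert by auto
 ultimately show ?case using insert by (auto intro!: norm_add_le finsum_closed)
qed auto

lemma norm_finsum_less:
 assumes "f \<in> A \<rightarrow> carrier G" "0 < c" "finite A" "!!i. i \<in> A ==> N (f i) < c"
 shows "N (finsum G f A) < c"
 using assms(3,1,4)
proof (induction A)
 case (insert a A)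
 hence "finsum G f (insert a A) = f a \<oplus> finsum G f A" by (intro finsum_insert) auto
 moreover have "N (finsum G f A) < c" "N (f a) < c" using insert by auto
 moreover have "N (f a \<oplus> finsum G f A) <= max (N (f a)) (N (finsum G f A))"
  using insert by (auto intro!: norm_add finsum_closed)
 ultimately show ?case by (metis max_less_iff_conj order_le_less_trans)
qed (use assms in auto)

text \<open>
 A strictly dominant term determines the norm of a sum. Multiplicativity of the Gauss norm and
 the bound for recurrences rest on this.
\<close>

lemma norm_finsum_dominant:
 assumes "f \<in> A \<rightarrow> carrier G" "finite A" "a \<in> A" "!!i. i \<in> A ==> i ~= a ==> N (f i) < N (f a)"
 shows "N (finsum G f A) = N (f a)"
proof (cases "A = {a}")
 case True thus ?thesis using assms by simp
next
 case False
 then obtain b where "b \<in> A" "b ~= a" using assms by blast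
 hence pos: "0 < N (f a)" using assms norm_nonneg[of "f b"] by force
 have "A = insert a (A - {a})" using assms by auto
 hence "finsum G f A = f a \<oplus> finsum G f (A - {a})"
  using assms finsum_insert[of "A - {a}" a f] by auto
 moreover have "N (finsum G f (A - {a})) < N (f a)"
  using assms pos by (intro norm_finsum_less) auto
 ultimately show ?thesis using assms by (auto intro!: norm_add_eq finsum_closed)
qed

lemma geometric_series:
 fixes C \<delta> :: real
 assumes s: "!!n. s n \<in> carrier G" and b: "!!n. N (s n) <= C * \<delta> ^ n" and \<delta>: "0 <= \<delta>" "\<delta> < 1"
 shows "\<exists>l\<in>carrier G. \<forall>n. N (l \<ominus> finsum G s {..<n}) <= C * \<delta> ^ n"
proof -
 define p where "p n = finsum G s {..<n}" for n :: nat
 have p: "p n \<in> carrier G" for n using s by (auto simp: p_def)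
 have C: "0 <= C" using b[of 0] norm_nonneg[OF s, of 0] by simp
 have step: "p (Suc n) = s n \<oplus> p n" for n
  unfolding p_def lessThan_Suc using s by (intro finsum_insert) auto
 have tail: "N (p m \<ominus> p n) <= C * \<delta> ^ n" if "n <= m" for m n
  using that
 proof (induction m rule: dec_induct)
  case base thus ?case using p C \<delta> by simp
 next
  case (step m)
  have "p (Suc m) \<ominus> p m = s m"
   using s p by (simp add: \<open>!!n. p (Suc n) = s n \<oplus> p n\<close> minus_eq a_assoc r_neg)
  moreover have "N (s m) <= C * \<delta> ^ n"
  proof -
   have "C * \<delta> ^ m <= C * \<delta> ^ n"
    using step \<delta> C by (intro mult_left_mono power_decreasing) auto
   thus ?thesis using b[of m] by linarith
  qed
  ultimately show ?case using step p by (intro norm_diff_trans[of "p (Suc m)" "p m" "p n"]) auto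
 qed
 have small: "\<exists>n0. C * \<delta> ^ n0 < e" if "0 < e" for e
 proof -
  have "(%n. C * \<delta> ^ n) \<longlonglongrightarrow> C * 0"
   using \<delta> by (intro tendsto_mult tendsto_const LIMSEQ_realpow_zero)
  hence "eventually (%n. C * \<delta> ^ n < e) sequentially"
   using that by (intro order_tendstoD) auto
  thus ?thesis by (auto simp: eventually_sequentially)
 qed
 have "\<exists>l\<in>carrier G. (%n. N (p n \<ominus> l)) \<longlonglongrightarrow> 0"
 proof (rule norm_complete)
  fix e :: real assume "0 < e"
  then obtain n0 where n0: "C * \<delta> ^ n0 < e" using small by blast
  have "N (p m \<ominus> p n) < e" if "m \<ge> n0" "n \<ge> n0" for m n
  proof -
   have "N (p m \<ominus> p n) <= C * \<delta> ^ n0"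
    using tail[OF that(1)] tail[OF that(2)] p norm_diff_commute
    by (intro norm_diff_trans[of "p m" "p n0" "p n"]) auto
   thus ?thesis using n0 by linarith
  qed
  thus "\<exists>n0. \<forall>m\<ge>n0. \<forall>n\<ge>n0. N (p m \<ominus> p n) < e" by blast
 qed (rule p)
 then obtain l where l: "l \<in> carrier G" "(%n. N (p n \<ominus> l)) \<longlonglongrightarrow> 0" by blast
 have "N (l \<ominus> p n) <= C * \<delta> ^ n" for n
 proof (rule field_le_epsilon)
  fix e :: real assume e: "0 < e"
  have "eventually (%m. N (p m \<ominus> l) < e) sequentially"
   using l(2) e by (intro order_tendstoD) auto
  then obtain m0 where m0: "!!m. m \<ge> m0 ==> N (p m \<ominus> l) < e" by (auto simp: eventually_sequentially)
  define m where "m = max m0 n"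
  have "N (l \<ominus> p m) <= C * \<delta> ^ n + e"
  proof -
   have "0 <= C * \<delta> ^ n" using C \<delta> by simp
   thus ?thesis using m0[of m] norm_diff_commute[OF l(1) p[of m]] by (simp add: m_def)
  qed
  moreover have "N (p m \<ominus> p n) <= C * \<delta> ^ n + e" using tail[of n m] e by (simp add: m_def)
  ultimately show "N (l \<ominus> p n) <= C * \<delta> ^ n + e" using l p by (intro norm_diff_trans[of l "p m" "p n"])
 qed
 thus ?thesis using l(1) unfolding p_def by blast
qed

definition norm_closed :: "'a set => bool" where
 "norm_closed J \<longleftrightarrow> (\<forall>x\<in>carrier G. (\<forall>e>0. \<exists>j\<in>J. N (x \<ominus> j) < e) --> x \<in> J)"

lemma norm_closed_zero: "norm_closed {\<zero>}"
 unfolding norm_closed_def using eq_zero_if_norm_small by auto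

end

locale banach_ring = cring R + nonarch_banach_group R N for R (structure) and N +
 assumes norm_one_le: "N \<one> <= 1"
  and norm_mult_le: "[|x \<in> carrier R; y \<in> carrier R|] ==> N (x \<otimes> y) <= N x * N y"
begin

lemma add_diff_add_cancel:
 "[|x \<in> carrier R; y \<in> carrier R; z \<in> carrier R|] ==> (x \<oplus> y) \<ominus> (z \<oplus> y) = x \<ominus> z"
 by algebra

lemma norm_mult_bound:
 "[|x \<in> carrier R; y \<in> carrier R; N x <= a; N y <= b|] ==> N (x \<otimes> y) <= a * b"
 using norm_mult_le[of x y] norm_nonneg mult_mono[of "N x" a "N y" b] by (smt (verit, best))

lemma norm_pow_le: "x \<in> carrier R ==> N (x [^] (n::nat)) <= N x ^ n"
proof (induction n)
 case (Suc n)
 thus ?case using norm_mult_bound[of "x [^] n" x "N x ^ n" "N x"] by (simp add: mult.commute)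
qed (simp add: norm_one_le)

lemma norm_pow_le_one: "x \<in> carrier R ==> N x <= 1 ==> N (x [^] (n::nat)) <= 1"
 using norm_pow_le[of x n] norm_nonneg[of x] power_le_one[of "N x" n] by linarith

end

text \<open>
 Finite sums of an element of \<open>J\<close> and of multiples of elements of \<open>W\<close>, with all coefficients of
 norm at most \<open>c\<close>. Stating finiteness of modules with such a bound on the coefficients replaces the open mapping
 theorem everywhere below.
\<close>

inductive_set combs ::
 "('r, 'm) ring_scheme => ('r => real) => ('s, 'n) ring_scheme => ('r => 's) => 's set => 's set => real => 's set"
 for R N S h J W c where
 base: "j \<in> J ==> j \<in> combs R N S h J W c"
| step: "[|z \<in> combs R N S h J W c; w \<in> W; x \<in> carrier R; N x <= c|] ==>
   z \<oplus>\<^sub>S h x \<otimes>\<^sub>S w \<in> combs R N S h J W c"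

lemma combs_mono:
 assumes "z \<in> combs R N S h J W c" "J \<subseteq> J'" "W \<subseteq> W'" "c <= c'"
 shows "z \<in> combs R N S h J' W' c'"
 using assms(1)
proof induction
 case (base j) thus ?case using assms by (auto intro: combs.base)
next
 case (step z w x) thus ?case using assms by (intro combs.step) auto
qed

locale banach_hom = R?: banach_ring R N + S?: banach_ring S M + ring_hom_cring R S h
  for R and N and S (structure) and M and h +
 assumes bounded: "\<exists>C. \<forall>x\<in>carrier R. M (h x) <= C * N x"
begin

lemma bound: obtains C where "0 < C" "!!x. x \<in> carrier R ==> M (h x) <= C * N x"
proof -
 obtain C where C: "\<forall>x\<in>carrier R. M (h x) <= C * N x" using bounded by blast
 show thesis
 proof (rule that[of "max C 1"])
  fix x assume x: "x \<in> carrier R"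
  have "C * N x <= max C 1 * N x" using R.norm_nonneg[OF x] by (intro mult_right_mono) auto
  thus "M (h x) <= max C 1 * N x" using C x by (meson order_trans)
 qed simp
qed

abbreviation lc :: "'c set => 'c set => real => 'c set" where
 "lc \<equiv> combs R N S h"

lemma lc_carrier:
 assumes "z \<in> lc J W c" "J \<subseteq> carrier S" "W \<subseteq> carrier S" shows "z \<in> carrier S"
 using assms by induction auto

lemma lc_single:
 assumes "additive_subgroup J S" "w \<in> W" "w \<in> carrier S" "x \<in> carrier R" "N x <= c"
 shows "h x \<otimes> w \<in> lc J W c"
proof -
 have "\<zero> \<in> lc J W c" by (intro combs.base additive_subgroup.zero_closed assms)
 thus ?thesis using combs.step[of "\<zero>" R N S h J W c w x] assms by simp
qed

lemma lc_elem:
 assumes "additive_subgroup J S" "w \<in> W" "w \<in> carrier S" "1 <= c"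
 shows "w \<in> lc J W c"
 using lc_single[OF assms(1-3), of "\<one>\<^sub>R"] R.norm_one_le assms by simp

lemma lc_add:
 assumes "a \<in> lc J W c" "b \<in> lc J W c" "additive_subgroup J S" "W \<subseteq> carrier S"
 shows "a \<oplus> b \<in> lc J W c"
 using assms(2)
proof induction
 interpret J: additive_subgroup J S by fact
 have aS: "a \<in> carrier S" using lc_carrier[OF assms(1)] J.a_subset assms by auto
 case (base j)
 show ?case using assms(1) base
 proof induction
  case (base i) thus ?case by (auto intro: combs.base)
 next
  case (step z w x)
  have "z \<in> carrier S" using lc_carrier[OF step(1)] J.a_subset assms by auto
  hence "z \<oplus> h x \<otimes> w \<oplus> j = (z \<oplus> j) \<oplus> h x \<otimes> w"
   using step assms J.a_subset by (auto simp: S.a_ac subset_iff)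
  thus ?case using step by (auto intro: combs.step)
 qed
next
 interpret J: additive_subgroup J S by fact
 have aS: "a \<in> carrier S" using lc_carrier[OF assms(1)] J.a_subset assms by auto
 case (step z w x)
 have "z \<in> carrier S" using lc_carrier[OF step(1)] J.a_subset assms by auto
 hence "a \<oplus> (z \<oplus> h x \<otimes> w) = (a \<oplus> z) \<oplus> h x \<otimes> w"
  using step assms aS by (auto simp: S.a_assoc subset_iff)
 thus ?case using step by (auto intro: combs.step)
qed

lemma lc_neg:
 assumes "a \<in> lc J W c" "additive_subgroup J S" "W \<subseteq> carrier S"
 shows "\<ominus> a \<in> lc J W c"
 using assms(1)
proof induction
 interpret J: additive_subgroup J S by fact
 case (base j) thus ?case by (auto intro: combs.base)
next
 interpret J: additive_subgroup J S by fact
 case (step z w x)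
 have "z \<in> carrier S" using lc_carrier[OF step(1)] J.a_subset assms by auto
 hence "\<ominus> (z \<oplus> h x \<otimes> w) = \<ominus> z \<oplus> h (\<ominus>\<^sub>R x) \<otimes> w"
  using step assms by (auto simp: S.minus_add S.l_minus subset_iff)
 thus ?case using combs.step[OF step(5) step(2), of "\<ominus>\<^sub>R x"] step by simp
qed

lemma lc_diff:
 assumes "a \<in> lc J W c" "b \<in> lc J W c" "additive_subgroup J S" "W \<subseteq> carrier S"
 shows "a \<ominus> b \<in> lc J W c"
 using lc_add[OF assms(1) lc_neg[OF assms(2)]] assms by (simp add: a_minus_def)

lemma lc_finsum:
 assumes "additive_subgroup J S" "W \<subseteq> carrier S" "!!i. i \<in> A ==> f i \<in> lc J W c"
 shows "finsum S f A \<in> lc J W c"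
 using assms(3)
proof (induction A rule: infinite_finite_induct)
 case (insert a A)
 have "J \<subseteq> carrier S" using assms(1) by (simp add: additive_subgroup.a_subset)
 hence "f \<in> A \<rightarrow> carrier S" "f a \<in> carrier S"
  using lc_carrier[OF insert(4) _ assms(2)] by auto
 hence "finsum S f (insert a A) = f a \<oplus> finsum S f A"
  using insert by (intro S.finsum_insert) auto
 thus ?case using insert assms by (auto intro: lc_add)
qed (auto intro: combs.base additive_subgroup.zero_closed[OF assms(1)])

lemma lc_scale:
 assumes "z \<in> lc J W c" "ideal J S" "W \<subseteq> carrier S" "r \<in> carrier R" "N r <= d"
 shows "h r \<otimes> z \<in> lc J W (d * c)"
 using assms(1)
proof induction
 interpret J: ideal J S by fact
 case (base j) thus ?case using assms by (auto intro!: combs.base J.I_l_closed)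
next
 interpret J: ideal J S by fact
 case (step z w x)
 have "z \<in> carrier S" using lc_carrier[OF step(1)] J.a_subset assms by auto
 hence "h r \<otimes> (z \<oplus> h x \<otimes> w) = h r \<otimes> z \<oplus> h (r \<otimes>\<^sub>R x) \<otimes> w"
  using step assms by (auto simp: S.r_distr S.m_assoc subset_iff)
 moreover have "N (r \<otimes>\<^sub>R x) <= d * c" using step assms by (intro R.norm_mult_bound) auto
 ultimately show ?case using combs.step[OF step(5) step(2), of "r \<otimes>\<^sub>R x"] step assms by simp
qed

lemma lc_mult_right:
 assumes "z \<in> lc J W c" "ideal J S" "W \<subseteq> carrier S" "u \<in> carrier S"
 shows "u \<otimes> z \<in> lc J ((%w. u \<otimes> w) ` W) c"
 using assms(1)
proof induction
 interpret J: ideal J S by fact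
 case (base j) thus ?case using assms by (auto intro!: combs.base J.I_l_closed)
next
 interpret J: ideal J S by fact
 case (step z w x)
 have "z \<in> carrier S" using lc_carrier[OF step(1)] J.a_subset assms by auto
 hence "u \<otimes> (z \<oplus> h x \<otimes> w) = u \<otimes> z \<oplus> h x \<otimes> (u \<otimes> w)"
  using step assms by (auto simp: S.r_distr S.m_lcomm subset_iff)
 thus ?case using step by (auto intro: combs.step)
qed

lemma lc_induct_closed:
 assumes z: "z \<in> lc J W c" and J: "J \<subseteq> X"
  and add: "!!a b. a \<in> X ==> b \<in> X ==> a \<oplus> b \<in> X"
  and gen: "!!w x. w \<in> W ==> x \<in> carrier R ==> N x <= c ==> h x \<otimes> w \<in> X"
 shows "z \<in> X"
 using z by induction (use J add gen in auto)

lemma lc_mult: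
 assumes z: "z \<in> lc J W c" and y: "y \<in> lc J V d" and "ideal J S" "W \<subseteq> carrier S" "V \<subseteq> carrier S"
  and U: "!!w v. w \<in> W ==> v \<in> V ==> w \<otimes> v \<in> U" and "U \<subseteq> carrier S"
 shows "z \<otimes> y \<in> lc J U (c * d)"
proof -
 interpret J: ideal J S by fact
 have yS: "y \<in> carrier S" using lc_carrier[OF y] J.a_subset assms by auto
 have sub: "additive_subgroup J S" by (rule J.additive_subgroup_axioms)
 show ?thesis using z
 proof induction
  case (base j) thus ?case using yS by (auto intro!: combs.base J.I_r_closed)
 next
  case (step z w x)
  have "z \<in> carrier S" using lc_carrier[OF step(1)] J.a_subset assms by auto
  hence "(z \<oplus> h x \<otimes> w) \<otimes> y = z \<otimes> y \<oplus> h x \<otimes> (w \<otimes> y)"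
   using step assms yS by (auto simp: S.l_distr S.m_assoc subset_iff)
  moreover have "w \<otimes> y \<in> lc J U d"
   using lc_mult_right[OF y \<open>ideal J S\<close>, of w] assms step
   by (elim combs_mono[OF lc_mult_right]) auto
  hence "h x \<otimes> (w \<otimes> y) \<in> lc J U (c * d)"
   using assms step by (intro lc_scale)
  ultimately show ?case using step sub assms by (auto intro: lc_add)
 qed
qed

lemma lc_norm:
 assumes "z \<in> lc {\<zero>} W c" "W \<subseteq> carrier S" "0 <= B" "0 <= D"
  and "!!x. x \<in> carrier R ==> M (h x) <= B * N x" "!!w. w \<in> W ==> M w <= D" "0 <= c"
 shows "M z <= B * c * D"
 using assms(1)
proof induction
 case (base j) thus ?case using assms by simp
next
 case (step z w x)
 have z: "z \<in> carrier S" using lc_carrier[OF step(1)] assms by auto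
 have "M (h x) <= B * c" using assms(5)[OF step(3)] mult_left_mono[OF step(4) assms(3)] by linarith
 hence "M (h x \<otimes> w) <= B * c * D" using step assms by (intro S.norm_mult_bound) auto
 thus ?case using z step assms by (intro S.norm_add_le) auto
qed

text \<open>
 Repeated use of a generator costs nothing, because the norm is non-archimedean.
\<close>

lemma lc_finite:
 assumes z: "z \<in> lc J W c" and "ideal J S" "W \<subseteq> carrier S" "finite W" "0 <= c"
 shows "\<exists>x. x \<in> W \<rightarrow> carrier R & (\<forall>w\<in>W. N (x w) <= c) &
  z \<ominus> finsum S (%w. h (x w) \<otimes> w) W \<in> J"
 using z
proof induction
 interpret J: ideal J S by fact
 case (base j)
 have "finsum S (%w. h \<zero>\<^sub>R \<otimes> w) W = \<zero>"
  using assms by (intro S.add.finprod_one_eqI) (auto simp: subset_iff)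
 thus ?case using base assms by (intro exI[of _ "%_. \<zero>\<^sub>R"]) auto
next
 interpret J: ideal J S by fact
 case (step z w y)
 then obtain x where x: "x \<in> W \<rightarrow> carrier R" "!!w. w \<in> W ==> N (x w) <= c"
  "z \<ominus> finsum S (%w. h (x w) \<otimes> w) W \<in> J" by blast
 have z: "z \<in> carrier S" using lc_carrier[OF step(1)] J.a_subset assms by auto
 have W: "v \<in> carrier S" if "v \<in> W" for v using that assms by auto
 define e where "e v = (if v = w then y else \<zero>\<^sub>R)" for v
 have "finsum S (%v. h (x v \<oplus>\<^sub>R e v) \<otimes> v) W
   = finsum S (%v. h (x v) \<otimes> v \<oplus> h (e v) \<otimes> v) W"
  using x W step by (intro S.finsum_cong') (auto simp: e_def S.l_distr Pi_iff)
 also have "\<dots> = finsum S (%v. h (x v) \<otimes> v) W \<oplus> finsum S (%v. h (e v) \<otimes> v) W"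
  using x W step by (intro S.finsum_addf) (auto simp: e_def Pi_iff)
 also have "finsum S (%v. h (e v) \<otimes> v) W = finsum S (%v. if w = v then h y \<otimes> v else \<zero>) W"
  using W step by (intro S.finsum_cong') (auto simp: e_def Pi_iff)
 also have "\<dots> = h y \<otimes> w"
  using W step assms by (intro S.add.finprod_singleton) (auto simp: Pi_iff)
 finally have eq: "finsum S (%v. h (x v \<oplus>\<^sub>R e v) \<otimes> v) W
   = finsum S (%v. h (x v) \<otimes> v) W \<oplus> h y \<otimes> w" .
 have "z \<oplus> h y \<otimes> w \<ominus> finsum S (%v. h (x v \<oplus>\<^sub>R e v) \<otimes> v) W
   = z \<ominus> finsum S (%w. h (x w) \<otimes> w) W" (is "?l = ?r")
 proof -
  have f: "finsum S (%v. h (x v) \<otimes> v) W \<in> carrier S"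
   using x W by (intro S.finsum_closed) (auto simp: Pi_iff)
  show ?thesis unfolding eq using z f W[OF step(2)] step(3)
   by (simp add: S.add_diff_add_cancel)
 qed
 moreover have "N (x v \<oplus>\<^sub>R e v) <= c" if "v \<in> W" for v
  using that x step assms by (intro R.norm_add_le) (auto simp: e_def)
 ultimately show ?case using x step
  by (intro exI[of _ "%v. x v \<oplus>\<^sub>R e v"]) (auto simp: e_def Pi_iff)
qed

lemma lc_of_finsum:
 assumes "ideal J S" "W \<subseteq> carrier S" "z \<in> carrier S" "x \<in> W \<rightarrow> carrier R" "!!w. w \<in> W ==> N (x w) <= c"
  "z \<ominus> finsum S (%w. h (x w) \<otimes> w) W \<in> J"
 shows "z \<in> lc J W c"
proof -
 interpret J: ideal J S by fact
 have f: "finsum S (%w. h (x w) \<otimes> w) W \<in> carrier S"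
  using assms by (intro S.finsum_closed) (auto simp: Pi_iff)
 have "finsum S (%w. h (x w) \<otimes> w) W \<in> lc J W c"
  using assms by (intro lc_finsum J.additive_subgroup_axioms lc_single) auto
 hence "(z \<ominus> finsum S (%w. h (x w) \<otimes> w) W) \<oplus> finsum S (%w. h (x w) \<otimes> w) W \<in> lc J W c"
  by (rule lc_add[OF combs.base[OF assms(6)] _ J.additive_subgroup_axioms assms(2)])
 thus ?thesis using assms(3) f by simp
qed

text \<open>
 The correction terms are added coefficientwise: for each of the finitely many generators they
 form a series with geometric decay. The sets \<open>U n\<close> let the approximation property hold in a form adapted to each use.
\<close>

lemma lc_successive_approximation:
 assumes J: "ideal J S" "S.norm_closed J" and W: "finite W" "W \<subseteq> carrier S"
  and c: "0 <= K" "0 <= C" "0 <= \<delta>" "\<delta> < 1"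
  and U: "!!n u. u \<in> U n ==> u \<in> carrier S & M u <= C * \<delta> ^ n"
  and step: "!!n u. u \<in> U n ==> \<exists>u'\<in>U (Suc n). u \<ominus> u' \<in> lc J W (K * \<delta> ^ n)"
  and y: "y \<in> U 0"
 shows "y \<in> lc J W K"
proof -
 interpret J: ideal J S by fact
 have "\<exists>u. u 0 = y & (\<forall>n. u n \<in> U n & u n \<ominus> u (Suc n) \<in> lc J W (K * \<delta> ^ n))"
 proof -
  obtain g where g: "!!n u. u \<in> U n ==> g n u \<in> U (Suc n) & u \<ominus> g n u \<in> lc J W (K * \<delta> ^ n)"
  proof -
   define g where "g n u = (SOME u'. u' \<in> U (Suc n) & u \<ominus> u' \<in> lc J W (K * \<delta> ^ n))" for n u
   have "g n u \<in> U (Suc n) & u \<ominus> g n u \<in> lc J W (K * \<delta> ^ n)" if "u \<in> U n" for n u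
    using someI_ex[of "%u'. u' \<in> U (Suc n) & u \<ominus> u' \<in> lc J W (K * \<delta> ^ n)"] step[OF that]
    unfolding g_def by blast
   thus thesis by (rule that)
  qed
  define u where "u = rec_nat y g"
  have "u n \<in> U n" for n by (induction n) (auto simp: u_def y g)
  thus ?thesis using g by (intro exI[of _ u]) (auto simp: u_def)
 qed
 then obtain u where u: "u 0 = y" "!!n. u n \<in> U n"
  "!!n. u n \<ominus> u (Suc n) \<in> lc J W (K * \<delta> ^ n)" by blast
 have uS: "u n \<in> carrier S" for n using U u by blast
 have "\<exists>x. x \<in> W \<rightarrow> carrier R & (\<forall>w\<in>W. N (x w) <= K * \<delta> ^ n) &
   (u n \<ominus> u (Suc n)) \<ominus> finsum S (%w. h (x w) \<otimes> w) W \<in> J" for n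
  by (rule lc_finite[OF u(3) J(1) W(2,1)]) (simp add: c)
 hence "\<exists>x. \<forall>n. x n \<in> W \<rightarrow> carrier R & (\<forall>w\<in>W. N (x n w) <= K * \<delta> ^ n) &
   (u n \<ominus> u (Suc n)) \<ominus> finsum S (%w. h (x n w) \<otimes> w) W \<in> J"
  by (intro choice allI)
 then obtain x where x: "!!n. x n \<in> W \<rightarrow> carrier R" "!!n w. w \<in> W ==> N (x n w) <= K * \<delta> ^ n"
  "!!n. (u n \<ominus> u (Suc n)) \<ominus> finsum S (%w. h (x n w) \<otimes> w) W \<in> J" by blast
 have xc: "x n w \<in> carrier R" if "w \<in> W" for n w using x(1) that by auto
 have "\<exists>l. \<forall>w\<in>W. l w \<in> carrier R & (\<forall>n. N (l w \<ominus>\<^sub>R finsum R (%n. x n w) {..<n}) <= K * \<delta> ^ n)"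
 proof -
  have "\<exists>l. l \<in> carrier R & (\<forall>n. N (l \<ominus>\<^sub>R finsum R (%n. x n w) {..<n}) <= K * \<delta> ^ n)" if "w \<in> W" for w
   using R.geometric_series[of "%n. x n w" K \<delta>] x(2) xc c that by auto
  hence "\<forall>w\<in>W. \<exists>l. l \<in> carrier R & (\<forall>n. N (l \<ominus>\<^sub>R finsum R (%n. x n w) {..<n}) <= K * \<delta> ^ n)"
   by blast
  thus ?thesis by (rule bchoice)
 qed
 then obtain l where l: "!!w. w \<in> W ==> l w \<in> carrier R"
  "!!w n. w \<in> W ==> N (l w \<ominus>\<^sub>R finsum R (%n. x n w) {..<n}) <= K * \<delta> ^ n" by blast
 define p where "p n w = finsum R (%n. x n w) {..<n}" for n w
 have pc: "p n w \<in> carrier R" if "w \<in> W" for n w unfolding p_def using xc that by auto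
 define P where "P q = finsum S (%w. h (q w) \<otimes> w) W" for q
 have WS: "w \<in> carrier S" if "w \<in> W" for w using that W by auto
 have Pc: "P q \<in> carrier S" if "!!w. w \<in> W ==> q w \<in> carrier R" for q
  unfolding P_def using that WS by (intro S.finsum_closed) auto
 have Padd: "P (%w. q w \<oplus>\<^sub>R r w) = P q \<oplus> P r"
  if "!!w. w \<in> W ==> q w \<in> carrier R" "!!w. w \<in> W ==> r w \<in> carrier R" for q r
 proof -
  have "P (%w. q w \<oplus>\<^sub>R r w) = finsum S (%w. h (q w) \<otimes> w \<oplus> h (r w) \<otimes> w) W"
   unfolding P_def using that WS by (intro S.finsum_cong') (auto simp: S.l_distr)
  thus ?thesis unfolding P_def using that WS by (simp add: S.finsum_addf)
 qed
 have Pcong: "P q = P r" if "!!w. w \<in> W ==> q w = r w" "!!w. w \<in> W ==> r w \<in> carrier R" for q r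
  unfolding P_def using that WS by (intro S.finsum_cong') auto
 have tel: "(y \<ominus> u n) \<ominus> P (p n) \<in> J" for n
 proof (induction n)
  case 0
  have "P (p 0) = \<zero>" unfolding P_def p_def using WS by (intro S.add.finprod_one_eqI) auto
  thus ?case using uS u(1) by auto
 next
  case (Suc n)
  have "P (p (Suc n)) = P (%w. x n w \<oplus>\<^sub>R p n w)"
   using xc pc by (intro Pcong) (auto simp: p_def lessThan_Suc intro!: R.finsum_insert)
  also have "\<dots> = P (x n) \<oplus> P (p n)" using xc pc by (intro Padd)
  finally have eq: "P (p (Suc n)) = P (x n) \<oplus> P (p n)" .
  have "P (x n) \<in> carrier S" "P (p n) \<in> carrier S" using xc pc Pc by auto
  moreover have "y \<in> carrier S" using u uS by metis
  ultimately have "(y \<ominus> u (Suc n)) \<ominus> P (p (Suc n))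
    = ((y \<ominus> u n) \<ominus> P (p n)) \<oplus> ((u n \<ominus> u (Suc n)) \<ominus> P (x n))"
   unfolding eq using uS[of n] uS[of "Suc n"] by algebra
  thus ?case using Suc x(3)[of n] by (simp add: P_def)
 qed
 have yS: "y \<in> carrier S" using u uS by metis
 have Pl: "P l \<in> carrier S" using l Pc by auto
 obtain B where B: "0 < B" "!!x. x \<in> carrier R ==> M (h x) <= B * N x" using bound by blast
 define D where "D = Max (insert 0 (M ` W))"
 have D: "0 <= D" "!!w. w \<in> W ==> M w <= D" using W by (auto simp: D_def)
 have close: "M (P l \<ominus> P (p n)) <= B * D * K * \<delta> ^ n" for n
 proof -
  have "P l = P (%w. (l w \<ominus>\<^sub>R p n w) \<oplus>\<^sub>R p n w)" using l pc by (intro Pcong) auto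
  also have "\<dots> = P (%w. l w \<ominus>\<^sub>R p n w) \<oplus> P (p n)" using l pc by (intro Padd) auto
  finally have "P l \<ominus> P (p n) = P (%w. l w \<ominus>\<^sub>R p n w)"
   using l pc Pc[of "p n"] Pc[of "%w. l w \<ominus>\<^sub>R p n w"] by (simp add: S.minus_eq S.a_assoc S.r_neg)
  moreover have "M (P (%w. l w \<ominus>\<^sub>R p n w)) <= (B * (K * \<delta> ^ n)) * D"
   unfolding P_def
  proof (intro S.norm_finsum_le)
   fix w assume w: "w \<in> W"
   have "M (h (l w \<ominus>\<^sub>R p n w)) <= B * (K * \<delta> ^ n)"
    using B(2)[of "l w \<ominus>\<^sub>R p n w"] l(2)[OF w, of n] w l pc B(1) unfolding p_def[symmetric]
    by (meson R.minus_closed mult_le_cancel_left_pos order_trans)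
   thus "M (h (l w \<ominus>\<^sub>R p n w) \<otimes> w) <= (B * (K * \<delta> ^ n)) * D"
    using w l pc D WS by (intro S.norm_mult_bound) auto
  qed (use l pc WS B c D in auto)
  ultimately show ?thesis by (simp add: mult_ac)
 qed
 have "y \<ominus> P l \<in> J"
 proof -
  have "\<exists>j\<in>J. M ((y \<ominus> P l) \<ominus> j) < e" if "0 < e" for e
  proof -
   define E where "E = max C (B * D * K)"
   have "(%n. E * \<delta> ^ n) \<longlonglongrightarrow> E * 0"
    using c by (intro tendsto_mult tendsto_const LIMSEQ_realpow_zero)
   hence "eventually (%n. E * \<delta> ^ n < e) sequentially"
    using \<open>0 < e\<close> by (intro order_tendstoD) auto
   then obtain n where n: "E * \<delta> ^ n < e" by (auto simp: eventually_sequentially)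
   define j where "j = (y \<ominus> u n) \<ominus> P (p n)"
   have Pp: "P (p n) \<in> carrier S" using pc Pc by auto
   have "(y \<ominus> P l) \<ominus> j = u n \<ominus> (P l \<ominus> P (p n))"
    unfolding j_def using yS Pl Pp uS[of n]
    by algebra
   moreover have "M (u n) <= E * \<delta> ^ n" "M (P l \<ominus> P (p n)) <= E * \<delta> ^ n"
    using U[OF u(2)[of n]] close[of n] c unfolding E_def
    by (auto intro: order_trans[OF _ mult_right_mono])
   ultimately have "M ((y \<ominus> P l) \<ominus> j) <= E * \<delta> ^ n"
    using uS Pl Pp by (auto intro!: S.norm_diff_le)
   thus ?thesis using n tel[of n] unfolding j_def by (meson order_le_less_trans)
  qed
  thus ?thesis using J(2) yS Pl unfolding S.norm_closed_def by auto
 qed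
 moreover have "N (l w) <= K" if "w \<in> W" for w using l(2)[OF that, of 0] l(1)[OF that] by simp
 ultimately show ?thesis
  using J W yS l unfolding P_def by (intro lc_of_finsum[where x = l]) auto
qed

end

context banach_ring
begin

lemma id_banach_hom: "banach_hom R N R N id"
proof (intro banach_hom.intro banach_hom_axioms.intro)
 show "ring_hom_cring R R id"
  by (intro ring_hom_cringI is_cring) (auto simp: ring_hom_def)
 show "\<exists>C. \<forall>x\<in>carrier R. N (id x) <= C * N x" by (intro exI[of _ 1]) auto
 show "banach_ring R N" "banach_ring R N" by (rule banach_ring_axioms)+
qed

text \<open>
 Every ideal is finitely generated, with a bound for the coefficients.
\<close>

definition strictly_noetherian :: bool where
 "strictly_noetherian \<longleftrightarrow> (\<forall>I. ideal I R --> (\<exists>W K. finite W & W \<subseteq> I & 0 <= K &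
   (\<forall>x\<in>I. x \<in> combs R N R id {\<zero>} W (K * N x))))"

lemma strictly_noetherianE:
 assumes "strictly_noetherian" "ideal I R"
 obtains W K where "finite W" "W \<subseteq> I" "0 <= K"
  "!!x. x \<in> I ==> x \<in> combs R N R id {\<zero>} W (K * N x)"
proof -
 have "\<exists>W K. finite W & W \<subseteq> I & 0 <= K & (\<forall>x\<in>I. x \<in> combs R N R id {\<zero>} W (K * N x))"
  using assms by (simp add: strictly_noetherian_def)
 thus thesis using that by (elim exE conjE) simp
qed

text \<open>
 A limit of elements of \<open>J\<close> is a telescoping series of elements of \<open>J\<close>, each of
 which is expanded with controlled coefficients.
\<close>

lemma strictly_noetherian_closed:
 assumes "strictly_noetherian" "ideal J R"
 shows "norm_closed J"
 unfolding norm_closed_def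
proof (intro ballI impI)
 interpret J: ideal J R by fact
 obtain W K where W: "finite W" "W \<subseteq> J" "0 <= K"
  "!!x. x \<in> J ==> x \<in> combs R N R id {\<zero>} W (K * N x)"
  by (rule strictly_noetherianE[OF assms], rule that) simp_all
 fix x assume x: "x \<in> carrier R" "\<forall>e>0. \<exists>j\<in>J. N (x \<ominus> j) < e"
 define U where "U n = {u \<in> carrier R. N u <= 1 * (1/2) ^ n & (\<exists>j\<in>J. u = x \<ominus> j)}" for n
 obtain j0 where j0: "j0 \<in> J" "N (x \<ominus> j0) < 1" using x(2)[rule_format, of 1] by auto
 have Jc: "j \<in> carrier R" if "j \<in> J" for j using that J.a_subset by auto
 have "x \<ominus> j0 \<in> combs R N R id {\<zero>} W K"
 proof (rule banach_hom.lc_successive_approximation[OF id_banach_hom, where \<delta> = "1/2" and U = U and C = 1])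
  show "ideal {\<zero>} R" by (rule zeroideal)
  show "x \<ominus> j0 \<in> U 0" using j0 x Jc by (auto simp: U_def)
  fix n u assume u: "u \<in> U n"
  then obtain j where j: "u \<in> carrier R" "N u <= (1/2) ^ n" "j \<in> J" "u = x \<ominus> j" by (auto simp: U_def)
  obtain j' where j': "j' \<in> J" "N (x \<ominus> j') < (1/2) ^ Suc n"
  proof -
   have "(0::real) < (1/2) ^ Suc n" by simp
   thus thesis using x(2)[rule_format, of "(1/2) ^ Suc n"] that by auto
  qed
  define u' where "u' = x \<ominus> j'"
  have u': "u' \<in> U (Suc n)" "u' \<in> carrier R" using j' x Jc by (auto simp: U_def u'_def)
  have "u \<ominus> u' = j' \<ominus> j" unfolding j(4) u'_def using x Jc[OF j(3)] Jc[OF j'(1)] by algebra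
  hence mem: "u \<ominus> u' \<in> J" using j j' by (simp add: a_minus_def)
  have le: "(1/2) ^ Suc n <= ((1/2) ^ n :: real)" by simp
  have "N u' <= (1/2) ^ n" using j'(2) le unfolding u'_def by linarith
  hence "N (u \<ominus> u') <= (1/2) ^ n"
   using j u' by (intro norm_diff_le) auto
  hence "u \<ominus> u' \<in> combs R N R id {\<zero>} W (K * (1/2) ^ n)"
   using combs_mono[OF W(4)[OF mem] order_refl order_refl] W(3) by (simp add: mult_left_mono)
  thus "\<exists>u'\<in>U (Suc n). u \<ominus> u' \<in> combs R N R id {\<zero>} W (K * (1/2) ^ n)" using u'(1) by (rule bexI)
 next
  show "finite W" "norm_closed {\<zero>}" "0 <= K" by (rule W norm_closed_zero)+
  show "W \<subseteq> carrier R" using W(2) J.a_subset by simp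
 qed (simp_all add: U_def)
 hence "x \<ominus> j0 \<in> J"
  by (rule banach_hom.lc_induct_closed[OF id_banach_hom]) (use W(2) J.I_l_closed in auto)
 hence "(x \<ominus> j0) \<oplus> j0 \<in> J" using j0 by (intro J.a_closed)
 thus "x \<in> J" using x Jc[OF j0(1)] by simp
qed

lemma strictly_noetherian_imp_noetherian:
 assumes "strictly_noetherian"
 shows "noetherian_ring R"
proof (rule noetherian_ringI)
 fix I assume I: "ideal I R"
 interpret I: ideal I R by fact
 obtain W K where W: "finite W" "W \<subseteq> I" "0 <= K"
  "!!x. x \<in> I ==> x \<in> combs R N R id {\<zero>} W (K * N x)"
  by (rule strictly_noetherianE[OF assms I], rule that) simp_all
 have Wc: "W \<subseteq> carrier R" using W I.a_subset by auto
 interpret G: ideal "Idl W" R by (rule genideal_ideal[OF Wc])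
 have "I \<subseteq> Idl W"
 proof
  fix x assume "x \<in> I"
  from W(4)[OF this] show "x \<in> Idl W"
   by (rule banach_hom.lc_induct_closed[OF id_banach_hom]) (use Wc genideal_self[OF Wc] in \<open>auto intro: G.I_l_closed\<close>)
 qed
 moreover have "Idl W \<subseteq> I" using W I genideal_minimal by auto
 ultimately show "\<exists>A\<subseteq>carrier R. finite A & I = Idl A" using W(1) Wc by blast
qed

end

lemma (in banach_hom) strictly_noetherian_image:
 assumes "R.strictly_noetherian" and K: "!!y. y \<in> carrier S ==> \<exists>x\<in>carrier R. h x = y & N x <= K * M y"
  and K0: "0 <= K"
 shows "S.strictly_noetherian"
 unfolding S.strictly_noetherian_def
proof (intro allI impI)
 fix I assume I: "ideal I S"
 interpret I: ideal I S by fact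
 have ideal: "ideal {r \<in> carrier R. h r \<in> I} R"
  by (intro ring_hom_ring.ideal_vimage[OF _ I] ring_hom_ringI2 R.ring_axioms S.ring_axioms homh)
 obtain W L where W: "finite W" "W \<subseteq> {r \<in> carrier R. h r \<in> I}" "0 <= L"
  "!!x. x \<in> {r \<in> carrier R. h r \<in> I} ==> x \<in> combs R N R id {\<zero>\<^sub>R} W (L * N x)"
  by (rule R.strictly_noetherianE[OF assms(1) ideal], rule that) simp_all
 obtain C where C: "0 < C" "!!x. x \<in> carrier R ==> M (h x) <= C * N x" using bound by blast
 have im: "h z \<in> combs S M S id {\<zero>} (h ` W) (C * c)" if "z \<in> combs R N R id {\<zero>\<^sub>R} W c" for z c
  using that
 proof induction
  case (base j) thus ?case by (auto intro: combs.base)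
 next
  case (step z w x)
  have "z \<in> carrier R" using banach_hom.lc_carrier[OF R.id_banach_hom step(1)] W by auto
  hence "h (z \<oplus>\<^sub>R x \<otimes>\<^sub>R w) = h z \<oplus> h x \<otimes> h w" using step W by (auto simp: subset_iff)
  moreover have "M (h x) <= C * c"
   using C(2)[OF step(3)] step(4) C(1) by (meson mult_left_mono less_imp_le order_trans)
  ultimately show ?case using step by (auto intro!: combs.step)
 qed
 have "y \<in> combs S M S id {\<zero>} (h ` W) ((C * L * K) * M y)" if "y \<in> I" for y
 proof -
  have "y \<in> carrier S" using that I.a_subset by auto
  then obtain x where x: "x \<in> carrier R" "h x = y" "N x <= K * M y" using K[of y] by blast
  hence "y \<in> combs S M S id {\<zero>} (h ` W) (C * (L * N x))"
   using im[OF W(4)[of x]] that by auto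
  moreover have "C * (L * N x) <= C * (L * (K * M y))"
   using x(3) C W(3) by (intro mult_left_mono) auto
  hence "C * (L * N x) <= (C * L * K) * M y" by (simp add: mult_ac)
  ultimately show ?thesis by (rule combs_mono[OF _ order_refl order_refl])
 qed
 thus "\<exists>W K. finite W & W \<subseteq> I & 0 <= K & (\<forall>x\<in>I. x \<in> combs S M S id {\<zero>} W (K * M x))"
  using W C K0 by (intro exI[of _ "h ` W"] exI[of _ "C * L * K"]) auto
qed

lemma (in abelian_monoid) finsum_Sigma:
 assumes "finite A" "!!a. a \<in> A ==> finite (B a)" "!!a b. a \<in> A ==> b \<in> B a ==> f a b \<in> carrier G"
 shows "finsum G (%a. finsum G (f a) (B a)) A = finsum G (%(a, b). f a b) (Sigma A B)"
 using assms
proof (induction A)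
 case (insert a A)
 have "Sigma (insert a A) B = Pair a ` B a \<union> Sigma A B" by auto
 moreover have "finsum G (%(a, b). f a b) (Pair a ` B a \<union> Sigma A B)
   = finsum G (%(a, b). f a b) (Pair a ` B a) \<oplus> finsum G (%(a, b). f a b) (Sigma A B)"
  using insert by (intro finsum_Un_disjoint) auto
 moreover have "finsum G (%(a, b). f a b) (Pair a ` B a) = finsum G (%b. f a b) (B a)"
  using insert by (subst finsum_reindex) (auto simp: inj_on_def)
 moreover have "finsum G (%a. finsum G (f a) (B a)) (insert a A)
   = finsum G (f a) (B a) \<oplus> finsum G (%a. finsum G (f a) (B a)) A"
  using insert by (intro finsum_insert) (auto intro!: finsum_closed)
 ultimately show ?case using insert by simp
qed simp

lemma double_diff_mset: "p \<subseteq># m ==> m - (m - p) = p"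
 by (auto simp: multiset_eq_iff subseteq_mset_def)

lemma finite_submultisets [simp]: "finite {p. p \<subseteq># (m :: 'a multiset)}"
proof (induction m)
 case (add x m)
 have "{p. p \<subseteq># add_mset x m} \<subseteq> {p. p \<subseteq># m} \<union> add_mset x ` {p. p \<subseteq># m}"
 proof
  fix p assume p: "p \<in> {p. p \<subseteq># add_mset x m}"
  show "p \<in> {p. p \<subseteq># m} \<union> add_mset x ` {p. p \<subseteq># m}"
  proof (cases "x \<in># p")
   case True
   then obtain q where "p = add_mset x q" by (metis mset_add)
   thus ?thesis using p by auto
  next
   case False
   hence "p - {#x#} = p" by (simp add: diff_single_trivial)
   thus ?thesis using p by (metis UnI1 add_mset_add_single mem_Collect_eq subset_eq_diff_conv)
  qed
 qed
 thus ?case using add finite_subset by blast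
qed simp

section \<open>Tate algebras\<close>

locale tate_field = analytic_field K v for K :: "'k ring" (structure) and v :: "'k => real"
begin

lemma val_one [simp]: "v \<one> = 1"
proof -
 have "v \<one> * v \<one> = v \<one>" using val_mult[of \<one> \<one>] by simp
 moreover have "v \<one> ~= 0" using norm_eq_0_iff[of \<one>] by simp
 ultimately show ?thesis by simp
qed

sublocale K: banach_ring K v
 by (intro banach_ring.intro banach_ring_axioms.intro is_cring nonarch_banach_group_axioms)
   (auto simp: val_mult)

lemma val_inv: "x \<in> carrier K ==> x ~= \<zero> ==> v (inv x) = inverse (v x)"
proof -
 assume x: "x \<in> carrier K" "x ~= \<zero>"
 hence u: "x \<in> Units K" by (simp add: field_Units)
 hence "v x * v (inv x) = 1" using val_mult[of x "inv x"] x by (simp add: Units_inv_closed)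
 thus ?thesis by (metis inverse_unique)
qed

abbreviation tate :: "nat => ('k, nat multiset => 'k) normed_module" where
 "tate n \<equiv> tate_algebra K v n (%_. 1)"

text \<open>
 The Gauss norm.
\<close>

definition gnorm :: "(nat multiset => 'k) => real" where
 "gnorm f = (SUP m. v (f m))"

abbreviation (input) tate_mult_syn ("(_ *\<^sub>_ _)" [70, 1000, 71] 70) where "f *\<^sub>n g \<equiv> f \<otimes>\<^bsub>tate n\<^esub> g"
abbreviation (input) tate_add_syn ("(_ +\<^sub>_ _)" [65, 1000, 66] 65) where "f +\<^sub>n g \<equiv> f \<oplus>\<^bsub>tate n\<^esub> g"
abbreviation (input) tate_minus_syn ("(_ -\<^sub>_ _)" [65, 1000, 66] 65) where "f -\<^sub>n g \<equiv> f \<ominus>\<^bsub>tate n\<^esub> g"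

abbreviation (input) series where "series n \<equiv> carrier (tate n)"

lemma tate_carrier:
 "f \<in> series n \<longleftrightarrow> (\<forall>m. f m \<in> carrier K) & (\<forall>m. \<not> set_mset m \<subseteq> {..<n} --> f m = \<zero>) &
   (\<forall>e>0. finite {m. e <= v (f m)})"
proof -
 have "((%m. v (f m)) \<longlongrightarrow> 0) cofinite \<longleftrightarrow> (\<forall>e>0. finite {m. e <= v (f m)})"
  if "\<forall>m. f m \<in> carrier K"
 proof -
  have "dist (v (f m)) 0 = v (f m)" for m using norm_nonneg[of "f m"] that by simp
  thus ?thesis by (simp add: tendsto_iff eventually_cofinite not_less)
 qed
 moreover have "f \<in> series n \<longleftrightarrow> (\<forall>m. f m \<in> carrier K) &
   (\<forall>m. \<not> set_mset m \<subseteq> {..<n} --> f m = \<zero>) & ((%m. v (f m)) \<longlongrightarrow> 0) cofinite"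
  unfolding tate_algebra_def by simp
 ultimately show ?thesis by metis
qed

lemma tateI:
 "[|!!m. f m \<in> carrier K; !!m. \<not> set_mset m \<subseteq> {..<n} ==> f m = \<zero>; !!e. e > 0 ==> finite {m. e <= v (f m)}|]
  ==> f \<in> series n"
 by (simp add: tate_carrier)

lemma tate_coeff [simp]: "f \<in> series n ==> f m \<in> carrier K"
 and tate_support: "f \<in> series n ==> \<not> set_mset m \<subseteq> {..<n} ==> f m = \<zero>"
 and tate_finite: "f \<in> series n ==> e > 0 ==> finite {m. e <= v (f m)}"
 by (auto simp: tate_carrier)

lemma tate_simps [simp]:
 "one (tate n) = (%m. if m = {#} then \<one> else \<zero>)"
 "zero (tate n) = (%m. \<zero>)"
 "add (tate n) f g = (%m. f m \<oplus> g m)"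
 "smult (tate n) c f = (%m. c \<otimes> f m)"
 "nrm (tate n) = gnorm"
 unfolding gnorm_def[abs_def]
 by (simp_all only: tate_algebra_def monoid.select_convs ring.select_convs module.select_convs
   normed_module.select_convs prod_mset.neutral_const mult_1_right)

lemma tate_mult: "mult (tate n) f g = (%m. \<Oplus>p\<in>{p. p \<subseteq># m}. f p \<otimes> g (m - p))"
 by (simp only: tate_algebra_def monoid.select_convs)

lemma tate_mono: "f \<in> series n ==> n <= n' ==> f \<in> series n'"
 by (auto simp: tate_carrier)
   (metis (mono_tags, lifting) lessThan_iff less_le_trans subset_iff)

lemma tate_max:
 assumes "f \<in> series n"
 shows "\<exists>m. \<forall>m'. v (f m') <= v (f m)"
proof (cases "\<forall>m. f m = \<zero>")
 case True thus ?thesis by simp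
next
 case False
 then obtain m0 where m0: "f m0 ~= \<zero>" by blast
 define e where "e = v (f m0)"
 have e: "e > 0" unfolding e_def using m0 assms norm_nonneg[of "f m0"] norm_eq_0_iff[of "f m0"] by simp
 define A where "A = {m. e <= v (f m)}"
 have A: "finite A" "m0 \<in> A" using tate_finite[OF assms e] by (auto simp: A_def e_def)
 have "Max ((%m. v (f m)) ` A) \<in> (%m. v (f m)) ` A" using A by (intro Max_in) auto
 then obtain m where m: "m \<in> A" "v (f m) = Max ((%m. v (f m)) ` A)" by auto
 have "v (f m') <= v (f m)" for m'
 proof (cases "m' \<in> A")
  case True thus ?thesis using m A by (auto intro!: Max_ge)
 next
  case False thus ?thesis using m unfolding A_def by auto
 qed
 thus ?thesis by blast
qed

lemma coeff_le_gnorm: "f \<in> series n ==> v (f m) <= gnorm f"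
 unfolding gnorm_def using tate_max[of f n] by (auto intro!: cSUP_upper simp: bdd_above_def)

lemma gnorm_attained: "f \<in> series n ==> \<exists>m. v (f m) = gnorm f"
proof -
 assume f: "f \<in> series n"
 then obtain m where m: "!!m'. v (f m') <= v (f m)" using tate_max by blast
 hence "gnorm f <= v (f m)" unfolding gnorm_def by (intro cSUP_least) auto
 thus ?thesis using coeff_le_gnorm[OF f, of m] by (intro exI[of _ m]) auto
qed

lemma gnorm_le_iff: "f \<in> series n ==> gnorm f <= c \<longleftrightarrow> (\<forall>m. v (f m) <= c)"
 using coeff_le_gnorm gnorm_attained by (metis order_trans)

lemma gnorm_less_iff: "f \<in> series n ==> gnorm f < c \<longleftrightarrow> (\<forall>m. v (f m) < c)"
proof -
 assume f: "f \<in> series n"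
 then obtain m where "v (f m) = gnorm f" using gnorm_attained by blast
 thus ?thesis using le_less_trans[OF coeff_le_gnorm[OF f]] by metis
qed

lemma gnorm_nonneg: "f \<in> series n ==> 0 <= gnorm f"
 using gnorm_attained norm_nonneg by (metis tate_coeff)

lemma gnorm_eq_0: "f \<in> series n ==> gnorm f = 0 \<longleftrightarrow> f = (%_. \<zero>)"
proof
 assume f: "f \<in> series n" "gnorm f = 0"
 hence "v (f m) = 0" for m using coeff_le_gnorm[OF f(1), of m] norm_nonneg[of "f m"] by auto
 thus "f = (%_. \<zero>)" using f norm_eq_0_iff by auto
qed (simp add: gnorm_def)

lemma tate_zero_closed: "(%_. \<zero>) \<in> series n"
 by (intro tateI) auto

lemma tate_one_closed: "(%m. if m = {#} then \<one> else \<zero>) \<in> series n"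
 by (rule tateI) (auto simp: if_distrib[of v] intro: finite_subset[of _ "{{#}}"])

lemma tate_add_closed:
 assumes "f \<in> series n" "g \<in> series n"
 shows "(%m. f m \<oplus> g m) \<in> series n"
proof (rule tateI)
 fix e :: real assume e: "e > 0"
 have "{m. e <= v (f m \<oplus> g m)} \<subseteq> {m. e <= v (f m)} \<union> {m. e <= v (g m)}"
 proof
  fix m assume "m \<in> {m. e <= v (f m \<oplus> g m)}"
  thus "m \<in> {m. e <= v (f m)} \<union> {m. e <= v (g m)}"
   using norm_add[of "f m" "g m"] assms by (auto simp: max_def split: if_splits)
 qed
 thus "finite {m. e <= v (f m \<oplus> g m)}"
  using tate_finite[OF assms(1) e] tate_finite[OF assms(2) e] by (meson finite_UnI finite_subset)
qed (use assms in \<open>auto simp: tate_support\<close>)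

lemma tate_uminus_closed:
 assumes "f \<in> series n" shows "(%m. \<ominus> f m) \<in> series n"
 using assms by (auto simp: tate_carrier)

lemma tate_abelian_group: "abelian_group (tate n)"
proof (rule abelian_groupI)
 fix f assume f: "f \<in> series n"
 hence "(%m. \<ominus> f m) +\<^sub>n f = \<zero>\<^bsub>tate n\<^esub>" by (auto simp: l_neg)
 thus "\<exists>g\<in>series n. g +\<^sub>n f = \<zero>\<^bsub>tate n\<^esub>" using tate_uminus_closed[OF f] by blast
qed (auto simp: tate_zero_closed tate_add_closed a_ac)

lemma tate_mult_closed:
 assumes f: "f \<in> series n" and g: "g \<in> series n"
 shows "f *\<^sub>n g \<in> series n"
proof (rule tateI)
 fix m
 show "(f *\<^sub>n g) m \<in> carrier K" using f g by (auto simp: tate_mult)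
 show "(f *\<^sub>n g) m = \<zero>" if m: "\<not> set_mset m \<subseteq> {..<n}"
  unfolding tate_mult
 proof (intro add.finprod_one_eqI)
  fix p assume p: "p \<in> {p. p \<subseteq># m}"
  hence "set_mset m = set_mset p \<union> set_mset (m - p)"
   by (metis mem_Collect_eq set_mset_union subset_mset.add_diff_inverse)
  hence "\<not> set_mset p \<subseteq> {..<n} \<or> \<not> set_mset (m - p) \<subseteq> {..<n}" using m by auto
  hence "f p = \<zero> \<or> g (m - p) = \<zero>" using tate_support[OF f] tate_support[OF g] by blast
  thus "f p \<otimes> g (m - p) = \<zero>" using f g by auto
 qed
next
 fix e :: real assume e: "e > 0"
 define B where "B = max 1 (max (gnorm f) (gnorm g))"
 have B: "B > 0" "gnorm f <= B" "gnorm g <= B" by (auto simp: B_def)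
 define P where "P = {m. e / B <= v (f m)}"
 define Q where "Q = {m. e / B <= v (g m)}"
 have fin: "finite P" "finite Q" unfolding P_def Q_def using f g e B by (auto intro!: tate_finite)
 have "m \<in> (%(p, q). p + q) ` (P \<times> Q)" if "e <= v ((f *\<^sub>n g) m)" for m
 proof (rule ccontr)
  assume not: "m \<notin> (%(p, q). p + q) ` (P \<times> Q)"
  have "v ((f *\<^sub>n g) m) < e"
   unfolding tate_mult
  proof (intro norm_finsum_less)
   fix p assume p: "p \<in> {p. p \<subseteq># m}"
   hence "m = p + (m - p)" by simp
   hence "p \<notin> P \<or> m - p \<notin> Q" using not by (metis (no_types, lifting) SigmaI case_prod_conv image_eqI)
   hence "v (f p) * v (g (m - p)) < e"
   proof
    assume "p \<notin> P"
    hence a: "v (f p) < e / B" by (simp add: P_def not_le)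
    have b: "v (g (m - p)) <= B" using coeff_le_gnorm[OF g] B by (meson order_trans)
    have "v (f p) * v (g (m - p)) <= v (f p) * B"
     using b norm_nonneg f by (intro mult_left_mono) auto
    also have "\<dots> < e" using a B by (simp add: field_simps)
    finally show ?thesis .
   next
    assume "m - p \<notin> Q"
    hence a: "v (g (m - p)) < e / B" by (simp add: Q_def not_le)
    have b: "v (f p) <= B" using coeff_le_gnorm[OF f] B by (meson order_trans)
    have "v (f p) * v (g (m - p)) <= B * v (g (m - p))"
     using b norm_nonneg g by (intro mult_right_mono) auto
    also have "\<dots> < e" using a B by (simp add: field_simps)
    finally show ?thesis .
   qed
   thus "v (f p \<otimes> g (m - p)) < e" using f g by (simp add: val_mult)
  qed (use e f g in auto)
  thus False using that by simp
 qed
 hence "{m. e <= v ((f *\<^sub>n g) m)} \<subseteq> (%(p, q). p + q) ` (P \<times> Q)" by blast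
 thus "finite {m. e <= v ((f *\<^sub>n g) m)}" using fin by (meson finite_SigmaI finite_imageI finite_subset)
qed

lemma gnorm_mult_le:
 assumes f: "f \<in> series n" and g: "g \<in> series n"
 shows "gnorm (f *\<^sub>n g) <= gnorm f * gnorm g"
proof -
 have "v ((f *\<^sub>n g) m) <= gnorm f * gnorm g" for m
  unfolding tate_mult
 proof (intro norm_finsum_le)
  show "v (f p \<otimes> g (m - p)) <= gnorm f * gnorm g" for p
   using f g coeff_le_gnorm[OF f, of p] coeff_le_gnorm[OF g, of "m - p"]
   by (intro K.norm_mult_bound) auto
 qed (use f g gnorm_nonneg in auto)
 thus ?thesis using gnorm_le_iff[OF tate_mult_closed[OF f g]] by blast
qed

lemma tate_cring: "cring (tate n)"
proof (intro cringI tate_abelian_group)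
 show "comm_monoid (tate n)"
 proof (rule comm_monoidI)
  fix f g h assume f: "f \<in> series n" and g: "g \<in> series n"
  show "f *\<^sub>n g \<in> series n" by (rule tate_mult_closed[OF f g])
  show "f *\<^sub>n g = g *\<^sub>n f"
  proof
   fix m :: "nat multiset"
   have bij: "{p. p \<subseteq># m} = (%p. m - p) ` {p. p \<subseteq># m}"
   proof (intro Set.set_eqI iffI)
    fix p assume "p \<in> {p. p \<subseteq># m}"
    thus "p \<in> (%p. m - p) ` {p. p \<subseteq># m}"
     by (intro image_eqI[of _ _ "m - p"]) (auto simp: double_diff_mset)
   qed auto
   have inj: "inj_on (%p. m - p) {p. p \<subseteq># m}"
    by (rule inj_onI) (metis mem_Collect_eq subset_mset.diff_add subset_mset.add_diff_inverse add_left_cancel)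
   have "(g *\<^sub>n f) m = (\<Oplus>p\<in>(%p. m - p) ` {p. p \<subseteq># m}. g p \<otimes> f (m - p))"
    unfolding tate_mult using bij by simp
   also have "\<dots> = (\<Oplus>p\<in>{p. p \<subseteq># m}. g (m - p) \<otimes> f (m - (m - p)))"
    using f g by (intro finsum_reindex inj) auto
   also have "\<dots> = (\<Oplus>p\<in>{p. p \<subseteq># m}. f p \<otimes> g (m - p))"
    using f g by (intro finsum_cong') (auto simp: m_comm double_diff_mset)
   finally show "(f *\<^sub>n g) m = (g *\<^sub>n f) m" by (simp add: tate_mult)
  qed
  show "\<one>\<^bsub>tate n\<^esub> *\<^sub>n f = f"
  proof
   fix m
   have "(\<one>\<^bsub>tate n\<^esub> *\<^sub>n f) m = (\<Oplus>p\<in>{p. p \<subseteq># m}. if {#} = p then f (m - p) else \<zero>)"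
    unfolding tate_mult using f by (intro finsum_cong') auto
   also have "\<dots> = f (m - {#})" using f by (intro finsum_singleton) auto
   finally show "(\<one>\<^bsub>tate n\<^esub> *\<^sub>n f) m = f m" by simp
  qed
  assume h: "h \<in> series n"
  show "(f *\<^sub>n g) *\<^sub>n h = f *\<^sub>n (g *\<^sub>n h)"
  proof
   fix m
   define S where "S m = {p. p \<subseteq># (m :: nat multiset)}" for m
   have S [simp]: "finite (S m)" for m by (simp add: S_def)
   define F where "F = (%(q, s). f q \<otimes> (g s \<otimes> h (m - q - s)))"
   define \<beta> where "\<beta> = (%(p, q). (q, p - q :: nat multiset))"
   have "((f *\<^sub>n g) *\<^sub>n h) m
     = (\<Oplus>p\<in>S m. (\<Oplus>q\<in>S p. f q \<otimes> g (p - q) \<otimes> h (m - p)))"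
    unfolding tate_mult S_def using f g h by (intro finsum_cong') (auto simp: finsum_ldistr)
   also have "\<dots> = finsum K (%(p, q). f q \<otimes> g (p - q) \<otimes> h (m - p)) (Sigma (S m) S)"
    using f g h by (intro finsum_Sigma) auto
   also have "\<dots> = (\<Oplus>x\<in>Sigma (S m) S. F (\<beta> x))"
   proof (rule finsum_cong'[OF refl])
    show "(%x. F (\<beta> x)) \<in> Sigma (S m) S \<rightarrow> carrier K"
     using f g h by (auto simp: F_def \<beta>_def)
    fix x assume "x \<in> Sigma (S m) S"
    then obtain p q where x: "x = (p, q)" "p \<subseteq># m" "q \<subseteq># p" by (auto simp: S_def)
    hence "m - q - (p - q) = m - p" by (simp add: diff_diff_add_mset)
    thus "(case x of (p, q) => f q \<otimes> g (p - q) \<otimes> h (m - p)) = F (\<beta> x)"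
     using f g h x by (simp add: F_def \<beta>_def m_assoc)
   qed
   also have "\<dots> = (\<Oplus>x\<in>\<beta> ` Sigma (S m) S. F x)"
    using f g h by (intro finsum_reindex[symmetric] inj_onI)
     (auto simp: F_def \<beta>_def S_def, metis subset_mset.diff_add)
   also have "\<beta> ` Sigma (S m) S = Sigma (S m) (%q. S (m - q))"
   proof (intro Set.set_eqI iffI)
    fix x assume "x \<in> \<beta> ` Sigma (S m) S"
    thus "x \<in> Sigma (S m) (%q. S (m - q))"
     by (auto simp: \<beta>_def S_def subseteq_mset_def diff_le_mono) (meson order_trans)
   next
    fix x assume "x \<in> Sigma (S m) (%q. S (m - q))"
    then obtain q s where x: "x = (q, s)" "q \<subseteq># m" "s \<subseteq># m - q" by (auto simp: S_def)
    hence "q + s \<subseteq># m" by (simp add: subset_mset.le_diff_conv2 add.commute)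
    thus "x \<in> \<beta> ` Sigma (S m) S"
     using x by (intro image_eqI[of _ _ "(q + s, q)"]) (auto simp: \<beta>_def S_def)
   qed
   also have "(\<Oplus>x\<in>Sigma (S m) (%q. S (m - q)). F x)
     = (\<Oplus>q\<in>S m. (\<Oplus>s\<in>S (m - q). f q \<otimes> (g s \<otimes> h (m - q - s))))"
    unfolding F_def using f g h by (intro finsum_Sigma[symmetric]) auto
   also have "\<dots> = (f *\<^sub>n (g *\<^sub>n h)) m"
    unfolding tate_mult S_def using f g h by (intro finsum_cong') (auto simp: finsum_rdistr)
   finally show "((f *\<^sub>n g) *\<^sub>n h) m = (f *\<^sub>n (g *\<^sub>n h)) m" .
  qed
 qed (simp add: tate_one_closed)
 fix f g h assume f: "f \<in> series n" and g: "g \<in> series n" and h: "h \<in> series n"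
 show "(f +\<^sub>n g) *\<^sub>n h = f *\<^sub>n h +\<^sub>n g *\<^sub>n h"
 proof
  fix m
  have "((f +\<^sub>n g) *\<^sub>n h) m = (\<Oplus>p\<in>{p. p \<subseteq># m}. f p \<otimes> h (m - p) \<oplus> g p \<otimes> h (m - p))"
   unfolding tate_mult using f g h by (intro finsum_cong') (auto simp: l_distr)
  also have "\<dots> = (f *\<^sub>n h +\<^sub>n g *\<^sub>n h) m"
   using f g h by (subst finsum_addf) (auto simp: tate_mult)
  finally show "((f +\<^sub>n g) *\<^sub>n h) m = (f *\<^sub>n h +\<^sub>n g *\<^sub>n h) m" .
 qed
qed

lemma tate_minus:
 assumes "f \<in> series n" "g \<in> series n"
 shows "f -\<^sub>n g = (%m. f m \<ominus> g m)"
proof -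
 interpret T: cring "tate n" by (rule tate_cring)
 have "\<ominus>\<^bsub>tate n\<^esub> g = (%m. \<ominus> g m)"
  using assms tate_uminus_closed[of g n] by (intro T.minus_equality) (auto simp: l_neg)
 thus ?thesis by (simp add: a_minus_def)
qed

lemma tate_diff_closed:
 assumes "f \<in> series n" "g \<in> series n"
 shows "(%m. f m \<ominus> g m) \<in> series n"
 using tate_add_closed[OF assms(1) tate_uminus_closed[OF assms(2)]] by (simp add: minus_eq)

lemma tate_complete:
 fixes s :: "nat => nat multiset => 'k"
 assumes s: "!!i. s i \<in> series n"
  and C: "!!e. 0 < e ==> \<exists>n0. \<forall>i\<ge>n0. \<forall>j\<ge>n0. gnorm (s i -\<^sub>n s j) < e"
 shows "\<exists>l\<in>series n. (%i. gnorm (s i -\<^sub>n l)) \<longlonglongrightarrow> 0"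
proof -
 interpret T: cring "tate n" by (rule tate_cring)
 have coeff: "v (s i m \<ominus> s j m) <= gnorm (s i -\<^sub>n s j)" for i j m
  unfolding tate_minus[OF s s] by (rule coeff_le_gnorm[OF tate_diff_closed[OF s s]])
 have "\<exists>l\<in>carrier K. (%i. v (s i m \<ominus> l)) \<longlonglongrightarrow> 0" for m
 proof (rule norm_complete)
  fix e :: real assume "0 < e"
  then obtain n0 where "\<forall>i\<ge>n0. \<forall>j\<ge>n0. gnorm (s i -\<^sub>n s j) < e" using C by blast
  hence "\<forall>i\<ge>n0. \<forall>j\<ge>n0. v (s i m \<ominus> s j m) < e" using le_less_trans[OF coeff] by simp
  thus "\<exists>n0. \<forall>i\<ge>n0. \<forall>j\<ge>n0. v (s i m \<ominus> s j m) < e" by (rule exI)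
 qed (rule tate_coeff[OF s])
 hence "\<exists>l. \<forall>m. l m \<in> carrier K & (%i. v (s i m \<ominus> l m)) \<longlonglongrightarrow> 0" by (intro choice) auto
 then obtain l where l: "!!m. l m \<in> carrier K" "!!m. (%i. v (s i m \<ominus> l m)) \<longlonglongrightarrow> 0" by blast
 have unif: "\<exists>n0. \<forall>i\<ge>n0. \<forall>m. v (s i m \<ominus> l m) < e" if e: "e > 0" for e
 proof -
  obtain n0 where n0: "\<forall>i\<ge>n0. \<forall>j\<ge>n0. gnorm (s i -\<^sub>n s j) < e" using C e by blast
  have "v (s i m \<ominus> l m) < e" if i: "i \<ge> n0" for i m
  proof -
   have "eventually (%j. v (s j m \<ominus> l m) < e) sequentially"
    using l(2) e by (intro order_tendstoD) auto
   then obtain j0 where j0: "!!j. j \<ge> j0 ==> v (s j m \<ominus> l m) < e" by (auto simp: eventually_sequentially)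
   define j where "j = max j0 n0"
   have "j \<ge> n0" "j \<ge> j0" by (auto simp: j_def)
   hence "v (s i m \<ominus> s j m) < e" "v (s j m \<ominus> l m) < e"
    using le_less_trans[OF coeff] n0 i j0 by blast+
   thus ?thesis
    by (rule norm_diff_trans_less[OF tate_coeff[OF s] tate_coeff[OF s] l(1)])
  qed
  thus ?thesis by blast
 qed
 have lT: "l \<in> series n"
 proof (rule tateI)
  fix m assume m: "\<not> set_mset m \<subseteq> {..<n}"
  hence "s i m = \<zero>" for i using s tate_support by blast
  hence "v (l m) = 0"
   using l(2)[of m] l(1)[of m] by (simp add: minus_eq LIMSEQ_const_iff)
  thus "l m = \<zero>" using l(1) norm_eq_0_iff by blast
 next
  fix e :: real assume e: "e > 0"
  obtain i where i: "!!m. v (s i m \<ominus> l m) < e" using unif[OF e] by blast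
  have "{m. e <= v (l m)} \<subseteq> {m. e <= v (s i m)}"
  proof
   fix m assume "m \<in> {m. e <= v (l m)}"
   hence le: "e <= v (l m)" by simp
   have "e <= v (s i m)"
   proof (rule ccontr)
    assume "\<not> e <= v (s i m)"
    moreover have "l m = s i m \<ominus> (s i m \<ominus> l m)" using l(1)[of m] tate_coeff[OF s, of i m] by algebra
    ultimately have "v (l m) < e"
     using norm_ultra[of "s i m" "s i m \<ominus> l m"] i[of m] s l(1) by (smt (verit) minus_closed tate_coeff)
    thus False using le by simp
   qed
   thus "m \<in> {m. e <= v (s i m)}" by simp
  qed
  thus "finite {m. e <= v (l m)}" using tate_finite[OF s e] by (meson finite_subset)
 qed (rule l)
 have "(%i. gnorm (s i -\<^sub>n l)) \<longlonglongrightarrow> 0"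
 proof (rule LIMSEQ_I)
  fix r :: real assume "0 < r"
  then obtain n0 where n0: "\<forall>i\<ge>n0. \<forall>m. v (s i m \<ominus> l m) < r" using unif by blast
  have "norm (gnorm (s i -\<^sub>n l) - 0) < r" if "i \<ge> n0" for i
  proof -
   have d: "(%m. s i m \<ominus> l m) \<in> series n" by (rule tate_diff_closed[OF s lT])
   hence "gnorm (%m. s i m \<ominus> l m) < r" using n0 that gnorm_less_iff[OF d] by simp
   thus ?thesis using gnorm_nonneg[OF d] by (simp add: tate_minus[OF s lT])
  qed
  thus "\<exists>n0. \<forall>i\<ge>n0. norm (gnorm (s i -\<^sub>n l) - 0) < r" by blast
 qed
 thus ?thesis using lT by blast
qed

lemma tate_banach_ring: "banach_ring (tate n) gnorm"
proof -
 interpret T: cring "tate n" by (rule tate_cring)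
 have diff: "gnorm (f -\<^sub>n g) <= max (gnorm f) (gnorm g)"
  if f: "f \<in> series n" and g: "g \<in> series n" for f g
 proof -
  have "v (f m \<ominus> g m) <= max (gnorm f) (gnorm g)" for m
   using norm_ultra[of "f m" "g m"] coeff_le_gnorm[OF f, of m] coeff_le_gnorm[OF g, of m] f g
   by (simp add: max_def split: if_splits)
  thus ?thesis using gnorm_le_iff[of "f -\<^sub>n g" n] f g by (simp add: tate_minus tate_diff_closed)
 qed
 have one: "gnorm \<one>\<^bsub>tate n\<^esub> <= 1"
  using gnorm_le_iff[OF tate_one_closed] by (simp add: if_distrib[of v])
 show ?thesis
  by (intro banach_ring.intro nonarch_banach_group.intro nonarch_banach_group_axioms.intro
    banach_ring_axioms.intro T.is_cring T.abelian_group_axioms tate_complete)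
   (use gnorm_nonneg gnorm_eq_0 diff one gnorm_mult_le in auto)
qed

end

section \<open>Dickson's lemma\<close>

lemma nat_seq_increasing_subseq:
 fixes s :: "nat => nat"
 shows "\<exists>g :: nat => nat. strict_mono g & (\<forall>i j. i <= j --> s (g i) <= s (g j))"
proof -
 obtain f :: "nat => nat" where f: "strict_mono f" "monoseq (%n. s (f n))" using seq_monosub by blast
 show ?thesis
 proof (cases "\<forall>i j. i <= j --> s (f i) <= s (f j)")
  case True thus ?thesis using f by blast
 next
  case False
  hence dec: "s (f j) <= s (f i)" if "i <= j" for i j using f(2) that unfolding monoseq_def by blast
  obtain n0 where n0: "!!n. s (f n0) <= s (f n)"
   using ex_has_least_nat[of "%_. True" 0 "%n. s (f n)"] by auto
  have "strict_mono (%n. f (n0 + n))" using f(1) by (auto simp: strict_mono_def)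
  moreover have "s (f (n0 + n)) = s (f n0)" for n using dec[of n0 "n0 + n"] n0 by (simp add: antisym)
  ultimately show ?thesis by (intro exI[of _ "%n. f (n0 + n)"]) auto
 qed
qed

lemma dickson_subseq:
 fixes s :: "nat => nat multiset"
 shows "\<exists>g :: nat => nat. strict_mono g & (\<forall>i j k. i <= j --> k < n --> count (s (g i)) k <= count (s (g j)) k)"
proof (induction n)
 case 0 thus ?case by (intro exI[of _ id]) (auto simp: strict_mono_def)
next
 case (Suc n)
 then obtain g :: "nat => nat" where g: "strict_mono g"
  "!!i j k. i <= j ==> k < n ==> count (s (g i)) k <= count (s (g j)) k" by blast
 obtain f :: "nat => nat" where f: "strict_mono f" "!!i j. i <= j ==> count (s (g (f i))) n <= count (s (g (f j))) n"
  using nat_seq_increasing_subseq[of "%i. count (s (g i)) n"] by blast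
 have "strict_mono (%i. g (f i))" using f(1) g(1) by (auto simp: strict_mono_def)
 moreover have "count (s (g (f i))) k <= count (s (g (f j))) k" if "i <= j" "k < Suc n" for i j k
 proof (cases "k = n")
  case True thus ?thesis using f(2) that by simp
 next
  case False
  have "f i <= f j" using f(1) that(1) by (simp add: strict_mono_less_eq)
  thus ?thesis using g(2) that False by simp
 qed
 ultimately show ?case by blast
qed

text \<open>
 Divisibility of monomials in finitely many variables is a well-quasi-order.
\<close>

lemma dickson:
 fixes s :: "nat => nat multiset"
 assumes "!!i. set_mset (s i) \<subseteq> {..<n}"
 shows "\<exists>i j. i < j & s i \<subseteq># s j"
proof -
 obtain g :: "nat => nat" where g: "strict_mono g"
  "!!i j k. i <= j ==> k < n ==> count (s (g i)) k <= count (s (g j)) k" using dickson_subseq by blast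
 have "count (s (g 0)) k <= count (s (g 1)) k" for k
 proof (cases "k < n")
  case True thus ?thesis using g(2)[of 0 1 k] by simp
 next
  case False
  hence "count (s (g 0)) k = 0" using assms[of "g 0"] by (force simp: not_in_iff[symmetric])
  thus ?thesis by simp
 qed
 moreover have "g 0 < g 1" using g(1) by (simp add: strict_mono_def)
 ultimately show ?thesis by (auto simp: subseteq_mset_def)
qed

section \<open>Leading monomials\<close>

lemma add_le_less_mset:
 fixes p q a b :: "nat multiset"
 assumes "p + q = a + b" "p < a" shows "b < q"
proof (rule ccontr)
 assume "\<not> b < q"
 hence "p + q < a + b" using assms(2) by (intro add_less_le_mono) auto
 thus False using assms(1) by simp
qed

lemma (in banach_ring) diff_diff_cancel: "[|x \<in> carrier R; y \<in> carrier R|] ==> x \<ominus> (x \<ominus> y) = y"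
 by algebra

context tate_field
begin

sublocale T: banach_ring "tate n" gnorm for n
 by (rule tate_banach_ring)

lemma gnorm_zero [simp]: "gnorm (%_. \<zero>) = 0"
 by (simp add: gnorm_def)

lemma gnorm_pos: "f \<in> series n ==> f ~= (%_. \<zero>) ==> 0 < gnorm f"
 using gnorm_nonneg gnorm_eq_0 by (metis less_eq_real_def)

definition monom :: "'k => nat multiset => nat multiset => 'k" where
 "monom c a = (%m. if m = a then c else \<zero>)"

lemma monom_closed [simp]:
 "c \<in> carrier K ==> set_mset a \<subseteq> {..<n} ==> monom c a \<in> series n"
 by (rule tateI) (auto simp: monom_def if_distrib[of v] intro: finite_subset[of _ "{a}"] split: if_splits)

lemma gnorm_monom: "c \<in> carrier K ==> gnorm (monom c a) = v c"
proof -
 assume c: "c \<in> carrier K"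
 show ?thesis
 proof (rule antisym)
  show "gnorm (monom c a) <= v c" unfolding gnorm_def using c norm_nonneg by (intro cSUP_least) (auto simp: monom_def)
  have "v (monom c a a) <= gnorm (monom c a)"
   unfolding gnorm_def using c norm_nonneg by (intro cSUP_upper) (auto simp: monom_def bdd_above_def intro!: exI[of _ "v c"])
  thus "v c <= gnorm (monom c a)" by (simp add: monom_def)
 qed
qed

lemma monom_mult:
 assumes "c \<in> carrier K" "f \<in> series n"
 shows "(monom c a *\<^sub>n f) m = (if a \<subseteq># m then c \<otimes> f (m - a) else \<zero>)"
proof (cases "a \<subseteq># m")
 case True
 have "(monom c a *\<^sub>n f) m = (\<Oplus>p\<in>{p. p \<subseteq># m}. if a = p then c \<otimes> f (m - p) else \<zero>)"
  unfolding tate_mult using assms by (intro finsum_cong') (auto simp: monom_def)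
 also have "\<dots> = c \<otimes> f (m - a)" using True assms by (intro finsum_singleton) auto
 finally show ?thesis using True by simp
next
 case False
 have "(monom c a *\<^sub>n f) m = \<zero>"
  unfolding tate_mult using assms False by (intro add.finprod_one_eqI) (auto simp: monom_def)
 thus ?thesis using False by simp
qed

text \<open>
 Among the monomials at which the Gauss norm is attained, the largest one. The order on multisets
 is a well-order on the monomials in finitely many variables and is compatible with multiplication.
\<close>

definition lm :: "(nat multiset => 'k) => nat multiset" where
 "lm f = Max {m. v (f m) = gnorm f}"

lemma
 assumes f: "f \<in> series n" "f ~= (%_. \<zero>)"
 shows val_lm: "v (f (lm f)) = gnorm f"
  and above_lm: "lm f < m ==> v (f m) < gnorm f"
proof -
 have "finite {m. v (f m) = gnorm f}"
  using tate_finite[OF f(1) gnorm_pos[OF f]] by (rule finite_subset[rotated]) auto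
 moreover have "{m. v (f m) = gnorm f} ~= {}" using gnorm_attained[OF f(1)] by auto
 ultimately have M: "lm f \<in> {m. v (f m) = gnorm f}" "!!m. v (f m) = gnorm f ==> m <= lm f"
  unfolding lm_def using Max_in[of "{m. v (f m) = gnorm f}"] by (auto intro: Max_ge)
 show "v (f (lm f)) = gnorm f" using M by simp
 show "v (f m) < gnorm f" if "lm f < m"
  using M(2)[of m] that coeff_le_gnorm[OF f(1), of m] by (cases "v (f m) = gnorm f") auto
qed

lemma lm_support: "f \<in> series n ==> f ~= (%_. \<zero>) ==> set_mset (lm f) \<subseteq> {..<n}"
 using tate_support[of f n "lm f"] val_lm[of f n] gnorm_pos[of f n] by (cases "set_mset (lm f) \<subseteq> {..<n}") auto

lemma lm_less:
 assumes "f \<in> series n" "f ~= (%_. \<zero>)" "!!m. a <= m ==> v (f m) < gnorm f"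
 shows "lm f < a"
 using assms(3)[of "lm f"] val_lm[OF assms(1,2)] by (cases "a <= lm f") auto

text \<open>
 The coefficient of the product at the sum of the leading monomials is dominated by the product of
 the two leading coefficients.
\<close>

lemma gnorm_mult:
 assumes f: "f \<in> series n" and g: "g \<in> series n"
 shows "gnorm (f *\<^sub>n g) = gnorm f * gnorm g"
proof (cases "f = (%_. \<zero>) \<or> g = (%_. \<zero>)")
 case True
 hence "f *\<^sub>n g = \<zero>\<^bsub>tate n\<^esub>"
  using T.l_null[OF g] T.r_null[OF f] by (auto simp: tate_simps)
 thus ?thesis using True by auto
next
 case False
 hence f0: "f ~= (%_. \<zero>)" and g0: "g ~= (%_. \<zero>)" by auto
 have pos: "0 < gnorm f" "0 < gnorm g" using gnorm_pos[OF f f0] gnorm_pos[OF g g0] .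
 define m where "m = lm f + lm g"
 have top: "v (f (lm f) \<otimes> g (m - lm f)) = gnorm f * gnorm g"
  using f g val_lm[OF f f0] val_lm[OF g g0] by (simp add: m_def val_mult)
 have "v (finsum K (%p. f p \<otimes> g (m - p)) {p. p \<subseteq># m}) = v (f (lm f) \<otimes> g (m - lm f))"
 proof (rule norm_finsum_dominant)
  fix p assume p: "p \<in> {p. p \<subseteq># m}" "p ~= lm f"
  have "v (f p) * v (g (m - p)) < gnorm f * gnorm g"
  proof (cases "lm f < p")
   case True
   have "v (f p) * v (g (m - p)) <= v (f p) * gnorm g"
    using coeff_le_gnorm[OF g] f norm_nonneg by (intro mult_left_mono) auto
   also have "\<dots> < gnorm f * gnorm g" using above_lm[OF f f0 True] pos by simp
   finally show ?thesis .
  next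
   case False
   hence "p < lm f" using p(2) by simp
   moreover have "p + (m - p) = lm f + lm g" using p by (simp add: m_def)
   ultimately have "lm g < m - p" using add_le_less_mset by blast
   hence lt: "v (g (m - p)) < gnorm g" using above_lm[OF g g0] by blast
   have "v (f p) * v (g (m - p)) <= gnorm f * v (g (m - p))"
    using coeff_le_gnorm[OF f] g norm_nonneg by (intro mult_right_mono) auto
   also have "\<dots> < gnorm f * gnorm g" using lt pos by simp
   finally show ?thesis .
  qed
  thus "v (f p \<otimes> g (m - p)) < v (f (lm f) \<otimes> g (m - lm f))" using top f g by (simp add: val_mult)
 qed (use f g in \<open>auto simp: m_def\<close>)
 hence "v ((f *\<^sub>n g) m) = gnorm f * gnorm g" using top by (simp add: tate_mult)
 thus ?thesis
  using coeff_le_gnorm[OF tate_mult_closed[OF f g], of m] gnorm_mult_le[OF f g] by simp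
qed

lemma tate_domain: "domain (tate n)"
proof (intro domain.intro domain_axioms.intro T.is_cring)
 show "\<one>\<^bsub>tate n\<^esub> ~= \<zero>\<^bsub>tate n\<^esub>" by (auto simp: fun_eq_iff)
next
 fix a b assume ab: "a *\<^sub>n b = \<zero>\<^bsub>tate n\<^esub>" and a: "a \<in> series n" and b: "b \<in> series n"
 have "gnorm a * gnorm b = 0" using gnorm_mult[OF a b] ab by simp
 hence "gnorm a = 0 \<or> gnorm b = 0" by simp
 thus "a = \<zero>\<^bsub>tate n\<^esub> \<or> b = \<zero>\<^bsub>tate n\<^esub>" using gnorm_eq_0[OF a] gnorm_eq_0[OF b] by auto
qed

section \<open>Tate algebras are strictly Noetherian\<close>

text \<open>
 Division with an error: the largest monomial whose coefficient exceeds the tolerance is cancelled as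
 long as some leading monomial in \<open>G\<close> divides it. Only monomials below it are affected beyond the tolerance, so this stops.
\<close>

lemma division_step:
 assumes G: "G \<subseteq> series n" "!!g. g \<in> G ==> gnorm g <= 1" "!!g. g \<in> G ==> g (lm g) = \<one>"
  "!!g m. g \<in> G ==> lm g < m ==> v (g m) <= \<epsilon>"
  and c: "0 < c" and \<epsilon>: "0 < \<epsilon>" "\<epsilon> < 1" and f: "f \<in> series n" "gnorm f <= c"
 shows "\<exists>z\<in>combs (tate n) gnorm (tate n) id {\<zero>\<^bsub>tate n\<^esub>} G c. \<exists>r\<in>series n. gnorm r <= c &
   (\<forall>m. r m ~= \<zero> --> (\<forall>g\<in>G. \<not> lm g \<subseteq># m)) & gnorm (f -\<^sub>n (z +\<^sub>n r)) <= \<epsilon> * c"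
proof -
 define L where "L = combs (tate n) gnorm (tate n) id {\<zero>\<^bsub>tate n\<^esub>} G c"
 note zero_ideal = T.zeroideal[of n]
 have zero_sub: "additive_subgroup {\<zero>\<^bsub>tate n\<^esub>} (tate n)" using zero_ideal by (rule ideal.axioms)
 have LT: "z \<in> series n" if "z \<in> L" for z
  using banach_hom.lc_carrier[OF T.id_banach_hom[of n] that[unfolded L_def]] G(1) T.zero_closed[of n] by blast
 have "\<forall>f. f \<in> series n --> gnorm f <= c --> (\<forall>m. \<epsilon> * c < v (f m) --> m < \<mu>) -->
  (\<exists>z\<in>L. \<exists>r\<in>series n. gnorm r <= c &
   (\<forall>m. r m ~= \<zero> --> (\<forall>g\<in>G. \<not> lm g \<subseteq># m)) & gnorm (f -\<^sub>n (z +\<^sub>n r)) <= \<epsilon> * c)" for \<mu>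
 proof (induction \<mu> rule: less_induct)
  case (less \<mu>)
  show ?case
  proof (intro allI impI)
   fix f assume f: "f \<in> series n" "gnorm f <= c" "\<forall>m. \<epsilon> * c < v (f m) --> m < \<mu>"
   show "\<exists>z\<in>L. \<exists>r\<in>series n. gnorm r <= c &
     (\<forall>m. r m ~= \<zero> --> (\<forall>g\<in>G. \<not> lm g \<subseteq># m)) & gnorm (f -\<^sub>n (z +\<^sub>n r)) <= \<epsilon> * c"
   proof (cases "\<forall>m. v (f m) <= \<epsilon> * c")
    case True
    have "\<zero>\<^bsub>tate n\<^esub> \<in> L" unfolding L_def by (rule combs.base) simp
    moreover have "f -\<^sub>n (\<zero>\<^bsub>tate n\<^esub> +\<^sub>n \<zero>\<^bsub>tate n\<^esub>) = f"
     using f(1) T.l_zero[OF T.zero_closed] T.diff_zero[OF f(1)] by metis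
    moreover have "gnorm f <= \<epsilon> * c" using True gnorm_le_iff[OF f(1)] by blast
    moreover have "gnorm \<zero>\<^bsub>tate n\<^esub> <= c" using c by simp
    ultimately show ?thesis using T.zero_closed[of n]
     by (intro bexI[of _ "\<zero>\<^bsub>tate n\<^esub>"] conjI) (simp_all del: T.r_zero T.l_zero)
   next
    case False
    define A where "A = {m. \<epsilon> * c < v (f m)}"
    have finA: "finite A"
     using tate_finite[OF f(1), of "\<epsilon> * c"] c \<epsilon> unfolding A_def by (auto intro: finite_subset[rotated])
    have neA: "A ~= {}" using False by (auto simp: A_def not_le)
    define m0 where "m0 = Max A"
    have m0: "m0 \<in> A" "!!m. m \<in> A ==> m <= m0" using finA neA by (auto simp: m0_def)
    have m0lt: "m0 < \<mu>" using m0(1) f(3) by (auto simp: A_def)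
    have above: "v (f m) <= \<epsilon> * c" if "m0 < m" for m
     using m0(2)[of m] that by (auto simp: A_def not_le[symmetric])
    have pos: "0 <= \<epsilon> * c" using c \<epsilon> by simp
    hence fm0: "f m0 ~= \<zero>" using m0(1) by (auto simp: A_def)
    have fc: "f m0 \<in> carrier K" "v (f m0) <= c" using f(1) coeff_le_gnorm[OF f(1), of m0] f(2) by auto
    have m0s: "set_mset m0 \<subseteq> {..<n}" using tate_support[OF f(1)] fm0 by blast
    \<comment> \<open>the two ways of removing the term \<open>m0\<close> differ only in the element \<open>q\<close> that is subtracted\<close>
    have reduce: "\<forall>m. \<epsilon> * c < v ((f -\<^sub>n q) m) --> m < m0"
     if q: "q \<in> series n" "q m0 = f m0" "!!m. m0 < m ==> v (q m) <= \<epsilon> * c" for q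
    proof (intro allI impI)
     fix m assume a: "\<epsilon> * c < v ((f -\<^sub>n q) m)"
     hence a': "\<epsilon> * c < v (f m \<ominus> q m)" by (simp add: tate_minus[OF f(1) q(1)])
     have "m ~= m0" using a' q(2) fc pos by auto
     moreover have "\<not> m0 < m"
      using a' above[of m] q(3)[of m] norm_ultra[of "f m" "q m"] tate_coeff[OF f(1)] tate_coeff[OF q(1)]
      by (auto simp: max_def split: if_splits)
     ultimately show "m < m0" by simp
    qed
    have small: "gnorm (f -\<^sub>n q) <= c" "f -\<^sub>n q \<in> series n"
     if q: "q \<in> series n" "gnorm q <= c" for q
     using f q T.norm_diff_le[of f n q c] by auto
    show ?thesis
    proof (cases "\<exists>g\<in>G. lm g \<subseteq># m0")
     case True
     then obtain g where g: "g \<in> G" "lm g \<subseteq># m0" by blast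
     have gT: "g \<in> series n" using G g by auto
     define a where "a = m0 - lm g"
     have as: "set_mset a \<subseteq> {..<n}" using m0s set_mset_mono[of a m0] unfolding a_def by auto
     define x where "x = monom (f m0) a"
     have x: "x \<in> series n" "gnorm x <= c"
      using fc as by (auto simp: x_def gnorm_monom)
     define q where "q = x *\<^sub>n g"
     have q: "q \<in> series n" unfolding q_def using x gT by simp
     have qL: "q \<in> L"
      unfolding L_def q_def
      using banach_hom.lc_single[OF T.id_banach_hom[of n], of "{\<zero>\<^bsub>tate n\<^esub>}" g G x c] zero_sub g(1) gT x
      by simp
     have coeff: "q m = (if a \<subseteq># m then f m0 \<otimes> g (m - a) else \<zero>)" for m
      unfolding q_def x_def by (rule monom_mult[OF fc(1) gT])
     have am: "a + lm g = m0" unfolding a_def using g by simp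
     hence "m0 - a = lm g" "a \<subseteq># m0" by auto
     hence "q m0 = f m0" using coeff[of m0] G(3)[OF g(1)] fc by simp
     moreover have "v (q m) <= \<epsilon> * c" if "m0 < m" for m
     proof (cases "a \<subseteq># m")
      case True
      hence "lm g + a < (m - a) + a" using that am by (simp add: add.commute)
      hence "lm g < m - a" by simp
      hence "v (g (m - a)) <= \<epsilon>" using G(4) g by blast
      hence "v (f m0 \<otimes> g (m - a)) <= c * \<epsilon>" using fc gT by (intro K.norm_mult_bound) auto
      thus ?thesis using coeff[of m] True by (simp add: mult.commute)
     next
      case False thus ?thesis using coeff[of m] c \<epsilon> by simp
     qed
     ultimately have red: "\<forall>m. \<epsilon> * c < v ((f -\<^sub>n q) m) --> m < m0" using reduce[OF q] by blast
     have "gnorm q <= c * 1" unfolding q_def using x gT G(2)[OF g(1)] by (intro T.norm_mult_bound)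
     hence sm: "gnorm (f -\<^sub>n q) <= c" "f -\<^sub>n q \<in> series n" using small[OF q] by auto
     obtain z r where zr: "z \<in> L" "r \<in> series n" "gnorm r <= c"
      "\<forall>m. r m ~= \<zero> --> (\<forall>g\<in>G. \<not> lm g \<subseteq># m)"
      "gnorm ((f -\<^sub>n q) -\<^sub>n (z +\<^sub>n r)) <= \<epsilon> * c"
      using less[OF m0lt, rule_format, OF sm(2,1) red[rule_format]] by blast
     have "q +\<^sub>n z \<in> L" unfolding L_def
      by (rule banach_hom.lc_add[OF T.id_banach_hom[of n] qL[unfolded L_def] zr(1)[unfolded L_def] zero_sub G(1)])
     moreover have "(f -\<^sub>n q) -\<^sub>n (z +\<^sub>n r) = f -\<^sub>n ((q +\<^sub>n z) +\<^sub>n r)"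
      using T.diff_add_eq[OF f(1) q, of "z +\<^sub>n r"] T.a_assoc[OF q LT[OF zr(1)] zr(2)]
       T.a_closed[OF LT[OF zr(1)] zr(2)] by (simp del: tate_simps)
     ultimately show ?thesis using zr
      by (intro bexI[of _ "q +\<^sub>n z"] bexI[of _ r] conjI) (simp_all del: tate_simps)
    next
     case False
     define q where "q = monom (f m0) m0"
     have q: "q \<in> series n" "gnorm q <= c" "q m0 = f m0"
      using fc m0s by (auto simp: q_def gnorm_monom) (simp add: monom_def)
     have "v (q m) <= \<epsilon> * c" if "m0 < m" for m
      using less_imp_neq[OF that] pos by (auto simp: q_def monom_def)
     hence red: "\<forall>m. \<epsilon> * c < v ((f -\<^sub>n q) m) --> m < m0" using reduce[OF q(1,3)] by blast
     have sm: "gnorm (f -\<^sub>n q) <= c" "f -\<^sub>n q \<in> series n" using small[OF q(1,2)] by auto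
     obtain z r where zr: "z \<in> L" "r \<in> series n" "gnorm r <= c"
      "\<forall>m. r m ~= \<zero> --> (\<forall>g\<in>G. \<not> lm g \<subseteq># m)"
      "gnorm ((f -\<^sub>n q) -\<^sub>n (z +\<^sub>n r)) <= \<epsilon> * c"
      using less[OF m0lt, rule_format, OF sm(2,1) red[rule_format]] by blast
     have "\<forall>m. (r +\<^sub>n q) m ~= \<zero> --> (\<forall>g\<in>G. \<not> lm g \<subseteq># m)"
      using zr(4) False tate_coeff[OF zr(2)] by (auto simp: q_def monom_def split: if_splits)
     moreover have "gnorm (r +\<^sub>n q) <= c" using zr q by (intro T.norm_add_le) auto
     moreover have "r +\<^sub>n q \<in> series n" using zr q by (intro T.a_closed)
     moreover have "(f -\<^sub>n q) -\<^sub>n (z +\<^sub>n r) = f -\<^sub>n (z +\<^sub>n (r +\<^sub>n q))"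
     proof -
      have "z +\<^sub>n (r +\<^sub>n q) = q +\<^sub>n (z +\<^sub>n r)"
       using LT[OF zr(1)] zr(2) q(1) T.a_ac by metis
      thus ?thesis
       using T.diff_add_eq[OF f(1) q(1) T.a_closed[OF LT[OF zr(1)] zr(2)]] by metis
     qed
     ultimately show ?thesis using zr
      by (intro bexI[of _ z] bexI[of _ "r +\<^sub>n q"] conjI) (simp_all del: tate_simps)
    qed
   qed
  qed
 qed
 moreover have "\<exists>\<mu>. \<forall>m. \<epsilon> * c < v (f m) --> m < \<mu>"
 proof -
  have fin: "finite {m. \<epsilon> * c < v (f m)}"
   using tate_finite[OF f(1), of "\<epsilon> * c"] c \<epsilon> by (auto intro: finite_subset[rotated])
  define \<mu> where "\<mu> = Max (insert {#} {m. \<epsilon> * c < v (f m)}) + {#0#}"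
  have "m < \<mu>" if "\<epsilon> * c < v (f m)" for m
  proof -
   have "m <= Max (insert {#} {m. \<epsilon> * c < v (f m)})" using fin that by (intro Max_ge) auto
   also have "\<dots> < \<mu>" by (simp add: \<mu>_def)
   finally show ?thesis .
  qed
  thus ?thesis by blast
 qed
 ultimately show ?thesis using f unfolding L_def by blast
qed

lemma exists_tail_bound:
 assumes g: "g \<in> series n" "g ~= (%_. \<zero>)" "gnorm g <= 1"
 shows "\<exists>\<epsilon>. 0 < \<epsilon> & \<epsilon> < 1 & (\<forall>m. lm g < m --> v (g m) <= \<epsilon>)"
proof -
 define A where "A = {m. 1/2 <= v (g m)} \<inter> {m. lm g < m}"
 have A: "finite A" unfolding A_def using tate_finite[OF g(1), of "1/2"] by (intro finite_Int) auto
 define \<epsilon> where "\<epsilon> = Max (insert (1/2) ((%m. v (g m)) ` A))"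
 have "\<epsilon> \<in> insert (1/2) ((%m. v (g m)) ` A)" unfolding \<epsilon>_def using A by (intro Max_in) auto
 moreover have "v (g m) < 1" if "m \<in> A" for m
  using above_lm[OF g(1,2), of m] that g(3) by (simp add: A_def)
 ultimately have "\<epsilon> < 1" by auto
 moreover have "1/2 <= \<epsilon>" unfolding \<epsilon>_def using A by (intro Max_ge) auto
 moreover have "v (g m) <= \<epsilon>" if "lm g < m" for m
 proof (cases "m \<in> A")
  case True thus ?thesis unfolding \<epsilon>_def using A by (intro Max_ge) auto
 next
  case False thus ?thesis using that \<open>1/2 <= \<epsilon>\<close> by (auto simp: A_def)
 qed
 ultimately show ?thesis by (intro exI[of _ \<epsilon>]) auto
qed

text \<open>
 Finitely many leading monomials generate all others by Dickson's lemma.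
\<close>

lemma exists_standard_basis:
 assumes I: "ideal I (tate n)"
 shows "\<exists>G. finite G & G \<subseteq> I & (\<forall>g\<in>G. g ~= (%_. \<zero>) & gnorm g <= 1 & g (lm g) = \<one>) &
  (\<forall>f\<in>I. f ~= (%_. \<zero>) --> (\<exists>g\<in>G. lm g \<subseteq># lm f))"
proof -
 interpret I: ideal I "tate n" by fact
 have IT: "f \<in> series n" if "f \<in> I" for f using that I.a_subset by auto
 define L where "L = lm ` (I - {%_. \<zero>})"
 define Mi where "Mi = {\<mu> \<in> L. \<forall>\<nu>\<in>L. \<nu> \<subseteq># \<mu> --> \<nu> = \<mu>}"
 have below: "\<exists>\<nu>\<in>Mi. \<nu> \<subseteq># \<mu>" if "\<mu> \<in> L" for \<mu>
  using that
 proof (induction "size \<mu>" arbitrary: \<mu> rule: less_induct)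
  case less
  show ?case
  proof (cases "\<mu> \<in> Mi")
   case False
   then obtain \<nu> where \<nu>: "\<nu> \<in> L" "\<nu> \<subseteq># \<mu>" "\<nu> ~= \<mu>" using less by (auto simp: Mi_def)
   hence "size \<nu> < size \<mu>" by (simp add: mset_subset_size subset_mset_def)
   then obtain \<rho> where "\<rho> \<in> Mi" "\<rho> \<subseteq># \<nu>" using less \<nu> by blast
   thus ?thesis using \<nu> by (meson subset_mset.order_trans)
  qed auto
 qed
 have "finite Mi"
 proof (rule ccontr)
  assume "infinite Mi"
  then obtain s :: "nat => nat multiset" where s: "inj s" "range s \<subseteq> Mi"
   using infinite_countable_subset by blast
  have "set_mset (s i) \<subseteq> {..<n}" for i
  proof -
   have "s i \<in> L" using s(2) unfolding Mi_def by blast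
   then obtain f where f: "s i = lm f" "f \<in> I - {%_. \<zero>}" unfolding L_def by (rule imageE)
   hence "f \<in> I" "f ~= (%_. \<zero>)" by simp_all
   thus ?thesis unfolding f(1) by (intro lm_support IT)
  qed
  then obtain i j where ij: "i < j" "s i \<subseteq># s j" using dickson[of s n] by blast
  hence "s i = s j" using s(2) by (auto simp: Mi_def image_subset_iff)
  thus False using s(1) ij(1) by (simp add: inj_eq)
 qed
 have "\<exists>g. \<forall>\<mu>\<in>Mi. g \<mu> \<in> I & g \<mu> ~= (%_. \<zero>) & gnorm (g \<mu>) <= 1 & g \<mu> \<mu> = \<one> & lm (g \<mu>) = \<mu>"
 proof (intro bchoice ballI)
  fix \<mu> assume "\<mu> \<in> Mi"
  then obtain f where f: "f \<in> I" "f ~= (%_. \<zero>)" "lm f = \<mu>" by (auto simp: Mi_def L_def)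
  have fT: "f \<in> series n" using IT f by auto
  have pos: "0 < gnorm f" using gnorm_pos[OF fT f(2)] .
  have vf: "v (f \<mu>) = gnorm f" using val_lm[OF fT f(2)] f(3) by simp
  have f0: "f \<mu> ~= \<zero>" "f \<mu> \<in> carrier K" using vf pos fT by auto
  define c where "c = inv (f \<mu>)"
  have c: "c \<in> carrier K" "v c = inverse (gnorm f)" "c \<otimes> f \<mu> = \<one>"
   using f0 vf val_inv[OF f0(2,1)] field_Units by (auto simp: c_def)
  define g where "g = monom c {#} *\<^sub>n f"
  have cT: "monom c {#} \<in> series n" using c by simp
  have gI: "g \<in> I" unfolding g_def using f cT by (intro I.I_l_closed)
  have gT: "g \<in> series n" using IT gI by auto
  have coeff: "g m = c \<otimes> f m" for m unfolding g_def using monom_mult[OF c(1) fT, of "{#}" m] by simp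
  have vg: "v (g m) = inverse (gnorm f) * v (f m)" for m using coeff c fT by (simp add: val_mult)
  have gn: "gnorm g = 1"
   unfolding g_def using gnorm_mult[OF cT fT] c pos by (simp add: gnorm_monom)
  have "{m. v (g m) = gnorm g} = {m. v (f m) = gnorm f}"
   using gn pos by (auto simp: vg field_simps)
  hence "lm g = \<mu>" unfolding lm_def using f(3) by (simp add: lm_def)
  moreover have "g ~= (%_. \<zero>)" using gn by auto
  ultimately show "\<exists>g. g \<in> I & g ~= (%_. \<zero>) & gnorm g <= 1 & g \<mu> = \<one> & lm g = \<mu>"
   using gI gn coeff[of \<mu>] c(3) by (intro exI[of _ g]) simp
 qed
 then obtain g where g: "!!\<mu>. \<mu> \<in> Mi ==> g \<mu> \<in> I & g \<mu> ~= (%_. \<zero>) & gnorm (g \<mu>) <= 1 & g \<mu> \<mu> = \<one> & lm (g \<mu>) = \<mu>"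
  by blast
 have "\<exists>h\<in>g ` Mi. lm h \<subseteq># lm f" if f: "f \<in> I" "f ~= (%_. \<zero>)" for f
 proof -
  have "lm f \<in> L" using f by (auto simp: L_def)
  then obtain \<nu> where "\<nu> \<in> Mi" "\<nu> \<subseteq># lm f" using below by blast
  thus ?thesis using g[of \<nu>] by (intro bexI[of _ "g \<nu>"]) auto
 qed
 thus ?thesis using \<open>finite Mi\<close> g by (intro exI[of _ "g ` Mi"]) auto
qed

text \<open>
 Dividing an element of \<open>I\<close> by a standard basis leaves a remainder that is small relative to it, as its
 leading monomial would otherwise be divisible by one of the basis. Successive approximation finishes the proof.
\<close>

theorem tate_strictly_noetherian: "banach_ring.strictly_noetherian (tate n) gnorm"
 unfolding T.strictly_noetherian_def
proof (intro allI impI)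
 fix I assume I: "ideal I (tate n)"
 interpret I: ideal I "tate n" by fact
 have IT: "f \<in> series n" if "f \<in> I" for f using that I.a_subset by auto
 obtain G where G: "finite G" "G \<subseteq> I" "!!g. g \<in> G ==> g ~= (%_. \<zero>)" "!!g. g \<in> G ==> gnorm g <= 1"
  "!!g. g \<in> G ==> g (lm g) = \<one>" "!!f. f \<in> I ==> f ~= (%_. \<zero>) ==> \<exists>g\<in>G. lm g \<subseteq># lm f"
  using exists_standard_basis[OF I] by blast
 have GT: "G \<subseteq> series n" using G(2) IT by auto
 have "\<exists>e. \<forall>g\<in>G. 0 < e g & e g < 1 & (\<forall>m. lm g < m --> v (g m) <= e g)"
  using exists_tail_bound G GT by (intro bchoice ballI) auto
 then obtain e where e: "!!g. g \<in> G ==> 0 < e g & e g < 1 & (\<forall>m. lm g < m --> v (g m) <= e g)" by blast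
 define \<epsilon> where "\<epsilon> = Max (insert (1/2) (e ` G))"
 have "\<epsilon> \<in> insert (1/2) (e ` G)" unfolding \<epsilon>_def using G by (intro Max_in) auto
 hence \<epsilon>: "0 < \<epsilon>" "\<epsilon> < 1" using e by auto
 have tail: "v (g m) <= \<epsilon>" if "g \<in> G" "lm g < m" for g m
 proof -
  have "e g <= \<epsilon>" unfolding \<epsilon>_def using G that by (intro Max_ge) auto
  thus ?thesis using e[OF that(1)] that(2) by (meson order_trans)
 qed
 have GI: "z \<in> I" if "z \<in> combs (tate n) gnorm (tate n) id {\<zero>\<^bsub>tate n\<^esub>} G c" for z c
  using that
 proof induction
  case (base j) thus ?case using I.zero_closed by simp
 next
  case (step z w x)
  hence "x *\<^sub>n w \<in> I" using G(2) by (intro I.I_l_closed) auto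
  thus ?case using step by (simp del: tate_simps)
 qed
 have step: "\<exists>f'\<in>I. gnorm f' <= \<epsilon> * c & f -\<^sub>n f' \<in> combs (tate n) gnorm (tate n) id {\<zero>\<^bsub>tate n\<^esub>} G c"
  if f: "f \<in> I" "gnorm f <= c" "0 < c" for f c
 proof -
  have fT: "f \<in> series n" using IT f by auto
  obtain z r where z: "z \<in> combs (tate n) gnorm (tate n) id {\<zero>\<^bsub>tate n\<^esub>} G c"
   and r: "r \<in> series n" "gnorm r <= c" "!!m g. r m ~= \<zero> ==> g \<in> G ==> \<not> lm g \<subseteq># m"
    "gnorm (f -\<^sub>n (z +\<^sub>n r)) <= \<epsilon> * c"
  proof -
   have "\<exists>z\<in>combs (tate n) gnorm (tate n) id {\<zero>\<^bsub>tate n\<^esub>} G c. \<exists>r\<in>series n. gnorm r <= c &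
     (\<forall>m. r m ~= \<zero> --> (\<forall>g\<in>G. \<not> lm g \<subseteq># m)) & gnorm (f -\<^sub>n (z +\<^sub>n r)) <= \<epsilon> * c"
    by (rule division_step) (fact GT G(4) G(5) tail f(3) \<epsilon> fT f(2))+
   thus thesis using that by blast
  qed
  have zI: "z \<in> I" using GI[OF z] .
  have zT: "z \<in> series n" using IT zI by auto
  define f' where "f' = f -\<^sub>n z"
  have f'I: "f' \<in> I" unfolding f'_def a_minus_def using f(1) zI by (intro I.a_closed I.a_inv_closed)
  have f'T: "f' \<in> series n" using IT f'I by auto
  have fz: "f -\<^sub>n f' = z" unfolding f'_def by (rule T.diff_diff_cancel[OF fT zT])
  have f'r: "gnorm (f' -\<^sub>n r) <= \<epsilon> * c"
   using r(4) T.diff_add_eq[OF fT zT r(1)] by (simp add: f'_def)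
  have "gnorm f' <= \<epsilon> * c"
  proof (rule ccontr)
   assume "\<not> gnorm f' <= \<epsilon> * c"
   hence big: "\<epsilon> * c < gnorm f'" by simp
   moreover have "0 < \<epsilon> * c" using f(3) \<epsilon> by simp
   ultimately have f'0: "f' ~= (%_. \<zero>)" by auto
   have "r (lm f') ~= \<zero>"
   proof
    assume r0: "r (lm f') = \<zero>"
    have "v ((f' -\<^sub>n r) (lm f')) = gnorm f'"
     using r0 f'T val_lm[OF f'T f'0] by (simp add: tate_minus[OF f'T r(1)])
    hence "gnorm f' <= \<epsilon> * c"
     using coeff_le_gnorm[OF T.minus_closed[OF f'T r(1)], of "lm f'"] f'r by linarith
    thus False using big by simp
   qed
   moreover obtain g where "g \<in> G" "lm g \<subseteq># lm f'" using G(6)[OF f'I f'0] by blast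
   ultimately show False using r(3) by blast
  qed
  thus ?thesis using f'I fz z by (intro bexI[of _ f']) auto
 qed
 have "f \<in> combs (tate n) gnorm (tate n) id {\<zero>\<^bsub>tate n\<^esub>} G (1 * gnorm f)" if f: "f \<in> I" for f
 proof (cases "f = (%_. \<zero>)")
  case True thus ?thesis by (simp add: combs.base)
 next
  case False
  have fT: "f \<in> series n" using IT f by auto
  define c where "c = gnorm f"
  have c: "0 < c" unfolding c_def using gnorm_pos[OF fT False] .
  define U where "U k = {u \<in> I. gnorm u <= c * \<epsilon> ^ k}" for k :: nat
  have "f \<in> combs (tate n) gnorm (tate n) id {\<zero>\<^bsub>tate n\<^esub>} G c"
  proof (rule banach_hom.lc_successive_approximation[OF T.id_banach_hom[of n], where \<delta> = \<epsilon> and U = U and C = c])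
   show "ideal {\<zero>\<^bsub>tate n\<^esub>} (tate n)" by (rule T.zeroideal)
   show "nonarch_banach_group.norm_closed (tate n) gnorm {\<zero>\<^bsub>tate n\<^esub>}" by (rule T.norm_closed_zero)
   show "u \<in> series n & gnorm u <= c * \<epsilon> ^ k" if "u \<in> U k" for k u using that IT by (auto simp: U_def)
   show "\<exists>u'\<in>U (Suc k). u -\<^sub>n u' \<in> combs (tate n) gnorm (tate n) id {\<zero>\<^bsub>tate n\<^esub>} G (c * \<epsilon> ^ k)"
    if "u \<in> U k" for k u
   proof -
    have "u \<in> I" "gnorm u <= c * \<epsilon> ^ k" using that by (auto simp: U_def)
    moreover have "0 < c * \<epsilon> ^ k" using c \<epsilon> by simp
    ultimately obtain u' where "u' \<in> I" "gnorm u' <= \<epsilon> * (c * \<epsilon> ^ k)"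
     "u -\<^sub>n u' \<in> combs (tate n) gnorm (tate n) id {\<zero>\<^bsub>tate n\<^esub>} G (c * \<epsilon> ^ k)" using step by blast
    thus ?thesis by (intro bexI[of _ u']) (auto simp: U_def mult_ac)
   qed
   show "f \<in> U 0" using f by (simp add: U_def c_def)
  qed (use G(1) GT c \<epsilon> in auto)
  thus ?thesis by (simp add: c_def)
 qed
 thus "\<exists>W K. finite W & W \<subseteq> I & 0 <= K &
   (\<forall>x\<in>I. x \<in> combs (tate n) gnorm (tate n) id {\<zero>\<^bsub>tate n\<^esub>} W (K * gnorm x))"
  using G(1,2) by (intro exI[of _ G] exI[of _ 1]) auto
qed

end

text \<open>
 Combinations of the first \<open>n\<close> vectors \<open>t\<close> with coefficients of norm at most 1.
\<close>

inductive_set unit_span :: "('r, 'm) ring_scheme => ('r => real) => (nat => nat => 'r) => nat => (nat => 'r) set"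
 for R N t n where
 base: "(%_. \<zero>\<^sub>R) \<in> unit_span R N t n"
| step: "[|z \<in> unit_span R N t n; j < n; x \<in> carrier R; N x <= 1|] ==>
   (%i. z i \<oplus>\<^sub>R x \<otimes>\<^sub>R t j i) \<in> unit_span R N t n"

context banach_ring
begin

lemma unit_span_closed:
 assumes "z \<in> unit_span R N t n" "!!j. t j i \<in> carrier R" shows "z i \<in> carrier R"
 using assms(1) by induction (use assms(2) in auto)

lemma unit_span_bound:
 assumes "z \<in> unit_span R N t n" "!!j. t j i \<in> carrier R" "!!j. N (t j i) <= B" "0 <= B"
 shows "N (z i) <= B"
 using assms(1)
proof induction
 case (step z j x)
 have "N (x \<otimes> t j i) <= 1 * B" using step assms by (intro norm_mult_bound) auto
 thus ?case using step assms unit_span_closed[OF step(1)] by (intro norm_add_le) auto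
qed (use assms in auto)

lemma unit_span_mono: "z \<in> unit_span R N t n ==> n <= n' ==> z \<in> unit_span R N t n'"
 by (induction rule: unit_span.induct) (auto intro: unit_span.intros)

lemma unit_span_add:
 assumes "y \<in> unit_span R N t n" "z \<in> unit_span R N t n" and t: "!!j i. t j i \<in> carrier R"
 shows "(%i. y i \<oplus> z i) \<in> unit_span R N t n"
 using assms(2)
proof induction
 case base
 have "(%i. y i \<oplus> \<zero>) = y" using unit_span_closed[OF assms(1) t] by auto
 thus ?case using assms(1) by simp
next
 case (step z j x)
 have "(%i. y i \<oplus> (z i \<oplus> x \<otimes> t j i)) = (%i. (y i \<oplus> z i) \<oplus> x \<otimes> t j i)"
  using unit_span_closed[OF assms(1) t] unit_span_closed[OF step(1) t] step t by (auto simp: a_assoc)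
 thus ?case using unit_span.step[OF step(5,2-4)] by simp
qed

lemma unit_span_scale:
 assumes "z \<in> unit_span R N t n" "y \<in> carrier R" "N y <= 1" and t: "!!j i. t j i \<in> carrier R"
 shows "(%i. y \<otimes> z i) \<in> unit_span R N t n"
 using assms(1)
proof induction
 case base thus ?case using assms(2) unit_span.base[of R N t n] by simp
next
 case (step z j x)
 have "(%i. y \<otimes> (z i \<oplus> x \<otimes> t j i)) = (%i. y \<otimes> z i \<oplus> (y \<otimes> x) \<otimes> t j i)"
  using unit_span_closed[OF step(1) t] step t assms(2) by (auto simp: r_distr m_assoc)
 moreover have "N (y \<otimes> x) <= 1 * 1" using step assms by (intro norm_mult_bound) auto
 ultimately show ?case using unit_span.step[OF step(5,2), of "y \<otimes> x"] step(3) assms(2) by simp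
qed

lemma unit_span_residual:
 assumes t: "!!j i. t j i \<in> carrier R" and z: "z \<in> unit_span R N t n" and z': "z' \<in> unit_span R N t n'"
  and "n < n'" and x: "x \<in> carrier R" "N x <= 1"
 shows "\<exists>u\<in>unit_span R N t n'. \<forall>i. (t n' i \<ominus> z' i) \<ominus> x \<otimes> (t n i \<ominus> z i) = t n' i \<ominus> u i"
proof -
 have "(%i. \<zero> \<oplus> x \<otimes> t n i) \<in> unit_span R N t n'"
  using assms by (intro unit_span.intros)
 hence "(%i. z' i \<oplus> (\<zero> \<oplus> x \<otimes> t n i)) \<in> unit_span R N t n'"
  by (rule unit_span_add[OF z' _ t])
 moreover have "(%i. (\<ominus> x) \<otimes> z i) \<in> unit_span R N t n'"
  using x unit_span_mono[OF z] assms(4) by (intro unit_span_scale t) auto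
 ultimately have "(%i. (z' i \<oplus> (\<zero> \<oplus> x \<otimes> t n i)) \<oplus> (\<ominus> x) \<otimes> z i) \<in> unit_span R N t n'"
  by (rule unit_span_add[OF _ _ t])
 moreover have "(t n' i \<ominus> z' i) \<ominus> x \<otimes> (t n i \<ominus> z i)
   = t n' i \<ominus> ((z' i \<oplus> (\<zero> \<oplus> x \<otimes> t n i)) \<oplus> (\<ominus> x) \<otimes> z i)" for i
  using t[of n i] t[of n' i] unit_span_closed[OF z t, of i] unit_span_closed[OF z' t, of i] x(1) by algebra
 ultimately show ?thesis
  by (intro bexI[of _ "%i. (z' i \<oplus> (\<zero> \<oplus> x \<otimes> t n i)) \<oplus> (\<ominus> x) \<otimes> z i"] allI)
qed

end

context tate_field
begin

text \<open>
 After scaling by \<open>B\<close> and passing to the reduction this says that submodules of a free module of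
 rank \<open>d\<close> over a polynomial ring are finitely generated. If it fails, every residual has a coordinate of norm \<open>B\<close>. Take
 residuals whose first such coordinate comes as late as possible and has the least leading monomial there: the pairs of index
 and monomial contradict Dickson's lemma.
\<close>

lemma approximate_dependence:
 fixes t :: "nat => nat => nat multiset => 'k"
 assumes t: "!!j i. t j i \<in> series n" "!!j i. gnorm (t j i) <= B" and B0: "0 < B"
 shows "\<exists>N. \<exists>z\<in>unit_span (tate n) gnorm t N. \<forall>i<d. gnorm (t N i -\<^sub>n z i) < B"
proof (rule ccontr)
 assume contra: "\<not> ?thesis"
 define Res where "Res N = {w. \<exists>z\<in>unit_span (tate n) gnorm t N. w = (%i. t N i -\<^sub>n z i)}" for N
 have B: "0 <= B" using B0 by simp
 have wT: "w i \<in> series n" if "w \<in> Res N" for w N i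
 proof -
  obtain z where z: "z \<in> unit_span (tate n) gnorm t N" "w = (%i. t N i -\<^sub>n z i)"
   using \<open>w \<in> Res N\<close> unfolding Res_def by blast
  show ?thesis unfolding z(2) by (intro T.minus_closed t T.unit_span_closed[OF z(1) t(1)])
 qed
 have wB: "gnorm (w i) <= B" if w: "w \<in> Res N" for w N i
 proof -
  obtain z where z: "z \<in> unit_span (tate n) gnorm t N" "w = (%i. t N i -\<^sub>n z i)"
   using w by (auto simp: Res_def)
  have "gnorm (z i) <= B" using T.unit_span_bound[OF z(1) t B] .
  thus ?thesis unfolding z(2) using t T.unit_span_closed[OF z(1) t(1)] by (intro T.norm_diff_le)
 qed
 define ind where "ind w = (LEAST i. i < d & gnorm (w i) = B)" for w
 have ind: "ind w < d & gnorm (w (ind w)) = B" if w: "w \<in> Res N" for w N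
  unfolding ind_def
 proof (rule LeastI_ex)
  obtain z where z: "z \<in> unit_span (tate n) gnorm t N" "w = (%i. t N i -\<^sub>n z i)"
   using w by (auto simp: Res_def)
  then obtain i where "i < d" "\<not> gnorm (w i) < B" using contra by blast
  thus "\<exists>i. i < d & gnorm (w i) = B" using wB[OF w, of i] by (intro exI[of _ i]) auto
 qed
 have ind_below: "gnorm (w i) < B" if "w \<in> Res N" "i < ind w" for w N i
  using not_less_Least[of i "%i. i < d & gnorm (w i) = B"] that ind[OF that(1)] wB[OF that(1), of i]
  unfolding ind_def[symmetric] by auto
 have ind_max: "ind w \<ge> i0"
  if "w \<in> Res N" "!!i. i < i0 ==> gnorm (w i) < B" for w N i0
  using ind[OF that(1)] that(2)[of "ind w"] by (cases "ind w < i0") auto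
 have ne: "Res N ~= {}" for N unfolding Res_def using unit_span.base[of "tate n" gnorm t N] by auto
 have "\<exists>w. w \<in> Res N & (\<forall>u\<in>Res N. ind u <= ind w & (ind u = ind w --> lm (w (ind w)) <= lm (u (ind u))))" for N
 proof -
  define m where "m = Max (ind ` Res N)"
  have fin: "finite (ind ` Res N)" using ind by (auto intro!: finite_subset[of _ "{..<d}"])
  have m: "m \<in> ind ` Res N" "!!u. u \<in> Res N ==> ind u <= m"
   using fin ne by (auto simp: m_def)
  define l where "l = (LEAST l. \<exists>u\<in>Res N. ind u = m & lm (u m) = l)"
  have "\<exists>u\<in>Res N. ind u = m & lm (u m) = l"
   unfolding l_def by (rule LeastI_ex) (use m(1) in auto)
  then obtain w where w: "w \<in> Res N" "ind w = m" "lm (w m) = l" by blast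
  have "l <= lm (u m)" if "u \<in> Res N" "ind u = m" for u
   unfolding l_def using that by (intro Least_le) auto
  thus ?thesis using w m(2) by (intro exI[of _ w]) auto
 qed
 hence "\<exists>w. \<forall>N. w N \<in> Res N & (\<forall>u\<in>Res N. ind u <= ind (w N) &
   (ind u = ind (w N) --> lm (w N (ind (w N))) <= lm (u (ind u))))" by (intro choice allI)
 then obtain w where w: "!!N. w N \<in> Res N" "!!N u. u \<in> Res N ==> ind u <= ind (w N)"
  "!!N u. u \<in> Res N ==> ind u = ind (w N) ==> lm (w N (ind (w N))) <= lm (u (ind u))" by blast
 define i where "i N = ind (w N)" for N
 define y where "y N = w N (i N)" for N
 define \<mu> where "\<mu> N = lm (y N)" for N
 have i: "i N < d" "gnorm (y N) = B" for N using ind[OF w(1), of N] by (auto simp: i_def y_def)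
 have yT: "y N \<in> series n" for N unfolding y_def by (rule wT[OF w(1)])
 have y0: "y N ~= (%_. \<zero>)" for N using i(2)[of N] B0 by auto
 have \<mu>s: "set_mset (\<mu> N) \<subseteq> {..<n}" for N unfolding \<mu>_def by (rule lm_support[OF yT y0])
 hence \<mu>c: "count (\<mu> N) k = 0" if "k \<ge> n" for N k
  using that by (metis count_eq_zero_iff lessThan_iff not_le subsetD)
 \<comment> \<open>two more variables record the index, so that divisibility forces equal indices\<close>
 define s where "s N = \<mu> N + (replicate_mset (i N) n + replicate_mset (d - i N) (Suc n))" for N
 have "set_mset (s N) \<subseteq> {..<Suc (Suc n)}" for N
  using \<mu>s[of N] by (auto simp: s_def split: if_splits)
 then obtain N N' where N: "N < N'" "s N \<subseteq># s N'" using dickson[of s] by blast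
 have sc: "count (s N) k <= count (s N') k" for k using N(2) by (simp add: subseteq_mset_def)
 have ieq: "i N = i N'"
  using sc[of n] sc[of "Suc n"] i(1)[of N] i(1)[of N'] by (simp add: s_def \<mu>c)
 have \<mu>sub: "\<mu> N \<subseteq># \<mu> N'"
  unfolding subseteq_mset_def
 proof
  fix k show "count (\<mu> N) k <= count (\<mu> N') k" using sc[of k] ieq by (simp add: s_def)
 qed
 define a where "a = \<mu> N' - \<mu> N"
 have a: "\<mu> N + a = \<mu> N'" unfolding a_def using \<mu>sub by simp
 have as: "set_mset a \<subseteq> {..<n}" using \<mu>s[of N'] a by (metis le_sup_iff set_mset_union)
 have vy: "v (y M (\<mu> M)) = B" for M unfolding \<mu>_def using val_lm[OF yT y0] i(2) by simp
 define c where "c = y N' (\<mu> N') \<otimes> inv (y N (\<mu> N))"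
 have yc: "y M m \<in> carrier K" for M m using tate_coeff[OF yT] .
 have yn0: "y M (\<mu> M) ~= \<zero>" for M using vy[of M] B0 by auto
 have yu: "y M (\<mu> M) \<in> Units K" for M using yc yn0 field_Units by simp
 have c: "c \<in> carrier K" "v c = 1" "c \<otimes> y N (\<mu> N) = y N' (\<mu> N')"
 proof -
  show "c \<in> carrier K" unfolding c_def using yc yu by simp
  show "v c = 1" unfolding c_def using yc yu yn0 vy B0 by (simp add: val_mult val_inv)
  show "c \<otimes> y N (\<mu> N) = y N' (\<mu> N')" unfolding c_def using yc yu by (simp add: m_assoc)
 qed
 define x where "x = monom c a"
 have x: "x \<in> series n" "gnorm x <= 1" using c as by (auto simp: x_def gnorm_monom)
 define u where "u = (%i. w N' i -\<^sub>n x *\<^sub>n w N i)"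
 have uR: "u \<in> Res N'"
 proof -
  obtain z where z: "z \<in> unit_span (tate n) gnorm t N" "w N = (%i. t N i -\<^sub>n z i)"
   using w(1)[of N] by (auto simp: Res_def)
  obtain z' where z': "z' \<in> unit_span (tate n) gnorm t N'" "w N' = (%i. t N' i -\<^sub>n z' i)"
   using w(1)[of N'] by (auto simp: Res_def)
  obtain q where "q \<in> unit_span (tate n) gnorm t N'"
   "\<forall>i. (t N' i -\<^sub>n z' i) -\<^sub>n x *\<^sub>n (t N i -\<^sub>n z i) = t N' i -\<^sub>n q i"
   using T.unit_span_residual[OF t(1) z(1) z'(1) N(1) x] by blast
  thus ?thesis unfolding Res_def u_def z(2) z'(2) by blast
 qed
 have below: "gnorm (u j) < B" if "j < i N'" for j
 proof -
  have w': "gnorm (w N' j) < B" using ind_below[OF w(1)] that by (simp add: i_def)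
  have w'': "gnorm (w N j) < B" using ind_below[OF w(1)] that ieq by (simp add: i_def)
  have "gnorm (x *\<^sub>n w N j) <= 1 * gnorm (w N j)"
   using x wT[OF w(1)] by (intro T.norm_mult_bound) auto
  thus ?thesis
   using w' w'' T.norm_ultra[OF wT[OF w(1)] T.m_closed[OF x(1) wT[OF w(1)]], of N' j N j] by (simp add: u_def)
 qed
 have uy: "u (i N') = y N' -\<^sub>n x *\<^sub>n y N" using ieq by (simp add: u_def y_def)
 have coeff: "u (i N') m = y N' m \<ominus> (if a \<subseteq># m then c \<otimes> y N (m - a) else \<zero>)" for m
  unfolding uy x_def using tate_minus[OF yT T.m_closed[OF x(1) yT], of N' N] monom_mult[OF c(1) yT]
  by (simp add: x_def)
 have sm: "v (u (i N') m) < B" if m: "\<mu> N' <= m" for m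
 proof (cases "m = \<mu> N'")
  case True
  have "\<mu> N' - a = \<mu> N" "a \<subseteq># \<mu> N'" using a by (metis add_diff_cancel_right', metis mset_subset_eq_add_right)
  thus ?thesis using coeff[of m] True c(3) B0 yc by simp
 next
  case False
  hence lt: "\<mu> N' < m" using m by simp
  have 1: "v (y N' m) < B" using above_lm[OF yT y0, of N' m] lt i(2) by (simp add: \<mu>_def)
  have 2: "v (if a \<subseteq># m then c \<otimes> y N (m - a) else \<zero>) < B"
  proof (cases "a \<subseteq># m")
   case True
   hence "\<mu> N + a < (m - a) + a" using a lt by simp
   hence "\<mu> N < m - a" by simp
   hence "v (y N (m - a)) < B" using above_lm[OF yT y0, of N] i(2) by (simp add: \<mu>_def)
   thus ?thesis using True c yc by (simp add: val_mult)
  qed (use B0 in simp)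
  show ?thesis unfolding coeff
   using norm_ultra[of "y N' m" "if a \<subseteq># m then c \<otimes> y N (m - a) else \<zero>"] 1 2 yc c(1)
   by (auto simp: max_def split: if_splits)
 qed
 have uT: "u j \<in> series n" for j by (rule wT[OF uR])
 show False
 proof (cases "gnorm (u (i N')) = B")
  case True
  have "ind u = i N'"
   using ind_max[OF uR below] w(2)[OF uR] by (simp add: i_def antisym)
  hence "\<mu> N' <= lm (u (i N'))" using w(3)[OF uR] by (simp add: \<mu>_def y_def i_def)
  moreover have "u (i N') ~= (%_. \<zero>)" using True B0 by auto
  ultimately show False using lm_less[OF uT, of "i N'" "\<mu> N'"] sm True by (simp add: not_less[symmetric])
 next
  case False
  hence "gnorm (u (i N')) < B" using wB[OF uR, of "i N'"] by simp
  hence "ind u \<ge> Suc (i N')" using below by (intro ind_max[OF uR]) (auto simp: less_Suc_eq)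
  thus False using w(2)[OF uR] by (simp add: i_def)
 qed
qed

end

section \<open>Evaluation homomorphisms\<close>

definition power_product :: "('a, 'm) ring_scheme => nat => (nat => 'a) => nat multiset => 'a" where
 "power_product R n x m = finprod R (%i. x i [^]\<^sub>R count m i) {..<n}"

context cring
begin

lemma power_product_closed [simp]:
 "(!!i. i < n ==> x i \<in> carrier R) ==> power_product R n x m \<in> carrier R"
 unfolding power_product_def by (intro finprod_closed) auto

lemma power_product_empty [simp]: "power_product R n x {#} = \<one>"
 unfolding power_product_def by (intro finprod_one_eqI) auto

lemma power_product_add:
 assumes "!!i. i < n ==> x i \<in> carrier R"
 shows "power_product R n x (m + m') = power_product R n x m \<otimes> power_product R n x m'"
proof -
 have "power_product R n x (m + m') = finprod R (%i. x i [^] count m i \<otimes> x i [^] count m' i) {..<n}"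
  unfolding power_product_def using assms by (intro finprod_cong') (auto simp: nat_pow_mult)
 also have "\<dots> = power_product R n x m \<otimes> power_product R n x m'"
  unfolding power_product_def using assms by (intro finprod_multf) auto
 finally show ?thesis .
qed

lemma power_product_single:
 assumes "!!i. i < n ==> x i \<in> carrier R" "j < n"
 shows "power_product R n x {#j#} = x j"
proof -
 have "power_product R n x {#j#} = finprod R (%i. if j = i then x i else \<one>) {..<n}"
  unfolding power_product_def using assms by (intro finprod_cong') auto
 also have "\<dots> = x j" using assms by (intro finprod_singleton) auto
 finally show ?thesis .
qed

end

lemma (in banach_ring) add_diff_add:
 "[|a \<in> carrier R; b \<in> carrier R; c \<in> carrier R; d \<in> carrier R|] ==> (a \<oplus> b) \<ominus> (c \<oplus> d) = (a \<ominus> c) \<oplus> (b \<ominus> d)"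
 by algebra

lemma banach_algebra_imp_banach_ring:
 assumes "banach_algebra K v A" shows "banach_ring A (nrm A)"
proof -
 interpret banach_algebra K v A by fact
 show ?thesis
  by (intro banach_ring.intro banach_ring_axioms.intro A.M_cring A.nonarch_banach_group_axioms)
   (use norm_one norm_mult in auto)
qed

context tate_field
begin

lemma tate_dense_induct [consumes 1, case_names zero add limit]:
 assumes f: "f \<in> series n"
  and zero: "P (%_. \<zero>)"
  and add: "!!f c a. [|f \<in> series n; P f; c \<in> carrier K; set_mset a \<subseteq> {..<n}|] ==> P (f +\<^sub>n monom c a)"
  and limit: "!!f. [|f \<in> series n; !!e. 0 < e ==> \<exists>g\<in>series n. P g & gnorm (f -\<^sub>n g) <= e|] ==> P f"
 shows "P f"
proof -
 define cut where "cut A = (%m. if m \<in> A then f m else \<zero>)" for A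
 have cut: "cut A \<in> series n" for A
 proof (rule tateI)
  fix e :: real assume e: "e > 0"
  have "{m. e <= v (cut A m)} \<subseteq> {m. e <= v (f m)}" using e by (auto simp: cut_def)
  thus "finite {m. e <= v (cut A m)}" using tate_finite[OF f e] finite_subset by blast
 qed (use f tate_support[OF f] in \<open>auto simp: cut_def\<close>)
 have fin: "P (cut A)" if "finite A" for A
  using that
 proof (induction A)
  case empty
  have "cut {} = (%_. \<zero>)" by (simp add: cut_def)
  thus ?case using zero by simp
 next
  case (insert a A)
  show ?case
  proof (cases "set_mset a \<subseteq> {..<n}")
   case True
   have "cut A +\<^sub>n monom (f a) a = cut (insert a A)"
    using insert f by (auto simp: cut_def monom_def fun_eq_iff)
   thus ?thesis using add[OF cut insert(3) tate_coeff[OF f] True, of a] by simp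
  next
   case False
   hence "f a = \<zero>" using tate_support[OF f] by blast
   hence "cut (insert a A) = cut A" by (auto simp: cut_def fun_eq_iff)
   thus ?thesis using insert by simp
  qed
 qed
 show ?thesis
 proof (rule limit[OF f])
  fix e :: real assume e: "0 < e"
  define A where "A = {m. e <= v (f m)}"
  have "finite A" unfolding A_def by (rule tate_finite[OF f e])
  moreover have "gnorm (f -\<^sub>n cut A) <= e"
   unfolding tate_minus[OF f cut] gnorm_le_iff[OF tate_diff_closed[OF f cut]]
   using e f by (auto simp: cut_def A_def)
  ultimately show "\<exists>g\<in>series n. P g & gnorm (f -\<^sub>n g) <= e" using fin cut by blast
 qed
qed

text \<open>
 Polynomials are dense.
\<close>

lemma additive_map_unique:
 assumes C: "banach_ring C M"
  and \<phi>: "!!f g. f \<in> series n ==> g \<in> series n ==> \<phi> (f +\<^sub>n g) = \<phi> f \<oplus>\<^sub>C \<phi> g"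
   "!!f. f \<in> series n ==> \<phi> f \<in> carrier C"
   "!!f. f \<in> series n ==> M (\<phi> f) <= B * gnorm f"
  and \<psi>: "!!f g. f \<in> series n ==> g \<in> series n ==> \<psi> (f +\<^sub>n g) = \<psi> f \<oplus>\<^sub>C \<psi> g"
   "!!f. f \<in> series n ==> \<psi> f \<in> carrier C"
   "!!f. f \<in> series n ==> M (\<psi> f) <= B' * gnorm f"
  and eq: "!!c a. c \<in> carrier K ==> set_mset a \<subseteq> {..<n} ==> \<phi> (monom c a) = \<psi> (monom c a)"
  and f: "f \<in> series n"
 shows "\<phi> f = \<psi> f"
proof -
 interpret C: banach_ring C M by fact
 define D where "D = max 1 (max B B')"
 have D: "1 <= D" "B <= D" "B' <= D" by (auto simp: D_def)
 have z: "\<chi> (%_. \<zero>) = \<zero>\<^sub>C"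
  if "!!f g. f \<in> series n ==> g \<in> series n ==> \<chi> (f +\<^sub>n g) = \<chi> f \<oplus>\<^sub>C \<chi> g"
   "!!f. f \<in> series n ==> \<chi> f \<in> carrier C" for \<chi>
  using that(1)[OF tate_zero_closed tate_zero_closed] that(2)[OF tate_zero_closed] C.add.l_cancel_one'
  by (simp add: fun_eq_iff)
 have dif: "\<chi> f \<ominus>\<^sub>C \<chi> g = \<chi> (f -\<^sub>n g)"
  if "!!f g. f \<in> series n ==> g \<in> series n ==> \<chi> (f +\<^sub>n g) = \<chi> f \<oplus>\<^sub>C \<chi> g"
   "!!f. f \<in> series n ==> \<chi> f \<in> carrier C" "f \<in> series n" "g \<in> series n" for \<chi> f g
 proof -
  have c: "f -\<^sub>n g \<in> series n" using that by (intro T.minus_closed)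
  have "\<chi> f = \<chi> (f -\<^sub>n g) \<oplus>\<^sub>C \<chi> g"
   using that(1)[OF c that(4)] T.diff_add_cancel[OF that(3,4)] by simp
  thus ?thesis using that(2)[OF c] that(2)[OF that(4)] by (simp add: C.minus_eq C.a_assoc C.r_neg)
 qed
 show ?thesis using f
 proof (induction rule: tate_dense_induct)
  case zero thus ?case using z[of \<phi>] z[of \<psi>] \<phi> \<psi> by simp
 next
  case (add f c a) thus ?case using \<phi>(1)[of f "monom c a"] \<psi>(1)[of f "monom c a"] eq by simp
 next
  case (limit f)
  have "\<phi> f \<ominus>\<^sub>C \<psi> f = \<zero>\<^sub>C"
  proof (rule C.eq_zero_if_norm_small)
   fix e :: real assume e: "0 < e"
   hence "0 < e / (2 * D)" using D by simp
   then obtain g where g: "g \<in> series n" "\<phi> g = \<psi> g" "gnorm (f -\<^sub>n g) <= e / (2 * D)"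
    using limit(2) by blast
   have c: "f -\<^sub>n g \<in> series n" using limit(1) g by (intro T.minus_closed)
   have nn: "0 <= gnorm (f -\<^sub>n g)" by (rule gnorm_nonneg[OF c])
   have le: "E * gnorm (f -\<^sub>n g) <= e / 2" if "E <= D" for E
   proof -
    have "E * gnorm (f -\<^sub>n g) <= D * (e / (2 * D))"
     using that g(3) nn D by (intro mult_mono) auto
    thus ?thesis using D by simp
   qed
   have 1: "M (\<phi> f \<ominus>\<^sub>C \<phi> g) <= e / 2"
    using \<phi>(3)[OF c] le[OF D(2)] dif[of \<phi> f g] \<phi>(1,2) limit(1) g by simp
   have 2: "M (\<psi> g \<ominus>\<^sub>C \<psi> f) <= e / 2"
    using \<psi>(3)[OF c] le[OF D(3)] dif[of \<psi> f g] \<psi>(1,2) limit(1) g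
     C.norm_diff_commute[of "\<psi> g" "\<psi> f"] by simp
   have "M (\<phi> f \<ominus>\<^sub>C \<psi> f) <= e / 2"
    using C.norm_diff_trans[OF \<phi>(2)[OF limit(1)] \<phi>(2)[OF g(1)] \<psi>(2)[OF limit(1)] 1] 2 g(2) by simp
   thus "M (\<phi> f \<ominus>\<^sub>C \<psi> f) < e" using e by linarith
  qed (use \<phi> \<psi> limit in auto)
  thus ?case using C.diff_eq_zero_iff \<phi>(2) \<psi>(2) limit(1) by blast
 qed
qed

end

locale tate_eval = tate_field K v for K :: "'k ring" (structure) and v +
 fixes C :: "('k, 'c) normed_module" and n :: nat and x :: "nat => 'c" and B :: real
 assumes alg: "banach_algebra K v C"
  and x: "!!i. i < n ==> x i \<in> carrier C"
  and B: "!!m. nrm C (power_product C n x m) <= B" "1 <= B"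
begin

sublocale C: banach_ring C "nrm C"
 by (rule banach_algebra_imp_banach_ring[OF alg])

sublocale M: module K C
 using alg by (simp add: banach_algebra_def algebra_def)

abbreviation "pp \<equiv> power_product C n x"

lemma pp [simp]: "pp m \<in> carrier C" by (intro C.power_product_closed x)

lemma smult_mult:
 "c \<in> carrier K ==> a \<in> carrier C ==> b \<in> carrier C ==> (c \<odot>\<^sub>C a) \<otimes>\<^sub>C b = c \<odot>\<^sub>C (a \<otimes>\<^sub>C b)"
 using alg by (simp add: banach_algebra_def algebra_def algebra_axioms_def)

lemma norm_smult: "c \<in> carrier K ==> a \<in> carrier C ==> nrm C (c \<odot>\<^sub>C a) = v c * nrm C a"
 using alg by (simp add: banach_algebra_def banach_algebra_axioms_def)

definition E :: "nat multiset set => (nat multiset => 'k) => 'c" where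
 "E A f = finsum C (%m. f m \<odot>\<^sub>C pp m) A"

lemma E_closed: "f \<in> series n ==> E A f \<in> carrier C"
 unfolding E_def by (intro C.finsum_closed) auto

lemma norm_term: "f \<in> series n ==> v (f m) <= e ==> nrm C (f m \<odot>\<^sub>C pp m) <= B * e"
proof -
 assume f: "f \<in> series n" "v (f m) <= e"
 have "v (f m) * nrm C (pp m) <= e * B"
  using f B norm_nonneg[of "f m"] C.norm_nonneg[OF pp, of m] by (intro mult_mono) auto
 thus ?thesis using f by (simp add: norm_smult mult.commute)
qed

lemma norm_E: "f \<in> series n ==> (!!m. m \<in> A ==> v (f m) <= e) ==> 0 <= e ==> nrm C (E A f) <= B * e"
 unfolding E_def using B by (intro C.norm_finsum_le norm_term) auto

lemma E_diff:
 assumes f: "f \<in> series n" and A: "finite A" "finite A'"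
  and e: "!!m. m \<in> A - A' ==> v (f m) <= e" "!!m. m \<in> A' - A ==> v (f m) <= e" "0 <= e"
 shows "nrm C (E A f \<ominus>\<^sub>C E A' f) <= B * e"
proof -
 have split: "E X f = E (X - Y) f \<oplus>\<^sub>C E (X \<inter> Y) f" if "finite X" for X Y
 proof -
  have "X = (X - Y) \<union> (X \<inter> Y)" by auto
  hence "E X f = E ((X - Y) \<union> (X \<inter> Y)) f" by simp
  also have "\<dots> = E (X - Y) f \<oplus>\<^sub>C E (X \<inter> Y) f"
   unfolding E_def using f that by (intro C.finsum_Un_disjoint) auto
  finally show ?thesis .
 qed
 have "A' \<inter> A = A \<inter> A'" by auto
 hence "E A f \<ominus>\<^sub>C E A' f = E (A - A') f \<ominus>\<^sub>C E (A' - A) f"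
  using split[OF A(1), of A'] split[OF A(2), of A] E_closed[OF f] by (simp add: C.add_diff_add_cancel)
 moreover have "nrm C (E (A - A') f) <= B * e" "nrm C (E (A' - A) f) <= B * e"
  using e by (auto intro!: norm_E[OF f])
 ultimately show ?thesis using E_closed[OF f] by (auto intro!: C.norm_diff_le)
qed

text \<open>
 The value of the power series \<open>f\<close>, as the limit of its finite partial sums.
\<close>

definition is_ev :: "(nat multiset => 'k) => 'c => bool" where
 "is_ev f y \<longleftrightarrow> y \<in> carrier C & (\<forall>e>0. \<forall>A. finite A --> (\<forall>m. m \<notin> A --> v (f m) <= e) --> nrm C (y \<ominus>\<^sub>C E A f) <= B * e)"

lemma is_evI:
 assumes f: "f \<in> series n" and y: "y \<in> carrier C"
  and ex: "!!e. e > 0 ==> \<exists>A. finite A & (\<forall>m. m \<notin> A --> v (f m) <= e) & nrm C (y \<ominus>\<^sub>C E A f) <= B * e"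
 shows "is_ev f y"
 unfolding is_ev_def
proof (intro conjI allI impI)
 fix e :: real and A assume e: "0 < e" "finite A" "\<forall>m. m \<notin> A --> v (f m) <= e"
 obtain A' where A': "finite A'" "\<forall>m. m \<notin> A' --> v (f m) <= e" "nrm C (y \<ominus>\<^sub>C E A' f) <= B * e"
  using ex[OF e(1)] by blast
 have "nrm C (E A' f \<ominus>\<^sub>C E A f) <= B * e" using e A' by (intro E_diff[OF f]) auto
 thus "nrm C (y \<ominus>\<^sub>C E A f) <= B * e"
  by (rule C.norm_diff_trans[OF y E_closed[OF f] E_closed[OF f] A'(3)])
qed (rule y)

lemma is_ev_exists:
 assumes f: "f \<in> series n" shows "\<exists>y. is_ev f y"
proof -
 define S where "S k = {m. (1/2) ^ k <= v (f m)}" for k :: nat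
 have S: "finite (S k)" for k unfolding S_def by (rule tate_finite[OF f]) simp
 have off: "v (f m) <= (1/2) ^ k" if "m \<notin> S k'" "k <= k'" for m k k'
 proof -
  have "v (f m) <= (1/2) ^ k'" using that by (simp add: S_def)
  also have "\<dots> <= (1/2) ^ k" using that by (intro power_decreasing) auto
  finally show ?thesis .
 qed
 have small: "\<exists>k. (1/2::real) ^ k < e" if "0 < e" for e using that by (intro real_arch_pow_inv) auto
 have "\<exists>l\<in>carrier C. (%k. nrm C (E (S k) f \<ominus>\<^sub>C l)) \<longlonglongrightarrow> 0"
 proof (rule C.norm_complete)
  fix e :: real assume e: "0 < e"
  then obtain k where k: "(1/2) ^ k < e / B" using small[of "e / B"] B by auto
  have "nrm C (E (S i) f \<ominus>\<^sub>C E (S j) f) < e" if "i \<ge> k" "j \<ge> k" for i j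
  proof -
   have "nrm C (E (S i) f \<ominus>\<^sub>C E (S j) f) <= B * (1/2) ^ k"
    using that off by (intro E_diff[OF f S S]) auto
   also have "\<dots> < e" using k B by (simp add: field_simps)
   finally show ?thesis .
  qed
  thus "\<exists>n0. \<forall>i\<ge>n0. \<forall>j\<ge>n0. nrm C (E (S i) f \<ominus>\<^sub>C E (S j) f) < e" by blast
 qed (rule E_closed[OF f])
 then obtain y where y: "y \<in> carrier C" "(%k. nrm C (E (S k) f \<ominus>\<^sub>C y)) \<longlonglongrightarrow> 0" by blast
 have "is_ev f y"
 proof (rule is_evI[OF f y(1)])
  fix e :: real assume e: "0 < e"
  obtain k where k: "(1/2) ^ k < e" using small e by blast
  have "eventually (%k. nrm C (E (S k) f \<ominus>\<^sub>C y) < B * e) sequentially"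
   using y(2) e B by (intro order_tendstoD) auto
  then obtain k0 where k0: "!!k. k \<ge> k0 ==> nrm C (E (S k) f \<ominus>\<^sub>C y) < B * e" by (auto simp: eventually_sequentially)
  define k' where "k' = max k k0"
  have "nrm C (y \<ominus>\<^sub>C E (S k') f) <= B * e"
   using k0[of k'] C.norm_diff_commute[OF y(1) E_closed[OF f]] by (simp add: k'_def)
  moreover have "\<forall>m. m \<notin> S k' --> v (f m) <= e" using off[of _ k' k] k by (force simp: k'_def)
  ultimately show "\<exists>A. finite A & (\<forall>m. m \<notin> A --> v (f m) <= e) & nrm C (y \<ominus>\<^sub>C E A f) <= B * e"
   using S by blast
 qed
 thus ?thesis by blast
qed

lemma is_ev_unique:
 assumes f: "f \<in> series n" and y: "is_ev f y" "is_ev f z" shows "y = z"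
proof -
 have yz: "y \<in> carrier C" "z \<in> carrier C" using y by (auto simp: is_ev_def)
 have "y \<ominus>\<^sub>C z = \<zero>\<^sub>C"
 proof (rule C.eq_zero_if_norm_small)
  fix e :: real assume e: "0 < e"
  define e' where "e' = e / (2 * B)"
  have e': "0 < e'" using e B by (simp add: e'_def)
  define A where "A = {m. e' <= v (f m)}"
  have A: "finite A" "\<forall>m. m \<notin> A --> v (f m) <= e'" using tate_finite[OF f e'] by (auto simp: A_def)
  have 1: "nrm C (y \<ominus>\<^sub>C E A f) <= B * e'" "nrm C (z \<ominus>\<^sub>C E A f) <= B * e'"
   using y A e' by (auto simp: is_ev_def)
  have "nrm C (E A f \<ominus>\<^sub>C z) <= B * e'" using 1(2) C.norm_diff_commute[OF yz(2) E_closed[OF f]] by simp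
  hence "nrm C (y \<ominus>\<^sub>C z) <= B * e'" by (rule C.norm_diff_trans[OF yz(1) E_closed[OF f] yz(2) 1(1)])
  also have "\<dots> < e" using e B by (simp add: e'_def)
  finally show "nrm C (y \<ominus>\<^sub>C z) < e" .
 qed (use yz in auto)
 thus ?thesis using C.diff_eq_zero_iff yz by blast
qed

definition ev :: "(nat multiset => 'k) => 'c" where "ev f = (THE y. is_ev f y)"

lemma is_ev_ev: "f \<in> series n ==> is_ev f (ev f)"
 unfolding ev_def using is_ev_exists is_ev_unique by (metis theI)

lemma ev_eqI: "f \<in> series n ==> is_ev f y ==> ev f = y"
 using is_ev_ev is_ev_unique by blast

lemma ev_closed [simp]: "f \<in> series n ==> ev f \<in> carrier C"
 using is_ev_ev by (auto simp: is_ev_def)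

lemma norm_ev: "f \<in> series n ==> nrm C (ev f) <= B * gnorm f"
proof (rule field_le_epsilon)
 fix e :: real assume f: "f \<in> series n" and e: "0 < e"
 define e' where "e' = gnorm f + e / B"
 have e': "0 < e'" using gnorm_nonneg[OF f] e B by (simp add: e'_def add_nonneg_pos)
 have "v (f m) <= e'" for m using coeff_le_gnorm[OF f, of m] e B by (simp add: e'_def add_increasing2)
 hence "nrm C (ev f \<ominus>\<^sub>C E {} f) <= B * e'" using is_ev_ev[OF f] e' by (auto simp: is_ev_def)
 thus "nrm C (ev f) <= B * gnorm f + e" using f B by (simp add: E_def e'_def distrib_left)
qed

lemma ev_add:
 assumes f: "f \<in> series n" and g: "g \<in> series n"
 shows "ev (f +\<^sub>n g) = ev f \<oplus>\<^sub>C ev g"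
proof (rule ev_eqI)
 show fg: "f +\<^sub>n g \<in> series n" using f g by (rule T.a_closed)
 show "is_ev (f +\<^sub>n g) (ev f \<oplus>\<^sub>C ev g)"
 proof (rule is_evI[OF fg])
  fix e :: real assume e: "0 < e"
  define A where "A = {m. e <= v (f m)} \<union> {m. e <= v (g m)}"
  have A: "finite A" "!!m. m \<notin> A ==> v (f m) <= e" "!!m. m \<notin> A ==> v (g m) <= e"
   using tate_finite[OF f e] tate_finite[OF g e] by (auto simp: A_def)
  have "E A (f +\<^sub>n g) = finsum C (%m. f m \<odot>\<^sub>C pp m \<oplus>\<^sub>C g m \<odot>\<^sub>C pp m) A"
   unfolding E_def using f g by (intro C.finsum_cong') (auto simp: M.smult_l_distr)
  also have "\<dots> = E A f \<oplus>\<^sub>C E A g" unfolding E_def using f g by (intro C.finsum_addf) auto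
  finally have "ev f \<oplus>\<^sub>C ev g \<ominus>\<^sub>C E A (f +\<^sub>n g) = (ev f \<ominus>\<^sub>C E A f) \<oplus>\<^sub>C (ev g \<ominus>\<^sub>C E A g)"
   using C.add_diff_add[OF ev_closed[OF f] ev_closed[OF g] E_closed[OF f] E_closed[OF g]] by simp
  moreover have "nrm C (ev f \<ominus>\<^sub>C E A f) <= B * e" "nrm C (ev g \<ominus>\<^sub>C E A g) <= B * e"
   using is_ev_ev[OF f] is_ev_ev[OF g] A e by (auto simp: is_ev_def)
  ultimately have "nrm C (ev f \<oplus>\<^sub>C ev g \<ominus>\<^sub>C E A (f +\<^sub>n g)) <= B * e"
   using f g E_closed by (auto intro!: C.norm_add_le)
  moreover have "v ((f +\<^sub>n g) m) <= e" if "m \<notin> A" for m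
   using A(2,3)[OF that] f g by (auto intro!: norm_add_le)
  ultimately show "\<exists>A. finite A & (\<forall>m. m \<notin> A --> v ((f +\<^sub>n g) m) <= e) &
    nrm C (ev f \<oplus>\<^sub>C ev g \<ominus>\<^sub>C E A (f +\<^sub>n g)) <= B * e" using A(1) by blast
 qed (use f g in auto)
qed

lemma ev_monom_mult:
 assumes c: "c \<in> carrier K" and a: "set_mset a \<subseteq> {..<n}" and g: "g \<in> series n"
 shows "ev (monom c a *\<^sub>n g) = (c \<odot>\<^sub>C pp a) \<otimes>\<^sub>C ev g"
proof (rule ev_eqI)
 define h where "h = monom c a *\<^sub>n g"
 have h: "h \<in> series n" unfolding h_def using c a g by (intro T.m_closed) auto
 thus "monom c a *\<^sub>n g \<in> series n" by (simp add: h_def)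
 have coeff: "h m = (if a \<subseteq># m then c \<otimes> g (m - a) else \<zero>)" for m
  unfolding h_def by (rule monom_mult[OF c g])
 have ca: "c \<odot>\<^sub>C pp a \<in> carrier C" using c by simp
 define D where "D = max 1 (nrm C (c \<odot>\<^sub>C pp a))"
 have D: "1 <= D" "nrm C (c \<odot>\<^sub>C pp a) <= D" by (auto simp: D_def)
 have vc: "0 <= v c" using c norm_nonneg by simp
 have "is_ev h ((c \<odot>\<^sub>C pp a) \<otimes>\<^sub>C ev g)"
 proof (rule is_evI[OF h])
  fix e :: real assume e: "0 < e"
  define e' where "e' = e / (max D (v c))"
  have e': "0 < e'" "D * e' <= e" "v c * e' <= e"
   using e D vc by (auto simp: e'_def field_simps max_def intro: mult_left_mono)
  define A where "A = {m. e' <= v (g m)}"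
  have A: "finite A" "!!m. m \<notin> A ==> v (g m) <= e'" using tate_finite[OF g e'(1)] by (auto simp: A_def)
  define A' where "A' = (%m. a + m) ` A"
  have "E A' h = finsum C (%m. h (a + m) \<odot>\<^sub>C pp (a + m)) A"
   unfolding E_def A'_def using h by (intro C.finsum_reindex) (auto simp: inj_on_def)
  also have "\<dots> = finsum C (%m. (c \<odot>\<^sub>C pp a) \<otimes>\<^sub>C (g m \<odot>\<^sub>C pp m)) A"
  proof (rule C.finsum_cong'[OF refl])
   fix m assume "m \<in> A"
   have gm: "g m \<in> carrier K" using g by simp
   have "h (a + m) \<odot>\<^sub>C pp (a + m) = (c \<otimes> g m) \<odot>\<^sub>C (pp a \<otimes>\<^sub>C pp m)"
    using coeff[of "a + m"] C.power_product_add[OF x] by simp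
   also have "\<dots> = c \<odot>\<^sub>C (g m \<odot>\<^sub>C (pp m \<otimes>\<^sub>C pp a))"
    using c gm by (simp add: M.smult_assoc1 C.m_comm)
   also have "\<dots> = c \<odot>\<^sub>C (pp a \<otimes>\<^sub>C (g m \<odot>\<^sub>C pp m))"
    using gm smult_mult[OF gm pp pp, of m a] by (simp add: C.m_comm)
   also have "\<dots> = (c \<odot>\<^sub>C pp a) \<otimes>\<^sub>C (g m \<odot>\<^sub>C pp m)" using c gm by (simp add: smult_mult)
   finally show "h (a + m) \<odot>\<^sub>C pp (a + m) = (c \<odot>\<^sub>C pp a) \<otimes>\<^sub>C (g m \<odot>\<^sub>C pp m)" .
  qed (use g c in auto)
  also have "\<dots> = (c \<odot>\<^sub>C pp a) \<otimes>\<^sub>C E A g"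
   unfolding E_def using g c A(1) by (intro C.finsum_rdistr[symmetric]) auto
  finally have "(c \<odot>\<^sub>C pp a) \<otimes>\<^sub>C ev g \<ominus>\<^sub>C E A' h = (c \<odot>\<^sub>C pp a) \<otimes>\<^sub>C (ev g \<ominus>\<^sub>C E A g)"
   using ca g E_closed[OF g] by (simp add: C.minus_eq C.r_distr C.r_minus)
  moreover have "nrm C (ev g \<ominus>\<^sub>C E A g) <= B * e'"
   using is_ev_ev[OF g] A e' by (auto simp: is_ev_def)
  ultimately have "nrm C ((c \<odot>\<^sub>C pp a) \<otimes>\<^sub>C ev g \<ominus>\<^sub>C E A' h) <= D * (B * e')"
   using ca g E_closed[OF g] D by (auto intro!: C.norm_mult_bound)
  also have "\<dots> <= B * e" using e'(2) B by (simp add: mult.left_commute)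
  finally have 1: "nrm C ((c \<odot>\<^sub>C pp a) \<otimes>\<^sub>C ev g \<ominus>\<^sub>C E A' h) <= B * e" .
  have "v (h m) <= e" if m: "m \<notin> A'" for m
  proof (cases "a \<subseteq># m")
   case True
   hence "m = a + (m - a)" by simp
   hence "m - a \<notin> A" using m unfolding A'_def by blast
   hence "v c * v (g (m - a)) <= v c * e'" using A(2) vc by (intro mult_left_mono) auto
   thus ?thesis using e'(3) True coeff[of m] c g by (simp add: val_mult)
  next
   case False thus ?thesis using coeff[of m] e by simp
  qed
  thus "\<exists>A. finite A & (\<forall>m. m \<notin> A --> v (h m) <= e) &
    nrm C ((c \<odot>\<^sub>C pp a) \<otimes>\<^sub>C ev g \<ominus>\<^sub>C E A h) <= B * e"
   using 1 A(1) by (intro exI[of _ A']) (auto simp: A'_def)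
 qed (use c g in auto)
 thus "is_ev (monom c a *\<^sub>n g) ((c \<odot>\<^sub>C pp a) \<otimes>\<^sub>C ev g)" by (simp add: h_def)
qed

lemma ev_one: "ev \<one>\<^bsub>tate n\<^esub> = \<one>\<^sub>C"
proof (rule ev_eqI)
 show "is_ev \<one>\<^bsub>tate n\<^esub> \<one>\<^sub>C"
 proof (rule is_evI)
  fix e :: real assume "0 < e"
  have "E {{#}} \<one>\<^bsub>tate n\<^esub> = \<one>\<^sub>C" by (simp add: E_def)
  thus "\<exists>A. finite A & (\<forall>m. m \<notin> A --> v (\<one>\<^bsub>tate n\<^esub> m) <= e) & nrm C (\<one>\<^sub>C \<ominus>\<^sub>C E A \<one>\<^bsub>tate n\<^esub>) <= B * e"
   using \<open>0 < e\<close> B by (intro exI[of _ "{{#}}"]) auto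
 qed (use T.one_closed in auto)
qed (rule T.one_closed)

lemma ev_monom:
 assumes "c \<in> carrier K" "set_mset a \<subseteq> {..<n}" shows "ev (monom c a) = c \<odot>\<^sub>C pp a"
 using ev_monom_mult[OF assms T.one_closed] T.r_one[OF monom_closed[OF assms]] assms(1) ev_one
 by (simp del: tate_simps)

lemma ev_var: "i < n ==> ev (monom \<one> {#i#}) = x i"
 using ev_monom[of \<one> "{#i#}"] C.power_product_single[OF x] x by simp

lemma ev_mult:
 assumes f: "f \<in> series n" and g: "g \<in> series n"
 shows "ev (f *\<^sub>n g) = ev f \<otimes>\<^sub>C ev g"
proof (rule additive_map_unique[OF C.banach_ring_axioms _ _ _ _ _ _ _ f,
   where \<phi> = "%f. ev (f *\<^sub>n g)" and \<psi> = "%f. ev f \<otimes>\<^sub>C ev g"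
    and B = "B * gnorm g" and B' = "B * nrm C (ev g)"])
 fix h k assume hk: "h \<in> series n" "k \<in> series n"
 show "ev ((h +\<^sub>n k) *\<^sub>n g) = ev (h *\<^sub>n g) \<oplus>\<^sub>C ev (k *\<^sub>n g)"
  using hk g ev_add[OF T.m_closed[OF hk(1) g] T.m_closed[OF hk(2) g]] T.l_distr[OF hk g] by simp
 show "ev (h +\<^sub>n k) \<otimes>\<^sub>C ev g = ev h \<otimes>\<^sub>C ev g \<oplus>\<^sub>C ev k \<otimes>\<^sub>C ev g"
  using hk g ev_add[OF hk] by (simp add: C.l_distr)
next
 fix h assume h: "h \<in> series n"
 show "ev (h *\<^sub>n g) \<in> carrier C" "ev h \<otimes>\<^sub>C ev g \<in> carrier C"
  using T.m_closed[OF h g] h g by auto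
 show "nrm C (ev (h *\<^sub>n g)) <= B * gnorm g * gnorm h"
  using norm_ev[OF T.m_closed[OF h g]] gnorm_mult[OF h g] by (simp add: mult_ac)
 show "nrm C (ev h \<otimes>\<^sub>C ev g) <= B * nrm C (ev g) * gnorm h"
  using C.norm_mult_bound[OF ev_closed[OF h] ev_closed[OF g] norm_ev[OF h] order_refl] by (simp add: mult_ac)
next
 fix c a assume "c \<in> carrier K" "set_mset a \<subseteq> {..<n}"
 thus "ev (monom c a *\<^sub>n g) = ev (monom c a) \<otimes>\<^sub>C ev g"
  using ev_monom_mult ev_monom g by simp
qed

lemma ev_banach_hom: "banach_hom (tate n) gnorm C (nrm C) ev"
proof (intro banach_hom.intro banach_hom_axioms.intro)
 show "banach_ring (tate n) gnorm" by (rule tate_banach_ring)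
 show "banach_ring C (nrm C)" by (rule C.banach_ring_axioms)
 show "ring_hom_cring (tate n) C ev"
  using ev_mult ev_add ev_one
  by (intro ring_hom_cringI T.is_cring C.is_cring) (auto simp: ring_hom_def simp del: tate_simps)
 show "\<exists>C'. \<forall>f\<in>series n. nrm C (ev f) <= C' * gnorm f" using norm_ev by blast
qed

lemma ev_smult:
 assumes c: "c \<in> carrier K" and f: "f \<in> series n"
 shows "ev (c \<odot>\<^bsub>tate n\<^esub> f) = c \<odot>\<^sub>C ev f"
proof -
 have "c \<odot>\<^bsub>tate n\<^esub> f = monom c {#} *\<^sub>n f"
  using monom_mult[OF c f, of "{#}"] by (auto simp: fun_eq_iff)
 thus ?thesis using ev_monom_mult[OF c _ f, of "{#}"] c f by (simp add: smult_mult)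
qed

lemma ev_algebra_hom: "banach_algebra_hom K (tate n) C ev"
 unfolding banach_algebra_hom_def
proof (intro conjI ballI)
 show "ev \<in> ring_hom (tate n) C" using ev_banach_hom by (simp add: banach_hom_def ring_hom_cring_def ring_hom_cring_axioms_def)
 show "\<exists>C'. \<forall>f\<in>series n. nrm C (ev f) <= C' * nrm (tate n) f" using norm_ev by auto
qed (rule ev_smult)

end

section \<open>Noether normalization of a hypersurface\<close>

lemma (in banach_ring) norm_power_product_le_one:
 assumes "!!i. i < n ==> x i \<in> carrier R" "!!i. i < n ==> N (x i) <= 1"
 shows "N (power_product R n x m) <= 1"
proof -
 have "N (finprod R (%i. x i [^] count m i) {..<k}) <= 1" if "k <= n" for k
  using that
 proof (induction k)
  case (Suc k)
  have "finprod R (%i. x i [^] count m i) {..<Suc k} = x k [^] count m k \<otimes> finprod R (%i. x i [^] count m i) {..<k}"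
   unfolding lessThan_Suc using Suc assms by (intro finprod_insert) auto
  moreover have "N (x k [^] count m k \<otimes> finprod R (%i. x i [^] count m i) {..<k}) <= 1 * 1"
   using Suc assms by (intro norm_mult_bound norm_pow_le_one finprod_closed) auto
  ultimately show ?case by simp
 qed (use norm_one_le in simp)
 thus ?thesis by (simp add: power_product_def)
qed

definition (in banach_hom) approx :: "'c set => 'c set => real => real => 'c set" where
 "approx J W c r = {z \<in> carrier S. \<exists>l\<in>lc J W c. M (z \<ominus> l) <= r}"

context banach_hom
begin

context
 fixes J W
 assumes J: "ideal J S" and W: "W \<subseteq> carrier S"
begin

lemma J_carrier: "J \<subseteq> carrier S" using J by (simp add: additive_subgroup.a_subset ideal.axioms(1))

lemma approx_lc: "0 <= r ==> lc J W c \<subseteq> approx J W c r"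
 using lc_carrier[OF _ J_carrier W] by (auto simp: approx_def intro!: bexI)

lemma approx_ball: "[|z \<in> carrier S; M z <= r|] ==> z \<in> approx J W c r"
 unfolding approx_def using additive_subgroup.zero_closed[OF ideal.axioms(1)[OF J]]
 by (auto intro!: bexI[of _ "\<zero>"] combs.base)

lemma approx_add:
 assumes "y \<in> approx J W c r" "z \<in> approx J W c r"
 shows "y \<oplus> z \<in> approx J W c r"
proof -
 obtain l l' where l: "y \<in> carrier S" "l \<in> lc J W c" "M (y \<ominus> l) <= r"
  "z \<in> carrier S" "l' \<in> lc J W c" "M (z \<ominus> l') <= r" using assms by (auto simp: approx_def)
 have lS: "l \<in> carrier S" "l' \<in> carrier S" using l lc_carrier J_carrier W by auto
 have "l \<oplus> l' \<in> lc J W c" using l by (intro lc_add ideal.axioms(1)[OF J] W)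
 moreover have "M ((y \<oplus> z) \<ominus> (l \<oplus> l')) <= r"
  unfolding S.add_diff_add[OF l(1,4) lS] using l lS by (intro S.norm_add_le) auto
 ultimately show ?thesis using l by (auto simp: approx_def)
qed

lemma approx_scale:
 assumes "z \<in> approx J W c r" "x \<in> carrier R" "N x <= d" "M (h x) <= d"
 shows "h x \<otimes> z \<in> approx J W (d * c) (d * r)"
proof -
 obtain l where l: "z \<in> carrier S" "l \<in> lc J W c" "M (z \<ominus> l) <= r" using assms by (auto simp: approx_def)
 have lS: "l \<in> carrier S" using l lc_carrier J_carrier W by auto
 have "h x \<otimes> l \<in> lc J W (d * c)" using l assms by (intro lc_scale J W)
 moreover have "h x \<otimes> z \<ominus> h x \<otimes> l = h x \<otimes> (z \<ominus> l)"
  using l lS assms(2) by (simp add: S.minus_eq S.r_distr S.r_minus)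
 moreover have "M (h x \<otimes> (z \<ominus> l)) <= d * r" using l lS assms by (intro S.norm_mult_bound) auto
 ultimately have "M (h x \<otimes> z \<ominus> h x \<otimes> l) <= d * r" "h x \<otimes> l \<in> lc J W (d * c)" by simp_all
 thus ?thesis using l(1) assms(2) unfolding approx_def by blast
qed

lemma lc_in_approx:
 assumes z: "z \<in> lc I V c" and "I \<subseteq> J" "V \<subseteq> approx J W 1 r" "0 <= r" "0 <= c"
  and contr: "!!x. x \<in> carrier R ==> M (h x) <= N x"
 shows "z \<in> approx J W c (c * r)"
proof (rule lc_induct_closed[OF z])
 show "I \<subseteq> approx J W c (c * r)"
 proof
  fix j assume "j \<in> I"
  hence "j \<in> lc J W c" using assms(2) by (intro combs.base) auto
  thus "j \<in> approx J W c (c * r)" using assms approx_lc[of "c * r" c] by auto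
 qed
 show "h x \<otimes> w \<in> approx J W c (c * r)" if "w \<in> V" "x \<in> carrier R" "N x <= c" for w x
  using approx_scale[of w 1 r x c] that assms contr[OF that(2)] by auto
qed (rule approx_add)

end

end

text \<open>
 Exponents are the digits of the weight, so monomials are determined by their weights.
\<close>

lemma digits_inj:
 fixes a b :: "nat => nat"
 assumes "(\<Sum>i<n. D ^ i * a i) = (\<Sum>i<n. D ^ i * b i)" "!!i. i < n ==> a i < D" "!!i. i < n ==> b i < D" "i < n"
 shows "a i = b i"
 using assms
proof (induction n arbitrary: a b i)
 case (Suc n)
 have s: "(\<Sum>i<Suc n. D ^ i * c i) = c 0 + D * (\<Sum>i<n. D ^ i * c (Suc i))" for c :: "nat => nat"
  unfolding sum.lessThan_Suc_shift by (simp add: sum_distrib_left mult.assoc)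
 have eq: "a 0 + D * (\<Sum>i<n. D ^ i * a (Suc i)) = b 0 + D * (\<Sum>i<n. D ^ i * b (Suc i))"
  using Suc.prems(1) unfolding s .
 have lt: "a 0 < D" "b 0 < D" using Suc.prems by auto
 have "(a 0 + D * (\<Sum>i<n. D ^ i * a (Suc i))) mod D = a 0" "(b 0 + D * (\<Sum>i<n. D ^ i * b (Suc i))) mod D = b 0"
  using lt by simp_all
 hence a0: "a 0 = b 0" using eq by simp
 hence "(\<Sum>i<n. D ^ i * a (Suc i)) = (\<Sum>i<n. D ^ i * b (Suc i))" using eq lt by simp
 hence "a (Suc j) = b (Suc j)" if "j < n" for j
  using Suc.IH[of "%i. a (Suc i)" "%i. b (Suc i)" j] Suc.prems that by auto
 thus ?case using a0 Suc.prems(4) by (cases i) auto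
qed simp

context tate_field
begin

lemma const_mult:
 assumes "c \<in> carrier K" "f \<in> series n"
 shows "monom c {#} *\<^sub>n f = (%m. c \<otimes> f m)"
 using monom_mult[OF assms, of "{#}"] by (auto simp: fun_eq_iff)

lemma tate_banach_algebra: "banach_algebra K v (tate n)"
proof (intro banach_algebra.intro banach_algebra_axioms.intro)
 show "analytic_field K v" by (rule analytic_field_axioms)
 show "algebra K (tate n)"
 proof (rule algebraI)
  fix a f assume a: "a \<in> carrier K" "f \<in> series n"
  show "a \<odot>\<^bsub>tate n\<^esub> f \<in> series n"
   using T.m_closed[of "monom a {#}" n f] a const_mult[OF a] by simp
  fix g assume g: "g \<in> series n"
  have fg: "f *\<^sub>n g \<in> series n" using a g by (intro T.m_closed)
  have "(a \<odot>\<^bsub>tate n\<^esub> f) *\<^sub>n g = (monom a {#} *\<^sub>n f) *\<^sub>n g"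
   using const_mult[OF a] by simp
  also have "\<dots> = monom a {#} *\<^sub>n (f *\<^sub>n g)"
   using a g by (intro T.m_assoc) auto
  also have "\<dots> = a \<odot>\<^bsub>tate n\<^esub> (f *\<^sub>n g)" using const_mult[OF a(1) fg] by simp
  finally show "(a \<odot>\<^bsub>tate n\<^esub> f) *\<^sub>n g = a \<odot>\<^bsub>tate n\<^esub> (f *\<^sub>n g)" .
 qed (auto simp: is_cring T.is_cring l_distr r_distr m_assoc)
 show "nonarch_banach_group (tate n) (nrm (tate n))"
  using T.nonarch_banach_group_axioms by simp
 show "nrm (tate n) \<one>\<^bsub>tate n\<^esub> <= 1" using T.norm_one_le by simp
 fix f assume f: "f \<in> series n"
 show "nrm (tate n) (f *\<^sub>n g) <= nrm (tate n) f * nrm (tate n) g" if "g \<in> series n" for g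
  using T.norm_mult_le[OF f that] by simp
 show "nrm (tate n) (c \<odot>\<^bsub>tate n\<^esub> f) = v c * nrm (tate n) f" if c: "c \<in> carrier K" for c
  using gnorm_mult[of "monom c {#}" n f] const_mult[OF c f] c f by (simp add: gnorm_monom)
qed

definition cut :: "nat multiset set => (nat multiset => 'k) => nat multiset => 'k" where
 "cut A f = (%m. if m \<in> A then f m else \<zero>)"

lemma cut_closed: "f \<in> series n ==> cut A f \<in> series n"
proof (rule tateI)
 fix e :: real assume f: "f \<in> series n" and e: "e > 0"
 have "{m. e <= v (cut A f m)} \<subseteq> {m. e <= v (f m)}" using e by (auto simp: cut_def)
 thus "finite {m. e <= v (cut A f m)}" using tate_finite[OF f e] finite_subset by blast
qed (auto simp: cut_def tate_support)

lemma cut_induct: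
 assumes "finite A" and f: "f \<in> series n"
  and zero: "\<zero>\<^bsub>tate n\<^esub> \<in> Z"
  and add: "!!a b. a \<in> Z ==> b \<in> Z ==> a +\<^sub>n b \<in> Z"
  and mon: "!!m. m \<in> A ==> set_mset m \<subseteq> {..<n} ==> monom (f m) m \<in> Z"
 shows "cut A f \<in> Z"
 using assms(1) mon
proof (induction A)
 case empty
 thus ?case using zero by (simp add: cut_def)
next
 case (insert a A)
 hence IH: "cut A f \<in> Z" by blast
 show ?case
 proof (cases "set_mset a \<subseteq> {..<n}")
  case True
  have "cut A f +\<^sub>n monom (f a) a = cut (insert a A) f"
   using insert f by (auto simp: cut_def monom_def fun_eq_iff)
  thus ?thesis using add[OF IH insert(4)[OF _ True]] by simp
 next
  case False
  hence "f a = \<zero>" using tate_support[OF f] by blast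
  hence "cut (insert a A) f = cut A f" by (auto simp: cut_def fun_eq_iff)
  thus ?thesis using IH by simp
 qed
qed

lemma gnorm_cut_le:
 assumes f: "f \<in> series n" and e: "!!m. m \<notin> A ==> v (f m) <= e" "0 <= e"
 shows "gnorm (f -\<^sub>n cut A f) <= e"
 unfolding tate_minus[OF f cut_closed[OF f]] gnorm_le_iff[OF tate_diff_closed[OF f cut_closed[OF f]]]
 using e f by (auto simp: cut_def)

lemma monom_monom_mult:
 assumes "c \<in> carrier K" "d \<in> carrier K" "set_mset b \<subseteq> {..<n}"
 shows "monom c a *\<^sub>n monom d b = monom (c \<otimes> d) (a + b)"
proof
 fix m
 show "(monom c a *\<^sub>n monom d b) m = monom (c \<otimes> d) (a + b) m"
  using monom_mult[OF assms(1) monom_closed[OF assms(2,3)], of a m] assms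
  by (auto simp: monom_def)
qed

text \<open>
 Let \<open>Y\<^sub>i = T\<^sub>i\<^sub>+\<^sub>1 - T\<^sub>0 ^ (D ^ (i + 1))\<close>. Over the subalgebra of the \<open>Y\<^sub>i\<close>, a monomial is a power of \<open>T\<^sub>0\<close>, with its
 weight as exponent, up to lower powers of \<open>T\<^sub>0\<close>. For large \<open>D\<close> the dominant monomials of \<open>h\<close> have distinct weights, so \<open>h\<close>
 is monic in \<open>T\<^sub>0\<close> up to scaling and a small error, and division by \<open>h\<close> bounds the degree in \<open>T\<^sub>0\<close>.
\<close>

theorem hypersurface_normalization:
 assumes h: "h \<in> series (Suc n)" "h ~= (%_. \<zero>)"
 shows "\<exists>\<eta> W. banach_hom (tate n) gnorm (tate (Suc n)) gnorm \<eta> &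
  (\<forall>f\<in>series n. gnorm (\<eta> f) <= gnorm f) & finite W & W \<subseteq> series (Suc n) &
  (\<forall>f\<in>series (Suc n). f \<in> combs (tate n) gnorm (tate (Suc n)) \<eta> (PIdl\<^bsub>tate (Suc n)\<^esub> h) W (gnorm f))"
proof -
 define S where "S = tate (Suc n)"
 interpret S: banach_ring S gnorm unfolding S_def by (rule tate_banach_ring)
 define Supp where "Supp = {m. v (h m) = gnorm h}"
 have hpos: "0 < gnorm h" using gnorm_pos[OF h] .
 have finS: "finite Supp"
  using tate_finite[OF h(1) hpos] unfolding Supp_def by (rule finite_subset[rotated]) auto
 have neS: "Supp ~= {}" using gnorm_attained[OF h(1)] by (auto simp: Supp_def)
 have supp: "set_mset m \<subseteq> {..<Suc n}" if "m \<in> Supp" for m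
  using tate_support[OF h(1), of m] that hpos by (cases "set_mset m \<subseteq> {..<Suc n}") (auto simp: Supp_def)
 define D where "D = Suc (Max (size ` Supp))"
 have D: "count m i < D" if "m \<in> Supp" for m i
 proof -
  have "count m i <= size m" by (rule count_le_size)
  also have "size m <= Max (size ` Supp)" using finS that by (intro Max_ge) auto
  finally show ?thesis by (simp add: D_def)
 qed
 define wt where "wt m = (\<Sum>i<Suc n. D ^ i * count m i)" for m
 have wt_add: "wt (add_mset i m) = D ^ i + wt m" if "i < Suc n" for i m
 proof -
  have "wt (add_mset i m) = (\<Sum>j<Suc n. (if j = i then D ^ i else 0) + D ^ j * count m j)"
   unfolding wt_def by (intro sum.cong) auto
  also have "\<dots> = D ^ i + wt m" unfolding sum.distrib wt_def using that by (simp del: sum.lessThan_Suc)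
  finally show ?thesis .
 qed
 have wt_inj: "m = m'" if "m \<in> Supp" "m' \<in> Supp" "wt m = wt m'" for m m'
 proof (rule multiset_eqI)
  fix i
  show "count m i = count m' i"
  proof (cases "i < Suc n")
   case True
   have "(\<Sum>i<Suc n. D ^ i * count m i) = (\<Sum>i<Suc n. D ^ i * count m' i)"
    using that(3) by (simp only: wt_def)
   thus ?thesis by (rule digits_inj[OF _ D[OF that(1)] D[OF that(2)] True])
  next
   case False
   hence "i \<notin># m" "i \<notin># m'" using supp that by auto
   thus ?thesis by (simp add: not_in_iff)
  qed
 qed
 define e where "e = Max (wt ` Supp)"
 have "e \<in> wt ` Supp" unfolding e_def using finS neS by (intro Max_in) auto
 then obtain \<mu> where \<mu>: "\<mu> \<in> Supp" "wt \<mu> = e" by auto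
 have wt_less: "wt m < e" if "m \<in> Supp" "m ~= \<mu>" for m
 proof -
  have "wt m <= e" unfolding e_def using finS that by (intro Max_ge) auto
  thus ?thesis using wt_inj[of m \<mu>] that \<mu> by (cases "wt m = e") auto
 qed
 \<comment> \<open>normalize \<open>h\<close> at the monomial of largest weight\<close>
 have hc: "h m \<in> carrier K" for m using h(1) by simp
 have h\<mu>: "h \<mu> ~= \<zero>" "v (h \<mu>) = gnorm h" using \<mu> hpos by (auto simp: Supp_def)
 define \<gamma> where "\<gamma> = inv (h \<mu>)"
 have \<gamma>: "\<gamma> \<in> carrier K" "v \<gamma> = inverse (gnorm h)" "\<gamma> \<otimes> h \<mu> = \<one>"
  using h\<mu> hc field_Units val_inv[OF hc h\<mu>(1)] by (auto simp: \<gamma>_def)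
 define H where "H = monom \<gamma> {#} \<otimes>\<^sub>S h"
 have Hc: "H m = \<gamma> \<otimes> h m" for m unfolding H_def S_def using const_mult[OF \<gamma>(1) h(1)] by simp
 have HS: "H \<in> carrier S" unfolding H_def using \<gamma> h by (intro S.m_closed) (auto simp: S_def)
 have vH: "v (H m) = v (h m) / gnorm h" for m using Hc \<gamma> hc by (simp add: val_mult field_simps)
 have H1: "v (H m) <= 1" for m using vH coeff_le_gnorm[OF h(1), of m] hpos by simp
 have H2: "v (H m) < 1" if "m \<notin> Supp" for m
  using vH coeff_le_gnorm[OF h(1), of m] hpos that by (auto simp: Supp_def less_le)
 define A0 where "A0 = {m. 1/2 <= v (H m)} - Supp"
 have A0: "finite A0" unfolding A0_def using tate_finite[OF HS[unfolded S_def], of "1/2"] by auto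
 define \<epsilon> where "\<epsilon> = Max (insert (1/2) ((%m. v (H m)) ` A0))"
 have "\<epsilon> \<in> insert (1/2) ((%m. v (H m)) ` A0)" unfolding \<epsilon>_def using A0 by (intro Max_in) auto
 hence \<epsilon>1: "\<epsilon> < 1" using H2 by (auto simp: A0_def)
 have \<epsilon>0: "1/2 <= \<epsilon>" unfolding \<epsilon>_def using A0 by (intro Max_ge) auto
 have \<epsilon>: "v (H m) <= \<epsilon>" if "m \<notin> Supp" for m
 proof (cases "m \<in> A0")
  case True thus ?thesis unfolding \<epsilon>_def using A0 by (intro Max_ge) auto
 next
  case False thus ?thesis using that \<epsilon>0 by (auto simp: A0_def)
 qed
 \<comment> \<open>the coordinate change\<close>
 define Xp where "Xp k = monom \<one> (replicate_mset k 0)" for k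
 have Xp [simp]: "Xp k \<in> carrier S" "gnorm (Xp k) = 1" for k
  unfolding Xp_def S_def by (auto simp: gnorm_monom intro!: monom_closed split: if_splits)
 have Xp_add: "Xp j \<otimes>\<^sub>S Xp k = Xp (j + k)" for j k
 proof -
  have "replicate_mset j 0 + replicate_mset k 0 = replicate_mset (j + k) (0 :: nat)"
   by (simp add: multiset_eq_iff)
  thus ?thesis
   unfolding Xp_def S_def by (subst monom_monom_mult) (auto split: if_splits)
 qed
 define Y where "Y i = monom \<one> {#Suc i#} \<ominus>\<^sub>S Xp (D ^ Suc i)" for i
 have var: "monom \<one> {#i#} \<in> carrier S" "gnorm (monom \<one> {#i#}) = 1" if "i < Suc n" for i
  using that by (auto simp: S_def gnorm_monom)
 have Y: "Y i \<in> carrier S" "gnorm (Y i) <= 1" if "i < n" for i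
  using var[of "Suc i"] that by (auto simp: Y_def intro!: S.norm_diff_le)
 interpret ev: tate_eval K v S n Y 1
 proof (intro tate_eval.intro tate_eval_axioms.intro)
  show "tate_field K v" by (rule tate_field_axioms)
  show "banach_algebra K v S" unfolding S_def by (rule tate_banach_algebra)
  show "nrm S (power_product S n Y m) <= 1" for m
   using S.norm_power_product_le_one[OF Y] by (simp add: S_def)
  show "Y i \<in> carrier S" if "i < n" for i by (rule Y(1)[OF that])
 qed simp
 define \<eta> where "\<eta> = ev.ev"
 have nrmS: "nrm S = gnorm" by (simp add: S_def)
 have hom: "banach_hom (tate n) gnorm S gnorm \<eta>" using ev.ev_banach_hom unfolding nrmS \<eta>_def .
 interpret \<eta>: banach_hom "tate n" gnorm S gnorm \<eta> by (rule hom)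
 have contr: "gnorm (\<eta> f) <= gnorm f" if "f \<in> series n" for f
  using ev.norm_ev[OF that] by (simp add: \<eta>_def nrmS)
 have \<eta>Y: "\<eta> (monom \<one> {#i#}) = Y i" if "i < n" for i unfolding \<eta>_def using ev.ev_var[OF that] .
 have \<eta>c: "\<eta> (monom c {#}) = monom c {#}" if "c \<in> carrier K" for c
  using ev.ev_monom[of c "{#}"] that by (auto simp: \<eta>_def S_def monom_def fun_eq_iff)
 define Z where "Z = {\<zero>\<^sub>S}"
 have Zi: "ideal Z S" unfolding Z_def by (rule S.zeroideal)
 have Zs: "additive_subgroup Z S" by (rule ideal.axioms(1)[OF Zi])
 define V where "V j = {Xp k | k. k < j}" for j
 have V: "V j \<subseteq> carrier S" for j by (auto simp: V_def)
 have Vmono: "V j \<subseteq> V k" if "j <= k" for j k using that by (auto simp: V_def)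
 have lcmono: "z \<in> \<eta>.lc Z (V k) c" if "z \<in> \<eta>.lc Z (V j) c" "j <= k" for z j k c
  by (rule combs_mono[OF that(1) order_refl Vmono[OF that(2)] order_refl])
 have Xmult: "Xp c \<otimes>\<^sub>S z \<in> \<eta>.lc I (V (c + j)) b" if "z \<in> \<eta>.lc I (V j) b" "ideal I S" for z c j b I
 proof -
  have "(%w. Xp c \<otimes>\<^sub>S w) ` V j \<subseteq> V (c + j)" unfolding V_def by (auto simp: Xp_add)
  thus ?thesis using combs_mono[OF \<eta>.lc_mult_right[OF that(1,2) V Xp(1)] order_refl _ order_refl] by blast
 qed
 have lcS: "z \<in> carrier S" if "z \<in> \<eta>.lc Z (V j) c" for z j c
  using \<eta>.lc_carrier[OF that _ V] by (simp add: Z_def)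
 have mono_main: "monom \<one> m \<ominus>\<^sub>S Xp (wt m) \<in> \<eta>.lc Z (V (wt m)) 1" if "set_mset m \<subseteq> {..<Suc n}" for m
  using that
 proof (induction m)
  case empty
  have "monom \<one> {#} \<ominus>\<^sub>S Xp (wt {#}) = \<zero>\<^sub>S" using Xp(1)[of 0] by (simp add: Xp_def wt_def)
  thus ?case by (simp add: Z_def combs.base)
 next
  case (add i m)
  hence i: "i < Suc n" and m: "set_mset m \<subseteq> {..<Suc n}" by auto
  define a where "a = monom \<one> m"
  have a: "a \<in> carrier S" using m by (simp add: a_def S_def)
  define d where "d = a \<ominus>\<^sub>S Xp (wt m)"
  have d: "d \<in> \<eta>.lc Z (V (wt m)) 1" "d \<in> carrier S" using add.IH[OF m] a by (auto simp: d_def a_def)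
  have wt: "wt (add_mset i m) = D ^ i + wt m" by (rule wt_add[OF i])
  have ma: "monom \<one> (add_mset i m) = monom \<one> {#i#} \<otimes>\<^sub>S a"
   unfolding a_def S_def using m by (subst monom_monom_mult) auto
  have XX: "Xp (wt (add_mset i m)) = Xp (D ^ i) \<otimes>\<^sub>S Xp (wt m)" unfolding wt Xp_add ..
  show ?case
  proof (cases i)
   case 0
   have "monom \<one> {#i#} = Xp (D ^ i)" using 0 by (simp add: Xp_def)
   hence "monom \<one> (add_mset i m) \<ominus>\<^sub>S Xp (wt (add_mset i m)) = Xp (D ^ i) \<otimes>\<^sub>S d"
    unfolding ma XX d_def using a Xp(1) by (simp add: S.minus_eq S.r_distr S.r_minus)
   thus ?thesis using Xmult[OF d(1) Zi, of "D ^ i"] by (simp add: wt)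
  next
   case (Suc i')
   hence i': "i' < n" using i by simp
   define y where "y = \<eta> (monom \<one> {#i'#})"
   have v1: "monom \<one> {#i'#} \<in> series n" "gnorm (monom \<one> {#i'#}) <= 1"
    using i' by (auto simp: gnorm_monom)
   have y: "y \<in> carrier S" unfolding y_def using v1 by simp
   have "y = monom \<one> {#i#} \<ominus>\<^sub>S Xp (D ^ i)" unfolding y_def \<eta>Y[OF i'] Y_def Suc ..
   hence Ti: "monom \<one> {#i#} = y \<oplus>\<^sub>S Xp (D ^ i)" using var(1)[OF i] by simp
   have eq: "monom \<one> (add_mset i m) \<ominus>\<^sub>S Xp (wt (add_mset i m)) = y \<otimes>\<^sub>S (d \<oplus>\<^sub>S Xp (wt m)) \<oplus>\<^sub>S Xp (D ^ i) \<otimes>\<^sub>S d"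
    unfolding ma XX Ti d_def using a y Xp(1)[of "D ^ i"] Xp(1)[of "wt m"] by algebra
   have "Xp (wt m) \<in> V (Suc (wt m))" by (auto simp: V_def)
   hence "d \<oplus>\<^sub>S Xp (wt m) \<in> \<eta>.lc Z (V (Suc (wt m))) 1"
    using d by (intro \<eta>.lc_add lcmono[OF d(1)] \<eta>.lc_elem Zs V) auto
   hence "y \<otimes>\<^sub>S (d \<oplus>\<^sub>S Xp (wt m)) \<in> \<eta>.lc Z (V (Suc (wt m))) (1 * 1)"
    unfolding y_def using v1 by (intro \<eta>.lc_scale Zi V)
   moreover have "Suc (wt m) <= D ^ i + wt m" by (simp add: D_def)
   ultimately have "y \<otimes>\<^sub>S (d \<oplus>\<^sub>S Xp (wt m)) \<in> \<eta>.lc Z (V (D ^ i + wt m)) 1" using lcmono by simp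
   hence "y \<otimes>\<^sub>S (d \<oplus>\<^sub>S Xp (wt m)) \<oplus>\<^sub>S Xp (D ^ i) \<otimes>\<^sub>S d \<in> \<eta>.lc Z (V (D ^ i + wt m)) 1"
    by (rule \<eta>.lc_add[OF _ Xmult[OF d(1) Zi] Zs V])
   thus ?thesis unfolding eq by (simp only: wt)
  qed
 qed
 have mono_lc: "monom \<one> m \<in> \<eta>.lc Z (V (Suc (wt m))) 1" if m: "set_mset m \<subseteq> {..<Suc n}" for m
 proof -
  have mS: "monom \<one> m \<in> carrier S" using m by (simp add: S_def)
  have "Xp (wt m) \<in> V (Suc (wt m))" by (auto simp: V_def)
  hence "(monom \<one> m \<ominus>\<^sub>S Xp (wt m)) \<oplus>\<^sub>S Xp (wt m) \<in> \<eta>.lc Z (V (Suc (wt m))) 1"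
   by (intro \<eta>.lc_add lcmono[OF mono_main[OF m]] \<eta>.lc_elem Zs V) auto
  thus ?thesis using mS by simp
 qed
 have scaled: "monom c m \<in> \<eta>.lc Z (V j) b"
  if "set_mset m \<subseteq> {..<Suc n}" "c \<in> carrier K" "v c <= b" "monom \<one> m \<in> \<eta>.lc Z (V j) 1" for c m j b
 proof -
  have "monom c m = \<eta> (monom c {#}) \<otimes>\<^sub>S monom \<one> m"
   unfolding \<eta>c[OF that(2)] S_def using that by (subst monom_monom_mult) auto
  moreover have "\<eta> (monom c {#}) \<otimes>\<^sub>S monom \<one> m \<in> \<eta>.lc Z (V j) (b * 1)"
   using that by (intro \<eta>.lc_scale Zi V) (auto simp: gnorm_monom)
  ultimately show ?thesis by simp
 qed
 define J where "J = PIdl\<^bsub>S\<^esub> h"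
 have hS: "h \<in> carrier S" using h by (simp add: S_def)
 have J: "ideal J S" unfolding J_def by (rule S.cgenideal_ideal[OF hS])
 interpret J: ideal J S by (rule J)
 have Jclosed: "S.norm_closed J"
  using banach_ring.strictly_noetherian_closed[OF S.banach_ring_axioms _ J] tate_strictly_noetherian[of "Suc n"]
  by (simp add: S_def)
 have HJ: "H \<in> J" unfolding H_def J_def using S.cgenideal_self[OF hS] \<gamma> J
  by (intro J.I_l_closed[unfolded J_def]) (auto simp: S_def)
 define W where "W = V e"
 have Wc: "W \<subseteq> carrier S" unfolding W_def by (rule V)
 have Wfin: "finite W" unfolding W_def V_def by simp
 have apx0: "\<eta>.lc I (V j) 1 \<subseteq> \<eta>.approx J W 1 \<epsilon>" if "V j \<subseteq> \<eta>.approx J W 1 \<epsilon>" "I \<subseteq> J" for j I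
  using \<eta>.lc_in_approx[OF J Wc _ that(2,1) _ _ contr, of _ 1] \<epsilon>0 by auto
 have WX: "W \<subseteq> \<eta>.approx J W 1 \<epsilon>"
  using \<eta>.approx_lc[OF J Wc, of \<epsilon> 1] \<epsilon>0 \<eta>.lc_elem[OF J.additive_subgroup_axioms, of _ W 1] Wc by auto
 have Xe: "\<exists>l\<in>\<eta>.lc J W 1. gnorm (Xp e \<ominus>\<^sub>S l) <= \<epsilon>"
 proof -
  have HT: "H \<in> series (Suc n)" using HS by (simp add: S_def)
  define q where "q = cut (Supp - {\<mu>}) H"
  have q: "q \<in> \<eta>.lc Z W 1"
   unfolding q_def
  proof (rule cut_induct[OF _ HT])
   show "\<zero>\<^bsub>tate (Suc n)\<^esub> \<in> \<eta>.lc Z W 1" by (simp add: Z_def S_def combs.base)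
   show "a +\<^sub>(Suc n) b \<in> \<eta>.lc Z W 1" if "a \<in> \<eta>.lc Z W 1" "b \<in> \<eta>.lc Z W 1" for a b
    using \<eta>.lc_add[OF that Zs Wc] unfolding S_def .
   fix m assume m: "m \<in> Supp - {\<mu>}" "set_mset m \<subseteq> {..<Suc n}"
   have "monom \<one> m \<in> \<eta>.lc Z (V e) 1"
    using lcmono[OF mono_lc[OF m(2)]] wt_less[of m] m by auto
   thus "monom (H m) m \<in> \<eta>.lc Z W 1"
    unfolding W_def using scaled m H1 HT by auto
  qed (use finS in auto)
  have qS: "q \<in> carrier S" using lcS q by (simp add: W_def)
  define p where "p = cut Supp H"
  have pS: "p \<in> carrier S" unfolding p_def S_def by (rule cut_closed[OF HT])
  have m\<mu>: "set_mset \<mu> \<subseteq> {..<Suc n}" using supp \<mu> by auto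
  have \<mu>S: "monom \<one> \<mu> \<in> carrier S" using m\<mu> by (simp add: S_def)
  have H\<mu>: "H \<mu> = \<one>" using Hc \<gamma> by simp
  have p_eq: "p = q \<oplus>\<^sub>S monom \<one> \<mu>"
   using \<mu>(1) H\<mu> tate_coeff[OF HT] by (auto simp: p_def q_def cut_def monom_def S_def fun_eq_iff)
  define d where "d = monom \<one> \<mu> \<ominus>\<^sub>S Xp e"
  have d: "d \<in> \<eta>.lc Z W 1" using mono_main[OF m\<mu>] \<mu>(2) by (simp add: d_def W_def)
  have dS: "d \<in> carrier S" unfolding d_def using \<mu>S by simp
  define l where "l = H \<ominus>\<^sub>S (q \<oplus>\<^sub>S d)"
  have "q \<oplus>\<^sub>S d \<in> \<eta>.lc Z W 1" by (rule \<eta>.lc_add[OF q d Zs Wc])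
  hence "q \<oplus>\<^sub>S d \<in> \<eta>.lc J W 1"
   by (rule combs_mono) (auto simp: Z_def)
  hence "l \<in> \<eta>.lc J W 1" unfolding l_def
   by (rule \<eta>.lc_diff[OF combs.base[OF HJ] _ J.additive_subgroup_axioms Wc])
  moreover have "Xp e \<ominus>\<^sub>S l = \<ominus>\<^sub>S (H \<ominus>\<^sub>S p)"
   unfolding l_def p_eq d_def using HS qS \<mu>S Xp(1)[of e] by algebra
  moreover have "gnorm (H \<ominus>\<^sub>S p) <= \<epsilon>"
   unfolding p_def S_def using \<epsilon> \<epsilon>0 by (intro gnorm_cut_le HT) auto
  ultimately show ?thesis using HS pS by (intro bexI[of _ l]) simp_all
 qed
 have XpX: "Xp k \<in> \<eta>.approx J W 1 \<epsilon>" for k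
 proof (induction k rule: less_induct)
  case (less k)
  show ?case
  proof (cases "k < e")
   case True thus ?thesis using WX by (auto simp: W_def V_def)
  next
   case False
   obtain l where l: "l \<in> \<eta>.lc J W 1" "gnorm (Xp e \<ominus>\<^sub>S l) <= \<epsilon>" using Xe by blast
   have lS: "l \<in> carrier S" using \<eta>.lc_carrier[OF l(1) J.a_subset Wc] .
   have k: "(k - e) + e = k" using False by simp
   have Vk: "V k \<subseteq> \<eta>.approx J W 1 \<epsilon>" using less by (auto simp: V_def)
   have 1: "Xp (k - e) \<otimes>\<^sub>S l \<in> \<eta>.approx J W 1 \<epsilon>"
    using Xmult[OF l(1)[unfolded W_def] J, of "k - e"] apx0[OF Vk order_refl] unfolding k by blast
   have "gnorm (Xp (k - e) \<otimes>\<^sub>S (Xp e \<ominus>\<^sub>S l)) <= 1 * \<epsilon>"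
    using l lS by (intro S.norm_mult_bound) auto
   hence 2: "Xp (k - e) \<otimes>\<^sub>S (Xp e \<ominus>\<^sub>S l) \<in> \<eta>.approx J W 1 \<epsilon>"
    using lS by (intro \<eta>.approx_ball[OF J Wc]) auto
   have "Xp (k - e) \<otimes>\<^sub>S l \<oplus>\<^sub>S Xp (k - e) \<otimes>\<^sub>S (Xp e \<ominus>\<^sub>S l) = Xp (k - e) \<otimes>\<^sub>S Xp e"
    using lS Xp(1)[of e] Xp(1)[of "k - e"] by algebra
   also have "\<dots> = Xp k" using k by (simp add: Xp_add)
   finally show ?thesis using \<eta>.approx_add[OF J Wc 1 2] by simp
  qed
 qed
 have all_approx: "\<exists>f'\<in>carrier S. gnorm f' <= \<epsilon> * c & f \<ominus>\<^sub>S f' \<in> \<eta>.lc J W c"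
  if f: "f \<in> carrier S" "gnorm f <= c" "0 < c" for f c
 proof -
  have fT: "f \<in> series (Suc n)" using f by (simp add: S_def)
  define A where "A = {m. \<epsilon> * c <= v (f m)}"
  have ec: "0 < \<epsilon> * c" using \<epsilon>0 f by simp
  have A: "finite A" unfolding A_def by (rule tate_finite[OF fT ec])
  have tail: "gnorm (f \<ominus>\<^sub>S cut A f) <= \<epsilon> * c"
   unfolding S_def using ec by (intro gnorm_cut_le[OF fT]) (auto simp: A_def)
  have cutS: "cut A f \<in> carrier S" unfolding S_def by (rule cut_closed[OF fT])
  have "cut A f \<in> \<eta>.approx J W c (c * \<epsilon>)"
  proof (rule cut_induct[OF A fT])
   have "\<zero>\<^sub>S \<in> \<eta>.approx J W c (c * \<epsilon>)" using f \<epsilon>0 by (intro \<eta>.approx_ball[OF J Wc]) auto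
   thus "\<zero>\<^bsub>tate (Suc n)\<^esub> \<in> \<eta>.approx J W c (c * \<epsilon>)" unfolding S_def .
   show "a +\<^sub>(Suc n) b \<in> \<eta>.approx J W c (c * \<epsilon>)"
    if "a \<in> \<eta>.approx J W c (c * \<epsilon>)" "b \<in> \<eta>.approx J W c (c * \<epsilon>)" for a b
    using \<eta>.approx_add[OF J Wc that] unfolding S_def .
   fix m assume m: "set_mset m \<subseteq> {..<Suc n}"
   have "v (f m) <= c" using coeff_le_gnorm[OF fT, of m] f(2) by linarith
   hence "monom (f m) m \<in> \<eta>.lc Z (V (Suc (wt m))) c"
    using scaled[OF m _ _ mono_lc[OF m]] fT by simp
   moreover have "V (Suc (wt m)) \<subseteq> \<eta>.approx J W 1 \<epsilon>" using XpX by (auto simp: V_def)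
   moreover have "Z \<subseteq> J" by (simp add: Z_def)
   ultimately show "monom (f m) m \<in> \<eta>.approx J W c (c * \<epsilon>)"
    using \<epsilon>0 f(3) contr by (intro \<eta>.lc_in_approx[OF J Wc]) auto
  qed
  then obtain l where l: "l \<in> \<eta>.lc J W c" "gnorm (cut A f \<ominus>\<^sub>S l) <= \<epsilon> * c"
   by (auto simp: \<eta>.approx_def mult.commute)
  have lS: "l \<in> carrier S" using \<eta>.lc_carrier[OF l(1) J.a_subset Wc] .
  have "gnorm (f \<ominus>\<^sub>S l) <= \<epsilon> * c" by (rule S.norm_diff_trans[OF f(1) cutS lS tail l(2)])
  moreover have "f \<ominus>\<^sub>S (f \<ominus>\<^sub>S l) = l" by (rule S.diff_diff_cancel[OF f(1) lS])
  ultimately show ?thesis using l f lS by (intro bexI[of _ "f \<ominus>\<^sub>S l"]) auto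
 qed
 have "f \<in> \<eta>.lc J W (gnorm f)" if f: "f \<in> carrier S" for f
 proof (cases "f = \<zero>\<^sub>S")
  case True thus ?thesis by (simp add: combs.base)
 next
  case False
  define c where "c = gnorm f"
  have c: "0 < c" unfolding c_def using False f S.norm_nonneg[OF f] S.norm_eq_0_iff[OF f] by linarith
  define U where "U k = {u \<in> carrier S. gnorm u <= c * \<epsilon> ^ k}" for k :: nat
  have "f \<in> \<eta>.lc J W c"
  proof (rule \<eta>.lc_successive_approximation[OF J Jclosed Wfin Wc, where \<delta> = \<epsilon> and U = U and C = c])
   show "\<exists>u'\<in>U (Suc k). u \<ominus>\<^sub>S u' \<in> \<eta>.lc J W (c * \<epsilon> ^ k)" if "u \<in> U k" for k u
   proof -
    have "u \<in> carrier S" "gnorm u <= c * \<epsilon> ^ k" using that by (auto simp: U_def)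
    moreover have "0 < c * \<epsilon> ^ k" using c \<epsilon>0 by simp
    ultimately obtain u' where "u' \<in> carrier S" "gnorm u' <= \<epsilon> * (c * \<epsilon> ^ k)" "u \<ominus>\<^sub>S u' \<in> \<eta>.lc J W (c * \<epsilon> ^ k)"
     using all_approx by blast
    thus ?thesis by (intro bexI[of _ u']) (auto simp: U_def mult_ac)
   qed
  qed (use c \<epsilon>0 \<epsilon>1 f in \<open>auto simp: U_def c_def\<close>)
  thus ?thesis by (simp add: c_def)
 qed
 thus ?thesis using hom contr Wfin Wc unfolding J_def S_def by blast
qed

end

section \<open>Linear algebra over a domain\<close>

text \<open>
 Fraction-free elimination.
\<close>

lemma (in domain) linear_dependence:
 assumes "finite J" "finite I" "card I = Suc (card J)" "!!i j. a i j \<in> carrier R"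
 shows "\<exists>l. (\<forall>i. l i \<in> carrier R) & (\<exists>i\<in>I. l i ~= \<zero>) & (\<forall>j\<in>J. finsum R (%i. l i \<otimes> a i j) I = \<zero>)"
 using assms
proof (induction J arbitrary: I a)
 case empty
 hence "I ~= {}" by auto
 thus ?case by (intro exI[of _ "%_. \<one>"]) auto
next
 case (insert j0 J)
 note a = insert.prems(3)
 show ?case
 proof (cases "\<forall>i\<in>I. a i j0 = \<zero>")
  case True
  obtain p where p: "p \<in> I" using insert.prems by fastforce
  have "card (I - {p}) = Suc (card J)" using insert p by simp
  moreover have "finite (I - {p})" using insert.prems by simp
  ultimately obtain l where l: "!!i. l i \<in> carrier R" "\<exists>i\<in>I - {p}. l i ~= \<zero>"
   "!!j. j \<in> J ==> finsum R (%i. l i \<otimes> a i j) (I - {p}) = \<zero>"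
   using insert.IH[of "I - {p}" a] a by blast
  define l' where "l' i = (if i = p then \<zero> else l i)" for i
  have "finsum R (%i. l' i \<otimes> a i j) I = \<zero>" if "j \<in> insert j0 J" for j
  proof (cases "j = j0")
   case True
   thus ?thesis using \<open>\<forall>i\<in>I. a i j0 = \<zero>\<close> l by (intro add.finprod_one_eqI) (auto simp: l'_def)
  next
   case False
   have "I = insert p (I - {p})" using p by auto
   hence "finsum R (%i. l' i \<otimes> a i j) I = l' p \<otimes> a p j \<oplus> finsum R (%i. l' i \<otimes> a i j) (I - {p})"
    using finsum_insert[of "I - {p}" p "%i. l' i \<otimes> a i j"] insert.prems l a by (auto simp: l'_def)
   also have "finsum R (%i. l' i \<otimes> a i j) (I - {p}) = finsum R (%i. l i \<otimes> a i j) (I - {p})"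
    using l a by (intro finsum_cong') (auto simp: l'_def)
   finally show ?thesis using l(3)[of j] that False a by (simp add: l'_def)
  qed
  thus ?thesis using l by (intro exI[of _ l']) (auto simp: l'_def)
 next
  case False
  then obtain p where p: "p \<in> I" "a p j0 ~= \<zero>" by blast
  define c where "c = a p j0"
  have c: "c \<in> carrier R" "c ~= \<zero>" using a p by (auto simp: c_def)
  define I' where "I' = I - {p}"
  have I': "finite I'" "card I' = Suc (card J)" "I = insert p I'" "p \<notin> I'" using insert p by (auto simp: I'_def)
  define b where "b i j = c \<otimes> a i j \<ominus> a i j0 \<otimes> a p j" for i j
  have b: "b i j \<in> carrier R" for i j using a c by (simp add: b_def)
  obtain l where l: "!!i. l i \<in> carrier R" "\<exists>i\<in>I'. l i ~= \<zero>"
   "!!j. j \<in> J ==> finsum R (%i. l i \<otimes> b i j) I' = \<zero>"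
   using insert.IH[of I' b] I'(1,2) b by blast
  define S where "S = finsum R (%i. l i \<otimes> a i j0) I'"
  have S: "S \<in> carrier R" unfolding S_def using l a by (intro finsum_closed) auto
  define m where "m i = (if i = p then \<ominus> S else c \<otimes> l i)" for i
  have m: "m i \<in> carrier R" for i using l c S by (simp add: m_def)
  have sum: "finsum R (%i. m i \<otimes> a i j) I = \<ominus> S \<otimes> a p j \<oplus> c \<otimes> finsum R (%i. l i \<otimes> a i j) I'" for j
  proof -
   have "finsum R (%i. m i \<otimes> a i j) I = m p \<otimes> a p j \<oplus> finsum R (%i. m i \<otimes> a i j) I'"
    unfolding I'(3) using I' m a by (intro finsum_insert) auto
   also have "finsum R (%i. m i \<otimes> a i j) I' = finsum R (%i. c \<otimes> (l i \<otimes> a i j)) I'"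
    using I'(4) l a c by (intro finsum_cong') (auto simp: m_def m_assoc)
   also have "\<dots> = c \<otimes> finsum R (%i. l i \<otimes> a i j) I'"
    using I' l a c by (intro finsum_rdistr[symmetric]) auto
   finally show ?thesis by (simp add: m_def)
  qed
  have "finsum R (%i. m i \<otimes> a i j) I = \<zero>" if "j \<in> insert j0 J" for j
  proof (cases "j = j0")
   case True
   have "\<ominus> S \<otimes> c \<oplus> c \<otimes> S = \<zero>" using S c(1) by algebra
   thus ?thesis using sum[of j] True by (simp add: S_def c_def)
  next
   case False
   hence "\<zero> = finsum R (%i. l i \<otimes> b i j) I'" using l(3) that by auto
   also have "\<dots> = finsum R (%i. c \<otimes> (l i \<otimes> a i j) \<oplus> (\<ominus> a p j) \<otimes> (l i \<otimes> a i j0)) I'"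
   proof (rule finsum_cong'[OF refl])
    fix i
    show "l i \<otimes> b i j = c \<otimes> (l i \<otimes> a i j) \<oplus> (\<ominus> a p j) \<otimes> (l i \<otimes> a i j0)"
     unfolding b_def using l(1)[of i] a[of i j] a[of i j0] a[of p j] c(1) by algebra
   qed (use l a c in auto)
   also have "\<dots> = c \<otimes> finsum R (%i. l i \<otimes> a i j) I' \<oplus> (\<ominus> a p j) \<otimes> S"
    unfolding S_def using I' l a c by (subst finsum_addf) (auto simp: finsum_rdistr)
   finally have z: "\<zero> = c \<otimes> finsum R (%i. l i \<otimes> a i j) I' \<oplus> (\<ominus> a p j) \<otimes> S" .
   define F where "F = finsum R (%i. l i \<otimes> a i j) I'"
   have F: "F \<in> carrier R" unfolding F_def using l a by (intro finsum_closed) auto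
   have "\<ominus> S \<otimes> a p j \<oplus> c \<otimes> F = c \<otimes> F \<oplus> (\<ominus> a p j) \<otimes> S"
    using F S c(1) a[of p j] by algebra
   thus ?thesis using sum[of j] z by (simp add: F_def)
  qed
  moreover obtain i where "i \<in> I'" "l i ~= \<zero>" using l(2) by blast
  hence "m i ~= \<zero>" "i \<in> I" using I' c l integral[of c "l i"] by (auto simp: m_def)
  ultimately show ?thesis using m by blast
 qed
qed

locale domain_extension = ring_hom_cring R E g + R?: domain R + S?: domain E
  for R and E (structure) and g +
 assumes inj: "[|a \<in> carrier R; g a = \<zero>|] ==> a = \<zero>\<^sub>R"
begin

definition lin :: "nat => (nat => 'c) => (nat => 'a) => 'c" where
 "lin q x y = finsum E (%i. g (y i) \<otimes> x i) {..<q}"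

definition indep :: "nat => (nat => 'c) => bool" where
 "indep q x \<longleftrightarrow> (\<forall>y. (\<forall>i. y i \<in> carrier R) --> lin q x y = \<zero> --> (\<forall>i<q. y i = \<zero>\<^sub>R))"

lemma lin_closed [simp]: "(!!i. x i \<in> carrier E) ==> (!!i. y i \<in> carrier R) ==> lin q x y \<in> carrier E"
 unfolding lin_def by (intro S.finsum_closed) auto

lemma lin_0 [simp]: "lin 0 x y = \<zero>" by (simp add: lin_def)

lemma lin_Suc:
 "(!!i. x i \<in> carrier E) ==> (!!i. y i \<in> carrier R) ==> lin (Suc q) x y = g (y q) \<otimes> x q \<oplus> lin q x y"
 unfolding lin_def lessThan_Suc by (intro S.finsum_insert) auto

lemma lin_cong:
 assumes "!!i. i < q ==> x i = x' i" "!!i. i < q ==> y i = y' i" "!!i. x' i \<in> carrier E" "!!i. y' i \<in> carrier R"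
 shows "lin q x y = lin q x' y'"
 unfolding lin_def using assms by (intro S.finsum_cong') auto

lemma lin_add:
 assumes "!!i. x i \<in> carrier E" "!!i. y i \<in> carrier R" "!!i. z i \<in> carrier R"
 shows "lin q x (%i. y i \<oplus>\<^sub>R z i) = lin q x y \<oplus> lin q x z"
proof -
 have "lin q x (%i. y i \<oplus>\<^sub>R z i) = finsum E (%i. g (y i) \<otimes> x i \<oplus> g (z i) \<otimes> x i) {..<q}"
  unfolding lin_def using assms by (intro S.finsum_cong') (auto simp: S.l_distr)
 also have "\<dots> = lin q x y \<oplus> lin q x z"
  unfolding lin_def using assms by (intro S.finsum_addf) auto
 finally show ?thesis .
qed

lemma lin_scale:
 assumes "!!i. x i \<in> carrier E" "!!i. y i \<in> carrier R" "c \<in> carrier R"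
 shows "lin q x (%i. c \<otimes>\<^sub>R y i) = g c \<otimes> lin q x y"
proof -
 have "lin q x (%i. c \<otimes>\<^sub>R y i) = finsum E (%i. g c \<otimes> (g (y i) \<otimes> x i)) {..<q}"
  unfolding lin_def using assms by (intro S.finsum_cong') (auto simp: S.m_assoc)
 also have "\<dots> = g c \<otimes> lin q x y"
  unfolding lin_def using assms by (intro S.finsum_rdistr[symmetric]) auto
 finally show ?thesis .
qed

lemma lin_zero [simp]: "(!!i. x i \<in> carrier E) ==> lin q x (%i. \<zero>\<^sub>R) = \<zero>"
 unfolding lin_def by (intro S.add.finprod_one_eqI) auto

lemma lin_minus:
 assumes "!!i. x i \<in> carrier E" "!!i. y i \<in> carrier R" "!!i. z i \<in> carrier R"
 shows "lin q x (%i. y i \<ominus>\<^sub>R z i) = lin q x y \<ominus> lin q x z"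
proof -
 have "lin q x (%i. y i \<ominus>\<^sub>R z i) = lin q x (%i. y i \<oplus>\<^sub>R (\<ominus>\<^sub>R \<one>\<^sub>R) \<otimes>\<^sub>R z i)"
  using assms by (intro lin_cong) (auto simp: R.minus_eq R.l_minus)
 also have "\<dots> = lin q x y \<oplus> g (\<ominus>\<^sub>R \<one>\<^sub>R) \<otimes> lin q x z"
  using assms by (simp add: lin_add lin_scale)
 finally show ?thesis using assms by (simp add: S.minus_eq S.l_minus)
qed

lemma lin_inj:
 assumes "indep q x" "!!i. x i \<in> carrier E" "!!i. y i \<in> carrier R" "!!i. z i \<in> carrier R"
  "lin q x y = lin q x z" "i < q"
 shows "y i = z i"
proof -
 have "lin q x (%i. y i \<ominus>\<^sub>R z i) = \<zero>"
  unfolding lin_minus[OF assms(2,3,4)] using assms by (simp add: S.minus_eq S.r_neg)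
 hence "y i \<ominus>\<^sub>R z i = \<zero>\<^sub>R" using assms unfolding indep_def by (meson R.minus_closed)
 thus ?thesis using assms by (simp add: R.r_right_minus_eq)
qed

lemma lin_extend:
 assumes "q <= q'" "!!i. x i \<in> carrier E" "!!i. y i \<in> carrier R" "!!i. q <= i ==> i < q' ==> y i = \<zero>\<^sub>R"
 shows "lin q' x y = lin q x y"
 using assms(1,4)
proof (induction q' rule: dec_induct)
 case (step k) thus ?case using assms(2,3) by (simp add: lin_Suc)
qed simp

lemma lin_combine:
 assumes "finite W" "!!i. x i \<in> carrier E" "!!w i. y w i \<in> carrier R" "!!w. b w \<in> carrier R"
 shows "lin q x (%i. finsum R (%w. b w \<otimes>\<^sub>R y w i) W) = finsum E (%w. g (b w) \<otimes> lin q x (y w)) W"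
 using assms(1)
proof (induction W)
 case empty thus ?case using assms by simp
next
 case (insert a W)
 have "lin q x (%i. finsum R (%w. b w \<otimes>\<^sub>R y w i) (insert a W))
   = lin q x (%i. b a \<otimes>\<^sub>R y a i \<oplus>\<^sub>R finsum R (%w. b w \<otimes>\<^sub>R y w i) W)"
  using insert assms by (intro lin_cong) (auto intro!: R.finsum_insert)
 also have "\<dots> = g (b a) \<otimes> lin q x (y a) \<oplus> finsum E (%w. g (b w) \<otimes> lin q x (y w)) W"
  using insert assms by (subst lin_add) (auto simp: lin_scale)
 also have "\<dots> = finsum E (%w. g (b w) \<otimes> lin q x (y w)) (insert a W)"
  using insert assms by (intro S.finsum_insert[symmetric]) auto
 finally show ?case .
qed

lemma not_zero_mult: "[|a \<in> carrier R; b \<in> carrier R; a ~= \<zero>\<^sub>R; b ~= \<zero>\<^sub>R|] ==> a \<otimes>\<^sub>R b ~= \<zero>\<^sub>R"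
 using R.integral by blast

lemma extend_to_basis:
 assumes "indep q x" "!!i. x i \<in> carrier E" "finite W" "W \<subseteq> carrier E"
 shows "\<exists>q' x' c. q <= q' & (\<forall>i<q. x' i = x i) & (\<forall>i. x' i \<in> carrier E) & indep q' x' &
  c \<in> carrier R & c ~= \<zero>\<^sub>R & (\<forall>w\<in>W. \<exists>y. (\<forall>i. y i \<in> carrier R) & g c \<otimes> w = lin q' x' y)"
 using assms(3,4)
proof (induction W)
 case empty
 show ?case using assms by (intro exI[of _ q] exI[of _ x] exI[of _ "\<one>\<^sub>R"]) auto
next
 case (insert w W)
 have "W \<subseteq> carrier E" using insert by simp
 then obtain q' x' c where IH: "q <= q'" "!!i. i < q ==> x' i = x i" "!!i. x' i \<in> carrier E" "indep q' x'"
  "c \<in> carrier R" "c ~= \<zero>\<^sub>R" "!!w. w \<in> W ==> \<exists>y. (\<forall>i. y i \<in> carrier R) & g c \<otimes> w = lin q' x' y"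
  using insert.IH by blast
 have w: "w \<in> carrier E" using insert by simp
 define x'' where "x'' = x'(q' := w)"
 have x'': "x'' i \<in> carrier E" for i using IH(3) w by (simp add: x''_def)
 have same: "lin q' x'' y = lin q' x' y" if "!!i. y i \<in> carrier R" for y
  using that IH(3) by (intro lin_cong) (auto simp: x''_def)
 show ?case
 proof (cases "indep (Suc q') x''")
  case True
  have "\<exists>y. (\<forall>i. y i \<in> carrier R) & g c \<otimes> u = lin (Suc q') x'' y" if u: "u \<in> insert w W" for u
  proof (cases "u = w")
   case True
   define y where "y i = (if i = q' then c else \<zero>\<^sub>R)" for i
   have y: "y i \<in> carrier R" for i using IH(5) by (simp add: y_def)
   have "lin q' x'' y = lin q' x'' (%_. \<zero>\<^sub>R)" using x'' by (intro lin_cong) (auto simp: y_def)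
   hence "lin (Suc q') x'' y = g c \<otimes> w"
    using lin_Suc[of x'' y q'] x'' y w IH(5) by (simp add: y_def x''_def)
   thus ?thesis using y True by metis
  next
   case False
   then obtain y where y: "!!i. y i \<in> carrier R" "g c \<otimes> u = lin q' x' y" using IH(7) u by blast
   define y' where "y' i = (if i = q' then \<zero>\<^sub>R else y i)" for i
   have y': "y' i \<in> carrier R" for i using y by (simp add: y'_def)
   have "lin (Suc q') x'' y' = lin q' x'' y'" using x'' y' by (intro lin_extend) (auto simp: y'_def)
   also have "\<dots> = lin q' x' y" using y IH(3) by (intro lin_cong) (auto simp: y'_def x''_def)
   finally show ?thesis using y y' by metis
  qed
  moreover have "\<forall>i<q. x'' i = x i" "q <= Suc q'" using IH(1,2) by (auto simp: x''_def)
  ultimately show ?thesis using IH(5,6) True x'' by blast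
 next
  case False
  then obtain y where y: "!!i. y i \<in> carrier R" "lin (Suc q') x'' y = \<zero>" "\<exists>i<Suc q'. y i ~= \<zero>\<^sub>R"
   unfolding indep_def by blast
  have rel: "g (y q') \<otimes> w \<oplus> lin q' x' y = \<zero>"
   using y lin_Suc[of x'' y q'] x'' same by (simp add: x''_def)
  have yq: "y q' ~= \<zero>\<^sub>R"
  proof
   assume z: "y q' = \<zero>\<^sub>R"
   hence "lin q' x' y = \<zero>" using rel w y IH(3) by simp
   hence "\<forall>i<q'. y i = \<zero>\<^sub>R" using IH(4) y(1) unfolding indep_def by blast
   thus False using y(3) z by (auto simp: less_Suc_eq)
  qed
  have gw: "g (y q') \<otimes> w = g (\<ominus>\<^sub>R \<one>\<^sub>R) \<otimes> lin q' x' y"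
   using rel w y IH(3) S.sum_zero_eq_neg[of "g (y q') \<otimes> w" "lin q' x' y"] by (simp add: S.l_minus)
  define c' where "c' = c \<otimes>\<^sub>R y q'"
  have c': "c' \<in> carrier R" "c' ~= \<zero>\<^sub>R" using IH y yq not_zero_mult by (auto simp: c'_def)
  have "\<exists>z. (\<forall>i. z i \<in> carrier R) & g c' \<otimes> u = lin q' x' z" if u: "u \<in> insert w W" for u
  proof (cases "u = w")
   case True
   have "g c' \<otimes> w = g (c \<otimes>\<^sub>R \<ominus>\<^sub>R \<one>\<^sub>R) \<otimes> lin q' x' y"
    using gw IH y w by (simp add: c'_def S.m_assoc)
   also have "\<dots> = lin q' x' (%i. (c \<otimes>\<^sub>R \<ominus>\<^sub>R \<one>\<^sub>R) \<otimes>\<^sub>R y i)" using IH y by (intro lin_scale[symmetric]) auto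
   finally show ?thesis using True y IH by (intro exI[of _ "%i. (c \<otimes>\<^sub>R \<ominus>\<^sub>R \<one>\<^sub>R) \<otimes>\<^sub>R y i"]) auto
  next
   case False
   then obtain z where z: "!!i. z i \<in> carrier R" "g c \<otimes> u = lin q' x' z" using IH(7) u by blast
   have uE: "u \<in> carrier E" using insert u by auto
   have "g c' \<otimes> u = g (y q') \<otimes> (g c \<otimes> u)"
    using IH y uE by (simp add: c'_def S.m_assoc S.m_lcomm)
   also have "\<dots> = lin q' x' (%i. y q' \<otimes>\<^sub>R z i)"
    unfolding z(2) using IH y z by (intro lin_scale[symmetric]) auto
   finally show ?thesis using z y by (intro exI[of _ "%i. y q' \<otimes>\<^sub>R z i"]) auto
  qed
  thus ?thesis using IH c' by (intro exI[of _ q'] exI[of _ x'] exI[of _ c']) auto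
 qed
qed

text \<open>
 The powers of \<open>s\<close> lie in a finitely generated module, so they are dependent; the first dependent
 power gives a relation whose leading coefficient is not zero.
\<close>

lemma minimal_relation:
 assumes s: "s \<in> carrier E" and W: "finite W" "!!w. w \<in> W ==> e w \<in> carrier E"
  and rep: "!!n::nat. \<exists>b. (\<forall>w. b w \<in> carrier R) & s [^] n = finsum E (%w. g (b w) \<otimes> e w) W"
 shows "\<exists>d G. 0 < d & indep d (%i. s [^] i) & (\<forall>i. G i \<in> carrier R) & G d ~= \<zero>\<^sub>R &
  lin (Suc d) (%i. s [^] i) G = \<zero>"
proof -
 define pw where "pw i = s [^] i" for i :: nat
 have pw: "pw i \<in> carrier E" for i using s by (simp add: pw_def)
 obtain b where b: "!!n w. b n w \<in> carrier R" "!!n. pw n = finsum E (%w. g (b n w) \<otimes> e w) W"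
  using choice[of "%n b. (\<forall>w. b w \<in> carrier R) & s [^] n = finsum E (%w. g (b w) \<otimes> e w) W"] rep
  unfolding pw_def by blast
 have WE: "e w \<in> carrier E" if "w \<in> W" for w using W(2) that by auto
 define k where "k = card W"
 obtain l where l: "!!i. l i \<in> carrier R" "\<exists>i\<in>{..<Suc k}. l i ~= \<zero>\<^sub>R"
  "!!w. w \<in> W ==> finsum R (%i. l i \<otimes>\<^sub>R b i w) {..<Suc k} = \<zero>\<^sub>R"
  using R.linear_dependence[OF W(1), of "{..<Suc k}" b] b(1) unfolding k_def by (simp only: finite_lessThan card_lessThan simp_thms True_implies_equals) blast
 have "lin (Suc k) pw l = finsum E (%i. finsum E (%w. g (l i \<otimes>\<^sub>R b i w) \<otimes> e w) W) {..<Suc k}"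
  unfolding lin_def
 proof (rule S.finsum_cong'[OF refl])
  fix i
  have "g (l i) \<otimes> pw i = finsum E (%w. g (l i) \<otimes> (g (b i w) \<otimes> e w)) W"
   unfolding b(2) using W l b WE by (intro S.finsum_rdistr) auto
  also have "\<dots> = finsum E (%w. g (l i \<otimes>\<^sub>R b i w) \<otimes> e w) W"
   using l b WE by (intro S.finsum_cong') (auto simp: S.m_assoc)
  finally show "g (l i) \<otimes> pw i = finsum E (%w. g (l i \<otimes>\<^sub>R b i w) \<otimes> e w) W" .
 qed (use l b WE in \<open>auto intro!: S.finsum_closed\<close>)
 also have "\<dots> = finsum E (%(i, w). g (l i \<otimes>\<^sub>R b i w) \<otimes> e w) ({..<Suc k} \<times> W)"
  using W l b WE by (intro S.finsum_Sigma) auto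
 also have "\<dots> = finsum E (%(w, i). g (l i \<otimes>\<^sub>R b i w) \<otimes> e w) (W \<times> {..<Suc k})"
 proof -
  have "{..<Suc k} \<times> W = prod.swap ` (W \<times> {..<Suc k})" by auto
  hence "finsum E (%(i, w). g (l i \<otimes>\<^sub>R b i w) \<otimes> e w) ({..<Suc k} \<times> W)
   = finsum E (%z. (%(i, w). g (l i \<otimes>\<^sub>R b i w) \<otimes> e w) (prod.swap z)) (W \<times> {..<Suc k})"
   using S.finsum_reindex[of "%(i, w). g (l i \<otimes>\<^sub>R b i w) \<otimes> e w" prod.swap "W \<times> {..<Suc k}"] l b WE
   by (auto simp: Pi_iff)
  thus ?thesis by (simp add: case_prod_beta')
 qed
 also have "\<dots> = finsum E (%w. finsum E (%i. g (l i \<otimes>\<^sub>R b i w) \<otimes> e w) {..<Suc k}) W"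
  using W l b WE by (intro S.finsum_Sigma[symmetric]) auto
 also have "\<dots> = finsum E (%w. g (finsum R (%i. l i \<otimes>\<^sub>R b i w) {..<Suc k}) \<otimes> e w) W"
 proof (rule S.finsum_cong'[OF refl])
  fix w assume w: "w \<in> W"
  have "finsum E (%i. g (l i \<otimes>\<^sub>R b i w) \<otimes> e w) {..<Suc k} = finsum E (%i. g (l i \<otimes>\<^sub>R b i w)) {..<Suc k} \<otimes> e w"
   using l b WE[OF w] by (intro S.finsum_ldistr[symmetric]) auto
  also have "finsum E (%i. g (l i \<otimes>\<^sub>R b i w)) {..<Suc k} = g (finsum R (%i. l i \<otimes>\<^sub>R b i w) {..<Suc k})"
   using l b hom_finsum[of "%i. l i \<otimes>\<^sub>R b i w" "{..<Suc k}"] by (simp add: o_def Pi_iff)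
  finally show "finsum E (%i. g (l i \<otimes>\<^sub>R b i w) \<otimes> e w) {..<Suc k}
   = g (finsum R (%i. l i \<otimes>\<^sub>R b i w) {..<Suc k}) \<otimes> e w" .
 qed (use l b WE in \<open>auto intro!: R.finsum_closed\<close>)
 also have "\<dots> = \<zero>" using l(3) WE by (intro S.add.finprod_one_eqI) auto
 finally have "\<not> indep (Suc k) pw" using l unfolding indep_def by auto
 hence ex: "\<exists>k. \<not> indep (Suc k) pw" by blast
 define d where "d = (LEAST k. \<not> indep (Suc k) pw)"
 have nd: "\<not> indep (Suc d) pw" unfolding d_def by (rule LeastI_ex[OF ex])
 have id: "indep d pw"
 proof (cases d)
  case 0 thus ?thesis by (simp add: indep_def)
 next
  case (Suc d')
  thus ?thesis using not_less_Least[of d' "%k. \<not> indep (Suc k) pw"] by (simp add: d_def)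
 qed
 obtain G where G: "!!i. G i \<in> carrier R" "lin (Suc d) pw G = \<zero>" "\<exists>i<Suc d. G i ~= \<zero>\<^sub>R"
  using nd unfolding indep_def by blast
 have Gd: "G d ~= \<zero>\<^sub>R"
 proof
  assume z: "G d = \<zero>\<^sub>R"
  hence "lin d pw G = \<zero>" using G lin_Suc[of pw G d] pw by simp
  hence "\<forall>i<d. G i = \<zero>\<^sub>R" using id G(1) unfolding indep_def by blast
  thus False using G(3) z by (auto simp: less_Suc_eq)
 qed
 have "0 < d"
 proof (rule ccontr)
  assume "\<not> 0 < d"
  hence "g (G 0) = \<zero>" using G lin_Suc[of pw G 0] pw by (simp add: pw_def)
  thus False using inj[OF G(1)] Gd \<open>\<not> 0 < d\<close> by simp
 qed
 thus ?thesis using id G Gd unfolding pw_def by blast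
qed

lemma shift_coordinates:
 assumes s: "s \<in> carrier E" and G: "!!i. G i \<in> carrier R" "lin (Suc d) (%i. s [^] i) G = \<zero>"
  and d: "0 < d" and y: "!!i. y i \<in> carrier R"
 shows "g (G d) \<otimes> (s \<otimes> lin d (%i. s [^] i) y)
  = lin d (%i. s [^] i) (%i. G d \<otimes>\<^sub>R (if i = 0 then \<zero>\<^sub>R else y (i - 1)) \<ominus>\<^sub>R y (d - 1) \<otimes>\<^sub>R G i)"
proof -
 define pw where "pw i = s [^] i" for i :: nat
 have pw: "pw i \<in> carrier E" for i using s by (simp add: pw_def)
 define y' where "y' i = (if i = 0 then \<zero>\<^sub>R else y (i - 1))" for i
 have y': "y' i \<in> carrier R" for i using y by (simp add: y'_def)
 have y'0: "y' 0 = \<zero>\<^sub>R" and y'S: "y' (Suc k) = y k" for k by (simp_all add: y'_def)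
 have pw_eq: "(%i. s [^] i) = pw" by (simp add: pw_def fun_eq_iff)
 have "s \<otimes> lin k pw y = lin (Suc k) pw y'" for k
 proof (induction k)
  case 0 thus ?case using lin_Suc[of pw y' 0] pw y' s by (simp add: y'0)
 next
  case (Suc k)
  have "s \<otimes> pw k = pw (Suc k)" using s by (simp add: pw_def S.m_comm)
  hence "s \<otimes> (g (y k) \<otimes> pw k) = g (y k) \<otimes> pw (Suc k)"
   using S.m_lcomm[of s "g (y k)" "pw k"] s y pw by simp
  thus ?case using Suc s pw y y' lin_Suc[of pw y k] lin_Suc[of pw y' "Suc k"]
   by (simp add: S.r_distr y'S)
 qed
 hence e1: "s \<otimes> lin d pw y = g (y (d - 1)) \<otimes> pw d \<oplus> lin d pw y'"
  using lin_Suc[of pw y' d] pw y' d y'S[of "d - 1"] by simp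
 have "g (G d) \<otimes> pw d \<oplus> lin d pw G = \<zero>"
  using G(2) lin_Suc[of pw G d, OF pw G(1)] unfolding pw_eq by simp
 hence e2: "g (G d) \<otimes> pw d = \<ominus> lin d pw G" using pw G by (intro S.sum_zero_eq_neg) auto
 have "g (G d) \<otimes> (s \<otimes> lin d pw y)
   = g (y (d - 1)) \<otimes> (g (G d) \<otimes> pw d) \<oplus> g (G d) \<otimes> lin d pw y'"
  unfolding e1 using pw G y y' by (simp add: S.r_distr S.m_lcomm)
 also have "\<dots> = g (G d) \<otimes> lin d pw y' \<ominus> g (y (d - 1)) \<otimes> lin d pw G"
  unfolding e2 using pw G y y' by (simp add: S.minus_eq S.r_minus S.a_comm)
 also have "\<dots> = lin d pw (%i. G d \<otimes>\<^sub>R y' i \<ominus>\<^sub>R y (d - 1) \<otimes>\<^sub>R G i)"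
  using pw G y y' by (simp add: lin_minus lin_scale)
 finally show ?thesis unfolding pw_eq y'_def .
qed

text \<open>
 The independent powers extend to a basis among the generators. With a common denominator \<open>c\<close>,
 the coordinates of \<open>s ^ n\<close> are linear in its coefficients with respect to the generators.
\<close>

lemma coordinates_of_powers:
 assumes s: "s \<in> carrier E" and d: "0 < d" "indep d (%i. s [^] i)"
  and G: "!!i. G i \<in> carrier R" "G d ~= \<zero>\<^sub>R" "lin (Suc d) (%i. s [^] i) G = \<zero>"
  and W: "finite W" "!!w. w \<in> W ==> e w \<in> carrier E"
 shows "\<exists>c Y. c \<in> carrier R & c ~= \<zero>\<^sub>R & (\<forall>w i. Y w i \<in> carrier R) &
  (\<forall>(n::nat) b. (\<forall>w. b w \<in> carrier R) --> s [^] n = finsum E (%w. g (b w) \<otimes> e w) W -->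
   g c \<otimes> s [^] n = lin d (%i. s [^] i) (%i. finsum R (%w. b w \<otimes>\<^sub>R Y w i) W))"
proof -
 define pw where "pw i = s [^] i" for i :: nat
 have pw: "pw i \<in> carrier E" for i using s by (simp add: pw_def)
 have pw_eq: "(%i. s [^] i) = pw" by (simp add: pw_def fun_eq_iff)
 obtain q x c where q: "d <= q" "!!i. i < d ==> x i = pw i" "!!i. x i \<in> carrier E" "indep q x"
  "c \<in> carrier R" "c ~= \<zero>\<^sub>R" "!!w. w \<in> e ` W ==> \<exists>y. (\<forall>i. y i \<in> carrier R) & g c \<otimes> w = lin q x y"
 proof -
  have We: "e ` W \<subseteq> carrier E" using W(2) by auto
  have "!!i. pw i \<in> carrier E" "finite (e ` W)" using pw W(1) by auto
  thus thesis using extend_to_basis[OF d(2)[unfolded pw_eq] _ _ We] W(1) that by blast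
 qed
 have "\<exists>Y. \<forall>w\<in>W. (\<forall>i. Y w i \<in> carrier R) & g c \<otimes> e w = lin q x (Y w)"
  using q(7) by (intro bchoice ballI) auto
 then obtain Y0 where Y0: "!!w i. w \<in> W ==> Y0 w i \<in> carrier R" "!!w. w \<in> W ==> g c \<otimes> e w = lin q x (Y0 w)"
  by blast
 define Y where "Y w = (if w \<in> W then Y0 w else (%_. \<zero>\<^sub>R))" for w
 have Y: "Y w i \<in> carrier R" for w i using Y0 by (simp add: Y_def)
 have powers: "\<exists>y. (\<forall>i. y i \<in> carrier R) & g (G d [^]\<^sub>R n) \<otimes> pw n = lin d pw y" for n :: nat
 proof (induction n)
  case 0
  define y where "y i = (if i = 0 then \<one>\<^sub>R else \<zero>\<^sub>R)" for i :: nat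
  have y: "y i \<in> carrier R" for i by (simp add: y_def)
  have "lin d pw y = lin 1 pw y" using d y pw by (intro lin_extend) (auto simp: y_def)
  also have "\<dots> = pw 0" using lin_Suc[of pw y 0] pw y by (simp add: y_def)
  finally show ?case using y pw[of 0] by (intro exI[of _ y]) simp
 next
  case (Suc n)
  then obtain y where y: "!!i. y i \<in> carrier R" "g (G d [^]\<^sub>R n) \<otimes> pw n = lin d pw y" by blast
  have "pw (Suc n) = s \<otimes> pw n" using s by (simp add: pw_def S.m_comm)
  hence "g (G d [^]\<^sub>R Suc n) \<otimes> pw (Suc n) = g (G d) \<otimes> (s \<otimes> (g (G d [^]\<^sub>R n) \<otimes> pw n))"
   using G s pw by (simp add: S.m_ac)
  also have "\<dots> = lin d pw (%i. G d \<otimes>\<^sub>R (if i = 0 then \<zero>\<^sub>R else y (i - 1)) \<ominus>\<^sub>R y (d - 1) \<otimes>\<^sub>R G i)"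
   unfolding y(2) by (rule shift_coordinates[OF s G(1) G(3) d(1) y(1), unfolded pw_eq])
  finally show ?case using y G
   by (intro exI[of _ "%i. G d \<otimes>\<^sub>R (if i = 0 then \<zero>\<^sub>R else y (i - 1)) \<ominus>\<^sub>R y (d - 1) \<otimes>\<^sub>R G i"]) auto
 qed
 have main: "g c \<otimes> pw n = lin d pw (%i. finsum R (%w. b w \<otimes>\<^sub>R Y w i) W)"
  if b: "!!w. b w \<in> carrier R" "pw n = finsum E (%w. g (b w) \<otimes> e w) W" for n b
 proof -
  define z where "z i = finsum R (%w. b w \<otimes>\<^sub>R Y w i) W" for i
  have z: "z i \<in> carrier R" for i unfolding z_def using b Y by (intro R.finsum_closed) auto
  have "g c \<otimes> pw n = finsum E (%w. g c \<otimes> (g (b w) \<otimes> e w)) W"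
   unfolding b(2) using W b q by (intro S.finsum_rdistr) auto
  also have "\<dots> = finsum E (%w. g (b w) \<otimes> lin q x (Y w)) W"
  proof (rule S.finsum_cong'[OF refl])
   fix w assume w: "w \<in> W"
   hence "g c \<otimes> (g (b w) \<otimes> e w) = g (b w) \<otimes> (g c \<otimes> e w)"
    using W b q by (auto intro!: S.m_lcomm)
   thus "g c \<otimes> (g (b w) \<otimes> e w) = g (b w) \<otimes> lin q x (Y w)" using Y0(2)[OF w] w by (simp add: Y_def)
  qed (use b Y q in auto)
  also have "\<dots> = lin q x z" unfolding z_def using W q Y b by (intro lin_combine[symmetric]) auto
  finally have zq: "g c \<otimes> pw n = lin q x z" .
  obtain y where y: "!!i. y i \<in> carrier R" "g (G d [^]\<^sub>R n) \<otimes> pw n = lin d pw y" using powers by blast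
  define y' where "y' i = (if i < d then c \<otimes>\<^sub>R y i else \<zero>\<^sub>R)" for i
  have y': "y' i \<in> carrier R" for i using y q by (simp add: y'_def)
  have Gn: "G d [^]\<^sub>R n \<in> carrier R" "G d [^]\<^sub>R n ~= \<zero>\<^sub>R"
  proof -
   show "G d [^]\<^sub>R n \<in> carrier R" using G(1) by simp
   show "G d [^]\<^sub>R n ~= \<zero>\<^sub>R" using G(1,2) not_zero_mult[of "G d [^]\<^sub>R n" "G d" for n] by (induction n) auto
  qed
  have "lin q x y' = lin d x y'" using q y' by (intro lin_extend) (auto simp: y'_def)
  also have "\<dots> = lin d pw (%i. c \<otimes>\<^sub>R y i)" using q y pw by (intro lin_cong) (auto simp: y'_def)
  also have "\<dots> = g c \<otimes> (g (G d [^]\<^sub>R n) \<otimes> pw n)" unfolding y(2) using q y pw by (intro lin_scale) auto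
  also have "\<dots> = g (G d [^]\<^sub>R n) \<otimes> lin q x z" using Gn q pw zq by (metis S.m_lcomm hom_closed)
  also have "\<dots> = lin q x (%i. G d [^]\<^sub>R n \<otimes>\<^sub>R z i)" using Gn q z by (intro lin_scale[symmetric]) auto
  finally have eq: "lin q x y' = lin q x (%i. G d [^]\<^sub>R n \<otimes>\<^sub>R z i)" .
  have "z i = \<zero>\<^sub>R" if "d <= i" "i < q" for i
  proof -
   have "y' i = G d [^]\<^sub>R n \<otimes>\<^sub>R z i" using lin_inj[OF q(4,3) y' _ eq that(2)] Gn z by auto
   thus ?thesis using that Gn z R.integral[of "G d [^]\<^sub>R n" "z i"] by (simp add: y'_def)
  qed
  hence "lin q x z = lin d x z" using q z by (intro lin_extend) auto
  also have "\<dots> = lin d pw z" using q z pw by (intro lin_cong) auto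
  finally show ?thesis using zq unfolding z_def by simp
 qed
 show ?thesis
  unfolding pw_eq using q(5,6) Y main unfolding pw_def by blast
qed

end

section \<open>Elements of finite domain extensions\<close>

text \<open>
 Gauss's lemma in disguise. Up to reversing \<open>G\<close>, the recurrence says that the product of the polynomial \<open>G\<close> and
 the series with coefficients \<open>u\<close> is a single term. If a lower coefficient of \<open>G\<close> dominated, then for a weight slightly
 below 1 the dominant terms would multiply to a nonzero term of higher degree.
\<close>

lemma (in banach_ring) recurrence_bound:
 assumes mult: "!!a b. a \<in> carrier R ==> b \<in> carrier R ==> N (a \<otimes> b) = N a * N b"
  and G: "!!i. G i \<in> carrier R" "G d ~= \<zero>" and u: "!!n. u n \<in> carrier R"
  and rel: "!!n. finsum R (%j. G j \<otimes> u (n + j)) {..<Suc d} = \<zero>"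
  and d: "0 < d" and u0: "!!n. n < d - 1 ==> u n = \<zero>" "u (d - 1) ~= \<zero>"
  and growth: "!!r. 1 < r ==> \<exists>B. \<forall>n. N (u n) <= B * r ^ n"
  and i0: "i0 <= d"
 shows "N (G i0) <= N (G d)"
proof (rule ccontr)
 assume "\<not> N (G i0) <= N (G d)"
 hence lt: "N (G d) < N (G i0)" by simp
 hence i0d: "i0 < d" using i0 by (cases "i0 = d") auto
 have Gd: "0 < N (G d)" using G norm_nonneg[of "G d"] norm_eq_0_iff[of "G d"] by simp
 define q where "q = N (G d) / N (G i0)"
 have q: "0 < q" "q < 1" using lt Gd by (auto simp: q_def)
 define k where "k = d - i0"
 have k: "0 < k" using i0d by (simp add: k_def)
 \<comment> \<open>a weight \<open>\<rho>\<close> slightly below 1 under which \<open>G d\<close> is still not dominant\<close>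
 define \<rho> where "\<rho> = 1 - (1 - q) / (2 * real k)"
 have \<rho>1: "\<rho> < 1" using q k by (simp add: \<rho>_def)
 have "(1 - q) / (2 * real k) < 1" using q k by (simp add: divide_less_eq)
 hence \<rho>0: "0 < \<rho>" by (simp add: \<rho>_def)
 have "1 + real k * (- ((1 - q) / (2 * real k))) <= (1 + - ((1 - q) / (2 * real k))) ^ k"
  using \<open>(1 - q) / (2 * real k) < 1\<close> by (intro Bernoulli_inequality) simp
 moreover have "real k * ((1 - q) / (2 * real k)) = (1 - q) / 2" using k by simp
 ultimately have "q < \<rho> ^ k" using q by (simp add: \<rho>_def)
 hence dom: "N (G d) < N (G i0) * \<rho> ^ (d - i0)"
  using lt Gd by (simp add: q_def k_def field_simps)
 define \<alpha> where "\<alpha> j = N (G j) * \<rho> ^ (d - j)" for j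
 define \<beta> where "\<beta> n = N (u n) * \<rho> ^ n" for n
 have \<alpha>0: "0 <= \<alpha> j" for j using norm_nonneg[OF G(1)] \<rho>0 by (simp add: \<alpha>_def)
 have \<beta>0: "0 <= \<beta> n" for n using norm_nonneg[OF u] \<rho>0 by (simp add: \<beta>_def)
 define M where "M = Max (\<alpha> ` {..d})"
 have M: "\<alpha> j <= M" if "j <= d" for j unfolding M_def using that by (intro Max_ge) auto
 have "\<exists>j. j <= d & \<alpha> j = M"
 proof -
  have "M \<in> \<alpha> ` {..d}" unfolding M_def by (intro Max_in) auto
  thus ?thesis by auto
 qed
 define js where "js = (LEAST j. j <= d & \<alpha> j = M)"
 have js: "js <= d" "\<alpha> js = M" using LeastI_ex[OF \<open>\<exists>j. j <= d & \<alpha> j = M\<close>] by (auto simp: js_def)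
 have js_less: "\<alpha> j < M" if "j < js" for j
  using not_less_Least[of j "%j. j <= d & \<alpha> j = M"] that js M[of j] by (auto simp: js_def)
 have Mpos: "\<alpha> d < M" using dom M[of i0] i0 by (simp add: \<alpha>_def)
 hence M0: "0 < M" using \<alpha>0[of d] by linarith
 have jsd: "js < d" using js Mpos by (cases "js = d") auto
 have b1: "0 < \<beta> (d - 1)" using u0(2) norm_nonneg[OF u] norm_eq_0_iff[OF u] \<rho>0 by (simp add: \<beta>_def less_le)
 define r where "r = (1 + 1 / \<rho>) / 2"
 have r: "1 < r" "r * \<rho> < 1" "0 < r" using \<rho>0 \<rho>1 by (auto simp: r_def field_simps)
 obtain B where B: "!!n. N (u n) <= B * r ^ n" using growth[OF r(1)] by blast
 have "(%n. B * (r * \<rho>) ^ n) \<longlonglongrightarrow> B * 0"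
  using r \<rho>0 by (intro tendsto_mult tendsto_const LIMSEQ_realpow_zero) auto
 hence "eventually (%n. B * (r * \<rho>) ^ n < \<beta> (d - 1)) sequentially"
  using b1 by (intro order_tendstoD) auto
 then obtain n1 where n1: "!!n. n \<ge> n1 ==> B * (r * \<rho>) ^ n < \<beta> (d - 1)" by (auto simp: eventually_sequentially)
 have small: "\<beta> n < \<beta> (d - 1)" if "n \<ge> n1" for n
 proof -
  have "\<beta> n <= B * r ^ n * \<rho> ^ n" unfolding \<beta>_def using B \<rho>0 by (intro mult_right_mono) auto
  also have "\<dots> = B * (r * \<rho>) ^ n" by (simp add: power_mult_distrib)
  finally show ?thesis using n1[OF that] by linarith
 qed
 define P where "P = {n. \<beta> (d - 1) <= \<beta> n}"
 have P: "finite P" "d - 1 \<in> P"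
 proof -
  have "P \<subseteq> {..<n1}" using small by (auto simp: P_def not_le[symmetric])
  thus "finite P" using finite_subset by blast
 qed (simp add: P_def)
 define M' where "M' = Max (\<beta> ` P)"
 have "M' \<in> \<beta> ` P" unfolding M'_def using P by (intro Max_in) auto
 have M': "\<beta> n <= M'" for n
 proof (cases "n \<in> P")
  case True thus ?thesis unfolding M'_def using P by (intro Max_ge) auto
 next
  case False
  have "\<beta> (d - 1) <= M'" unfolding M'_def using P by (intro Max_ge) auto
  thus ?thesis using False by (auto simp: P_def)
 qed
 have M'0: "0 < M'" using M'[of "d - 1"] b1 by linarith
 define ns where "ns = Max {n. \<beta> n = M'}"
 have "{n. \<beta> n = M'} \<subseteq> P" using M'[of "d - 1"] by (auto simp: P_def)
 hence fin: "finite {n. \<beta> n = M'}" using P finite_subset by blast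
 moreover have "{n. \<beta> n = M'} ~= {}" using \<open>M' \<in> \<beta> ` P\<close> by auto
 ultimately have ns: "\<beta> ns = M'" unfolding ns_def using Max_in[of "{n. \<beta> n = M'}"] by auto
 have ns_less: "\<beta> n < M'" if "ns < n" for n
  using Max_ge[OF fin, of n] that M'[of n] unfolding ns_def[symmetric] by (cases "\<beta> n = M'") auto
 have "d - 1 <= ns"
 proof (rule ccontr)
  assume "\<not> d - 1 <= ns"
  hence "\<beta> ns = 0" using u0(1)[of ns] by (simp add: \<beta>_def)
  thus False using ns M'0 by simp
 qed
 hence jsn: "js <= ns" using jsd by linarith
 define n0 where "n0 = ns - js"
 have weight: "N (G j \<otimes> u (n0 + j)) * \<rho> ^ (d + n0) = \<alpha> j * \<beta> (n0 + j)" if "j <= d" for j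
 proof -
  have "\<rho> ^ (d + n0) = \<rho> ^ (d - j) * \<rho> ^ (n0 + j)" using that by (simp add: power_add[symmetric])
  thus ?thesis unfolding \<alpha>_def \<beta>_def using mult[OF G(1) u] by (simp add: mult_ac)
 qed
 have "N (finsum R (%j. G j \<otimes> u (n0 + j)) {..<Suc d}) = N (G js \<otimes> u (n0 + js))"
 proof (rule norm_finsum_dominant)
  fix j assume j: "j \<in> {..<Suc d}" "j ~= js"
  have "\<alpha> j * \<beta> (n0 + j) < M * M'"
  proof (cases "j < js")
   case True
   have "\<alpha> j * \<beta> (n0 + j) <= \<alpha> j * M'" using M' \<alpha>0 by (intro mult_left_mono)
   also have "\<dots> < M * M'" using js_less[OF True] M'0 by simp
   finally show ?thesis .
  next
   case False
   hence "ns < n0 + j" using j jsn by (simp add: n0_def)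
   hence "\<beta> (n0 + j) < M'" by (rule ns_less)
   hence "M * \<beta> (n0 + j) < M * M'" using M0 by simp
   moreover have "\<alpha> j * \<beta> (n0 + j) <= M * \<beta> (n0 + j)" using M[of j] j \<beta>0 by (intro mult_right_mono) auto
   ultimately show ?thesis by linarith
  qed
  hence "N (G j \<otimes> u (n0 + j)) * \<rho> ^ (d + n0) < N (G js \<otimes> u (n0 + js)) * \<rho> ^ (d + n0)"
   using weight[of j] weight[of js] j js ns jsn by (simp add: n0_def)
  thus "N (G j \<otimes> u (n0 + j)) < N (G js \<otimes> u (n0 + js))" using \<rho>0 by simp
 qed (use G u jsd in auto)
 hence "N (G js \<otimes> u (n0 + js)) = 0" using rel by simp
 hence "M * M' = 0" using weight[of js] js ns jsn by (simp add: n0_def)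
 thus False using M0 M'0 by simp
qed

text \<open>
 An element \<open>s\<close> of a domain extension with a minimal relation \<open>G\<close> of degree \<open>d\<close>, and the
 coordinates \<open>t n\<close> of \<open>c s ^ n\<close>, which grow at rate at most 1.
\<close>

locale power_coordinates = domain_extension R E g + N?: banach_ring R N
  for R and N and E (structure) and g +
 fixes s and d :: nat and G :: "nat => 'a" and c and t :: "nat => nat => 'a"
 assumes mult: "!!a b. a \<in> carrier R ==> b \<in> carrier R ==> N (a \<otimes>\<^sub>R b) = N a * N b"
  and s: "s \<in> carrier E" and d: "0 < d" and ind: "indep d (%i. s [^] i)"
  and G: "!!i. G i \<in> carrier R" "G d ~= \<zero>\<^sub>R" "lin (Suc d) (%i. s [^] i) G = \<zero>"
  and c: "c \<in> carrier R" "c ~= \<zero>\<^sub>R"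
  and t: "!!n i. t n i \<in> carrier R" "!!n. g c \<otimes> s [^] n = lin d (%i. s [^] i) (t n)"
  and growth: "!!r. 1 < r ==> \<exists>B. \<forall>n. \<forall>i<d. N (t n i) <= B * r ^ n"
begin

abbreviation pw :: "nat => 'c" where "pw \<equiv> %i. s [^] i"

lemma pw [simp]: "s [^] (i::nat) \<in> carrier E" using s by simp

lemma coordinates_unique:
 assumes "!!i. y i \<in> carrier R" "!!i. z i \<in> carrier R" "lin d pw y = lin d pw z" "i < d"
 shows "y i = z i"
 by (rule lin_inj[OF ind _ assms(1) assms(2) assms(3,4)]) simp

lemma norm_c_pos: "0 < N c" using c norm_nonneg[of c] norm_eq_0_iff[of c] by simp

lemma coordinates_small_powers:
 assumes "n < d" "i < d" shows "t n i = (if i = n then c else \<zero>\<^sub>R)"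
proof -
 define y where "y i = (if i = n then c else \<zero>\<^sub>R)" for i
 have y: "y i \<in> carrier R" for i using c by (simp add: y_def)
 have "lin d pw y = lin (Suc n) pw y" using assms y by (intro lin_extend) (auto simp: y_def)
 also have "\<dots> = g c \<otimes> pw n \<oplus> lin n pw y" using lin_Suc[of pw y n] y by (simp add: y_def)
 also have "lin n pw y = lin 0 pw y" using y by (intro lin_extend) (auto simp: y_def)
 finally have "lin d pw y = g c \<otimes> pw n" using c by simp
 hence "lin d pw (t n) = lin d pw y" using t(2)[of n] by simp
 hence "t n i = y i" by (rule coordinates_unique[OF t(1) y _ assms(2)])
 thus ?thesis by (simp add: y_def)
qed

text \<open>
 The last coordinate of \<open>c s ^ n\<close> satisfies the recurrence with coefficients \<open>G\<close>.
\<close>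

lemma coefficients_bounded: "i <= d ==> N (G i) <= N (G d)"
proof (rule recurrence_bound[where u = "%n. t n (d - 1)" and d = d])
 fix n
 define y where "y k = finsum R (%j. G j \<otimes>\<^sub>R t (n + j) k) {..<Suc d}" for k
 have y: "y k \<in> carrier R" for k unfolding y_def using G t by (intro R.finsum_closed) auto
 have "lin d pw y = finsum E (%j. g (G j) \<otimes> lin d pw (t (n + j))) {..<Suc d}"
  unfolding y_def using G t by (intro lin_combine) auto
 also have "\<dots> = finsum E (%j. (g c \<otimes> pw n) \<otimes> (g (G j) \<otimes> pw j)) {..<Suc d}"
 proof (rule S.finsum_cong'[OF refl])
  fix j
  have "pw (n + j) = pw n \<otimes> pw j" using s by (simp add: S.nat_pow_mult)
  thus "g (G j) \<otimes> lin d pw (t (n + j)) = (g c \<otimes> pw n) \<otimes> (g (G j) \<otimes> pw j)"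
   unfolding t(2)[symmetric] using c G by (simp add: S.m_ac)
 qed (use c G in auto)
 also have "\<dots> = (g c \<otimes> pw n) \<otimes> lin (Suc d) pw G"
  unfolding lin_def using c G by (intro S.finsum_rdistr[symmetric]) auto
 also have "\<dots> = \<zero>" using G c by simp
 finally have "lin d pw y = lin d pw (%_. \<zero>\<^sub>R)" by simp
 hence "y (d - 1) = \<zero>\<^sub>R" using d by (intro coordinates_unique[OF y, of "%_. \<zero>\<^sub>R"]) auto
 thus "finsum R (%j. G j \<otimes>\<^sub>R t (n + j) (d - 1)) {..<Suc d} = \<zero>\<^sub>R" by (simp add: y_def)
next
 show "t n (d - 1) = \<zero>\<^sub>R" if "n < d - 1" for n using that coordinates_small_powers[of n "d - 1"] by simp
 show "t (d - 1) (d - 1) ~= \<zero>\<^sub>R" using coordinates_small_powers[of "d - 1" "d - 1"] d c by simp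
 show "\<exists>B. \<forall>n. N (t n (d - 1)) <= B * r ^ n" if "1 < r" for r
  using growth[OF that] d by (meson diff_less zero_less_one)
qed (use mult G t d in auto)

text \<open>
 Multiplication by \<open>s\<close> is the companion matrix of \<open>G\<close>, whose entries have norm at most 1 after
 division by the leading coefficient.
\<close>

lemma shift_contracts:
 assumes e: "e \<in> carrier E" "!!i. y i \<in> carrier R" "!!i. y' i \<in> carrier R"
  and eq: "g c \<otimes> e = lin d pw y" "g c \<otimes> (s \<otimes> e) = lin d pw y'"
  and b: "!!i. i < d ==> N (y i) <= b" "0 <= b" and i: "i < d"
 shows "N (y' i) <= b"
proof -
 define z where "z i = G d \<otimes>\<^sub>R (if i = 0 then \<zero>\<^sub>R else y (i - 1)) \<ominus>\<^sub>R y (d - 1) \<otimes>\<^sub>R G i" for i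
 have z: "z i \<in> carrier R" for i using e G by (simp add: z_def)
 have "lin d pw (%i. G d \<otimes>\<^sub>R y' i) = g (G d) \<otimes> (g c \<otimes> (s \<otimes> e))"
  unfolding eq(2) using e G by (intro lin_scale) auto
 also have "\<dots> = g (G d) \<otimes> (s \<otimes> (g c \<otimes> e))" using s e c G by (simp add: S.m_lcomm)
 also have "\<dots> = lin d pw z" unfolding eq(1) z_def by (rule shift_coordinates[OF s G(1,3) d e(2)])
 finally have "G d \<otimes>\<^sub>R y' i = z i" using z e G i by (intro coordinates_unique[of "%i. G d \<otimes>\<^sub>R y' i" z]) auto
 hence eqn: "N (G d) * N (y' i) = N (z i)" using mult[OF G(1) e(3)] by metis
 have "N (z i) <= N (G d) * b"
  unfolding z_def
 proof (rule norm_diff_le)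
  show "N (G d \<otimes>\<^sub>R (if i = 0 then \<zero>\<^sub>R else y (i - 1))) <= N (G d) * b"
   using G e b i by (intro norm_mult_bound) auto
  have "N (y (d - 1) \<otimes>\<^sub>R G i) <= b * N (G d)"
   using G e b d i coefficients_bounded[of i] by (intro norm_mult_bound) auto
  thus "N (y (d - 1) \<otimes>\<^sub>R G i) <= N (G d) * b" by (simp add: mult.commute)
 qed (use G e in auto)
 hence "N (G d) * N (y' i) <= N (G d) * b" using eqn by simp
 moreover have "0 < N (G d)" using G norm_nonneg[of "G d"] norm_eq_0_iff[of "G d"] by simp
 ultimately show ?thesis by simp
qed

lemma power_coordinates_bounded: "i < d ==> N (t n i) <= N c"
proof (induction n arbitrary: i)
 case 0 thus ?case using coordinates_small_powers[of 0 i] d c by (simp add: norm_c_pos less_imp_le)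
next
 case (Suc n)
 have "g c \<otimes> (s \<otimes> pw n) = lin d pw (t (Suc n))" using t(2)[of "Suc n"] s by (simp add: S.m_comm)
 show ?case
 proof (rule shift_contracts[where e = "pw n" and y = "t n" and y' = "t (Suc n)"])
  show "g c \<otimes> (s \<otimes> pw n) = lin d pw (t (Suc n))" by fact
 qed (use t Suc norm_c_pos in auto)
qed

text \<open>
 Elements \<open>e\<close> such that all \<open>c s ^ n e\<close> lie in the lattice spanned over \<open>R\<close> by the first \<open>d\<close> powers of \<open>s\<close>. It
 contains the polynomials in \<open>s\<close>.
\<close>

definition stable :: "'c set" where
 "stable = {e \<in> carrier E. \<forall>n::nat. \<exists>y. (\<forall>i. y i \<in> carrier R) & g c \<otimes> (s [^] n \<otimes> e) = lin d pw y}"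

lemma stable_carrier: "e \<in> stable ==> e \<in> carrier E" by (simp add: stable_def)

lemma stable_coords: "e \<in> stable ==> \<exists>y. (\<forall>i. y i \<in> carrier R) & g c \<otimes> e = lin d pw y"
proof -
 assume e: "e \<in> stable"
 hence "\<exists>y. (\<forall>i. y i \<in> carrier R) & g c \<otimes> (s [^] (0::nat) \<otimes> e) = lin d pw y"
  unfolding stable_def by blast
 thus ?thesis using stable_carrier[OF e] by simp
qed

lemma stable_one: "\<one> \<in> stable"
 unfolding stable_def using t by auto

lemma stable_add:
 assumes "a \<in> stable" "b \<in> stable" shows "a \<oplus> b \<in> stable"
 unfolding stable_def
proof (intro CollectI conjI allI)
 fix n :: nat
 obtain y z where y: "!!i. y i \<in> carrier R" "g c \<otimes> (s [^] n \<otimes> a) = lin d pw y"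
  and z: "!!i. z i \<in> carrier R" "g c \<otimes> (s [^] n \<otimes> b) = lin d pw z"
  using assms unfolding stable_def by blast
 have "g c \<otimes> (s [^] n \<otimes> (a \<oplus> b)) = lin d pw (%i. y i \<oplus>\<^sub>R z i)"
  using y z stable_carrier[OF assms(1)] stable_carrier[OF assms(2)] c by (simp add: lin_add S.r_distr)
 thus "\<exists>y. (\<forall>i. y i \<in> carrier R) & g c \<otimes> (s [^] n \<otimes> (a \<oplus> b)) = lin d pw y"
  using y z by (intro exI[of _ "%i. y i \<oplus>\<^sub>R z i"]) auto
qed (use assms stable_carrier in auto)

lemma stable_scale:
 assumes "a \<in> stable" "x \<in> carrier R" shows "g x \<otimes> a \<in> stable"
 unfolding stable_def
proof (intro CollectI conjI allI)
 fix n :: nat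
 obtain y where y: "!!i. y i \<in> carrier R" "g c \<otimes> (s [^] n \<otimes> a) = lin d pw y"
  using assms unfolding stable_def by blast
 have "g c \<otimes> (s [^] n \<otimes> (g x \<otimes> a)) = g x \<otimes> (g c \<otimes> (s [^] n \<otimes> a))"
  using stable_carrier[OF assms(1)] assms(2) c by (simp add: S.m_ac)
 hence "g c \<otimes> (s [^] n \<otimes> (g x \<otimes> a)) = lin d pw (%i. x \<otimes>\<^sub>R y i)"
  using y assms(2) by (simp add: lin_scale)
 thus "\<exists>y. (\<forall>i. y i \<in> carrier R) & g c \<otimes> (s [^] n \<otimes> (g x \<otimes> a)) = lin d pw y"
  using y assms(2) by (intro exI[of _ "%i. x \<otimes>\<^sub>R y i"]) auto
qed (use assms stable_carrier in auto)

lemma stable_pow: "a \<in> stable ==> s [^] (k::nat) \<otimes> a \<in> stable"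
 unfolding stable_def using s by (auto simp: S.m_assoc[symmetric] S.nat_pow_mult)

lemma stable_poly:
 assumes "z \<in> combs R N E g {\<zero>} {s [^] i | i::nat. i < n} b" "a \<in> stable"
 shows "z \<in> carrier E" "z \<otimes> a \<in> stable"
proof -
 have "z \<in> carrier E & z \<otimes> a \<in> stable" using assms(1)
 proof induction
  case (base j)
  have "\<zero> = g \<zero>\<^sub>R \<otimes> a" using stable_carrier[OF assms(2)] by simp
  thus ?case using base stable_scale[OF assms(2), of "\<zero>\<^sub>R"] stable_carrier[OF assms(2)] by simp
 next
  case (step z w x)
  then obtain i :: nat where i: "w = s [^] i" by blast
  have "(z \<oplus> g x \<otimes> w) \<otimes> a = z \<otimes> a \<oplus> g x \<otimes> (s [^] i \<otimes> a)"
   unfolding i using step stable_carrier[OF assms(2)] by (simp add: S.l_distr S.m_assoc)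
  thus ?case using step i stable_add stable_scale[OF stable_pow[OF assms(2)]] by auto
 qed
 thus "z \<in> carrier E" "z \<otimes> a \<in> stable" by auto
qed

text \<open>
 Multiplication by \<open>p\<close> maps the lattice spanned by the powers of \<open>s\<close> into \<open>\<delta>\<close> times itself,
 since \<open>p\<close> does so for the unit element and commutes with \<open>s\<close>.
\<close>

lemma powers_tend_to_zero:
 assumes z: "z \<in> combs R N E g {\<zero>} {s [^] i | i::nat. i < n} b"
  and p: "p = s [^] n \<ominus> z" "!!i. y0 i \<in> carrier R" "g c \<otimes> p = lin d pw y0"
  and \<delta>: "0 <= \<delta>" "!!i. i < d ==> N (y0 i) <= \<delta> * N c"
 shows "\<exists>y. (\<forall>i. y i \<in> carrier R) & g c \<otimes> p [^] (l::nat) = lin d pw y & (\<forall>i<d. N (y i) <= \<delta> ^ l * N c)"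
proof -
 have zE: "z \<in> carrier E" using stable_poly[OF z stable_one] by simp
 have pE: "p \<in> carrier E" unfolding p(1) using zE by simp
 have p_stable: "p \<otimes> a \<in> stable" if a: "a \<in> stable" for a
 proof -
  have "p \<otimes> a = s [^] n \<otimes> a \<oplus> g (\<ominus>\<^sub>R \<one>\<^sub>R) \<otimes> (z \<otimes> a)"
   unfolding p(1) using zE stable_carrier[OF a] by (simp add: S.minus_eq S.l_distr S.l_minus)
  thus ?thesis using stable_add[OF stable_pow[OF a] stable_scale[OF stable_poly(2)[OF z a], of "\<ominus>\<^sub>R \<one>\<^sub>R"]] by simp
 qed
 have ps: "p \<in> stable" using p_stable[OF stable_one] pE by simp
 have pl: "p [^] l \<in> stable" for l :: nat
 proof (induction l)
  case 0 thus ?case using stable_one by simp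
 next
  case (Suc l) thus ?case using p_stable[OF Suc] pE by (simp add: S.m_comm)
 qed
 have "\<exists>y. \<forall>i::nat. (\<forall>k. y i k \<in> carrier R) & g c \<otimes> (s [^] i \<otimes> p) = lin d pw (y i)"
  using ps unfolding stable_def by (intro choice) blast
 then obtain y where y: "!!(i::nat) k. y i k \<in> carrier R" "!!i. g c \<otimes> (s [^] i \<otimes> p) = lin d pw (y i)" by blast
 have d0: "0 <= \<delta> * N c" using \<delta> norm_c_pos by simp
 have yb: "k < d ==> N (y i k) <= \<delta> * N c" for k and i :: nat
 proof (induction i arbitrary: k)
  case 0
  have "lin d pw (y 0) = lin d pw y0" using y(2)[of 0] p(3) pE by simp
  hence "y 0 k = y0 k" using y p 0 by (intro coordinates_unique) auto
  thus ?case using \<delta> 0 by simp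
 next
  case (Suc i)
  have e: "s [^] i \<otimes> p \<in> carrier E" using pE by simp
  have "g c \<otimes> (s \<otimes> (s [^] i \<otimes> p)) = lin d pw (y (Suc i))"
   using y(2)[of "Suc i"] s pE by (simp add: S.m_ac)
  show ?case
  proof (rule shift_contracts[where e = "s [^] i \<otimes> p" and y = "y i" and y' = "y (Suc i)"])
   show "g c \<otimes> (s \<otimes> (s [^] i \<otimes> p)) = lin d pw (y (Suc i))" by fact
  qed (use e y Suc d0 in auto)
 qed
 show ?thesis
 proof (induction l)
  case 0
  define z where "z i = (if i = 0 then c else \<zero>\<^sub>R)" for i :: nat
  have "g c \<otimes> p [^] (0::nat) = lin d pw (t 0)" using t(2)[of 0] by simp
  moreover have "N (t 0 i) <= \<delta> ^ 0 * N c" if "i < d" for i using power_coordinates_bounded[OF that, of 0] by simp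
  ultimately show ?case using t(1) by blast
 next
  case (Suc l)
  then obtain x where x: "!!i. x i \<in> carrier R" "g c \<otimes> p [^] l = lin d pw x" "!!i. i < d ==> N (x i) <= \<delta> ^ l * N c"
   by blast
  obtain x' where x': "!!i. x' i \<in> carrier R" "g c \<otimes> p [^] Suc l = lin d pw x'"
   using stable_coords[OF pl[of "Suc l"]] by blast
  define w where "w k = finsum R (%i. x i \<otimes>\<^sub>R y i k) {..<d}" for k
  have w: "w k \<in> carrier R" for k unfolding w_def using x y by (intro R.finsum_closed) auto
  have "lin d pw (%k. c \<otimes>\<^sub>R x' k) = g c \<otimes> (g c \<otimes> p [^] Suc l)"
   unfolding x'(2) using c x' by (intro lin_scale) auto
  also have "\<dots> = lin d pw x \<otimes> (g c \<otimes> p)"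
   unfolding x(2)[symmetric] using pE c by (simp add: S.m_ac)
  also have "\<dots> = finsum E (%i. (g (x i) \<otimes> pw i) \<otimes> (g c \<otimes> p)) {..<d}"
   unfolding lin_def using x pE c by (intro S.finsum_ldistr) auto
  also have "\<dots> = finsum E (%i. g (x i) \<otimes> lin d pw (y i)) {..<d}"
  proof (rule S.finsum_cong'[OF refl])
   fix i
   show "(g (x i) \<otimes> pw i) \<otimes> (g c \<otimes> p) = g (x i) \<otimes> lin d pw (y i)"
    unfolding y(2)[symmetric] using x pE c by (simp add: S.m_ac)
  qed (use x y in auto)
  also have "\<dots> = lin d pw w" unfolding w_def using x y by (intro lin_combine[symmetric]) auto
  finally have eq: "lin d pw (%k. c \<otimes>\<^sub>R x' k) = lin d pw w" .
  have "N (x' k) <= \<delta> ^ Suc l * N c" if k: "k < d" for k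
  proof -
   have "c \<otimes>\<^sub>R x' k = w k" using eq c x' w k by (intro coordinates_unique[of "%k. c \<otimes>\<^sub>R x' k" w]) auto
   hence "N c * N (x' k) = N (w k)" using mult[OF c(1) x'(1)] by metis
   also have "N (w k) <= (\<delta> ^ l * N c) * (\<delta> * N c)"
    unfolding w_def
   proof (rule norm_finsum_le)
    show "N (x i \<otimes>\<^sub>R y i k) <= (\<delta> ^ l * N c) * (\<delta> * N c)" if "i \<in> {..<d}" for i
     using that x y yb[OF k] by (intro norm_mult_bound) auto
   qed (use x y \<delta> norm_c_pos in auto)
   finally have "N c * N (x' k) <= N c * (\<delta> ^ Suc l * N c)" by (simp add: mult_ac)
   thus ?thesis using norm_c_pos by simp
  qed
  thus ?case using x' by blast
 qed
qed

end

section \<open>Power-bounded and almost integral elements\<close>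

context banach_ring
begin

text \<open>
 The residue norm of \<open>s ^ n\<close> modulo \<open>J\<close> grows more slowly than any \<open>r ^ n\<close> with \<open>r > 1\<close>: the
 spectral seminorm of the residue class of \<open>s\<close> is at most 1.
\<close>

definition growth_le_one_mod :: "'a set => 'a => bool" where
 "growth_le_one_mod J s \<longleftrightarrow> (\<forall>r>1. \<exists>B. \<forall>n::nat. \<exists>j\<in>J. N (s [^] n \<ominus> j) <= B * r ^ n)"

definition power_bounded_mod :: "'a set => 'a => bool" where
 "power_bounded_mod J s \<longleftrightarrow> (\<exists>B. \<forall>n::nat. \<exists>j\<in>J. N (s [^] n \<ominus> j) <= B)"

definition adjoin :: "'a set => 'a => 'a set" where
 "adjoin J a = {j \<oplus> u \<otimes> a | j u. j \<in> J & u \<in> carrier R}"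

lemma adjoinE:
 assumes "y \<in> adjoin J a" obtains j u where "j \<in> J" "u \<in> carrier R" "y = j \<oplus> u \<otimes> a"
 using assms by (auto simp: adjoin_def)

lemma adjoin_ideal:
 assumes "ideal J R" "a \<in> carrier R" shows "ideal (adjoin J a) R"
proof -
 have "adjoin J a = set_add R J (PIdl a)" by (auto simp: adjoin_def set_add_defs cgenideal_def)
 thus ?thesis using add_ideals[OF assms(1) cgenideal_ideal[OF assms(2)]] by simp
qed

text \<open>
 Elements of \<open>a R + J\<close> are multiples of \<open>a\<close> modulo \<open>J\<close>, with bounds.
\<close>

lemma principal_division:
 assumes SN: strictly_noetherian and J: "ideal J R" and a: "a \<in> carrier R"
 shows "\<exists>K\<ge>0. \<forall>y\<in>adjoin J a. \<exists>u\<in>carrier R. y \<ominus> a \<otimes> u \<in> J & N u <= K * N y"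
proof -
 interpret J: ideal J R by (rule J)
 have I: "ideal (adjoin J a) R" by (rule adjoin_ideal[OF J a])
 obtain W K where W: "finite W" "W \<subseteq> adjoin J a" "0 <= K"
  "!!x. x \<in> adjoin J a ==> x \<in> combs R N R id {\<zero>} W (K * N x)"
  by (rule strictly_noetherianE[OF SN I], rule that) simp_all
 have "\<exists>u. \<forall>w\<in>W. u w \<in> carrier R & w \<in> carrier R & w \<ominus> a \<otimes> u w \<in> J"
 proof (intro bchoice ballI)
  fix w assume "w \<in> W"
  then obtain j u where ju: "j \<in> J" "u \<in> carrier R" "w = j \<oplus> u \<otimes> a"
   using W(2) adjoinE by blast
  have jR: "j \<in> carrier R" using ju J.a_subset by auto
  have "w \<ominus> a \<otimes> u = j" unfolding ju(3) using jR ju(2) a by algebra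
  thus "\<exists>u. u \<in> carrier R & w \<in> carrier R & w \<ominus> a \<otimes> u \<in> J" using ju jR a by (intro exI[of _ u]) simp
 qed
 then obtain u where u: "!!w. w \<in> W ==> u w \<in> carrier R" "!!w. w \<in> W ==> w \<in> carrier R"
  "!!w. w \<in> W ==> w \<ominus> a \<otimes> u w \<in> J" by blast
 define D where "D = Max (insert 0 ((%w. N (u w)) ` W))"
 have D: "0 <= D" "!!w. w \<in> W ==> N (u w) <= D" using W(1) by (auto simp: D_def)
 have main: "z \<in> carrier R & (\<exists>v\<in>carrier R. z \<ominus> a \<otimes> v \<in> J & N v <= c * D)"
  if "z \<in> combs R N R id {\<zero>} W c" "0 <= c" for z c
  using that(1)
 proof induction
  case (base j)
  thus ?case using a D that(2) by (intro conjI bexI[of _ \<zero>]) auto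
 next
  case (step z w x)
  then obtain v where v: "z \<in> carrier R" "v \<in> carrier R" "z \<ominus> a \<otimes> v \<in> J" "N v <= c * D" by blast
  have "(z \<oplus> x \<otimes> w) \<ominus> a \<otimes> (v \<oplus> x \<otimes> u w) = (z \<ominus> a \<otimes> v) \<oplus> x \<otimes> (w \<ominus> a \<otimes> u w)"
   using v step u[OF step(2)] a by algebra
  moreover have "(z \<ominus> a \<otimes> v) \<oplus> x \<otimes> (w \<ominus> a \<otimes> u w) \<in> J"
   using v step u(3)[OF step(2)] by (intro J.a_closed J.I_l_closed)
  moreover have "N (v \<oplus> x \<otimes> u w) <= c * D"
   using v step u[OF step(2)] D(2)[OF step(2)] by (intro norm_add_le norm_mult_bound) auto
  ultimately show ?case using v step u[OF step(2)]
   by (intro conjI bexI[of _ "v \<oplus> x \<otimes> u w"]) auto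
 qed
 have "\<exists>v\<in>carrier R. y \<ominus> a \<otimes> v \<in> J & N v <= (K * D) * N y" if y: "y \<in> adjoin J a" for y
 proof -
  have "0 <= K * N y" using W(3) norm_nonneg ideal.Icarr[OF I y] by simp
  from main[OF W(4)[OF y] this] show ?thesis by (simp add: mult_ac)
 qed
 thus ?thesis using W(3) D(1) by (intro exI[of _ "K * D"]) auto
qed

end

context banach_hom
begin

definition finite_mod :: "'c set => bool" where
 "finite_mod J \<longleftrightarrow> (\<exists>W K. finite W & W \<subseteq> carrier S & 0 <= K & (\<forall>x\<in>carrier S. x \<in> lc J W (K * M x)))"

definition pows :: "'c => nat => 'c set" where
 "pows s n = {s [^] i | i::nat. i < n}"

text \<open>
 Values at \<open>s\<close> of monic polynomials of degree \<open>n\<close> with coefficients of norm at most 1.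
\<close>

definition monic_values :: "'c => nat => 'c set" where
 "monic_values s n = {s [^] n \<ominus> z | z. z \<in> lc {\<zero>} (pows s n) 1}"

definition almost_integral_mod :: "'c set => 'c => bool" where
 "almost_integral_mod J s \<longleftrightarrow> (\<forall>e>0. \<exists>n. \<exists>p\<in>monic_values s n. \<exists>j\<in>J. M (p \<ominus> j) <= e)"

context
 fixes s assumes s: "s \<in> carrier S"
begin

lemma pows_closed: "pows s n \<subseteq> carrier S" using s by (auto simp: pows_def)

lemma zero_subgroup: "additive_subgroup {\<zero>} S" by (rule ideal.axioms(1)[OF S.zeroideal])

lemma lc_pows_closed: "z \<in> lc {\<zero>} (pows s n) c ==> z \<in> carrier S"
 using lc_carrier[OF _ _ pows_closed] by simp

lemma monic_closed: "p \<in> monic_values s n ==> p \<in> carrier S"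
 using lc_pows_closed s by (auto simp: monic_values_def)

lemma pow_times_lc:
 assumes "z \<in> lc {\<zero>} (pows s n) c"
 shows "s [^] k \<otimes> z \<in> lc {\<zero>} (pows s (k + n)) c"
proof -
 have sub: "(%w. s [^] k \<otimes> w) ` pows s n \<subseteq> pows s (k + n)"
  using s by (auto simp: pows_def S.nat_pow_mult)
 have "s [^] k \<otimes> z \<in> lc {\<zero>} ((%w. s [^] k \<otimes> w) ` pows s n) c"
  using s by (intro lc_mult_right[OF assms S.zeroideal pows_closed]) auto
 thus ?thesis by (rule combs_mono[OF _ order_refl sub order_refl])
qed

lemma monic_mult:
 assumes "p \<in> monic_values s m" "p' \<in> monic_values s n"
 shows "p \<otimes> p' \<in> monic_values s (m + n)"
proof -
 obtain z z' where z: "z \<in> lc {\<zero>} (pows s m) 1" "p = s [^] m \<ominus> z"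
  and z': "z' \<in> lc {\<zero>} (pows s n) 1" "p' = s [^] n \<ominus> z'"
  using assms by (auto simp: monic_values_def)
 note c = lc_pows_closed[OF z(1)] lc_pows_closed[OF z'(1)]
 have 1: "s [^] m \<otimes> z' \<in> lc {\<zero>} (pows s (m + n)) 1" by (rule pow_times_lc[OF z'(1)])
 have 2: "s [^] n \<otimes> z \<in> lc {\<zero>} (pows s (m + n)) 1"
  using pow_times_lc[OF z(1), of n] by (simp add: add.commute)
 have 3: "z \<otimes> z' \<in> lc {\<zero>} (pows s (m + n)) (1 * 1)"
 proof (rule lc_mult[OF z(1) z'(1) S.zeroideal pows_closed pows_closed _ pows_closed])
  fix w v assume "w \<in> pows s m" "v \<in> pows s n"
  then obtain i j where "w = s [^] i" "i < m" "v = s [^] j" "j < n" by (auto simp: pows_def)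
  thus "w \<otimes> v \<in> pows s (m + n)"
   using s unfolding pows_def by (auto simp: S.nat_pow_mult intro!: exI[of _ "i + j"])
 qed
 define q where "q = (s [^] m \<otimes> z' \<oplus> s [^] n \<otimes> z) \<ominus> z \<otimes> z'"
 have "q \<in> lc {\<zero>} (pows s (m + n)) 1" unfolding q_def
  using 3 by (intro lc_diff lc_add 1 2 zero_subgroup pows_closed) simp
 moreover have "p \<otimes> p' = s [^] (m + n) \<ominus> q"
 proof -
  have "s [^] (m + n) = s [^] m \<otimes> s [^] n" using s by (simp add: S.nat_pow_mult)
  moreover have "a \<in> carrier S ==> b \<in> carrier S ==> (a \<ominus> z) \<otimes> (b \<ominus> z')
    = a \<otimes> b \<ominus> ((a \<otimes> z' \<oplus> b \<otimes> z) \<ominus> z \<otimes> z')" for a b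
   using c by algebra
  ultimately show ?thesis using s unfolding z(2) z'(2) q_def by simp
 qed
 ultimately show ?thesis by (auto simp: monic_values_def)
qed

lemma monic_one: "\<one> \<in> monic_values s 0"
proof -
 have "\<zero> \<in> lc {\<zero>} (pows s 0) 1" by (auto intro: combs.base)
 thus ?thesis unfolding monic_values_def by (auto intro!: exI[of _ "\<zero>"])
qed

lemma monic_pow: "p \<in> monic_values s n ==> p [^] (l::nat) \<in> monic_values s (l * n)"
proof (induction l)
 case 0 thus ?case using monic_one by simp
next
 case (Suc l) thus ?case using monic_mult[of "p [^] l" "l * n" p n] by (simp add: add.commute)
qed

lemma monic_bounded_mod:
 assumes J: "ideal J S" and B: "!!n::nat. \<exists>j\<in>J. M (s [^] n \<ominus> j) <= B"
 shows "\<exists>B'\<ge>0. \<forall>n. \<forall>p\<in>monic_values s n. \<exists>b\<in>carrier S. p \<ominus> b \<in> J & M b <= B'"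
proof -
 interpret J: ideal J S by (rule J)
 obtain C where C: "0 < C" "!!x. x \<in> carrier R ==> M (h x) <= C * N x" using bound by blast
 have B0: "0 <= B"
 proof -
  obtain j where "j \<in> J" "M (s [^] (0::nat) \<ominus> j) <= B" using B by blast
  moreover have "j \<in> carrier S" using \<open>j \<in> J\<close> J.a_subset by auto
  ultimately show ?thesis using S.norm_nonneg[of "s [^] (0::nat) \<ominus> j"] by simp
 qed
 have pb: "\<exists>b\<in>carrier S. s [^] (n::nat) \<ominus> b \<in> J & M b <= B" for n
 proof -
  obtain j where j: "j \<in> J" "M (s [^] n \<ominus> j) <= B" using B by blast
  hence jS: "j \<in> carrier S" using J.a_subset by auto
  hence "s [^] n \<ominus> (s [^] n \<ominus> j) = j" using s by (intro S.diff_diff_cancel) auto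
  thus ?thesis using j jS s by (intro bexI[of _ "s [^] n \<ominus> j"]) auto
 qed
 define B' where "B' = max B (C * B)"
 have lc_b: "z \<in> carrier S & (\<exists>b\<in>carrier S. z \<ominus> b \<in> J & M b <= C * B)"
  if "z \<in> lc {\<zero>} (pows s n) 1" for z n
  using that
 proof induction
  case (base j) thus ?case using C B0 by (intro conjI bexI[of _ "\<zero>"]) auto
 next
  case (step z w x)
  then obtain v where v: "z \<in> carrier S" "v \<in> carrier S" "z \<ominus> v \<in> J" "M v <= C * B" by blast
  obtain i :: nat where i: "w = s [^] i" using step by (auto simp: pows_def)
  obtain b where b: "b \<in> carrier S" "w \<ominus> b \<in> J" "M b <= B" using pb[of i] i by blast
  have wS: "w \<in> carrier S" using i s by simp
  have "C * N x <= C * 1" using step(4) C(1) by (intro mult_left_mono) auto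
  hence hx: "h x \<in> carrier S" "M (h x) <= C"
   using C(2)[OF step(3)] step(3) by simp_all
  have "(z \<oplus> h x \<otimes> w) \<ominus> (v \<oplus> h x \<otimes> b) = (z \<ominus> v) \<oplus> h x \<otimes> (w \<ominus> b)"
   using v b(1) hx(1) wS by algebra
  moreover have "(z \<ominus> v) \<oplus> h x \<otimes> (w \<ominus> b) \<in> J"
   using v b hx by (intro J.a_closed J.I_l_closed)
  moreover have "M (v \<oplus> h x \<otimes> b) <= C * B"
   using v b hx by (intro S.norm_add_le S.norm_mult_bound) auto
  ultimately show ?case using v b hx wS by (intro conjI bexI[of _ "v \<oplus> h x \<otimes> b"]) auto
 qed
 have "\<exists>b\<in>carrier S. p \<ominus> b \<in> J & M b <= B'" if pm: "p \<in> monic_values s n" for p n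
 proof -
  obtain z where z: "z \<in> lc {\<zero>} (pows s n) 1" "p = s [^] n \<ominus> z" using pm by (auto simp: monic_values_def)
  obtain v where v: "z \<in> carrier S" "v \<in> carrier S" "z \<ominus> v \<in> J" "M v <= C * B" using lc_b[OF z(1)] by blast
  obtain b where b: "b \<in> carrier S" "s [^] n \<ominus> b \<in> J" "M b <= B" using pb by blast
  have "a \<in> carrier S ==> (a \<ominus> z) \<ominus> (b \<ominus> v) = (a \<ominus> b) \<ominus> (z \<ominus> v)" for a
   using v b(1) by algebra
  hence "p \<ominus> (b \<ominus> v) = (s [^] n \<ominus> b) \<ominus> (z \<ominus> v)" using s by (simp add: z(2))
  moreover have "(s [^] n \<ominus> b) \<ominus> (z \<ominus> v) \<in> J"
   unfolding a_minus_def[of S "s [^] n \<ominus> b"] using b v by (intro J.a_closed J.a_inv_closed)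
  moreover have "M (b \<ominus> v) <= B'" using v b by (intro S.norm_diff_le) (auto simp: B'_def)
  ultimately show ?thesis using v b by (intro bexI[of _ "b \<ominus> v"]) auto
 qed
 thus ?thesis using B0 by (intro exI[of _ B']) (auto simp: B'_def)
qed

text \<open>
 Modulo \<open>J + a S\<close> replace \<open>s ^ n\<close> by bounded \<open>y n\<close>. The defects \<open>s y n - y (n + 1)\<close> lie in this ideal,
 so they are \<open>a u n\<close> modulo \<open>J\<close> with \<open>u n\<close> bounded. Then \<open>s ^ n - y n\<close> is a sum of terms \<open>s ^ k a u i\<close>, and \<open>a s ^ k\<close> is
 bounded modulo \<open>J\<close> because \<open>s ^ k\<close> is so modulo the second ideal.
\<close>

lemma power_bounded_combine:
 assumes SN: "S.strictly_noetherian" and J: "ideal J S" and a: "a \<in> carrier S"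
  and J1: "S.power_bounded_mod (S.adjoin J a) s"
  and J2: "S.power_bounded_mod {x \<in> carrier S. a \<otimes> x \<in> J} s"
 shows "S.power_bounded_mod J s"
proof -
 interpret J: ideal J S by (rule J)
 define I where "I = S.adjoin J a"
 have I: "ideal I S" unfolding I_def by (rule S.adjoin_ideal[OF J a])
 interpret I: ideal I S by (rule I)
 obtain K where K: "0 <= K" "!!y. y \<in> I ==> \<exists>u\<in>carrier S. y \<ominus> a \<otimes> u \<in> J & M u <= K * M y"
  using S.principal_division[OF SN J a] unfolding I_def by blast
 obtain B1 where B1: "!!n::nat. \<exists>j\<in>I. M (s [^] n \<ominus> j) <= B1"
  using J1 unfolding S.power_bounded_mod_def I_def by blast
 obtain B2 where B2: "!!n::nat. \<exists>j\<in>carrier S. a \<otimes> j \<in> J & M (s [^] n \<ominus> j) <= B2"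
  using J2 unfolding S.power_bounded_mod_def by blast
 define B where "B = max 1 B1"
 have "\<exists>y. \<forall>n::nat. y n \<in> carrier S & s [^] n \<ominus> y n \<in> I & M (y n) <= B & (n = 0 --> y n = \<one>)"
 proof (intro choice allI)
  fix n :: nat
  show "\<exists>y. y \<in> carrier S & s [^] n \<ominus> y \<in> I & M y <= B & (n = 0 --> y = \<one>)"
  proof (cases "n = 0")
   case True
   thus ?thesis using S.norm_one_le I.zero_closed by (intro exI[of _ "\<one>"]) (auto simp: B_def)
  next
   case False
   obtain j where j: "j \<in> I" "M (s [^] n \<ominus> j) <= B1" using B1 by blast
   hence jS: "j \<in> carrier S" using I.a_subset by auto
   hence "s [^] n \<ominus> (s [^] n \<ominus> j) = j" using s by (intro S.diff_diff_cancel) auto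
   thus ?thesis using j jS s False by (intro exI[of _ "s [^] n \<ominus> j"]) (auto simp: B_def)
  qed
 qed
 then obtain y where y: "!!n::nat. y n \<in> carrier S" "!!n. s [^] n \<ominus> y n \<in> I" "!!n. M (y n) <= B" "y 0 = \<one>"
  by blast
 define B3 where "B3 = max (M s * B) B"
 have B3: "0 <= B3" by (simp add: B3_def B_def)
 have w: "\<exists>u\<in>carrier S. (s \<otimes> y n \<ominus> y (Suc n)) \<ominus> a \<otimes> u \<in> J & M u <= K * B3" for n
 proof -
  have e: "p \<in> carrier S ==> s \<otimes> y n \<ominus> y (Suc n) = (p \<otimes> s \<ominus> y (Suc n)) \<ominus> s \<otimes> (p \<ominus> y n)" for p
   using s y(1)[of n] y(1)[of "Suc n"] by algebra
  have "s \<otimes> y n \<ominus> y (Suc n) = (s [^] Suc n \<ominus> y (Suc n)) \<ominus> s \<otimes> (s [^] n \<ominus> y n)"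
   using e[of "s [^] n"] s by simp
  also have "\<dots> \<in> I"
   unfolding a_minus_def[of S "s [^] Suc n \<ominus> y (Suc n)"]
   using y(2) s by (intro I.a_closed I.a_inv_closed I.I_l_closed)
  finally obtain u where u: "u \<in> carrier S" "(s \<otimes> y n \<ominus> y (Suc n)) \<ominus> a \<otimes> u \<in> J"
   "M u <= K * M (s \<otimes> y n \<ominus> y (Suc n))" using K(2) by blast
  have "M (s \<otimes> y n) <= M s * B" using s y by (intro S.norm_mult_bound) auto
  hence "M (s \<otimes> y n \<ominus> y (Suc n)) <= B3"
   using s y(1,3) y(3)[of "Suc n"] by (intro S.norm_diff_le) (auto simp: B3_def le_max_iff_disj)
  hence "K * M (s \<otimes> y n \<ominus> y (Suc n)) <= K * B3" using K(1) by (intro mult_left_mono)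
  thus ?thesis using u by (meson order_trans)
 qed
 define D where "D = max 0 (B2 * (K * B3))"
 have main: "\<exists>v\<in>carrier S. s [^] k \<otimes> (s [^] n \<ominus> y n) \<ominus> a \<otimes> v \<in> J & M v <= D" for n k :: nat
 proof (induction n arbitrary: k)
  case 0
  have "s [^] k \<otimes> (s [^] (0::nat) \<ominus> y 0) \<ominus> a \<otimes> \<zero> = \<zero>" using s a y(4) by simp
  thus ?case by (intro bexI[of _ "\<zero>"]) (auto simp: D_def)
 next
  case (Suc n)
  obtain v where v: "v \<in> carrier S" "M v <= D"
   "s [^] Suc k \<otimes> (s [^] n \<ominus> y n) \<ominus> a \<otimes> v \<in> J" using Suc.IH[of "Suc k"] by blast
  obtain u where u: "u \<in> carrier S" "M u <= K * B3"
   "(s \<otimes> y n \<ominus> y (Suc n)) \<ominus> a \<otimes> u \<in> J" using w by blast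
  obtain j where j: "j \<in> carrier S" "a \<otimes> j \<in> J" "M (s [^] k \<ominus> j) <= B2" using B2 by blast
  define x where "x = s [^] k \<ominus> j"
  have x: "x \<in> carrier S" "M x <= B2" using j s by (auto simp: x_def)
  have "s [^] k \<otimes> (s [^] Suc n \<ominus> y (Suc n)) \<ominus> a \<otimes> (v \<oplus> x \<otimes> u)
   = (s [^] Suc k \<otimes> (s [^] n \<ominus> y n) \<ominus> a \<otimes> v)
    \<oplus> (s [^] k \<otimes> ((s \<otimes> y n \<ominus> y (Suc n)) \<ominus> a \<otimes> u) \<oplus> u \<otimes> (a \<otimes> j))"
  proof -
   have "p \<in> carrier S ==> q \<in> carrier S ==> p \<otimes> (q \<otimes> s \<ominus> y (Suc n)) \<ominus> a \<otimes> (v \<oplus> (p \<ominus> j) \<otimes> u)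
    = ((p \<otimes> s) \<otimes> (q \<ominus> y n) \<ominus> a \<otimes> v)
     \<oplus> (p \<otimes> ((s \<otimes> y n \<ominus> y (Suc n)) \<ominus> a \<otimes> u) \<oplus> u \<otimes> (a \<otimes> j))" for p q
    using s v(1) u(1) j(1) a y(1)[of n] y(1)[of "Suc n"] by algebra
   thus ?thesis using s unfolding x_def by simp
  qed
  also have "\<dots> \<in> J"
   using s u(1) by (intro J.a_closed[OF v(3)] J.a_closed J.I_l_closed[OF u(3)] J.I_l_closed[OF j(2)]) auto
  finally have mem: "s [^] k \<otimes> (s [^] Suc n \<ominus> y (Suc n)) \<ominus> a \<otimes> (v \<oplus> x \<otimes> u) \<in> J" .
  have "M (x \<otimes> u) <= B2 * (K * B3)" using x u by (intro S.norm_mult_bound)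
  hence "M (v \<oplus> x \<otimes> u) <= D" using v u x by (intro S.norm_add_le) (auto simp: D_def)
  thus ?case using mem v u x by (intro bexI[of _ "v \<oplus> x \<otimes> u"]) auto
 qed
 have "\<exists>j\<in>J. M (s [^] n \<ominus> j) <= max B (M a * D)" for n :: nat
 proof -
  obtain v where v: "v \<in> carrier S" "M v <= D" "s [^] (0::nat) \<otimes> (s [^] n \<ominus> y n) \<ominus> a \<otimes> v \<in> J"
   using main[of 0 n] by blast
  have j: "(s [^] n \<ominus> y n) \<ominus> a \<otimes> v \<in> J" using v s y(1) by simp
  have "p \<in> carrier S ==> p \<ominus> ((p \<ominus> y n) \<ominus> a \<otimes> v) = y n \<oplus> a \<otimes> v" for p
   using y(1)[of n] a v(1) by algebra
  hence e: "s [^] n \<ominus> ((s [^] n \<ominus> y n) \<ominus> a \<otimes> v) = y n \<oplus> a \<otimes> v" using s by simp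
  have "M (a \<otimes> v) <= M a * D" using a v by (intro S.norm_mult_bound) auto
  hence "M (y n \<oplus> a \<otimes> v) <= max B (M a * D)"
   using y(1,3) a v by (intro S.norm_add_le) (auto simp: le_max_iff_disj)
  thus ?thesis using j e by (intro bexI[of _ "(s [^] n \<ominus> y n) \<ominus> a \<otimes> v"]) auto
 qed
 thus ?thesis unfolding S.power_bounded_mod_def by blast
qed

text \<open>
 A product \<open>p1 p2\<close> of monic values works: \<open>p1\<close> is near \<open>a u\<close> modulo \<open>J\<close>, and \<open>p2\<close> is near an
 element that \<open>a\<close> sends into \<open>J\<close>. The tolerance for \<open>p2\<close> depends on \<open>u\<close>, so the norm of \<open>p2\<close> modulo \<open>J\<close> must be bounded
 independently of its degree; power-boundedness gives this.
\<close>

lemma almost_integral_combine: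
 assumes J: "ideal J S" and a: "a \<in> carrier S" and pb: "S.power_bounded_mod J s"
  and J1: "almost_integral_mod (S.adjoin J a) s"
  and J2: "almost_integral_mod {x \<in> carrier S. a \<otimes> x \<in> J} s"
 shows "almost_integral_mod J s"
 unfolding almost_integral_mod_def
proof (intro allI impI)
 interpret J: ideal J S by (rule J)
 fix e :: real assume e: "0 < e"
 obtain B where B: "!!n::nat. \<exists>j\<in>J. M (s [^] n \<ominus> j) <= B" using pb unfolding S.power_bounded_mod_def by blast
 obtain B' where B': "0 <= B'" "!!n p. p \<in> monic_values s n ==> \<exists>b\<in>carrier S. p \<ominus> b \<in> J & M b <= B'"
  using monic_bounded_mod[OF J B] by blast
 have "0 < e / (B' + 1)" using e B'(1) by simp
 then obtain m p1 j1 where p1: "p1 \<in> monic_values s m" "j1 \<in> S.adjoin J a" "M (p1 \<ominus> j1) <= e / (B' + 1)"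
  using J1 unfolding almost_integral_mod_def by blast
 obtain i u where iu: "i \<in> J" "u \<in> carrier S" "j1 = i \<oplus> u \<otimes> a"
  using p1(2) S.adjoinE by blast
 define L where "L = M (a \<otimes> u) + 1"
 have L: "0 < L" "M (a \<otimes> u) <= L" using S.norm_nonneg[of "a \<otimes> u"] a iu by (auto simp: L_def)
 have "0 < e / L" using e L by simp
 then obtain n p2 j2 where p2: "p2 \<in> monic_values s n" "j2 \<in> carrier S" "a \<otimes> j2 \<in> J" "M (p2 \<ominus> j2) <= e / L"
  using J2 unfolding almost_integral_mod_def by blast
 obtain b where b: "b \<in> carrier S" "p2 \<ominus> b \<in> J" "M b <= B'" using B'(2)[OF p2(1)] by blast
 have c: "p1 \<in> carrier S" "p2 \<in> carrier S" using p1 p2 monic_closed by auto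
 have iS: "i \<in> carrier S" using iu J.a_subset by auto
 have j1S: "j1 \<in> carrier S" using iu iS a by simp
 define X where "X = (p1 \<ominus> j1) \<otimes> b \<oplus> (a \<otimes> u) \<otimes> (p2 \<ominus> j2)"
 have XS: "X \<in> carrier S" unfolding X_def using c j1S b a iu p2 by simp
 define Y where "Y = (a \<otimes> u) \<otimes> (p2 \<ominus> j2)"
 have Y: "Y \<in> carrier S" unfolding Y_def using a iu c p2 by simp
 have A: "p1 \<otimes> p2 \<ominus> ((p1 \<ominus> j1) \<otimes> b \<oplus> Y) = (p1 \<ominus> j1) \<otimes> (p2 \<ominus> b) \<oplus> (j1 \<otimes> p2 \<ominus> Y)"
  using c j1S b(1) Y by algebra
 have B: "j1 \<otimes> p2 \<ominus> Y = p2 \<otimes> i \<oplus> u \<otimes> (a \<otimes> j2)"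
  unfolding Y_def iu(3) using c(2) iS iu(2) a p2(2) by algebra
 have "p1 \<otimes> p2 \<ominus> X = (p1 \<ominus> j1) \<otimes> (p2 \<ominus> b) \<oplus> (p2 \<otimes> i \<oplus> u \<otimes> (a \<otimes> j2))"
  using A unfolding B unfolding X_def Y_def .
 also have "\<dots> \<in> J"
  by (intro J.a_closed J.I_l_closed b(2) iu(1,2) p2(3) c S.minus_closed j1S)
 finally have mem: "p1 \<otimes> p2 \<ominus> X \<in> J" .
 have "M ((p1 \<ominus> j1) \<otimes> b) <= (e / (B' + 1)) * B'" using c j1S b p1 by (intro S.norm_mult_bound) auto
 also have "\<dots> <= e" using e B'(1) by (simp add: field_simps)
 finally have 1: "M ((p1 \<ominus> j1) \<otimes> b) <= e" .
 have "M ((a \<otimes> u) \<otimes> (p2 \<ominus> j2)) <= L * (e / L)" using a iu c p2 L by (intro S.norm_mult_bound) auto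
 hence 2: "M ((a \<otimes> u) \<otimes> (p2 \<ominus> j2)) <= e" using L by simp
 have "M X <= e" unfolding X_def using 1 2 c j1S b a iu p2 by (intro S.norm_add_le) auto
 moreover have "p1 \<otimes> p2 \<ominus> (p1 \<otimes> p2 \<ominus> X) = X" using c XS by (intro S.diff_diff_cancel) auto
 ultimately show "\<exists>n. \<exists>p\<in>monic_values s n. \<exists>j\<in>J. M (p \<ominus> j) <= e"
  using mem monic_mult[OF p1(1) p2(1)]
  by (intro exI[of _ "m + n"] bexI[of _ "p1 \<otimes> p2"] bexI[of _ "p1 \<otimes> p2 \<ominus> X"]) auto
qed

end

end

section \<open>The case of a prime ideal that meets the ground ring trivially\<close>

context banach_hom
begin

lemma finite_mod_growth:
 assumes J: "ideal J S" and fin: "finite_mod J" and s: "s \<in> carrier S" and gr: "S.growth_le_one_mod J s"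
 shows "\<exists>W. finite W & W \<subseteq> carrier S & (\<forall>r>1. \<exists>B\<ge>0. \<forall>n::nat. \<exists>b. (\<forall>w. b w \<in> carrier R & N (b w) <= B * r ^ n) &
  s [^] n \<ominus> finsum S (%w. h (b w) \<otimes> w) W \<in> J)"
proof -
 interpret J: ideal J S by (rule J)
 obtain W K where W: "finite W" "W \<subseteq> carrier S" "0 <= K" "!!x. x \<in> carrier S ==> x \<in> lc J W (K * M x)"
  using fin unfolding finite_mod_def by blast
 have "\<exists>B\<ge>0. \<forall>n::nat. \<exists>b. (\<forall>w. b w \<in> carrier R & N (b w) <= B * r ^ n) &
  s [^] n \<ominus> finsum S (%w. h (b w) \<otimes> w) W \<in> J" if r: "1 < r" for r :: real
 proof -
  obtain B where B: "!!n::nat. \<exists>j\<in>J. M (s [^] n \<ominus> j) <= B * r ^ n"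
   using gr r unfolding S.growth_le_one_mod_def by blast
  have "\<exists>b. (\<forall>w. b w \<in> carrier R & N (b w) <= (K * max B 0) * r ^ n) &
   s [^] n \<ominus> finsum S (%w. h (b w) \<otimes> w) W \<in> J" for n :: nat
  proof -
   define c where "c = (K * max B 0) * r ^ n"
   have c0: "0 <= c" using W(3) r by (simp add: c_def)
   obtain j where j: "j \<in> J" "M (s [^] n \<ominus> j) <= B * r ^ n" using B by blast
   have jS: "j \<in> carrier S" using j(1) J.a_subset by auto
   define x where "x = s [^] n \<ominus> j"
   have xS: "x \<in> carrier S" using s jS by (simp add: x_def)
   have "B * r ^ n <= max B 0 * r ^ n" using r by (intro mult_right_mono) auto
   hence "K * M x <= K * (max B 0 * r ^ n)" using j(2) W(3) unfolding x_def by (intro mult_left_mono) auto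
   hence "x \<in> lc J W c"
    using combs_mono[OF W(4)[OF xS] order_refl order_refl, of c] by (simp add: c_def mult_ac)
   from lc_finite[OF this J W(2,1) c0]
   obtain b where b: "b \<in> W \<rightarrow> carrier R" "\<forall>w\<in>W. N (b w) <= c"
    "x \<ominus> finsum S (%w. h (b w) \<otimes> w) W \<in> J" by blast
   define b' where "b' w = (if w \<in> W then b w else \<zero>\<^sub>R)" for w
   have e: "finsum S (%w. h (b w) \<otimes> w) W = finsum S (%w. h (b' w) \<otimes> w) W"
    using W(2) b(1) by (intro S.finsum_cong') (auto simp: b'_def Pi_iff)
   have f: "finsum S (%w. h (b w) \<otimes> w) W \<in> carrier S"
    using W(2) b(1) by (intro S.finsum_closed) (auto simp: Pi_iff)
   have "p \<in> carrier S ==> p \<ominus> finsum S (%w. h (b w) \<otimes> w) W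
    = ((p \<ominus> j) \<ominus> finsum S (%w. h (b w) \<otimes> w) W) \<oplus> j" for p
   proof -
    have "z \<in> carrier S ==> p \<in> carrier S ==> p \<ominus> z = ((p \<ominus> j) \<ominus> z) \<oplus> j" for z
     using jS by algebra
    thus "p \<in> carrier S ==> p \<ominus> finsum S (%w. h (b w) \<otimes> w) W
    = ((p \<ominus> j) \<ominus> finsum S (%w. h (b w) \<otimes> w) W) \<oplus> j" using f by blast
   qed
   hence "s [^] n \<ominus> finsum S (%w. h (b w) \<otimes> w) W = (x \<ominus> finsum S (%w. h (b w) \<otimes> w) W) \<oplus> j"
    using s unfolding x_def by simp
   hence "s [^] n \<ominus> finsum S (%w. h (b' w) \<otimes> w) W \<in> J"
    using J.a_closed[OF b(3) j(1)] e by simp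
   moreover have "b' w \<in> carrier R & N (b' w) <= c" for w
    using b(1,2) c0 by (auto simp: b'_def Pi_iff)
   ultimately show ?thesis unfolding c_def by (intro exI[of _ b']) auto
  qed
  thus ?thesis using W(3) by (intro exI[of _ "K * max B 0"]) auto
 qed
 thus ?thesis using W by (intro exI[of _ W]) auto
qed

text \<open>
 In the domain \<open>S / J\<close> the coordinates of the powers of \<open>s\<close> are bounded. Multiples of \<open>h c\<close> with bounded
 coordinates lift to bounded elements, and \<open>h c\<close> can be divided out modulo the prime ideal. For almost integrality,
 \<open>dep\<close> yields a monic value \<open>p\<close> whose coordinates are smaller than those of 1; its powers tend to 0.
\<close>

theorem prime_case:
 assumes mult: "!!a b. a \<in> carrier R ==> b \<in> carrier R ==> N (a \<otimes>\<^sub>R b) = N a * N b"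
  and R: "domain R" and SN: "S.strictly_noetherian" and J: "primeideal J S"
  and inj: "!!x. x \<in> carrier R ==> h x \<in> J ==> x = \<zero>\<^sub>R"
  and fin: "finite_mod J" and s: "s \<in> carrier S" and gr: "S.growth_le_one_mod J s"
  and dep: "!!(t :: nat => nat => 'a) B d. (!!j i. t j i \<in> carrier R) ==> (!!j i. N (t j i) <= B) ==> 0 < B ==>
   \<exists>n. \<exists>z\<in>unit_span R N t n. \<forall>i<d. N (t n i \<ominus>\<^sub>R z i) < B"
 shows "S.power_bounded_mod J s & almost_integral_mod J s"
proof -
 interpret J: primeideal J S by (rule J)
 define E where "E = S Quot J"
 define q where "q = (%x. J +> x)"
 interpret D: domain R by (rule R)
 interpret E: domain E unfolding E_def by (rule J.quotient_is_domain)
 have q_hom: "ring_hom_cring S E q" unfolding E_def q_def by (rule J.rcos_ring_hom_cring)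
 interpret q: ring_hom_cring S E q by (rule q_hom)
 have q_eq: "q x = q y \<longleftrightarrow> x \<ominus> y \<in> J" if "x \<in> carrier S" "y \<in> carrier S" for x y
  unfolding q_def by (rule S.quotient_eq_iff_same_a_r_cos[OF J.is_ideal that, symmetric])
 define g where "g = (%x. q (h x))"
 have g_hom: "g \<in> ring_hom R E" unfolding g_def
  by (rule ring_hom_memI) simp_all
 interpret X: domain_extension R E g
 proof (intro domain_extension.intro ring_hom_cring.intro domain_extension_axioms.intro
   ring_hom_cring_axioms.intro R.is_cring E.is_cring g_hom R E.domain_axioms)
  fix a assume a: "a \<in> carrier R" "g a = \<zero>\<^sub>E"
  hence "h a \<ominus> \<zero> \<in> J" using q_eq[of "h a" "\<zero>"] by (simp add: g_def)
  thus "a = \<zero>\<^sub>R" using inj a by (simp add: S.minus_eq)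
 qed
 obtain W where W: "finite W" "W \<subseteq> carrier S"
  and rep: "!!r. 1 < r ==> \<exists>B\<ge>0. \<forall>n::nat. \<exists>b. (\<forall>w. b w \<in> carrier R & N (b w) <= B * r ^ n) &
   s [^] n \<ominus> finsum S (%w. h (b w) \<otimes> w) W \<in> J"
  using finite_mod_growth[OF J.is_ideal fin s gr] by blast
 define z where "z = q s"
 have zE: "z \<in> carrier E" using s by (simp add: z_def)
 have qpow: "q (s [^] n) = z [^]\<^sub>E n" for n :: nat using s by (simp add: z_def)
 define e where "e w = (if w \<in> W then q w else \<zero>\<^sub>E)" for w
 have eE: "e w \<in> carrier E" for w using W(2) by (auto simp: e_def)
 have qsum: "q (finsum S (%w. h (b w) \<otimes> w) W) = finsum E (%w. g (b w) \<otimes>\<^sub>E e w) W"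
  if b: "!!w. b w \<in> carrier R" for b
 proof -
  have "q (finsum S (%w. h (b w) \<otimes> w) W) = finsum E (q \<circ> (%w. h (b w) \<otimes> w)) W"
   using b W(2) by (intro q.hom_finsum) auto
  also have "\<dots> = finsum E (%w. g (b w) \<otimes>\<^sub>E e w) W"
  proof (rule E.finsum_cong')
   fix w assume w: "w \<in> W"
   have "h (b w) \<in> carrier S" "w \<in> carrier S" using b w W(2) by auto
   thus "(q \<circ> (%w. h (b w) \<otimes> w)) w = g (b w) \<otimes>\<^sub>E e w" using w by (simp add: g_def e_def)
  qed (use b eE in auto)
  finally show ?thesis .
 qed
 have rep': "\<exists>B\<ge>0. \<forall>n. \<exists>b. (\<forall>w. b w \<in> carrier R & N (b w) <= B * r ^ n) &
   z [^]\<^sub>E n = finsum E (%w. g (b w) \<otimes>\<^sub>E e w) W" if "1 < r" for r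
 proof -
  obtain B where B: "0 <= B" "!!n::nat. \<exists>b. (\<forall>w. b w \<in> carrier R & N (b w) <= B * r ^ n) &
   s [^] n \<ominus> finsum S (%w. h (b w) \<otimes> w) W \<in> J" using rep[OF \<open>1 < r\<close>] by blast
  have "\<exists>b. (\<forall>w. b w \<in> carrier R & N (b w) <= B * r ^ n) &
   z [^]\<^sub>E n = finsum E (%w. g (b w) \<otimes>\<^sub>E e w) W" for n
  proof -
   obtain b where b: "!!w. b w \<in> carrier R" "!!w. N (b w) <= B * r ^ n"
    "s [^] n \<ominus> finsum S (%w. h (b w) \<otimes> w) W \<in> J" using B(2) by blast
   have f: "finsum S (%w. h (b w) \<otimes> w) W \<in> carrier S"
    using W(2) b(1) by (intro S.finsum_closed) auto
   have "z [^]\<^sub>E n = q (finsum S (%w. h (b w) \<otimes> w) W)"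
    using q_eq[OF _ f, of "s [^] n"] b(3) s qpow by simp
   thus ?thesis using qsum[OF b(1)] b by (intro exI[of _ b]) simp
  qed
  thus ?thesis using B(1) by blast
 qed
 have rep0: "\<exists>b. (\<forall>w. b w \<in> carrier R) & z [^]\<^sub>E n = finsum E (%w. g (b w) \<otimes>\<^sub>E e w) W" for n :: nat
 proof -
  have "1 < (2::real)" by simp
  from rep'[OF this] show ?thesis by blast
 qed
 from X.minimal_relation[OF zE W(1) eE rep0]
 obtain d G where d: "0 < d" "X.indep d (%i. z [^]\<^sub>E i)"
  and G: "!!i. G i \<in> carrier R" "G d ~= \<zero>\<^sub>R" "X.lin (Suc d) (%i. z [^]\<^sub>E i) G = \<zero>\<^sub>E" by blast
 define Q where "Q c Y \<longleftrightarrow> c \<in> carrier R & c ~= \<zero>\<^sub>R & (\<forall>w i. Y w i \<in> carrier R) &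
  (\<forall>(n::nat) b. (\<forall>w. b w \<in> carrier R) --> z [^]\<^sub>E n = finsum E (%w. g (b w) \<otimes>\<^sub>E e w) W -->
   g c \<otimes>\<^sub>E z [^]\<^sub>E n = X.lin d (%i. z [^]\<^sub>E i) (%i. finsum R (%w. b w \<otimes>\<^sub>R Y w i) W))" for c Y
 have "\<exists>c Y. Q c Y" unfolding Q_def by (rule X.coordinates_of_powers[OF zE d G W(1) eE])
 then obtain c Y where "Q c Y" by blast
 hence cY: "c \<in> carrier R & c ~= \<zero>\<^sub>R & (\<forall>w i. Y w i \<in> carrier R) &
  (\<forall>(n::nat) b. (\<forall>w. b w \<in> carrier R) --> z [^]\<^sub>E n = finsum E (%w. g (b w) \<otimes>\<^sub>E e w) W -->
   g c \<otimes>\<^sub>E z [^]\<^sub>E n = X.lin d (%i. z [^]\<^sub>E i) (%i. finsum R (%w. b w \<otimes>\<^sub>R Y w i) W))"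
  unfolding Q_def .
 have c: "c \<in> carrier R" "c ~= \<zero>\<^sub>R" and Y: "!!w i. Y w i \<in> carrier R"
  using cY[THEN conjunct1] cY[THEN conjunct2, THEN conjunct1] cY[THEN conjunct2, THEN conjunct2, THEN conjunct1]
  by blast+
 have crd: "g c \<otimes>\<^sub>E z [^]\<^sub>E n = X.lin d (%i. z [^]\<^sub>E i) (%i. finsum R (%w. b w \<otimes>\<^sub>R Y w i) W)"
  if "!!w. b w \<in> carrier R" "z [^]\<^sub>E n = finsum E (%w. g (b w) \<otimes>\<^sub>E e w) W" for n :: nat and b
  by (rule cY[THEN conjunct2, THEN conjunct2, THEN conjunct2, rule_format]) (rule that)+
 have sumR: "finsum R (%w. b w \<otimes>\<^sub>R Y w i) W \<in> carrier R" if "!!w. b w \<in> carrier R" for b i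
  using that Y by (intro R.finsum_closed) auto
 have "\<exists>t. \<forall>n::nat. (\<forall>i. t n i \<in> carrier R) & g c \<otimes>\<^sub>E z [^]\<^sub>E n = X.lin d (%i. z [^]\<^sub>E i) (t n)"
 proof (intro choice allI)
  fix n :: nat
  obtain b where "!!w. b w \<in> carrier R" "z [^]\<^sub>E n = finsum E (%w. g (b w) \<otimes>\<^sub>E e w) W"
   using rep0 by blast
  thus "\<exists>t. (\<forall>i. t i \<in> carrier R) & g c \<otimes>\<^sub>E z [^]\<^sub>E n = X.lin d (%i. z [^]\<^sub>E i) t"
   using crd[of b n] sumR[of b] by (intro exI[of _ "%i. finsum R (%w. b w \<otimes>\<^sub>R Y w i) W"]) blast
 qed
 then obtain t where t: "!!(n::nat) i. t n i \<in> carrier R"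
  "!!n. g c \<otimes>\<^sub>E z [^]\<^sub>E n = X.lin d (%i. z [^]\<^sub>E i) (t n)" by blast
 define D where "D = Max (insert 0 ((%(w, i). N (Y w i)) ` (W \<times> {..<d})))"
 have D: "0 <= D" "!!w i. w \<in> W ==> i < d ==> N (Y w i) <= D"
 proof -
  have f: "finite (insert 0 ((%(w, i). N (Y w i)) ` (W \<times> {..<d})))" using W(1) by simp
  show "0 <= D" unfolding D_def by (intro Max_ge f) simp
  show "N (Y w i) <= D" if "w \<in> W" "i < d" for w i
   unfolding D_def by (intro Max_ge f) (use that in auto)
 qed
 have zpw: "z [^]\<^sub>E i \<in> carrier E" for i :: nat using zE by simp
 have growth: "\<exists>B. \<forall>n. \<forall>i<d. N (t n i) <= B * r ^ n" if r: "1 < r" for r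
 proof -
  obtain B where B: "0 <= B" "!!n. \<exists>b. (\<forall>w. b w \<in> carrier R & N (b w) <= B * r ^ n) &
   z [^]\<^sub>E n = finsum E (%w. g (b w) \<otimes>\<^sub>E e w) W" using rep'[OF r] by blast
  have "N (t n i) <= (B * D) * r ^ n" if i: "i < d" for n i
  proof -
   obtain b where b: "!!w. b w \<in> carrier R" "!!w. N (b w) <= B * r ^ n"
    "z [^]\<^sub>E n = finsum E (%w. g (b w) \<otimes>\<^sub>E e w) W" using B(2) by blast
   have "t n i = finsum R (%w. b w \<otimes>\<^sub>R Y w i) W"
    by (rule X.lin_inj[OF d(2) zpw t(1) sumR[OF b(1)] _ i]) (use t(2)[of n] crd[OF b(1,3)] in simp)
   also have "N \<dots> <= (B * r ^ n) * D"
    using W(1) b Y D i B(1) r by (intro R.norm_finsum_le R.norm_mult_bound) auto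
   finally show ?thesis by (simp add: mult_ac)
  qed
  thus ?thesis by blast
 qed
 interpret P: power_coordinates R N E g z d G c t
  by (intro power_coordinates.intro power_coordinates_axioms.intro X.domain_extension_axioms R.banach_ring_axioms
    mult zE d G c t growth)
 have Nc: "0 < N c" by (rule P.norm_c_pos)
 define a where "a = h c"
 have a: "a \<in> carrier S" "a \<notin> J" using c inj[OF c(1)] by (auto simp: a_def)
 obtain C where C: "0 < C" "!!x. x \<in> carrier R ==> M (h x) <= C * N x" using bound by blast
 obtain L where L: "0 <= L" "!!y. y \<in> S.adjoin J a ==> \<exists>u\<in>carrier S. y \<ominus> a \<otimes> u \<in> J & M u <= L * M y"
  using S.principal_division[OF SN J.is_ideal a(1)] by blast
 define D' where "D' = Max (insert 0 ((%i. M (s [^] (i::nat))) ` {..<d}))"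
 have D': "0 <= D'" "!!i::nat. i < d ==> M (s [^] i) <= D'" by (auto simp: D'_def)
 have lift: "\<exists>u\<in>carrier S. p \<ominus> u \<in> J & M u <= (L * C * D') * b"
  if p: "p \<in> carrier S" "!!i. y i \<in> carrier R" "g c \<otimes>\<^sub>E q p = X.lin d (%i. z [^]\<^sub>E i) y"
   and b: "0 <= b" "!!i. i < d ==> N (y i) <= b" for p y b
 proof -
  define x where "x = finsum S (%i. h (y i) \<otimes> s [^] i) {..<d}"
  have xS: "x \<in> carrier S" unfolding x_def using p s by (intro S.finsum_closed) auto
  have "q x = finsum E (q \<circ> (%i. h (y i) \<otimes> s [^] i)) {..<d}"
   unfolding x_def using p s by (intro q.hom_finsum) auto
  also have "\<dots> = X.lin d (%i. z [^]\<^sub>E i) y" unfolding X.lin_def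
  proof (rule E.finsum_cong')
   fix i show "(q \<circ> (%i. h (y i) \<otimes> s [^] i)) i = g (y i) \<otimes>\<^sub>E z [^]\<^sub>E i"
    using p(2)[of i] s by (simp add: g_def z_def)
  qed (use p(2) zpw in auto)
  finally have "q x = q (a \<otimes> p)" using p(1,3) a(1) by (simp add: g_def a_def)
  hence xj: "x \<ominus> a \<otimes> p \<in> J" using q_eq[OF xS, of "a \<otimes> p"] a(1) p(1) by simp
  have "x = (x \<ominus> a \<otimes> p) \<oplus> p \<otimes> a" using xS a(1) p(1) by algebra
  hence "x \<in> S.adjoin J a" using xj p(1) unfolding S.adjoin_def by blast
  then obtain u where u: "u \<in> carrier S" "x \<ominus> a \<otimes> u \<in> J" "M u <= L * M x" using L(2) by blast
  have "M x <= (C * b) * D'" unfolding x_def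
  proof (rule S.norm_finsum_le)
   fix i assume i: "i \<in> {..<d}"
   have "C * N (y i) <= C * b" using b(2)[of i] i C(1) by (intro mult_left_mono) auto
   hence "M (h (y i)) <= C * b" using C(2)[OF p(2)[of i]] by simp
   thus "M (h (y i) \<otimes> s [^] i) <= C * b * D'"
    using p(2)[of i] s D'(2)[of i] i by (intro S.norm_mult_bound) auto
  qed (use p(2) s C(1) b(1) D'(1) in auto)
  hence "L * M x <= L * ((C * b) * D')" by (intro mult_left_mono L(1))
  hence "M u <= (L * C * D') * b" using u(3) by (simp add: mult_ac)
  moreover have "p \<ominus> u \<in> J"
  proof -
   have "a \<otimes> (p \<ominus> u) = (x \<ominus> a \<otimes> u) \<oplus> \<ominus> (x \<ominus> a \<otimes> p)"
    using xS a(1) p(1) u(1) by algebra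
   also have "\<dots> \<in> J" by (intro J.a_closed u(2) J.a_inv_closed xj)
   finally show ?thesis using J.I_prime[OF a(1), of "p \<ominus> u"] a(2) p(1) u(1) by auto
  qed
  ultimately show ?thesis using u(1) by blast
 qed
 have PB: "S.power_bounded_mod J s" unfolding S.power_bounded_mod_def
 proof (intro exI allI)
  fix n :: nat
  have "\<exists>u\<in>carrier S. s [^] n \<ominus> u \<in> J & M u <= (L * C * D') * N c"
   by (rule lift[of _ "t n"]) (use s t qpow Nc P.power_coordinates_bounded in auto)
  then obtain u where u: "u \<in> carrier S" "s [^] n \<ominus> u \<in> J" "M u <= (L * C * D') * N c" by blast
  have "s [^] n \<ominus> (s [^] n \<ominus> u) = u" using s u by (intro S.diff_diff_cancel) auto
  thus "\<exists>j\<in>J. M (s [^] n \<ominus> j) <= (L * C * D') * N c" using u by (intro bexI[OF _ u(2)]) simp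
 qed
 define t' where "t' n i = (if i < d then t n i else \<zero>\<^sub>R)" for n i
 have t': "t' n i \<in> carrier R" "N (t' n i) <= N c" for n i
  using t(1) P.power_coordinates_bounded[of i n] Nc by (auto simp: t'_def)
 have t'_lin: "g c \<otimes>\<^sub>E z [^]\<^sub>E n = X.lin d (%i. z [^]\<^sub>E i) (t' n)" for n
  unfolding t(2) by (rule X.lin_cong) (use t'(1) zpw in \<open>auto simp: t'_def\<close>)
 obtain n y where y: "y \<in> unit_span R N t' n" "!!i. i < d ==> N (t' n i \<ominus>\<^sub>R y i) < N c"
  using dep[of t' "N c" d, OF t' Nc] by blast
 have yR: "y i \<in> carrier R" for i by (rule R.unit_span_closed[OF y(1) t'(1)])
 have "\<exists>zs\<in>lc {\<zero>} (pows s n) 1. g c \<otimes>\<^sub>E q zs = X.lin d (%i. z [^]\<^sub>E i) y"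
  using y(1)
 proof induction
  case base
  show ?case
   by (intro bexI[of _ "\<zero>"] combs.base) (use c(1) zpw in auto)
 next
  case (step y j x)
  then obtain zs where zs: "zs \<in> lc {\<zero>} (pows s n) 1" "g c \<otimes>\<^sub>E q zs = X.lin d (%i. z [^]\<^sub>E i) y" by blast
  have zsS: "zs \<in> carrier S" by (rule lc_pows_closed[OF s zs(1)])
  have yR: "y i \<in> carrier R" for i by (rule R.unit_span_closed[OF step(1) t'(1)])
  have gx: "g x \<in> carrier E" "g c \<in> carrier E" using step c(1) by simp_all
  have "X.lin d (%i. z [^]\<^sub>E i) (%i. y i \<oplus>\<^sub>R x \<otimes>\<^sub>R t' j i) = g c \<otimes>\<^sub>E q zs \<oplus>\<^sub>E g x \<otimes>\<^sub>E (g c \<otimes>\<^sub>E z [^]\<^sub>E j)"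
   unfolding zs(2) t'_lin using step(3)
   by (subst X.lin_add[OF zpw yR]) (auto simp: t' X.lin_scale[OF zpw t'(1)])
  also have "\<dots> = g c \<otimes>\<^sub>E (q zs \<oplus>\<^sub>E g x \<otimes>\<^sub>E z [^]\<^sub>E j)"
  proof -
   have "u \<in> carrier E ==> v \<in> carrier E ==> g c \<otimes>\<^sub>E u \<oplus>\<^sub>E g x \<otimes>\<^sub>E (g c \<otimes>\<^sub>E v) = g c \<otimes>\<^sub>E (u \<oplus>\<^sub>E g x \<otimes>\<^sub>E v)" for u v
    using gx by algebra
   thus ?thesis using zsS zpw by simp
  qed
  also have "q zs \<oplus>\<^sub>E g x \<otimes>\<^sub>E z [^]\<^sub>E j = q (zs \<oplus> h x \<otimes> s [^] j)"
   using zsS step(3) s by (simp add: g_def z_def)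
  finally have "g c \<otimes>\<^sub>E q (zs \<oplus> h x \<otimes> s [^] j) = X.lin d (%i. z [^]\<^sub>E i) (%i. y i \<oplus>\<^sub>R x \<otimes>\<^sub>R t' j i)" by simp
  moreover have "zs \<oplus> h x \<otimes> s [^] j \<in> lc {\<zero>} (pows s n) 1"
   using step by (intro combs.step[OF zs(1)]) (auto simp: pows_def)
  ultimately show ?case by blast
 qed
 then obtain zs where zs: "zs \<in> lc {\<zero>} (pows s n) 1" "g c \<otimes>\<^sub>E q zs = X.lin d (%i. z [^]\<^sub>E i) y" by blast
 have zsS: "zs \<in> carrier S" by (rule lc_pows_closed[OF s zs(1)])
 have qzs: "q zs \<in> combs R N E g {\<zero>\<^sub>E} {z [^]\<^sub>E i | i::nat. i < n} 1"
 proof -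
  have "u \<in> carrier S & q u \<in> combs R N E g {\<zero>\<^sub>E} {z [^]\<^sub>E i | i::nat. i < n} 1"
   if "u \<in> lc {\<zero>} (pows s n) 1" for u using that
  proof induction
   case (base j) thus ?case by (auto intro!: combs.base)
  next
   case (step u w x)
   then obtain i :: nat where i: "i < n" "w = s [^] i" by (auto simp: pows_def)
   have "q (u \<oplus> h x \<otimes> w) = q u \<oplus>\<^sub>E g x \<otimes>\<^sub>E z [^]\<^sub>E i"
    using step s i by (simp add: g_def z_def)
   moreover have "q u \<oplus>\<^sub>E g x \<otimes>\<^sub>E z [^]\<^sub>E i \<in> combs R N E g {\<zero>\<^sub>E} {z [^]\<^sub>E i | i::nat. i < n} 1"
    using step i by (intro combs.step) auto
   ultimately show ?case using step s i by simp
  qed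
  thus ?thesis using zs(1) by blast
 qed
 define p where "p = s [^] n \<ominus> zs"
 have p: "p \<in> carrier S" "p \<in> monic_values s n" using s zsS zs(1) by (auto simp: p_def monic_values_def)
 have qp: "q p = z [^]\<^sub>E n \<ominus>\<^sub>E q zs" using s zsS by (simp add: p_def z_def)
 define \<delta> where "\<delta> = Max ((%i. N (t' n i \<ominus>\<^sub>R y i) / N c) ` {..<d})"
 have ne: "(%i. N (t' n i \<ominus>\<^sub>R y i) / N c) ` {..<d} ~= {}" using d(1) by auto
 have "\<delta> \<in> (%i. N (t' n i \<ominus>\<^sub>R y i) / N c) ` {..<d}" unfolding \<delta>_def using ne by (intro Max_in) auto
 hence \<delta>: "0 <= \<delta>" "\<delta> < 1" using y(2) Nc t'(1) yR by (auto simp: divide_less_eq intro!: divide_nonneg_pos R.norm_nonneg)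
 have \<delta>_le: "N (t' n i \<ominus>\<^sub>R y i) <= \<delta> * N c" if "i < d" for i
 proof -
  have "N (t' n i \<ominus>\<^sub>R y i) / N c <= \<delta>" unfolding \<delta>_def by (intro Max_ge) (use that in auto)
  thus ?thesis using Nc by (simp add: divide_le_eq)
 qed
 have gcp: "g c \<otimes>\<^sub>E q p = X.lin d (%i. z [^]\<^sub>E i) (%i. t' n i \<ominus>\<^sub>R y i)"
 proof -
  have "g c \<in> carrier E" "q zs \<in> carrier E" using c(1) zsS by simp_all
  moreover have "v \<in> carrier E ==> u \<in> carrier E ==> w \<in> carrier E ==> u \<otimes>\<^sub>E (v \<ominus>\<^sub>E w) = u \<otimes>\<^sub>E v \<ominus>\<^sub>E u \<otimes>\<^sub>E w" for u v w
   by algebra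
  ultimately have "g c \<otimes>\<^sub>E q p = g c \<otimes>\<^sub>E z [^]\<^sub>E n \<ominus>\<^sub>E g c \<otimes>\<^sub>E q zs" using zpw unfolding qp by blast
  thus ?thesis unfolding zs(2) t'_lin X.lin_minus[OF zpw t'(1) yR] .
 qed
 have AI: "almost_integral_mod J s" unfolding almost_integral_mod_def
 proof (intro allI impI)
  fix \<epsilon> :: real assume \<epsilon>: "0 < \<epsilon>"
  define L' where "L' = L * C * D' * N c"
  have "(%l. L' * \<delta> ^ l) \<longlonglongrightarrow> L' * 0" using \<delta> by (intro tendsto_intros LIMSEQ_realpow_zero) auto
  hence "eventually (%l. L' * \<delta> ^ l < \<epsilon>) sequentially" using \<epsilon> by (intro order_tendstoD(2)) auto
  then obtain l where l: "L' * \<delta> ^ l < \<epsilon>" by (auto simp: eventually_sequentially)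
  have "\<exists>x. (\<forall>i. x i \<in> carrier R) & g c \<otimes>\<^sub>E (q p) [^]\<^sub>E l = X.lin d (%i. z [^]\<^sub>E i) x & (\<forall>i<d. N (x i) <= \<delta> ^ l * N c)"
   by (rule P.powers_tend_to_zero[OF qzs qp _ gcp \<delta>(1) \<delta>_le]) (use t'(1) yR in auto)
  then obtain x where x: "!!i. x i \<in> carrier R" "g c \<otimes>\<^sub>E (q p) [^]\<^sub>E l = X.lin d (%i. z [^]\<^sub>E i) x"
   "!!i. i < d ==> N (x i) <= \<delta> ^ l * N c" by blast
  have "\<exists>u\<in>carrier S. p [^] l \<ominus> u \<in> J & M u <= (L * C * D') * (\<delta> ^ l * N c)"
   by (rule lift[of _ x]) (use x p(1) \<delta>(1) Nc in auto)
  then obtain u where u: "u \<in> carrier S" "p [^] l \<ominus> u \<in> J" "M u <= (L * C * D') * (\<delta> ^ l * N c)" by blast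
  have "(L * C * D') * (\<delta> ^ l * N c) = L' * \<delta> ^ l" by (simp add: L'_def)
  hence "M u <= L' * \<delta> ^ l" using u(3) by (simp only:)
  hence "M u <= \<epsilon>" using l by linarith
  moreover have "p [^] l \<ominus> (p [^] l \<ominus> u) = u" using p(1) u(1) by (intro S.diff_diff_cancel) auto
  ultimately show "\<exists>n. \<exists>p\<in>monic_values s n. \<exists>j\<in>J. M (p \<ominus> j) <= \<epsilon>"
   using monic_pow[OF s p(2), of l] u(2)
   by (intro exI[of _ "l * n"] bexI[of _ "p [^] l"] bexI[of _ "p [^] l \<ominus> u"]) auto
 qed
 show ?thesis using PB AI by blast
qed

end

section \<open>Reduction to prime ideals\<close>

text \<open>
 An ideal maximal among those violating \<open>P\<close> is prime.
\<close>

lemma (in banach_ring) prime_devissage: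
 assumes noeth: "noetherian_ring R" and J0: "ideal J0 R"
  and unit: "P (carrier R)"
  and prime: "!!J. primeideal J R ==> J0 \<subseteq> J ==> P J"
  and comb: "!!J a. ideal J R ==> J0 \<subseteq> J ==> a \<in> carrier R ==> P (adjoin J a) ==> P {x \<in> carrier R. a \<otimes> x \<in> J} ==> P J"
 shows "P J0"
proof (rule ccontr)
 assume bad: "\<not> P J0"
 define \<A> where "\<A> = {J. ideal J R & J0 \<subseteq> J & \<not> P J}"
 interpret noetherian_ring R by (rule noeth)
 have "\<exists>U\<in>\<A>. \<forall>X\<in>C. X \<subseteq> U" if C: "subset.chain \<A> C" for C
 proof (cases "C = {}")
  case True thus ?thesis using J0 bad by (auto simp: \<A>_def)
 next
  case False
  have "subset.chain {I. ideal I R} C" using C unfolding subset_chain_def \<A>_def by blast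
  from ideal_chain_is_trivial[OF False this] have "\<Union>C \<in> \<A>" using C unfolding subset_chain_def by blast
  thus ?thesis by blast
 qed
 from subset_Zorn[OF this]
 obtain J where J: "J \<in> \<A>" and max: "!!X. X \<in> \<A> ==> J \<subseteq> X ==> X = J" by blast
 have id: "ideal J R" "J0 \<subseteq> J" "\<not> P J" using J by (auto simp: \<A>_def)
 interpret J: ideal J R by (rule id(1))
 have "primeideal J R"
 proof (rule primeidealI[OF id(1) is_cring])
  show "carrier R ~= J" using unit id(3) by auto
  fix a b assume ab: "a \<in> carrier R" "b \<in> carrier R" "a \<otimes> b \<in> J"
  show "a \<in> J \<or> b \<in> J"
  proof (rule ccontr)
   assume n: "\<not> (a \<in> J \<or> b \<in> J)"
   let ?Q = "{x \<in> carrier R. a \<otimes> x \<in> J}"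
   have sub1: "J \<subseteq> adjoin J a"
   proof
    fix j assume j: "j \<in> J"
    hence "j = j \<oplus> \<zero> \<otimes> a" using J.a_subset ab(1) by auto
    thus "j \<in> adjoin J a" using j unfolding adjoin_def by blast
   qed
   have mem1: "a \<in> adjoin J a"
   proof -
    have "a = \<zero> \<oplus> \<one> \<otimes> a" using ab(1) by simp
    thus ?thesis using J.zero_closed unfolding adjoin_def by blast
   qed
   have sub2: "J \<subseteq> ?Q" using J.a_subset J.I_l_closed ab(1) by auto
   have id2: "ideal ?Q R"
   proof (rule idealI)
    show "ring R" by (rule ring_axioms)
    show "subgroup ?Q (add_monoid R)"
    proof
     show "x \<otimes>\<^bsub>add_monoid R\<^esub> y \<in> ?Q" if "x \<in> ?Q" "y \<in> ?Q" for x y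
      using that ab(1) J.a_closed by (auto simp: r_distr)
     show "inv\<^bsub>add_monoid R\<^esub> x \<in> ?Q" if x: "x \<in> ?Q" for x
     proof -
      have "a \<otimes> (\<ominus> x) = \<ominus> (a \<otimes> x)" using x ab(1) by (simp add: r_minus)
      thus ?thesis using x J.a_inv_closed unfolding a_inv_def[symmetric] by auto
     qed
    qed (use ab(1) J.zero_closed in auto)
    show "x \<otimes> y \<in> ?Q" "y \<otimes> x \<in> ?Q" if x: "y \<in> ?Q" "x \<in> carrier R" for x y
    proof -
     have "a \<otimes> (x \<otimes> y) = x \<otimes> (a \<otimes> y)" "y \<otimes> x = x \<otimes> y" using x ab(1) by (simp_all add: m_lcomm m_comm)
     thus "x \<otimes> y \<in> ?Q" "y \<otimes> x \<in> ?Q" using x J.I_l_closed by auto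
    qed
   qed
   have "P (adjoin J a)"
   proof (rule ccontr)
    assume "\<not> P (adjoin J a)"
    hence "adjoin J a \<in> \<A>" using adjoin_ideal[OF id(1) ab(1)] sub1 id(2) by (auto simp: \<A>_def)
    thus False using max[OF _ sub1] mem1 n by blast
   qed
   moreover have "P ?Q"
   proof (rule ccontr)
    assume "\<not> P ?Q"
    hence "?Q \<in> \<A>" using id2 sub2 id(2) unfolding \<A>_def by blast
    thus False using max[OF _ sub2] ab n by blast
   qed
   ultimately show False using comb[OF id(1,2) ab(1)] id(3) by blast
  qed
 qed
 thus False using prime id by blast
qed

context banach_hom
begin

lemma finite_mod_mono: "finite_mod J ==> J \<subseteq> J' ==> finite_mod J'"
proof -
 assume "finite_mod J" and sub: "J \<subseteq> J'"
 then obtain W K where W: "finite W" "W \<subseteq> carrier S" "0 <= K" "!!x. x \<in> carrier S ==> x \<in> lc J W (K * M x)"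
  unfolding finite_mod_def by blast
 have "x \<in> lc J' W (K * M x)" if "x \<in> carrier S" for x
  by (rule combs_mono[OF W(4)[OF that] sub order_refl order_refl])
 thus "finite_mod J'" using W(1-3) unfolding finite_mod_def by blast
qed

lemma growth_mono: "S.growth_le_one_mod J s ==> J \<subseteq> J' ==> S.growth_le_one_mod J' s"
 unfolding S.growth_le_one_mod_def
proof (intro allI impI)
 fix r :: real
 assume h: "\<forall>r>1. \<exists>B. \<forall>n::nat. \<exists>j\<in>J. M (s [^] n \<ominus> j) <= B * r ^ n" "J \<subseteq> J'" "1 < r"
 obtain B where "\<forall>n::nat. \<exists>j\<in>J. M (s [^] n \<ominus> j) <= B * r ^ n" using h(1,3) by blast
 thus "\<exists>B. \<forall>n::nat. \<exists>j\<in>J'. M (s [^] n \<ominus> j) <= B * r ^ n" using h(2) by blast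
qed

lemma power_bounded_unit: "s \<in> carrier S ==> S.power_bounded_mod (carrier S) s"
 unfolding S.power_bounded_mod_def
proof (intro exI allI)
 fix n :: nat assume s: "s \<in> carrier S"
 show "\<exists>j\<in>carrier S. M (s [^] n \<ominus> j) <= 0"
  using s by (intro bexI[of _ "s [^] n"]) auto
qed

lemma almost_integral_unit:
 assumes s: "s \<in> carrier S" shows "almost_integral_mod (carrier S) s"
 unfolding almost_integral_mod_def
proof (intro allI impI)
 fix e :: real assume "0 < e"
 thus "\<exists>n. \<exists>p\<in>monic_values s n. \<exists>j\<in>carrier S. M (p \<ominus> j) <= e"
  using monic_one[OF s] by (intro exI[of _ 0] bexI[of _ "\<one>"]) auto
qed

lemma power_bounded_and_almost_integral:
 assumes SN: "S.strictly_noetherian" and J0: "ideal J0 S" and s: "s \<in> carrier S"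
  and prime: "!!J. primeideal J S ==> J0 \<subseteq> J ==> S.power_bounded_mod J s & almost_integral_mod J s"
 shows "S.power_bounded_mod J0 s & almost_integral_mod J0 s"
proof (rule S.prime_devissage[OF S.strictly_noetherian_imp_noetherian[OF SN] J0,
   where P = "%J. S.power_bounded_mod J s & almost_integral_mod J s"])
 show "S.power_bounded_mod (carrier S) s & almost_integral_mod (carrier S) s"
  using power_bounded_unit[OF s] almost_integral_unit[OF s] by blast
 show "S.power_bounded_mod J s & almost_integral_mod J s" if "primeideal J S" "J0 \<subseteq> J" for J
  by (rule prime[OF that])
 fix J a assume J: "ideal J S" and a: "a \<in> carrier S"
  and 1: "S.power_bounded_mod (S.adjoin J a) s & almost_integral_mod (S.adjoin J a) s"
  and 2: "S.power_bounded_mod {x \<in> carrier S. a \<otimes> x \<in> J} s & almost_integral_mod {x \<in> carrier S. a \<otimes> x \<in> J} s"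
 have "S.power_bounded_mod J s" using power_bounded_combine[OF s SN J a] 1 2 by blast
 moreover from this have "almost_integral_mod J s" using almost_integral_combine[OF s J a] 1 2 by blast
 ultimately show "S.power_bounded_mod J s & almost_integral_mod J s" by blast
qed

end

context tate_field
begin

text \<open>
 Induction on the number of variables. A prime ideal meeting the Tate algebra in \<open>f ~= 0\<close> makes \<open>S\<close>
 finite modulo \<open>J\<close> over one variable fewer; the change of coordinates is contractive, so almost integrality over the smaller
 algebra implies it over the larger one.
\<close>

theorem finite_over_tate:
 fixes S (structure)
 assumes SN: "banach_ring.strictly_noetherian S M" and s: "s \<in> carrier S"
  and \<chi>: "banach_hom (tate m) gnorm S M \<chi>" and J0: "ideal J0 S"
  and fin: "banach_hom.finite_mod (tate m) gnorm S M \<chi> J0"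
  and gr: "banach_ring.growth_le_one_mod S M J0 s"
 shows "banach_ring.power_bounded_mod S M J0 s & banach_hom.almost_integral_mod (tate m) gnorm S M \<chi> J0 s"
 using \<chi> J0 fin gr
proof (induction m arbitrary: \<chi> J0)
 case (0 \<chi> J0)
 interpret X: banach_hom "tate 0" gnorm S M \<chi> by (rule 0(1))
 show ?case
 proof (rule X.power_bounded_and_almost_integral[OF SN 0(2) s])
  fix J assume J: "primeideal J S" "J0 \<subseteq> J"
  interpret J: primeideal J S by (rule J(1))
  show "X.S.power_bounded_mod J s & X.almost_integral_mod J s"
  proof (rule X.prime_case[OF gnorm_mult tate_domain SN J(1) _ X.finite_mod_mono[OF 0(3) J(2)] s
     X.growth_mono[OF 0(4) J(2)] approximate_dependence])
   fix f assume f: "f \<in> series 0" "\<chi> f \<in> J"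
   show "f = \<zero>\<^bsub>tate 0\<^esub>"
   proof (rule ccontr)
    assume ne: "f ~= \<zero>\<^bsub>tate 0\<^esub>"
    have fm: "f m = \<zero>\<^sub>K" if "m ~= {#}" for m using tate_support[OF f(1), of m] that by auto
    have "f {#} ~= \<zero>\<^sub>K"
    proof
     assume "f {#} = \<zero>\<^sub>K"
     hence "f = (%_. \<zero>\<^sub>K)" using fm by (intro ext) (metis (full_types))
     thus False using ne by simp
    qed
    hence u: "f {#} \<in> Units K" using tate_coeff[OF f(1)] by (simp add: field_Units)
    hence i: "inv\<^bsub>K\<^esub> (f {#}) \<in> carrier K" "inv\<^bsub>K\<^esub> (f {#}) \<otimes>\<^sub>K f {#} = \<one>\<^sub>K" by simp_all
    have mc: "monom (inv\<^bsub>K\<^esub> (f {#})) {#} \<in> series 0" using i(1) by (intro monom_closed) simp_all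
    have "monom (inv\<^bsub>K\<^esub> (f {#})) {#} *\<^sub>0 f = \<one>\<^bsub>tate 0\<^esub>"
    proof (rule ext)
     fix m
     show "(monom (inv\<^bsub>K\<^esub> (f {#})) {#} *\<^sub>0 f) m = \<one>\<^bsub>tate 0\<^esub> m"
      using monom_mult[OF i(1) f(1), of "{#}" m] i fm[of m] by (cases "m = {#}") simp_all
    qed
    hence "\<one>\<^sub>S = \<chi> (monom (inv\<^bsub>K\<^esub> (f {#})) {#}) \<otimes>\<^sub>S \<chi> f"
     using X.hom_mult[OF mc f(1)] X.hom_one by simp
    hence "\<one>\<^sub>S \<in> J" using J.I_l_closed[OF f(2) X.hom_closed[OF mc]] by simp
    thus False using J.one_imp_carrier J.I_notcarr by simp
   qed
  qed
 qed
next
 case (Suc n \<chi> J0)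
 interpret X: banach_hom "tate (Suc n)" gnorm S M \<chi> by (rule Suc.prems(1))
 show ?case
 proof (rule X.power_bounded_and_almost_integral[OF SN Suc.prems(2) s])
  fix J assume J: "primeideal J S" "J0 \<subseteq> J"
  interpret J: primeideal J S by (rule J(1))
  note fin = X.finite_mod_mono[OF Suc.prems(3) J(2)] and gr = X.growth_mono[OF Suc.prems(4) J(2)]
  show "X.S.power_bounded_mod J s & X.almost_integral_mod J s"
  proof (cases "\<forall>f\<in>series (Suc n). \<chi> f \<in> J --> f = \<zero>\<^bsub>tate (Suc n)\<^esub>")
   case True
   show ?thesis
    by (rule X.prime_case[OF gnorm_mult tate_domain SN J(1) _ fin s gr approximate_dependence])
     (use True in auto)
  next
   case False
   then obtain f where f: "f \<in> series (Suc n)" "\<chi> f \<in> J" "f ~= \<zero>\<^bsub>tate (Suc n)\<^esub>" by blast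
   hence "f ~= (%_. \<zero>\<^sub>K)" by simp
   from hypersurface_normalization[OF f(1) this]
   obtain \<eta> V where \<eta>: "banach_hom (tate n) gnorm (tate (Suc n)) gnorm \<eta>"
    "!!g. g \<in> series n ==> gnorm (\<eta> g) <= gnorm g" and V: "finite V" "V \<subseteq> series (Suc n)"
    "!!g. g \<in> series (Suc n) ==>
     g \<in> combs (tate n) gnorm (tate (Suc n)) \<eta> (PIdl\<^bsub>tate (Suc n)\<^esub> f) V (gnorm g)" by blast
   interpret E: banach_hom "tate n" gnorm "tate (Suc n)" gnorm \<eta> by (rule \<eta>(1))
   define \<theta> where "\<theta> = (%g. \<chi> (\<eta> g))"
   obtain C where C: "0 < C" "!!x. x \<in> series (Suc n) ==> M (\<chi> x) <= C * gnorm x" using X.bound by blast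
   have \<theta>: "banach_hom (tate n) gnorm S M \<theta>"
   proof (intro banach_hom.intro banach_hom_axioms.intro ring_hom_cring.intro ring_hom_cring_axioms.intro
     banach_hom.axioms(1)[OF \<eta>(1)] banach_hom.axioms(2)[OF Suc.prems(1)]
     banach_ring.axioms(1)[OF banach_hom.axioms(1)[OF \<eta>(1)]]
     banach_ring.axioms(1)[OF banach_hom.axioms(2)[OF Suc.prems(1)]])
    show "\<theta> \<in> ring_hom (tate n) S" unfolding \<theta>_def
     by (rule ring_hom_memI) (simp_all del: tate_simps)
    show "\<exists>C. \<forall>x\<in>series n. M (\<theta> x) <= C * gnorm x"
    proof (intro exI ballI)
     fix x assume x: "x \<in> series n"
     have "C * gnorm (\<eta> x) <= C * gnorm x" using \<eta>(2)[OF x] C(1) by (intro mult_left_mono) auto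
     thus "M (\<theta> x) <= C * gnorm x" using C(2)[OF E.hom_closed[OF x]] unfolding \<theta>_def by linarith
    qed
   qed
   interpret Y: banach_hom "tate n" gnorm S M \<theta> by (rule \<theta>)
   have finY: "Y.finite_mod J"
   proof -
    obtain W D where W: "finite W" "W \<subseteq> carrier S" "0 <= D" "!!x. x \<in> carrier S ==> x \<in> X.lc J W (D * M x)"
     using fin unfolding X.finite_mod_def by blast
    define W' where "W' = (%(w, e). \<chi> e \<otimes>\<^sub>S w) ` (W \<times> V)"
    have W': "finite W'" "W' \<subseteq> carrier S" using W(1,2) V(1,2) by (auto simp: W'_def)
    have gen: "\<chi> g \<otimes>\<^sub>S w \<in> Y.lc J W' c" if w: "w \<in> W" and g: "g \<in> series (Suc n)" "gnorm g <= c" for w g c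
    proof -
     have wS: "w \<in> carrier S" using w W(2) by auto
     have "g \<in> E.lc (PIdl\<^bsub>tate (Suc n)\<^esub> f) V c"
      by (rule combs_mono[OF V(3)[OF g(1)] order_refl order_refl g(2)])
     hence "g \<in> series (Suc n) & \<chi> g \<otimes>\<^sub>S w \<in> Y.lc J W' c"
     proof induction
      case (base j)
      then obtain k where k: "k \<in> series (Suc n)" "j = k *\<^sub>(Suc n) f"
       by (auto simp: cgenideal_def simp del: tate_simps)
      have "\<chi> j \<otimes>\<^sub>S w = (w \<otimes>\<^sub>S \<chi> k) \<otimes>\<^sub>S \<chi> f"
      proof -
       have "\<chi> j = \<chi> k \<otimes>\<^sub>S \<chi> f" unfolding k(2) by (rule X.hom_mult[OF k(1) f(1)])
       moreover have "\<chi> k \<in> carrier S" "\<chi> f \<in> carrier S" using k(1) f(1) by (simp_all del: tate_simps)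
       ultimately show ?thesis using wS by (simp add: X.S.m_ac)
      qed
      also have "\<dots> \<in> J" using wS X.hom_closed[OF k(1)] by (intro J.I_l_closed f(2)) auto
      finally show ?case using k f(1) by (auto intro: combs.base simp del: tate_simps)
     next
      case (step z e x)
      have eT: "e \<in> series (Suc n)" using step(2) V(2) by auto
      have c: "\<eta> x \<in> series (Suc n)" by (rule E.hom_closed[OF step(3)])
      have "\<chi> (z +\<^sub>(Suc n) \<eta> x *\<^sub>(Suc n) e) \<otimes>\<^sub>S w = \<chi> z \<otimes>\<^sub>S w \<oplus>\<^sub>S \<theta> x \<otimes>\<^sub>S (\<chi> e \<otimes>\<^sub>S w)"
       using step(5) eT c wS by (simp add: \<theta>_def X.S.l_distr X.S.m_assoc del: tate_simps)
      moreover have "\<chi> z \<otimes>\<^sub>S w \<oplus>\<^sub>S \<theta> x \<otimes>\<^sub>S (\<chi> e \<otimes>\<^sub>S w) \<in> Y.lc J W' c"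
       using step w by (intro combs.step) (auto simp: W'_def)
      ultimately show ?case using step(5) eT c by (simp del: tate_simps)
     qed
     thus ?thesis by blast
    qed
    have "x \<in> Y.lc J W' (D * M x)" if x: "x \<in> carrier S" for x
    proof (rule X.lc_induct_closed[OF W(4)[OF x]])
     show "J \<subseteq> Y.lc J W' (D * M x)" by (auto intro: combs.base)
     show "a \<oplus>\<^sub>S b \<in> Y.lc J W' (D * M x)" if "a \<in> Y.lc J W' (D * M x)" "b \<in> Y.lc J W' (D * M x)" for a b
      by (rule Y.lc_add[OF that J.additive_subgroup_axioms W'(2)])
    qed (rule gen)
    thus ?thesis using W' W(3) unfolding Y.finite_mod_def by blast
   qed
   have pb: "X.S.power_bounded_mod J s & Y.almost_integral_mod J s"
    by (rule Suc.IH[OF \<theta> J.ideal_axioms finY gr])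
   have lcs: "z \<in> X.lc {\<zero>\<^sub>S} U 1" if "z \<in> Y.lc {\<zero>\<^sub>S} U 1" for z U using that
   proof induction
    case (base j) thus ?case by (rule combs.base)
   next
    case (step z w x)
    have "gnorm (\<eta> x) <= 1" using \<eta>(2)[OF step(3)] step(4) by linarith
    thus ?case unfolding \<theta>_def
     by (rule combs.step[OF step(5) step(2) E.hom_closed[OF step(3)]])
   qed
   have "Y.monic_values s k \<subseteq> X.monic_values s k" for k
    using lcs unfolding X.monic_values_def Y.monic_values_def X.pows_def Y.pows_def by blast
   hence "X.almost_integral_mod J s"
    using pb unfolding X.almost_integral_mod_def Y.almost_integral_mod_def by blast
   thus ?thesis using pb by blast
  qed
 qed
qed

end

section \<open>The spectral seminorm\<close>

text \<open>
 Fekete's lemma in multiplicative form. The spectral seminorm is defined by an unspecified limit, so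
 its existence is needed.
\<close>

lemma submultiplicative_root_convergent:
 fixes x :: "nat => real"
 assumes x0: "!!n. 0 <= x n" and sub: "!!m n. x (m + n) <= x m * x n"
 shows "convergent (%n. root n (x n))"
proof -
 define L where "L = Inf ((%n. root n (x n)) ` {1..})"
 have r0: "0 <= root n (x n)" for n using x0 by (cases "n = 0") auto
 have bdd: "bdd_below ((%n. root n (x n)) ` {1..})" using r0 by (intro bdd_belowI[of _ 0]) auto
 have L0: "0 <= L" unfolding L_def using r0 by (intro cINF_greatest) auto
 have low: "L <= root n (x n)" if "1 <= n" for n unfolding L_def using that by (intro cINF_lower bdd) auto
 have up: "eventually (%n. root n (x n) < L + e) sequentially" if e: "0 < e" for e
 proof -
  define q where "q = L + e / 2"
  have q: "0 < q" "q < L + e" using L0 e by (auto simp: q_def)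
  have "L < q" using e by (simp add: q_def)
  hence "\<exists>p\<in>{1..}. root p (x p) < q" unfolding L_def using bdd by (subst (asm) cINF_less_iff) auto
  then obtain p where p: "1 <= p" "root p (x p) < q" by auto
  have "(root p (x p)) ^ p <= q ^ p" using p r0 by (intro power_mono) auto
  hence xp: "x p <= q ^ p" using p(1) x0 by (simp add: real_root_pow_pos2)
  define D where "D = Max (insert 1 ((%r. x r / q ^ r) ` {..<p}))"
  have D: "1 <= D" unfolding D_def by (intro Max_ge) auto
  have Dr: "x r <= D * q ^ r" if "r < p" for r
  proof -
   have "x r / q ^ r <= D" unfolding D_def by (intro Max_ge) (use that in auto)
   thus ?thesis using q by (simp add: divide_le_eq)
  qed
  have bound: "x (p * d + r) <= D * q ^ (p * d + r)" if r: "r < p" for d r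
  proof (induction d)
   case 0 thus ?case using Dr[OF r] by simp
  next
   case (Suc d)
   have "x (p * Suc d + r) <= x p * x (p * d + r)" using sub[of p "p * d + r"] by (simp add: ac_simps)
   also have "\<dots> <= q ^ p * (D * q ^ (p * d + r))" using xp Suc x0 q by (intro mult_mono) auto
   also have "\<dots> = D * q ^ (p * Suc d + r)" by (simp add: power_add mult_ac)
   finally show ?case .
  qed
  have "x n <= D * q ^ n" for n using bound[of "n mod p" "n div p"] p(1) by simp
  hence le: "root n (x n) <= root n D * q" if "1 <= n" for n
   using real_root_le_mono[of n "x n" "D * q ^ n"] that q D by (simp add: real_root_mult real_root_power_cancel)
  have "(%n. root n D * q) \<longlonglongrightarrow> 1 * q" using D by (intro tendsto_intros LIMSEQ_root_const) auto
  hence "eventually (%n. root n D * q < L + e) sequentially" using q(2) by (simp add: order_tendstoD(2))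
  moreover have "eventually (%n::nat. 1 <= n) sequentially" by (rule eventually_ge_at_top)
  ultimately show ?thesis
  proof eventually_elim
   case (elim n)
   thus ?case using le[of n] by linarith
  qed
 qed
 have "(%n. root n (x n)) \<longlonglongrightarrow> L"
 proof (rule order_tendstoI)
  fix a assume a: "a < L"
  show "eventually (%n. a < root n (x n)) sequentially"
   using eventually_ge_at_top[of 1] by eventually_elim (use low a in \<open>meson less_le_trans\<close>)
 next
  fix a assume "L < a"
  thus "eventually (%n. root n (x n) < a) sequentially" using up[of "a - L"] by simp
 qed
 thus ?thesis by (rule convergentI)
qed

context banach_ring
begin

lemma nat_pow_norm_convergent: "a \<in> carrier R ==> convergent (%n. root n (N (a [^] n)))"
proof (rule submultiplicative_root_convergent)
 assume a: "a \<in> carrier R"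
 show "0 <= N (a [^] n)" for n :: nat using a norm_nonneg by simp
 show "N (a [^] (m + n)) <= N (a [^] m) * N (a [^] n)" for m n :: nat
  using a norm_mult_le[of "a [^] m" "a [^] n"] by (simp add: nat_pow_mult)
qed

lemma growth_of_spectral:
 assumes a: "a \<in> carrier R" and le: "lim (%n. root n (N (a [^] n))) <= 1"
 shows "growth_le_one_mod {\<zero>} a"
 unfolding growth_le_one_mod_def
proof (intro allI impI)
 fix r :: real assume r: "1 < r"
 have "(%n. root n (N (a [^] n))) \<longlonglongrightarrow> lim (%n. root n (N (a [^] n)))"
  using nat_pow_norm_convergent[OF a] by (simp add: convergent_LIMSEQ_iff)
 hence "eventually (%n. root n (N (a [^] n)) < r) sequentially"
  by (rule order_tendstoD(2)) (use le r in linarith)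
 then obtain n0 where n0: "!!n. n0 <= n ==> root n (N (a [^] n)) < r" by (auto simp: eventually_sequentially)
 define B where "B = Max (insert 1 ((%n. N (a [^] (n::nat))) ` {..n0}))"
 have B: "1 <= B" unfolding B_def by (intro Max_ge) auto
 have "N (a [^] n) <= B * r ^ n" for n :: nat
 proof (cases "n <= n0")
  case True
  have "N (a [^] n) <= B" unfolding B_def by (intro Max_ge) (use True in auto)
  also have "\<dots> <= B * r ^ n" using B r by (simp add: mult_le_cancel_left1)
  finally show ?thesis .
 next
  case False
  hence n: "0 < n" "root n (N (a [^] n)) < r" using n0[of n] by auto
  have x0: "0 <= N (a [^] n)" using a norm_nonneg by simp
  have "(root n (N (a [^] n))) ^ n <= r ^ n" using n x0 by (intro power_mono) auto
  hence "N (a [^] n) <= r ^ n" using n(1) x0 by (simp add: real_root_pow_pos2)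
  also have "\<dots> <= B * r ^ n" using B r by (simp add: mult_le_cancel_right1)
  finally show ?thesis .
 qed
 thus "\<exists>B. \<forall>n::nat. \<exists>j\<in>{\<zero>}. N (a [^] n \<ominus> j) <= B * r ^ n" using a by (intro exI[of _ B]) (simp add: minus_eq)
qed

lemma spectral_of_power_bounded:
 assumes a: "a \<in> carrier R" and B: "!!n::nat. N (a [^] n) <= B"
 shows "lim (%n. root n (N (a [^] n))) <= 1"
proof (rule LIMSEQ_le)
 show "(%n. root n (N (a [^] n))) \<longlonglongrightarrow> lim (%n. root n (N (a [^] n)))"
  using nat_pow_norm_convergent[OF a] by (simp add: convergent_LIMSEQ_iff)
 show "(%n. root n (max B 1)) \<longlonglongrightarrow> 1" by (intro LIMSEQ_root_const) simp
 show "\<exists>k. \<forall>n\<ge>k. root n (N (a [^] n)) <= root n (max B 1)"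
  using B by (intro exI[of _ 1]) (auto intro!: real_root_le_mono simp: le_max_iff_disj)
qed

lemma power_product_bounded:
 assumes x: "!!i. i < n ==> x i \<in> carrier R" and b: "!!i. i < n ==> \<exists>B. \<forall>k::nat. N (x i [^] k) <= B"
 shows "\<exists>B\<ge>1. \<forall>m. N (power_product R n x m) <= B"
 using assms
proof (induction n)
 case 0
 thus ?case using norm_one_le by (intro exI[of _ 1]) (simp add: power_product_def)
next
 case (Suc n)
 then obtain B where B: "1 <= B" "!!m. N (power_product R n x m) <= B" by force
 obtain B' where B': "!!k::nat. N (x n [^] k) <= B'" using Suc.prems(2)[of n] by auto
 have "N (power_product R (Suc n) x m) <= max B' 1 * B" for m
 proof -
  have "power_product R (Suc n) x m = x n [^] count m n \<otimes> power_product R n x m"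
   unfolding power_product_def lessThan_Suc using Suc.prems(1) by (subst finprod_insert) (auto simp: Pi_iff)
  moreover have "N (x n [^] count m n) <= max B' 1" using B' by (simp add: le_max_iff_disj)
  ultimately show ?thesis
   using norm_mult_bound[of "x n [^] count m n" "power_product R n x m" "max B' 1" B] Suc.prems(1) B by simp
 qed
 moreover have "1 <= max B' 1 * B" using mult_mono[of 1 "max B' 1" 1 B] B(1) by simp
 ultimately show ?case by blast
qed

lemma power_product_in_submonoid:
 assumes Y: "Y \<subseteq> carrier R" "\<one> \<in> Y" "!!a b. a \<in> Y ==> b \<in> Y ==> a \<otimes> b \<in> Y" and x: "!!i. i < n ==> x i \<in> Y"
 shows "power_product R n x m \<in> Y"
proof -
 have pow: "a [^] (k::nat) \<in> Y" if "a \<in> Y" for a k using that by (induction k) (auto intro: Y)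
 have "k <= n ==> power_product R k x m \<in> Y" for k
 proof (induction k)
  case 0 thus ?case using Y(2) by (simp add: power_product_def)
 next
  case (Suc k)
  have "x i \<in> carrier R" if "i < Suc k" for i using x[of i] Y(1) Suc.prems that by auto
  hence "power_product R (Suc k) x m = x k [^] count m k \<otimes> power_product R k x m"
   unfolding power_product_def lessThan_Suc by (subst finprod_insert) (auto simp: Pi_iff)
  thus ?case using Suc x[of k] pow Y(3) by simp
 qed
 thus ?thesis by blast
qed

end

section \<open>Admissible surjections\<close>

text \<open>
 The infimum in the quotient norm need not be attained; a factor 2 makes up for it, except at 0.
\<close>

lemma admissible_surjection_lift:
 assumes adm: "admissible_surjection M N f" and pos: "!!x. x \<in> carrier M ==> 0 <= nrm M x"
  and z: "z \<in> carrier M" "nrm M z = 0" and y0: "!!y. y \<in> carrier N ==> nrm N y <= 0 ==> y = f z"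
 shows "\<exists>k\<ge>0. \<forall>y\<in>carrier N. \<exists>x\<in>carrier M. f x = y & nrm M x <= k * nrm N y"
proof -
 obtain c where c: "0 < c" "!!y. y \<in> carrier N ==> c * quotient_norm M f y <= nrm N y"
  and im: "f ` carrier M = carrier N" using adm unfolding admissible_surjection_def by blast
 have "\<exists>x\<in>carrier M. f x = y & nrm M x <= (2 / c) * nrm N y" if y: "y \<in> carrier N" for y
 proof -
  let ?F = "nrm M ` {x \<in> carrier M. f x = y}"
  have "y \<in> f ` carrier M" using y im by simp
  hence ne: "?F ~= {}" by blast
  have bdd: "bdd_below ?F" using pos by (intro bdd_belowI[of _ 0]) auto
  have q0: "0 <= quotient_norm M f y" unfolding quotient_norm_def using ne pos by (intro cInf_greatest) auto
  hence y0': "0 <= nrm N y" using c(2)[OF y] c(1) by (meson mult_nonneg_nonneg less_imp_le order_trans)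
  show ?thesis
  proof (cases "nrm N y = 0")
   case True
   thus ?thesis using y0[OF y] z by (intro bexI[of _ z]) auto
  next
   case False
   have "quotient_norm M f y <= nrm N y / c" using c(2)[OF y] c(1) by (simp add: field_simps)
   also have "\<dots> < (2 / c) * nrm N y" using False y0' c(1) by (simp add: field_simps)
   finally have "Inf ?F < (2 / c) * nrm N y" unfolding quotient_norm_def .
   hence "\<exists>t\<in>?F. t < (2 / c) * nrm N y" using ne bdd by (simp add: cInf_less_iff)
   thus ?thesis by (auto intro: less_imp_le)
  qed
 qed
 thus ?thesis using c(1) by (intro exI[of _ "2 / c"]) auto
qed

lemma admissible_surjectionI:
 assumes im: "f ` carrier M = carrier N" and pos: "!!x. x \<in> carrier M ==> 0 <= nrm M x"
  and C: "0 < C" "!!x. x \<in> carrier M ==> nrm N (f x) <= C * nrm M x"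
  and k: "0 < k" "!!y. y \<in> carrier N ==> \<exists>x\<in>carrier M. f x = y & nrm M x <= k * nrm N y"
 shows "admissible_surjection M N f"
proof -
 have "(1 / k) * quotient_norm M f y <= nrm N y & nrm N y <= C * quotient_norm M f y" if y: "y \<in> carrier N" for y
 proof
  let ?F = "nrm M ` {x \<in> carrier M. f x = y}"
  have bdd: "bdd_below ?F" using pos by (intro bdd_belowI[of _ 0]) auto
  obtain x where x: "x \<in> carrier M" "f x = y" "nrm M x <= k * nrm N y" using k(2)[OF y] by blast
  have "quotient_norm M f y <= nrm M x" unfolding quotient_norm_def using x by (intro cInf_lower bdd) auto
  thus "(1 / k) * quotient_norm M f y <= nrm N y" using x(3) k(1) by (simp add: field_simps)
  have "nrm N y / C <= quotient_norm M f y" unfolding quotient_norm_def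
  proof (rule cInf_greatest)
   show "?F ~= {}" using x by blast
   fix t assume "t \<in> ?F"
   then obtain x' where "x' \<in> carrier M" "f x' = y" "t = nrm M x'" by blast
   thus "nrm N y / C <= t" using C(2)[of x'] C(1) by (simp add: field_simps)
  qed
  thus "nrm N y <= C * quotient_norm M f y" using C(1) by (simp add: field_simps)
 qed
 thus ?thesis unfolding admissible_surjection_def using im C(1) k(1)
  by (intro conjI exI[of _ "1 / k"] exI[of _ C]) auto
qed

lemma banach_algebra_hom_imp_banach_hom:
 assumes "banach_algebra K v A" "banach_algebra K v B" "banach_algebra_hom K A B f"
 shows "banach_hom A (nrm A) B (nrm B) f"
proof -
 interpret A: banach_ring A "nrm A" by (rule banach_algebra_imp_banach_ring[OF assms(1)])
 interpret B: banach_ring B "nrm B" by (rule banach_algebra_imp_banach_ring[OF assms(2)])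
 show ?thesis
  using assms(3) unfolding banach_algebra_hom_def
  by (intro banach_hom.intro banach_hom_axioms.intro ring_hom_cring.intro ring_hom_cring_axioms.intro
    A.banach_ring_axioms B.banach_ring_axioms A.is_cring B.is_cring) auto
qed

lemma finite_admissible_combs:
 assumes C: "banach_ring C (nrm C)" and D: "banach_ring D (nrm D)" and h: "banach_hom C (nrm C) D (nrm D) h"
  and fin: "finite_admissible C D h"
 shows "\<exists>W k. finite W & W \<subseteq> carrier D & 0 <= k &
  (\<forall>y\<in>carrier D. y \<in> combs C (nrm C) D h {\<zero>\<^sub>D} W (k * nrm D y))"
proof -
 interpret h: banach_hom C "nrm C" D "nrm D" h by (rule h)
 obtain n f where f: "module_linear C (free_module C n) (module_via h D) f"
  "admissible_surjection (free_module C n) (module_via h D) f" using fin unfolding finite_admissible_def by blast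
 have fc: "f x \<in> carrier D" if "x \<in> {..<n} \<rightarrow>\<^sub>E carrier C" for x
  using f(1) that by (auto simp: module_linear_def free_module_def module_via_def)
 have fadd: "f (\<lambda>i\<in>{..<n}. x i \<oplus>\<^sub>C y i) = f x \<oplus>\<^sub>D f y"
  if "x \<in> {..<n} \<rightarrow>\<^sub>E carrier C" "y \<in> {..<n} \<rightarrow>\<^sub>E carrier C" for x y
  using f(1) that by (auto simp: module_linear_def free_module_def module_via_def)
 have fsm: "f (\<lambda>i\<in>{..<n}. c \<otimes>\<^sub>C x i) = h c \<otimes>\<^sub>D f x" if "c \<in> carrier C" "x \<in> {..<n} \<rightarrow>\<^sub>E carrier C" for c x
  using f(1) that by (auto simp: module_linear_def free_module_def module_via_def)
 define z where "z = (\<lambda>i\<in>{..<n}. \<zero>\<^sub>C)"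
 have zc: "z \<in> {..<n} \<rightarrow>\<^sub>E carrier C" by (auto simp: z_def)
 have "f (\<lambda>i\<in>{..<n}. \<zero>\<^sub>C \<otimes>\<^sub>C z i) = h \<zero>\<^sub>C \<otimes>\<^sub>D f z" by (rule fsm) (use zc in auto)
 moreover have "(\<lambda>i\<in>{..<n}. \<zero>\<^sub>C \<otimes>\<^sub>C z i) = z" by (auto simp: z_def)
 ultimately have fz: "f z = \<zero>\<^sub>D" using fc[OF zc] by simp
 define \<delta> where "\<delta> j = (\<lambda>i\<in>{..<n}. if i = j then \<one>\<^sub>C else \<zero>\<^sub>C)" for j
 have dc: "\<delta> j \<in> {..<n} \<rightarrow>\<^sub>E carrier C" for j by (auto simp: \<delta>_def)
 define W where "W = (%j. f (\<delta> j)) ` {..<n}"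
 have W: "finite W" "W \<subseteq> carrier D" using fc[OF dc] by (auto simp: W_def)
 have comb: "f x \<in> h.lc {\<zero>\<^sub>D} W c" if x: "x \<in> {..<n} \<rightarrow>\<^sub>E carrier C" and c: "!!i. i < n ==> nrm C (x i) <= c" for x c
 proof -
  define t where "t k = (\<lambda>i\<in>{..<n}. if i < k then x i else \<zero>\<^sub>C)" for k
  have tc: "t k \<in> {..<n} \<rightarrow>\<^sub>E carrier C" for k using x by (auto simp: t_def PiE_iff)
  have xk: "x k \<in> carrier C" if "k < n" for k using x that by (auto simp: PiE_iff)
  have "k <= n ==> f (t k) \<in> h.lc {\<zero>\<^sub>D} W c" for k
  proof (induction k)
   case 0
   have "t 0 = z" by (auto simp: t_def z_def)
   thus ?case using fz by (auto intro: combs.base)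
  next
   case (Suc k)
   hence k: "k < n" by simp
   define d where "d = (\<lambda>i\<in>{..<n}. x k \<otimes>\<^sub>C \<delta> k i)"
   have d: "d \<in> {..<n} \<rightarrow>\<^sub>E carrier C" using xk[OF k] by (auto simp: d_def \<delta>_def)
   have "t (Suc k) i = (\<lambda>i\<in>{..<n}. t k i \<oplus>\<^sub>C d i) i" for i
   proof (cases "i < n")
    case True
    thus ?thesis using xk[OF True] xk[OF k] by (auto simp: t_def d_def \<delta>_def less_Suc_eq)
   qed (simp add: t_def)
   hence "t (Suc k) = (\<lambda>i\<in>{..<n}. t k i \<oplus>\<^sub>C d i)" by (rule ext)
   hence "f (t (Suc k)) = f (t k) \<oplus>\<^sub>D f d" using fadd[OF tc d, of k] by (simp only:)
   also have "f d = h (x k) \<otimes>\<^sub>D f (\<delta> k)" unfolding d_def by (rule fsm[OF xk[OF k] dc])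
   finally show ?case using Suc k xk[OF k] c[OF k]
    by (auto simp: W_def intro!: combs.step)
  qed
  moreover have "t n = x" using x by (auto simp: t_def PiE_iff extensional_def fun_eq_iff)
  ultimately show ?thesis by force
 qed
 have nf: "nrm (free_module C n) x = Max (insert 0 ((%i. nrm C (x i)) ` {..<n}))" for x by (simp add: free_module_def)
 have "\<exists>k\<ge>0. \<forall>y\<in>carrier (module_via h D). \<exists>x\<in>carrier (free_module C n). f x = y & nrm (free_module C n) x <= k * nrm (module_via h D) y"
 proof (rule admissible_surjection_lift[OF f(2), of z])
  show "0 <= nrm (free_module C n) x" for x unfolding nf by (intro Max_ge) auto
  show "z \<in> carrier (free_module C n)" using zc by (simp add: free_module_def)
  have "nrm C (z i) = 0" if "i < n" for i using that h.R.norm_eq_0_iff[of "\<zero>\<^sub>C"] by (simp add: z_def)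
  hence "insert 0 ((%i. nrm C (z i)) ` {..<n}) = {0}" by auto
  thus "nrm (free_module C n) z = 0" unfolding nf by (simp only: Max_singleton)
  show "y = f z" if "y \<in> carrier (module_via h D)" "nrm (module_via h D) y <= 0" for y
   using that h.S.norm_nonneg[of y] h.S.norm_eq_0_iff[of y] unfolding fz by (simp add: module_via_def)
 qed
 then obtain k where k: "0 <= k" "!!y. y \<in> carrier D ==> \<exists>x\<in>{..<n} \<rightarrow>\<^sub>E carrier C. f x = y & nrm (free_module C n) x <= k * nrm D y"
  by (auto simp: module_via_def free_module_def)
 have "y \<in> h.lc {\<zero>\<^sub>D} W (k * nrm D y)" if y: "y \<in> carrier D" for y
 proof -
  obtain x where x: "x \<in> {..<n} \<rightarrow>\<^sub>E carrier C" "f x = y" "nrm (free_module C n) x <= k * nrm D y" using k(2)[OF y] by blast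
  have "nrm C (x i) <= k * nrm D y" if "i < n" for i
  proof -
   have "nrm C (x i) <= nrm (free_module C n) x" unfolding nf by (intro Max_ge) (use that in auto)
   thus ?thesis using x(3) by linarith
  qed
  thus ?thesis using comb[OF x(1)] x(2) by simp
 qed
 thus ?thesis using W k(1) by blast
qed

section \<open>Fiber products\<close>

lemma fiber_product_simps [simp]:
 "carrier (fiber_product A B \<phi> \<psi>) = {(a, b). a \<in> carrier A & b \<in> carrier B & \<phi> a = \<psi> b}"
 "(a, b) \<otimes>\<^bsub>fiber_product A B \<phi> \<psi>\<^esub> (a', b') = (a \<otimes>\<^sub>A a', b \<otimes>\<^sub>B b')"
 "(a, b) \<oplus>\<^bsub>fiber_product A B \<phi> \<psi>\<^esub> (a', b') = (a \<oplus>\<^sub>A a', b \<oplus>\<^sub>B b')"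
 "\<one>\<^bsub>fiber_product A B \<phi> \<psi>\<^esub> = (\<one>\<^sub>A, \<one>\<^sub>B)" "\<zero>\<^bsub>fiber_product A B \<phi> \<psi>\<^esub> = (\<zero>\<^sub>A, \<zero>\<^sub>B)"
 "c \<odot>\<^bsub>fiber_product A B \<phi> \<psi>\<^esub> (a, b) = (c \<odot>\<^sub>A a, c \<odot>\<^sub>B b)"
 "nrm (fiber_product A B \<phi> \<psi>) (a, b) = max (nrm A a) (nrm B b)"
 by (auto simp: fiber_product_def product_algebra_def)

lemma fiber_product_banach_algebra:
 assumes A: "banach_algebra K v A" and B: "banach_algebra K v B" and C: "banach_algebra K v C"
  and \<phi>: "banach_algebra_hom K A C \<phi>" and \<psi>: "banach_algebra_hom K B C \<psi>"
 shows "banach_algebra K v (fiber_product A B \<phi> \<psi>)"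
proof -
 interpret f: banach_hom A "nrm A" C "nrm C" \<phi> by (rule banach_algebra_hom_imp_banach_hom[OF A C \<phi>])
 interpret g: banach_hom B "nrm B" C "nrm C" \<psi> by (rule banach_algebra_hom_imp_banach_hom[OF B C \<psi>])
 interpret AA: algebra K A using A by (simp add: banach_algebra_def)
 interpret BB: algebra K B using B by (simp add: banach_algebra_def)
 define F where "F = fiber_product A B \<phi> \<psi>"
 have ag: "abelian_group F" unfolding F_def
 proof (rule abelian_groupI)
  fix x assume x: "x \<in> carrier (fiber_product A B \<phi> \<psi>)"
  thus "\<exists>y\<in>carrier (fiber_product A B \<phi> \<psi>). y \<oplus>\<^bsub>fiber_product A B \<phi> \<psi>\<^esub> x = \<zero>\<^bsub>fiber_product A B \<phi> \<psi>\<^esub>"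
   by (cases x) (auto intro!: exI[of _ "\<ominus>\<^sub>A fst x"] exI[of _ "\<ominus>\<^sub>B snd x"] simp: f.R.l_neg g.R.l_neg)
 qed (auto simp: f.R.a_ac g.R.a_ac)
 interpret F: abelian_group F by (rule ag)
 have crF: "cring F" unfolding F_def
 proof (rule cringI[OF ag[unfolded F_def]])
  show "Group.comm_monoid (fiber_product A B \<phi> \<psi>)"
   by (rule comm_monoidI) (auto simp: f.R.m_ac g.R.m_ac)
 qed (auto simp: f.R.l_distr g.R.l_distr)
 have inv: "\<ominus>\<^sub>F (a, b) = (\<ominus>\<^sub>A a, \<ominus>\<^sub>B b)" if "a \<in> carrier A" "b \<in> carrier B" "\<phi> a = \<psi> b" for a b
  using that by (intro F.minus_equality) (auto simp: F_def f.R.l_neg g.R.l_neg)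
 have mn: "(a, b) \<ominus>\<^sub>F (a', b') = (a \<ominus>\<^sub>A a', b \<ominus>\<^sub>B b')"
  if "a' \<in> carrier A" "b' \<in> carrier B" "\<phi> a' = \<psi> b'" for a b a' b'
  using inv[OF that] by (simp add: a_minus_def) (simp add: F_def)
 have mn': "x \<ominus>\<^sub>F y = (fst x \<ominus>\<^sub>A fst y, snd x \<ominus>\<^sub>B snd y)" if "y \<in> carrier F" for x y
  using mn[of "fst y" "snd y" "fst x" "snd x"] that by (auto simp: F_def)
 have nF: "nrm F x = max (nrm A (fst x)) (nrm B (snd x))" for x by (cases x) (simp add: F_def)
 have cF: "x \<in> carrier F \<longleftrightarrow> fst x \<in> carrier A & snd x \<in> carrier B & \<phi> (fst x) = \<psi> (snd x)" for x
  by (cases x) (simp add: F_def)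
 have nb: "nonarch_banach_group F (nrm F)"
 proof (intro nonarch_banach_group.intro nonarch_banach_group_axioms.intro ag)
  fix x assume x: "x \<in> carrier F"
  show "0 <= nrm F x" using x f.R.norm_nonneg by (auto simp: nF cF le_max_iff_disj)
  show "nrm F x = 0 \<longleftrightarrow> x = \<zero>\<^sub>F"
   using x f.R.norm_nonneg[of "fst x"] g.R.norm_nonneg[of "snd x"] f.R.norm_eq_0_iff[of "fst x"] g.R.norm_eq_0_iff[of "snd x"]
   by (cases x) (auto simp: F_def max_def split: if_splits)
  fix y assume y: "y \<in> carrier F"
  show "nrm F (x \<ominus>\<^sub>F y) <= max (nrm F x) (nrm F y)"
   using x y f.R.norm_ultra[of "fst x" "fst y"] g.R.norm_ultra[of "snd x" "snd y"]
   by (auto simp: mn' nF cF)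
 next
  fix s
  assume s: "!!n::nat. s n \<in> carrier F" and cau: "!!e. 0 < e ==> \<exists>n0. \<forall>m\<ge>n0. \<forall>n\<ge>n0. nrm F (s m \<ominus>\<^sub>F s n) < e"
  have sc: "fst (s n) \<in> carrier A" "snd (s n) \<in> carrier B" "\<phi> (fst (s n)) = \<psi> (snd (s n))" for n using s cF by auto
  have "\<exists>l\<in>carrier A. (%n. nrm A (fst (s n) \<ominus>\<^sub>A l)) \<longlonglongrightarrow> 0"
  proof (rule f.R.norm_complete[OF sc(1)])
   fix e :: real assume "0 < e"
   thus "\<exists>n0. \<forall>m\<ge>n0. \<forall>n\<ge>n0. nrm A (fst (s m) \<ominus>\<^sub>A fst (s n)) < e" using cau[of e] by (simp add: mn'[OF s] nF) blast
  qed
  then obtain a where a: "a \<in> carrier A" "(%n. nrm A (fst (s n) \<ominus>\<^sub>A a)) \<longlonglongrightarrow> 0" by blast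
  have "\<exists>l\<in>carrier B. (%n. nrm B (snd (s n) \<ominus>\<^sub>B l)) \<longlonglongrightarrow> 0"
  proof (rule g.R.norm_complete[OF sc(2)])
   fix e :: real assume "0 < e"
   thus "\<exists>n0. \<forall>m\<ge>n0. \<forall>n\<ge>n0. nrm B (snd (s m) \<ominus>\<^sub>B snd (s n)) < e" using cau[of e] by (simp add: mn'[OF s] nF) blast
  qed
  then obtain b where b: "b \<in> carrier B" "(%n. nrm B (snd (s n) \<ominus>\<^sub>B b)) \<longlonglongrightarrow> 0" by blast
  obtain D where D: "0 < D" "!!x. x \<in> carrier A ==> nrm C (\<phi> x) <= D * nrm A x" using f.bound by blast
  obtain E where E: "0 < E" "!!x. x \<in> carrier B ==> nrm C (\<psi> x) <= E * nrm B x" using g.bound by blast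
  have le: "nrm C (\<phi> a \<ominus>\<^sub>C \<psi> b) <= D * nrm A (fst (s n) \<ominus>\<^sub>A a) + E * nrm B (snd (s n) \<ominus>\<^sub>B b)" for n
  proof -
   have e: "\<phi> a \<ominus>\<^sub>C \<psi> b = \<psi> (snd (s n) \<ominus>\<^sub>B b) \<ominus>\<^sub>C \<phi> (fst (s n) \<ominus>\<^sub>A a)"
   proof -
    have "x \<in> carrier C ==> y \<in> carrier C ==> z \<in> carrier C ==> x \<ominus>\<^sub>C y = (z \<ominus>\<^sub>C y) \<ominus>\<^sub>C (z \<ominus>\<^sub>C x)" for x y z
     by algebra
    thus ?thesis using a(1) b(1) sc[of n] by (simp add: f.R.minus_eq g.R.minus_eq f.S.minus_eq)
   qed
   have "nrm C (\<psi> (snd (s n) \<ominus>\<^sub>B b) \<ominus>\<^sub>C \<phi> (fst (s n) \<ominus>\<^sub>A a))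
    <= max (nrm C (\<psi> (snd (s n) \<ominus>\<^sub>B b))) (nrm C (\<phi> (fst (s n) \<ominus>\<^sub>A a)))"
    using a(1) b(1) sc[of n] by (intro f.S.norm_ultra) simp_all
   moreover have "nrm C (\<psi> (snd (s n) \<ominus>\<^sub>B b)) <= E * nrm B (snd (s n) \<ominus>\<^sub>B b)" using b(1) sc by (intro E) simp
   moreover have "nrm C (\<phi> (fst (s n) \<ominus>\<^sub>A a)) <= D * nrm A (fst (s n) \<ominus>\<^sub>A a)" using a(1) sc by (intro D) simp
   moreover have "0 <= D * nrm A (fst (s n) \<ominus>\<^sub>A a)" "0 <= E * nrm B (snd (s n) \<ominus>\<^sub>B b)"
    using a(1) b(1) sc D(1) E(1) f.R.norm_nonneg g.R.norm_nonneg by simp_all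
   ultimately show ?thesis unfolding e by linarith
  qed
  have "(%n. D * nrm A (fst (s n) \<ominus>\<^sub>A a) + E * nrm B (snd (s n) \<ominus>\<^sub>B b)) \<longlonglongrightarrow> D * 0 + E * 0"
   by (intro tendsto_intros a b)
  hence "nrm C (\<phi> a \<ominus>\<^sub>C \<psi> b) <= D * 0 + E * 0" by (rule LIMSEQ_le_const) (use le in blast)
  hence "\<phi> a = \<psi> b"
   using f.S.diff_eq_zero_iff[of "\<phi> a" "\<psi> b"] f.S.norm_eq_0_iff[of "\<phi> a \<ominus>\<^sub>C \<psi> b"] f.S.norm_nonneg[of "\<phi> a \<ominus>\<^sub>C \<psi> b"] a(1) b(1)
   by simp
  hence ab: "(a, b) \<in> carrier F" using a(1) b(1) by (simp add: F_def)
  have "(%n. max (nrm A (fst (s n) \<ominus>\<^sub>A a)) (nrm B (snd (s n) \<ominus>\<^sub>B b))) \<longlonglongrightarrow> max 0 0" by (intro tendsto_max a b)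
  thus "\<exists>l\<in>carrier F. (%n. nrm F (s n \<ominus>\<^sub>F l)) \<longlonglongrightarrow> 0"
   using ab by (intro bexI[of _ "(a, b)"]) (simp_all add: mn'[OF ab] nF)
 qed
 have sm: "\<phi> (c \<odot>\<^sub>A a) = c \<odot>\<^sub>C \<phi> a" "\<psi> (c \<odot>\<^sub>B b) = c \<odot>\<^sub>C \<psi> b"
  if "c \<in> carrier K" "a \<in> carrier A" "b \<in> carrier B" for a b c
  using \<phi> \<psi> that by (auto simp: banach_algebra_hom_def)
 have nsA: "nrm A (c \<odot>\<^sub>A a) = v c * nrm A a" if "c \<in> carrier K" "a \<in> carrier A" for c a
  using A that by (simp add: banach_algebra_def banach_algebra_axioms_def)
 have nsB: "nrm B (c \<odot>\<^sub>B b) = v c * nrm B b" if "c \<in> carrier K" "b \<in> carrier B" for c b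
  using B that by (simp add: banach_algebra_def banach_algebra_axioms_def)
 have af: "analytic_field K v" using A by (simp add: banach_algebra_def)
 then interpret kk: nonarch_banach_group K v by (simp add: analytic_field_def)
 have "algebra K F" unfolding F_def
  by (rule algebraI[OF AA.R.is_cring crF[unfolded F_def]])
   (auto simp: sm AA.smult_l_distr BB.smult_l_distr AA.smult_r_distr BB.smult_r_distr
    AA.smult_assoc1 BB.smult_assoc1 AA.smult_assoc2 BB.smult_assoc2)
 moreover have "nrm F \<one>\<^sub>F <= 1" using f.R.norm_one_le g.R.norm_one_le by (simp add: F_def)
 moreover have "nrm F (x \<otimes>\<^sub>F y) <= nrm F x * nrm F y" if x: "x \<in> carrier F" and y: "y \<in> carrier F" for x y
 proof -
  obtain a b a' b' where e: "x = (a, b)" "y = (a', b')" by (cases x, cases y)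
  have c: "a \<in> carrier A" "b \<in> carrier B" "a' \<in> carrier A" "b' \<in> carrier B" using x y by (auto simp: e F_def)
  have "nrm A (a \<otimes>\<^sub>A a') <= max (nrm A a) (nrm B b) * max (nrm A a') (nrm B b')"
   using c by (intro f.R.norm_mult_bound) auto
  moreover have "nrm B (b \<otimes>\<^sub>B b') <= max (nrm A a) (nrm B b) * max (nrm A a') (nrm B b')"
   using c by (intro g.R.norm_mult_bound) auto
  ultimately show ?thesis by (simp add: e F_def)
 qed
 moreover have "nrm F (c \<odot>\<^sub>F x) = v c * nrm F x" if c: "c \<in> carrier K" and x: "x \<in> carrier F" for c x
  using c x kk.norm_nonneg[OF c] by (cases x) (simp add: F_def nsA nsB max_mult_distrib_left)
 ultimately have "banach_algebra K v F"
  by (intro banach_algebra.intro banach_algebra_axioms.intro af nb)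
 thus ?thesis unfolding F_def .
qed

section \<open>Generators of finite algebras\<close>

context banach_hom
begin

lemma lc_finite_support: "z \<in> lc J W c ==> \<exists>V. finite V & V \<subseteq> W & z \<in> lc J V c"
proof (induction rule: combs.induct)
 case (base j)
 thus ?case by (intro exI[of _ "{}"]) (auto intro: combs.base)
next
 case (step z w x)
 then obtain V where V: "finite V" "V \<subseteq> W" "z \<in> lc J V c" by blast
 have "z \<in> lc J (insert w V) c" by (rule combs_mono[OF V(3)]) auto
 hence "z \<oplus> h x \<otimes> w \<in> lc J (insert w V) c" by (rule combs.step) (use step in auto)
 thus ?case using V step(2) by (intro exI[of _ "insert w V"]) auto
qed

text \<open>
 Generators may be perturbed: replacing them by sufficiently close elements leaves an error
 that is at most half of what is approximated.
\<close>

lemma generators_from_dense_set: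
 assumes E: "finite E" "E \<subseteq> carrier S" "0 <= K" "!!y. y \<in> carrier S ==> y \<in> lc {\<zero>} E (K * M y)"
  and P: "P \<subseteq> carrier S"
  and dense: "!!e r. e \<in> carrier S ==> 0 < r ==> \<exists>c. \<exists>l\<in>lc {\<zero>} P c. M (e \<ominus> l) <= r"
 shows "\<exists>V D. finite V & V \<subseteq> P & 0 <= D & (\<forall>y\<in>carrier S. y \<in> lc {\<zero>} V (D * M y))"
proof -
 note zi = S.zeroideal
 note za = ideal.axioms(1)[OF S.zeroideal]
 obtain C where C: "0 < C" "!!x. x \<in> carrier R ==> M (h x) <= C * N x" using bound by blast
 \<comment> \<open>the admissible perturbation of the generators\<close>
 define \<eta> where "\<eta> = 1 / (2 * (C * K + 1))"
 have CK: "0 <= C * K" using C(1) E(3) by simp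
 have \<eta>: "0 < \<eta>" using CK by (simp add: \<eta>_def)
 have \<eta>2: "C * K * \<eta> <= 1 / 2" using CK by (simp add: \<eta>_def field_simps)
 have "\<exists>l c VV. \<forall>e\<in>E. l e \<in> lc {\<zero>} (VV e) (c e) & finite (VV e) & VV e \<subseteq> P & M (e \<ominus> l e) <= \<eta>"
 proof -
  have "\<exists>t. \<forall>e\<in>E. fst (t e) \<in> lc {\<zero>} (snd (snd (t e))) (fst (snd (t e))) & finite (snd (snd (t e))) & snd (snd (t e)) \<subseteq> P & M (e \<ominus> fst (t e)) <= \<eta>"
  proof (intro bchoice ballI)
   fix e assume "e \<in> E"
   hence "e \<in> carrier S" using E(2) by blast
   from dense[OF this \<eta>] obtain c l where l: "l \<in> lc {\<zero>} P c" "M (e \<ominus> l) <= \<eta>" by blast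
   from lc_finite_support[OF l(1)] obtain V where "finite V" "V \<subseteq> P" "l \<in> lc {\<zero>} V c" by blast
   thus "\<exists>t. fst t \<in> lc {\<zero>} (snd (snd t)) (fst (snd t)) & finite (snd (snd t)) & snd (snd t) \<subseteq> P & M (e \<ominus> fst t) <= \<eta>"
    using l(2) by (intro exI[of _ "(l, c, V)"]) simp
  qed
  then obtain t where "\<forall>e\<in>E. fst (t e) \<in> lc {\<zero>} (snd (snd (t e))) (fst (snd (t e))) & finite (snd (snd (t e))) & snd (snd (t e)) \<subseteq> P & M (e \<ominus> fst (t e)) <= \<eta>" by blast
  thus ?thesis by (intro exI[of _ "%e. fst (t e)"] exI[of _ "%e. fst (snd (t e))"] exI[of _ "%e. snd (snd (t e))"]) simp
 qed
 then obtain l c VV where l: "!!e. e \<in> E ==> l e \<in> lc {\<zero>} (VV e) (c e)" "!!e. e \<in> E ==> finite (VV e)"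
  "!!e. e \<in> E ==> VV e \<subseteq> P" "!!e. e \<in> E ==> M (e \<ominus> l e) <= \<eta>" by blast
 define V where "V = (\<Union>e\<in>E. VV e)"
 define c0 where "c0 = Max (insert 0 (c ` E))"
 have V: "finite V" "V \<subseteq> P" using E(1) l(2,3) by (auto simp: V_def)
 have VS: "V \<subseteq> carrier S" using V(2) P by blast
 have c0: "0 <= c0" "!!e. e \<in> E ==> c e <= c0" using E(1) by (auto simp: c0_def)
 have le: "l e \<in> lc {\<zero>} V c0" if "e \<in> E" for e
  by (rule combs_mono[OF l(1)[OF that] order_refl _ c0(2)[OF that]]) (use that in \<open>auto simp: V_def\<close>)
 have lS: "l e \<in> carrier S" if "e \<in> E" for e using lc_carrier[OF le[OF that] _ VS] by simp
 have near_comb: "x \<in> carrier S & (\<exists>y\<in>lc {\<zero>} V (b * c0). M (x \<ominus> y) <= C * b * \<eta>)"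
  if "x \<in> lc {\<zero>} E b" and b: "0 <= b" for x b
  using that(1)
 proof induction
  case (base j)
  thus ?case using C(1) b \<eta> by (auto intro!: bexI[of _ "\<zero>"] combs.base)
 next
  case (step z e a)
  then obtain y where y: "z \<in> carrier S" "y \<in> lc {\<zero>} V (b * c0)" "M (z \<ominus> y) <= C * b * \<eta>" by blast
  have yS: "y \<in> carrier S" using lc_carrier[OF y(2) _ VS] by simp
  have eS: "e \<in> carrier S" using step(2) E(2) by blast
  have a: "h a \<in> carrier S" using step(3) by simp
  have "C * N a <= C * b" using step(4) C(1) by (intro mult_left_mono) auto
  hence Ma: "M (h a) <= C * b" using C(2)[OF step(3)] by linarith
  have "h a \<otimes> e \<ominus> h a \<otimes> l e = h a \<otimes> (e \<ominus> l e)" using a eS lS[OF step(2)] by algebra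
  hence "M (h a \<otimes> e \<ominus> h a \<otimes> l e) <= C * b * \<eta>"
   using S.norm_mult_bound[OF a _ Ma l(4)[OF step(2)]] eS lS[OF step(2)] by simp
  hence "M ((z \<oplus> h a \<otimes> e) \<ominus> (y \<oplus> h a \<otimes> l e)) <= C * b * \<eta>"
   using y yS a eS lS[OF step(2)] by (subst S.add_diff_add) (auto intro!: S.norm_add_le)
  moreover have "y \<oplus> h a \<otimes> l e \<in> lc {\<zero>} V (b * c0)"
   by (intro lc_add y(2) lc_scale le step zi VS za)
  ultimately show ?case using y(1) a eS by blast
 qed
 have gen: "y \<in> lc {\<zero>} V (K * c0 * M y)" if y: "y \<in> carrier S" for y
 proof (rule lc_successive_approximation[OF zi S.norm_closed_zero V(1) VS, where \<delta> = "1/2" and C = "M y"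
    and U = "%k. {u \<in> carrier S. M u <= M y * (1/2) ^ k}"])
  show "0 <= K * c0 * M y" "0 <= M y" using E(3) c0(1) S.norm_nonneg[OF y] by simp_all
  fix k u assume u: "u \<in> {u \<in> carrier S. M u <= M y * (1/2) ^ k}"
  define b where "b = K * (M y * (1/2) ^ k)"
  have b: "0 <= b" using E(3) S.norm_nonneg[OF y] by (simp add: b_def)
  have "K * M u <= b" unfolding b_def using u E(3) by (intro mult_left_mono) auto
  hence "u \<in> lc {\<zero>} E b" using E(4)[of u] u combs_mono[of u R N S h _ E "K * M u" _ E b] by auto
  from near_comb[OF this b]
  obtain x where x: "x \<in> lc {\<zero>} V (b * c0)" "M (u \<ominus> x) <= C * b * \<eta>" by blast
  have xS: "x \<in> carrier S" using lc_carrier[OF x(1) _ VS] by simp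
  have "C * b * \<eta> = (C * K * \<eta>) * (M y * (1/2) ^ k)" by (simp add: b_def)
  also have "\<dots> <= (1 / 2) * (M y * (1/2) ^ k)" using S.norm_nonneg[OF y] by (intro mult_right_mono \<eta>2) simp
  finally have "M (u \<ominus> x) <= M y * (1/2) ^ Suc k" using x(2) by simp
  moreover have "u \<ominus> (u \<ominus> x) = x" using u xS by (intro S.diff_diff_cancel) auto
  moreover have "b * c0 = K * c0 * M y * (1/2) ^ k" by (simp add: b_def)
  with x(1) have "x \<in> lc {\<zero>} V (K * c0 * M y * (1/2) ^ k)" by (simp only:)
  ultimately show "\<exists>u'\<in>{u \<in> carrier S. M u <= M y * (1/2) ^ Suc k}. u \<ominus> u' \<in> lc {\<zero>} V (K * c0 * M y * (1/2) ^ k)"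
   using u xS by (intro bexI[of _ "u \<ominus> x"]) auto
 qed (use y in auto)
 thus ?thesis using V c0(1) E(3) by (intro exI[of _ V] exI[of _ "K * c0"]) auto
qed

text \<open>
 Induction on the degree rewrites a monomial as a combination of the finitely many monomials
 with small exponents and an error with coefficients of norm at most 1/2. By density of the combinations of monomials this
 applies to all elements, and successive approximation removes the error.
\<close>

theorem finite_by_monomial_reduction:
 fixes sm :: "nat multiset => 'c" and n :: nat
 defines "SM \<equiv> sm ` {\<nu>. set_mset \<nu> \<subseteq> {..<n}}"
 assumes sm: "!!\<nu>. set_mset \<nu> \<subseteq> {..<n} ==> sm \<nu> \<in> carrier S" "!!\<nu>. set_mset \<nu> \<subseteq> {..<n} ==> M (sm \<nu>) <= D"
   "!!\<mu> \<nu>. set_mset \<mu> \<subseteq> {..<n} ==> set_mset \<nu> \<subseteq> {..<n} ==> sm (\<mu> + \<nu>) = sm \<mu> \<otimes> sm \<nu>" "0 <= D"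
  and red: "!!j. j < n ==> \<exists>N'\<ge>1. \<exists>t\<in>carrier R. N t <= 1 & (\<exists>l\<in>lc {\<zero>} {sm (replicate_mset i j) | i. i < N'} 1.
   \<exists>r\<in>lc {\<zero>} SM (1 / 2). sm (replicate_mset N' j) = h t \<oplus> l \<oplus> r)"
  and k: "0 < k" and dense: "!!y r. y \<in> carrier S ==> 0 < r ==> \<exists>l\<in>lc {\<zero>} SM (k * M y). M (y \<ominus> l) <= r"
 shows "\<exists>W K. finite W & W \<subseteq> carrier S & 0 <= K & (\<forall>y\<in>carrier S. y \<in> lc {\<zero>} W (K * M y))"
proof -
 note zi = S.zeroideal
 note za = ideal.axioms(1)[OF S.zeroideal]
 have SM: "SM \<subseteq> carrier S" using sm(1) by (auto simp: SM_def)
 have "\<exists>f. \<forall>j\<in>{..<n}. 1 <= f j & (\<exists>t\<in>carrier R. N t <= 1 & (\<exists>l\<in>lc {\<zero>} {sm (replicate_mset i j) | i. i < f j} 1.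
   \<exists>r\<in>lc {\<zero>} SM (1 / 2). sm (replicate_mset (f j) j) = h t \<oplus> l \<oplus> r))"
  by (intro bchoice ballI) (use red in auto)
 then obtain f where f: "!!j. j < n ==> 1 <= f j" "!!j. j < n ==> \<exists>t\<in>carrier R. N t <= 1 & (\<exists>l\<in>lc {\<zero>} {sm (replicate_mset i j) | i. i < f j} 1.
   \<exists>r\<in>lc {\<zero>} SM (1 / 2). sm (replicate_mset (f j) j) = h t \<oplus> l \<oplus> r)" by blast
 define \<beta> where "\<beta> = (\<Sum>j<n. replicate_mset (f j) j)"
 have \<beta>: "count \<beta> j = f j" if "j < n" for j using that by (simp add: \<beta>_def count_sum)
 define Box where "Box = sm ` ({\<nu>. \<nu> \<subseteq># \<beta>} \<inter> {\<nu>. set_mset \<nu> \<subseteq> {..<n}})"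
 have Box: "finite Box" "Box \<subseteq> carrier S" using sm(1) by (auto simp: Box_def)
 define G where "G c d = {z \<in> carrier S. \<exists>x\<in>lc {\<zero>} Box c. z \<ominus> x \<in> lc {\<zero>} SM d}" for c d
 have BoxS: "x \<in> carrier S" if "x \<in> lc {\<zero>} Box c" for x c using lc_carrier[OF that _ Box(2)] by simp
 have SMS: "x \<in> carrier S" if "x \<in> lc {\<zero>} SM c" for x c using lc_carrier[OF that _ SM] by simp
 have zl: "\<zero> \<in> lc {\<zero>} U c" for U c by (auto intro: combs.base)
 have G_zero: "\<zero> \<in> G c d" for c d unfolding G_def by (auto intro!: bexI[OF _ zl] zl)
 have G_Box: "x \<in> G c d" if "x \<in> lc {\<zero>} Box c" for x c d
  unfolding G_def using that BoxS[OF that] zl by (auto intro!: bexI[OF _ that])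
 have G_SM: "x \<in> G c d" if "x \<in> lc {\<zero>} SM d" for x c d
  unfolding G_def using that SMS[OF that] by (auto intro!: bexI[OF _ zl] simp: S.minus_eq)
 have G_add: "a \<oplus> b \<in> G c d" if ab: "a \<in> G c d" "b \<in> G c d" for a b c d
 proof -
  obtain x y where xy: "a \<in> carrier S" "x \<in> lc {\<zero>} Box c" "a \<ominus> x \<in> lc {\<zero>} SM d"
   "b \<in> carrier S" "y \<in> lc {\<zero>} Box c" "b \<ominus> y \<in> lc {\<zero>} SM d" using ab unfolding G_def by blast
  have "(a \<oplus> b) \<ominus> (x \<oplus> y) \<in> lc {\<zero>} SM d"
   using xy BoxS by (subst S.add_diff_add) (auto intro!: lc_add za SM)
  moreover have "x \<oplus> y \<in> lc {\<zero>} Box c" by (intro lc_add xy za Box)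
  ultimately show ?thesis using xy unfolding G_def by blast
 qed
 have G_scale: "h r \<otimes> a \<in> G (e * c) (e * d)" if a: "a \<in> G c d" "r \<in> carrier R" "N r <= e" for a r c d e
 proof -
  obtain x where x: "a \<in> carrier S" "x \<in> lc {\<zero>} Box c" "a \<ominus> x \<in> lc {\<zero>} SM d" using a(1) unfolding G_def by blast
  have "h r \<otimes> a \<ominus> h r \<otimes> x = h r \<otimes> (a \<ominus> x)"
  proof -
   have "h r \<in> carrier S" "x \<in> carrier S" using a(2) BoxS[OF x(2)] by simp_all
   thus ?thesis using x(1) by algebra
  qed
  moreover have "h r \<otimes> (a \<ominus> x) \<in> lc {\<zero>} SM (e * d)" by (rule lc_scale[OF x(3) zi SM a(2,3)])
  moreover have "h r \<otimes> x \<in> lc {\<zero>} Box (e * c)" by (rule lc_scale[OF x(2) zi Box(2) a(2,3)])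
  ultimately show ?thesis using x(1) a(2) unfolding G_def by (intro CollectI conjI bexI[of _ "h r \<otimes> x"]) simp_all
 qed
 have G_combs: "z \<in> G c (c / 2)" if z: "z \<in> lc {\<zero>} U c" and U: "!!u. u \<in> U ==> u \<in> G 1 (1 / 2)" for z U c
 proof (rule lc_induct_closed[OF z])
  show "{\<zero>} \<subseteq> G c (c / 2)" using G_zero by blast
  show "h x \<otimes> w \<in> G c (c / 2)" if "w \<in> U" "x \<in> carrier R" "N x <= c" for w x
   using G_scale[OF U[OF that(1)] that(2,3)] by simp
 qed (rule G_add)
 have reduce: "sm \<nu> \<in> G 1 (1 / 2)" if "set_mset \<nu> \<subseteq> {..<n}" for \<nu>
  using that
 proof (induction "size \<nu>" arbitrary: \<nu> rule: less_induct)
  case less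
  show ?case
  proof (cases "\<nu> \<subseteq># \<beta>")
   case True
   have "sm \<nu> \<in> Box" unfolding Box_def using True less.prems by blast
   thus ?thesis using lc_elem[OF za] Box(2) by (intro G_Box) auto
  next
   case False
   then obtain j where "\<not> count \<nu> j <= count \<beta> j" unfolding subseteq_mset_def by blast
   moreover from this have "j \<in># \<nu>" by (cases "j \<in># \<nu>") (auto simp: not_in_iff)
   ultimately have j: "j < n" "f j <= count \<nu> j" using less.prems \<beta>[of j] by auto
   define \<mu> where "\<mu> = \<nu> - replicate_mset (f j) j"
   have \<nu>: "\<nu> = \<mu> + replicate_mset (f j) j"
    unfolding \<mu>_def using j(2) by (simp add: count_le_replicate_mset_subset_eq)
   have \<mu>n: "set_mset \<mu> \<subseteq> {..<n}" using less.prems unfolding \<nu> by auto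
   have rn: "set_mset (replicate_mset i j) \<subseteq> {..<n}" for i using j(1) by auto
   obtain t l r where tlr: "t \<in> carrier R" "N t <= 1" "l \<in> lc {\<zero>} {sm (replicate_mset i j) | i. i < f j} 1"
    "r \<in> lc {\<zero>} SM (1 / 2)" "sm (replicate_mset (f j) j) = h t \<oplus> l \<oplus> r" using f(2)[OF j(1)] by blast
   have lsub: "{sm (replicate_mset i j) | i. i < f j} \<subseteq> carrier S" using sm(1)[OF rn] by auto
   have c: "h t \<in> carrier S" "l \<in> carrier S" "r \<in> carrier S" "sm \<mu> \<in> carrier S"
    using tlr(1) lc_carrier[OF tlr(3) _ lsub] SMS[OF tlr(4)] sm(1)[OF \<mu>n] by auto
   have "sm \<nu> = sm \<mu> \<otimes> (h t \<oplus> l \<oplus> r)" unfolding \<nu> sm(3)[OF \<mu>n rn] tlr(5) ..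
   also have "\<dots> = h t \<otimes> sm \<mu> \<oplus> sm \<mu> \<otimes> l \<oplus> sm \<mu> \<otimes> r" using c by algebra
   also have "\<dots> \<in> G 1 (1 / 2)"
   proof (intro G_add)
    have "size \<mu> < size \<nu>" using f(1)[OF j(1)] unfolding \<nu> by simp
    thus "h t \<otimes> sm \<mu> \<in> G 1 (1 / 2)" using G_scale[OF less.hyps[OF _ \<mu>n] tlr(1,2)] by simp
    have "sm \<mu> \<otimes> l \<in> lc {\<zero>} ((%w. sm \<mu> \<otimes> w) ` {sm (replicate_mset i j) | i. i < f j}) 1"
     by (rule lc_mult_right[OF tlr(3) zi lsub c(4)])
    hence "sm \<mu> \<otimes> l \<in> G 1 (1 / 2)"
    proof (rule G_combs)
     fix u assume "u \<in> (%w. sm \<mu> \<otimes> w) ` {sm (replicate_mset i j) | i. i < f j}"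
     then obtain i where i: "i < f j" "u = sm (\<mu> + replicate_mset i j)" using sm(3)[OF \<mu>n rn] by auto
     show "u \<in> G 1 (1 / 2)" unfolding i(2)
      by (rule less.hyps) (use i(1) \<mu>n rn in \<open>auto simp: \<nu> split: if_splits\<close>)
    qed
    thus "sm \<mu> \<otimes> l \<in> G 1 (1 / 2)" by simp
    have "(%w. sm \<mu> \<otimes> w) ` SM \<subseteq> SM"
    proof
     fix u assume "u \<in> (%w. sm \<mu> \<otimes> w) ` SM"
     then obtain \<kappa> where \<kappa>: "set_mset \<kappa> \<subseteq> {..<n}" "u = sm (\<mu> + \<kappa>)" using sm(3)[OF \<mu>n] by (auto simp: SM_def)
     thus "u \<in> SM" unfolding SM_def using \<mu>n by (intro image_eqI[of _ _ "\<mu> + \<kappa>"]) auto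
    qed
    hence "sm \<mu> \<otimes> r \<in> lc {\<zero>} SM (1 / 2)"
     using combs_mono[OF lc_mult_right[OF tlr(4) zi SM c(4)] order_refl _ order_refl] by blast
    thus "sm \<mu> \<otimes> r \<in> G 1 (1 / 2)" by (rule G_SM)
   qed
   finally show ?thesis .
  qed
 qed
 have split: "z \<in> G c (c / 2)" if "z \<in> lc {\<zero>} SM c" for z c
  by (rule G_combs[OF that]) (use reduce in \<open>auto simp: SM_def\<close>)
 obtain C where C: "0 < C" "!!x. x \<in> carrier R ==> M (h x) <= C * N x" using bound by blast
 have "y \<in> lc {\<zero>} Box (k * M y)" if y: "y \<in> carrier S" for y
 proof (cases "M y = 0")
  case True
  thus ?thesis using zl S.norm_eq_0_iff[OF y] by simp
 next
  case False
  define c0 where "c0 = k * M y"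
  have c0: "0 < c0" using False k S.norm_nonneg[OF y] by (simp add: c0_def less_le)
  define U where "U i = {u \<in> carrier S. \<forall>r>0. \<exists>l\<in>lc {\<zero>} SM (c0 * (1/2) ^ i). M (u \<ominus> l) <= r}" for i :: nat
  have "y \<in> lc {\<zero>} Box c0"
  proof (rule lc_successive_approximation[OF zi S.norm_closed_zero Box, where \<delta> = "1/2" and C = "C * c0 * D + 1" and U = U])
   show "0 <= c0" "0 <= C * c0 * D + 1" using c0 C(1) sm(4) by simp_all
   show "y \<in> U 0" unfolding U_def using dense[OF y] y by (auto simp: c0_def)
  next
   fix i u assume u: "u \<in> U i"
   have uS: "u \<in> carrier S" using u by (simp add: U_def)
   have "0 < (1/2::real) ^ i" by simp
   then obtain l where l: "l \<in> lc {\<zero>} SM (c0 * (1/2) ^ i)" "M (u \<ominus> l) <= (1/2) ^ i"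
    using u unfolding U_def by blast
   have lS: "l \<in> carrier S" by (rule SMS[OF l(1)])
   have "M l <= C * (c0 * (1/2) ^ i) * D"
    by (rule lc_norm[OF l(1) SM _ sm(4) C(2)]) (use C(1) c0 sm(2) in \<open>auto simp: SM_def\<close>)
   also have "\<dots> <= (C * c0 * D + 1) * (1/2) ^ i" by (simp add: distrib_right mult_ac)
   finally have "M ((u \<ominus> l) \<oplus> l) <= (C * c0 * D + 1) * (1/2) ^ i"
    using l(2) uS lS C(1) c0 sm(4) by (intro S.norm_add_le) (auto simp: distrib_right intro: add_increasing)
   thus "u \<in> carrier S & M u <= (C * c0 * D + 1) * (1/2) ^ i" using uS lS by simp
  next
   fix i u assume u: "u \<in> U i"
   have uS: "u \<in> carrier S" using u by (simp add: U_def)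
   define r0 where "r0 = c0 * (1/2) ^ Suc i / k"
   have r0: "0 < r0" using c0 k by (simp add: r0_def)
   then obtain l where l: "l \<in> lc {\<zero>} SM (c0 * (1/2) ^ i)" "M (u \<ominus> l) <= r0"
    using u unfolding U_def by blast
   obtain x where x: "l \<in> carrier S" "x \<in> lc {\<zero>} Box (c0 * (1/2) ^ i)" "l \<ominus> x \<in> lc {\<zero>} SM (c0 * (1/2) ^ Suc i)"
    using split[OF l(1)] unfolding G_def by auto
   have xS: "x \<in> carrier S" by (rule BoxS[OF x(2)])
   have "u \<ominus> x \<in> U (Suc i)" unfolding U_def
   proof (intro CollectI conjI allI impI)
    show "u \<ominus> x \<in> carrier S" using uS xS by simp
    fix r :: real assume "0 < r"
    then obtain l2 where l2: "l2 \<in> lc {\<zero>} SM (k * M (u \<ominus> l))" "M ((u \<ominus> l) \<ominus> l2) <= r"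
     using dense[of "u \<ominus> l" r] uS x(1) by auto
    have "k * M (u \<ominus> l) <= k * r0" using l(2) k by (intro mult_left_mono) auto
    hence "k * M (u \<ominus> l) <= c0 * (1/2) ^ Suc i" using k by (simp add: r0_def)
    hence l2': "l2 \<in> lc {\<zero>} SM (c0 * (1/2) ^ Suc i)" by (rule combs_mono[OF l2(1) order_refl order_refl])
    have l2S: "l2 \<in> carrier S" by (rule SMS[OF l2(1)])
    have "(u \<ominus> x) \<ominus> ((l \<ominus> x) \<oplus> l2) = (u \<ominus> l) \<ominus> l2" using uS xS x(1) l2S by algebra
    moreover have "(l \<ominus> x) \<oplus> l2 \<in> lc {\<zero>} SM (c0 * (1/2) ^ Suc i)" by (intro lc_add x(3) l2' za SM)
    ultimately show "\<exists>l\<in>lc {\<zero>} SM (c0 * (1/2) ^ Suc i). M ((u \<ominus> x) \<ominus> l) <= r"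
     using l2(2) by (intro bexI[of _ "(l \<ominus> x) \<oplus> l2"]) auto
   qed
   moreover have "u \<ominus> (u \<ominus> x) = x" using uS xS by (intro S.diff_diff_cancel)
   ultimately show "\<exists>u'\<in>U (Suc i). u \<ominus> u' \<in> lc {\<zero>} Box (c0 * (1/2) ^ i)" using x(2)
    by (intro bexI[of _ "u \<ominus> x"]) auto
  qed (auto)
  thus ?thesis by (simp add: c0_def)
 qed
 thus ?thesis using Box k by (intro exI[of _ Box] exI[of _ k]) auto
qed

end

section \<open>Algebras finite over an evaluation homomorphism\<close>

lemma banach_algebra_hom_comp:
 assumes "banach_algebra_hom K A B f" "banach_algebra_hom K B C g"
  and "!!x. x \<in> carrier B ==> 0 <= nrm B x"
 shows "banach_algebra_hom K A C (%x. g (f x))"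
proof -
 have fc: "f x \<in> carrier B" if "x \<in> carrier A" for x
  using assms(1) that by (auto simp: banach_algebra_hom_def ring_hom_def Pi_iff)
 obtain D where D: "!!x. x \<in> carrier A ==> nrm B (f x) <= D * nrm A x" using assms(1) unfolding banach_algebra_hom_def by blast
 obtain E where E: "!!x. x \<in> carrier B ==> nrm C (g x) <= E * nrm B x" using assms(2) unfolding banach_algebra_hom_def by blast
 have "nrm C (g (f x)) <= (max E 0 * D) * nrm A x" if x: "x \<in> carrier A" for x
 proof -
  have "E * nrm B (f x) <= max E 0 * nrm B (f x)" using assms(3)[OF fc[OF x]] by (intro mult_right_mono) auto
  also have "\<dots> <= max E 0 * (D * nrm A x)" using D[OF x] by (intro mult_left_mono) auto
  finally show ?thesis using E[OF fc[OF x]] by (simp add: mult_ac)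
 qed
 moreover have "(%x. g (f x)) \<in> ring_hom A C"
  using assms(1,2) fc by (auto simp: banach_algebra_hom_def ring_hom_def Pi_iff)
 ultimately show ?thesis using assms(1,2) fc unfolding banach_algebra_hom_def by auto
qed

context tate_field
begin

lemma nrm_tate: "nrm (tate n) = gnorm" by simp

lemma tate_hom:
 assumes "banach_algebra K v A" "banach_algebra_hom K (tate n) A f"
 shows "banach_hom (tate n) gnorm A (nrm A) f"
 using banach_algebra_hom_imp_banach_hom[OF tate_banach_algebra assms] unfolding nrm_tate .

lemma tate_hom_monom:
 assumes "banach_algebra_hom K (tate n) A f" "c \<in> carrier K" "set_mset a \<subseteq> {..<n}"
 shows "f (monom c a) = c \<odot>\<^sub>A f (monom \<one> a)"
proof -
 have "monom c a = c \<odot>\<^bsub>tate n\<^esub> monom \<one> a" using assms(2) by (auto simp: monom_def fun_eq_iff)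
 moreover have "monom \<one> a \<in> series n" by (rule monom_closed[OF one_closed assms(3)])
 ultimately show ?thesis using assms(1,2) unfolding banach_algebra_hom_def by metis
qed

lemma tate_hom_const:
 assumes A: "banach_algebra K v A" and f: "banach_algebra_hom K (tate n) A f" and c: "c \<in> carrier K" and y: "y \<in> carrier A"
 shows "f (monom c {#}) \<otimes>\<^sub>A y = c \<odot>\<^sub>A y"
proof -
 interpret A: banach_ring A "nrm A" by (rule banach_algebra_imp_banach_ring[OF A])
 have "f (monom c {#}) = c \<odot>\<^sub>A f (monom \<one> {#})" by (rule tate_hom_monom[OF f c]) simp
 moreover have "monom \<one> {#} = \<one>\<^bsub>tate n\<^esub>" by (auto simp: monom_def fun_eq_iff)
 moreover have "f \<one>\<^bsub>tate n\<^esub> = \<one>\<^sub>A" using f unfolding banach_algebra_hom_def by (simp add: ring_hom_one del: tate_simps)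
 ultimately have e: "f (monom c {#}) = c \<odot>\<^sub>A \<one>\<^sub>A" by (simp only:)
 have "algebra K A" using A by (simp add: banach_algebra_def)
 hence "(c \<odot>\<^sub>A \<one>\<^sub>A) \<otimes>\<^sub>A y = c \<odot>\<^sub>A (\<one>\<^sub>A \<otimes>\<^sub>A y)" using c y by (intro algebra.smult_assoc2) auto
 thus ?thesis using e y by simp
qed

lemma tate_hom_unique:
 assumes A: "banach_algebra K v A" and f: "banach_algebra_hom K (tate n) A f" and g: "banach_algebra_hom K (tate n) A g"
  and eq: "!!i. i < n ==> f (monom \<one> {#i#}) = g (monom \<one> {#i#})" and h: "h \<in> series n"
 shows "f h = g h"
proof -
 interpret f: banach_hom "tate n" gnorm A "nrm A" f by (rule tate_hom[OF A f])
 interpret g: banach_hom "tate n" gnorm A "nrm A" g by (rule tate_hom[OF A g])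
 have mono: "set_mset a \<subseteq> {..<n} ==> f (monom \<one> a) = g (monom \<one> a)" for a
 proof (induction a)
  case empty
  have "monom \<one> {#} = \<one>\<^bsub>tate n\<^esub>" by (auto simp: monom_def fun_eq_iff)
  thus ?case using f.hom_one g.hom_one by (simp only:)
 next
  case (add i a)
  have c: "monom \<one> {#i#} \<in> series n" "monom \<one> a \<in> series n"
   using add.prems by (intro monom_closed one_closed; simp)+
  have "monom \<one> {#i#} *\<^sub>n monom \<one> a = monom \<one> (add_mset i a)"
   using monom_monom_mult[OF one_closed one_closed, of a n "{#i#}"] add.prems by simp
  moreover have "f (monom \<one> {#i#} *\<^sub>n monom \<one> a) = g (monom \<one> {#i#} *\<^sub>n monom \<one> a)"
   unfolding f.hom_mult[OF c] g.hom_mult[OF c] using add eq[of i] by simp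
  ultimately show ?case by (simp only:)
 qed
 obtain C where C: "!!x. x \<in> series n ==> nrm A (f x) <= C * gnorm x" using f.bound by blast
 obtain C' where C': "!!x. x \<in> series n ==> nrm A (g x) <= C' * gnorm x" using g.bound by blast
 show ?thesis
 proof (rule additive_map_unique[OF banach_algebra_imp_banach_ring[OF A] _ _ C _ _ C' _ h])
  show "f (monom c a) = g (monom c a)" if "c \<in> carrier K" "set_mset a \<subseteq> {..<n}" for c a
   unfolding tate_hom_monom[OF f that] tate_hom_monom[OF g that] mono[OF that(2)] ..
 qed (simp_all del: tate_simps)
qed

lemma tate_hom_restrict:
 assumes f: "banach_algebra_hom K (tate n') A f" and n: "n <= n'" shows "banach_algebra_hom K (tate n) A f"
proof -
 have ops: "x *\<^sub>n y = x *\<^sub>n' y" "x +\<^sub>n y = x +\<^sub>n' y" "\<one>\<^bsub>tate n\<^esub> = \<one>\<^bsub>tate n'\<^esub>"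
  "c \<odot>\<^bsub>tate n\<^esub> x = c \<odot>\<^bsub>tate n'\<^esub> x" "nrm (tate n) x = nrm (tate n') x" for c x y
  unfolding tate_algebra_def by (rule refl | simp only: monoid.simps ring.simps module.simps normed_module.simps)+
 note mono = tate_mono[OF _ n]
 have hom: "f \<in> ring_hom (tate n') A" using f unfolding banach_algebra_hom_def by blast
 have "f \<in> ring_hom (tate n) A"
  by (rule ring_hom_memI) (unfold ops, auto dest!: mono simp: ring_hom_closed[OF hom] ring_hom_mult[OF hom]
    ring_hom_add[OF hom] ring_hom_one[OF hom] simp del: tate_simps)
 moreover obtain C where "\<forall>x\<in>series n'. nrm A (f x) <= C * nrm (tate n') x"
  using f unfolding banach_algebra_hom_def by blast
 hence "\<forall>x\<in>series n. nrm A (f x) <= C * nrm (tate n) x" unfolding ops using mono by blast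
 moreover have "\<forall>c\<in>carrier K. \<forall>x\<in>series n. f (c \<odot>\<^bsub>tate n\<^esub> x) = c \<odot>\<^sub>A f x"
  using f mono unfolding banach_algebra_hom_def ops by blast
 ultimately show ?thesis unfolding banach_algebra_hom_def by blast
qed

text \<open>
 Truncate the power series. Constants act through \<open>\<theta>\<close>.
\<close>

lemma monomials_dense:
 assumes C: "banach_algebra K v C" and \<theta>: "banach_algebra_hom K (tate p) C \<theta>" and \<sigma>: "banach_algebra_hom K (tate n) C \<sigma>"
  and f: "f \<in> series n" and r: "0 < r"
 shows "\<exists>l\<in>combs (tate p) gnorm C \<theta> {\<zero>\<^sub>C} ((%\<nu>. \<sigma> (monom \<one> \<nu>)) ` {\<nu>. set_mset \<nu> \<subseteq> {..<n}}) (gnorm f).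
  nrm C (\<sigma> f \<ominus>\<^sub>C l) <= r"
proof -
 interpret s: banach_hom "tate n" gnorm C "nrm C" \<sigma> by (rule tate_hom[OF C \<sigma>])
 interpret t: banach_hom "tate p" gnorm C "nrm C" \<theta> by (rule tate_hom[OF C \<theta>])
 let ?SM = "(%\<nu>. \<sigma> (monom \<one> \<nu>)) ` {\<nu>. set_mset \<nu> \<subseteq> {..<n}}"
 have mc: "monom \<one> \<nu> \<in> series n" if "set_mset \<nu> \<subseteq> {..<n}" for \<nu> by (rule monom_closed[OF one_closed that])
 have SM: "?SM \<subseteq> carrier C" using s.hom_closed[OF mc] by blast
 note za = ideal.axioms(1)[OF s.S.zeroideal]
 obtain D where D: "0 < D" "!!x. x \<in> series n ==> nrm C (\<sigma> x) <= D * gnorm x" using s.bound by blast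
 define A where "A = {m. r / D <= v (f m)}"
 have rD: "0 < r / D" using r D by simp
 have A: "finite A" unfolding A_def by (rule tate_finite[OF f rD])
 have cc: "cut A f \<in> series n" by (rule cut_closed[OF f])
 have "cut A f \<in> {g \<in> series n. \<sigma> g \<in> t.lc {\<zero>\<^sub>C} ?SM (gnorm f)}"
 proof (rule cut_induct[OF A f])
  show "\<zero>\<^bsub>tate n\<^esub> \<in> {g \<in> series n. \<sigma> g \<in> t.lc {\<zero>\<^sub>C} ?SM (gnorm f)}"
   using s.hom_zero T.zero_closed[of n] by (auto intro: combs.base simp del: tate_simps)
 next
  fix a b assume ab: "a \<in> {g \<in> series n. \<sigma> g \<in> t.lc {\<zero>\<^sub>C} ?SM (gnorm f)}"
   "b \<in> {g \<in> series n. \<sigma> g \<in> t.lc {\<zero>\<^sub>C} ?SM (gnorm f)}"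
  hence "\<sigma> (a +\<^sub>n b) = \<sigma> a \<oplus>\<^sub>C \<sigma> b" by (intro s.hom_add) auto
  moreover have "\<sigma> a \<oplus>\<^sub>C \<sigma> b \<in> t.lc {\<zero>\<^sub>C} ?SM (gnorm f)" using ab by (intro t.lc_add za SM) auto
  moreover have "a +\<^sub>n b \<in> series n" using ab by (intro T.a_closed) auto
  ultimately show "a +\<^sub>n b \<in> {g \<in> series n. \<sigma> g \<in> t.lc {\<zero>\<^sub>C} ?SM (gnorm f)}"
   by (simp del: tate_simps)
 next
  fix m assume m: "set_mset m \<subseteq> {..<n}"
  have fm: "f m \<in> carrier K" by (rule tate_coeff[OF f])
  have "\<sigma> (monom (f m) m) = \<theta> (monom (f m) {#}) \<otimes>\<^sub>C \<sigma> (monom \<one> m)"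
   unfolding tate_hom_const[OF C \<theta> fm s.hom_closed[OF mc[OF m]]] by (rule tate_hom_monom[OF \<sigma> fm m])
  also have "\<dots> \<in> t.lc {\<zero>\<^sub>C} ?SM (gnorm f)"
  proof (rule t.lc_single[OF za _ s.hom_closed[OF mc[OF m]]])
   show "monom (f m) {#} \<in> series p" by (intro monom_closed fm) simp
   show "gnorm (monom (f m) {#}) <= gnorm f" unfolding gnorm_monom[OF fm] by (rule coeff_le_gnorm[OF f])
  qed (use m in blast)
  finally show "monom (f m) m \<in> {g \<in> series n. \<sigma> g \<in> t.lc {\<zero>\<^sub>C} ?SM (gnorm f)}"
   using monom_closed[OF fm m] by blast
 qed
 hence l: "\<sigma> (cut A f) \<in> t.lc {\<zero>\<^sub>C} ?SM (gnorm f)" by blast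
 have "gnorm (f -\<^sub>n cut A f) <= r / D" by (rule gnorm_cut_le[OF f]) (use rD in \<open>auto simp: A_def\<close>)
 hence "D * gnorm (f -\<^sub>n cut A f) <= r" using D(1) by (simp add: field_simps)
 moreover have "\<sigma> (f -\<^sub>n cut A f) = \<sigma> f \<ominus>\<^sub>C \<sigma> (cut A f)"
  using f cc by (simp add: a_minus_def del: tate_simps)
 ultimately have "nrm C (\<sigma> f \<ominus>\<^sub>C \<sigma> (cut A f)) <= r"
  using D(2)[OF T.minus_closed[OF f cc]] by simp
 thus ?thesis using l by blast
qed

lemma exists_small_scalar:
 assumes nontrivial: "\<exists>c\<in>carrier K. c ~= \<zero> & v c ~= 1" and e: "0 < e"
 shows "\<exists>a\<in>carrier K. a ~= \<zero> & v a <= e"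
proof -
 obtain c0 where c0: "c0 \<in> carrier K" "c0 ~= \<zero>" "v c0 ~= 1" using nontrivial by blast
 have p0: "0 < v c0" using c0 norm_nonneg[of c0] norm_eq_0_iff[of c0] by (simp add: less_le)
 have u0: "c0 \<in> Units K" using c0 by (simp add: field_Units)
 have "\<exists>c\<in>carrier K. c ~= \<zero> & 0 < v c & v c < 1"
 proof (cases "v c0 < 1")
  case True thus ?thesis using c0 p0 by blast
 next
  case False
  have i: "inv c0 \<in> carrier K" "inv c0 \<otimes> c0 = \<one>" using u0 by simp_all
  hence "v (inv c0) * v c0 = 1" using val_mult[OF i(1) c0(1)] by simp
  moreover have "1 < v c0" using False c0(3) by simp
  ultimately have "v (inv c0) = 1 / v c0" using p0 by (simp add: field_simps)
  moreover from this have "inv c0 ~= \<zero>" using p0 norm_eq_0_iff[OF i(1)] by auto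
  ultimately show ?thesis using i(1) \<open>1 < v c0\<close> by (intro bexI[of _ "inv c0"]) auto
 qed
 then obtain c where c: "c \<in> carrier K" "c ~= \<zero>" "0 < v c" "v c < 1" by blast
 have vp: "v (c [^] N) = v c ^ N" for N :: nat
  by (induction N) (use c(1) in \<open>simp_all add: val_mult mult.commute\<close>)
 obtain N where N: "v c ^ N < e" using real_arch_pow_inv[OF e c(4)] by blast
 have "c [^] N ~= \<zero>" using vp[of N] c(3) norm_eq_0_iff[of "c [^] N"] c(1) by auto
 thus ?thesis using N vp[of N] c(1) by (intro bexI[of _ "c [^] N"]) auto
qed

end

context tate_eval
begin

text \<open>
 The module generators, scaled into the unit ball, become values of additional variables. This uses a
 nontrivial scalar.
\<close>

theorem affinoid_if_finite:
 assumes nontrivial: "\<exists>c\<in>carrier K. c ~= \<zero> & v c ~= 1"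
  and W: "finite W" "W \<subseteq> carrier C" and k: "0 <= k"
  and gen: "!!y. y \<in> carrier C ==> y \<in> combs (tate n) gnorm C ev {\<zero>\<^sub>C} W (k * nrm C y)"
 shows "affinoid_algebra K v C"
proof -
 define D where "D = Max (insert 1 (nrm C ` W))"
 have D: "1 <= D" "!!w. w \<in> W ==> nrm C w <= D" using W(1) by (auto simp: D_def)
 have "0 < 1 / D" using D by simp
 from exists_small_scalar[OF nontrivial this]
 obtain a where a: "a \<in> carrier K" "a ~= \<zero>" "v a <= 1 / D" by blast
 have "a \<in> Units K" using a by (simp add: field_Units)
 hence ai: "inv a \<in> carrier K" "inv a \<otimes> a = \<one>" by simp_all
 obtain e where e: "bij_betw e {0..<card W} W" using ex_bij_betw_nat_finite[OF W(1)] by blast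
 define q where "q = card W"
 have eW: "e i \<in> W" if "i < q" for i using e that by (auto simp: bij_betw_def q_def)
 have eC: "e i \<in> carrier C" if "i < q" for i using eW[OF that] W(2) by blast
 define x' where "x' i = (if i < n then x i else a \<odot>\<^sub>C e (i - n))" for i
 have x': "x' i \<in> carrier C" if "i < n + q" for i using that x a eC by (auto simp: x'_def)
 have small: "nrm C (x' (n + i) [^]\<^sub>C (l::nat)) <= 1" if i: "i < q" for i l
 proof (rule C.norm_pow_le_one)
  show "x' (n + i) \<in> carrier C" using x'[of "n + i"] i by simp
  have "v a * nrm C (e i) <= (1 / D) * D"
   using a D eW[OF i] C.norm_nonneg[OF eC[OF i]] norm_nonneg[OF a(1)] by (intro mult_mono) auto
  thus "nrm C (x' (n + i)) <= 1" using a(1) eC[OF i] D(1) by (simp add: x'_def norm_smult)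
 qed
 have pb: "i <= q ==> nrm C (power_product C (n + i) x' m) <= B" for i m
 proof (induction i)
  case 0
  have "power_product C n x' m = power_product C n x m"
   unfolding power_product_def using x by (intro C.finprod_cong') (auto simp: x'_def)
  thus ?case using B(1) by simp
 next
  case (Suc i)
  have c: "x' j \<in> carrier C" if "j < Suc (n + i)" for j using x'[of j] that Suc.prems by simp
  have "power_product C (Suc (n + i)) x' m = x' (n + i) [^]\<^sub>C count m (n + i) \<otimes>\<^sub>C power_product C (n + i) x' m"
   unfolding power_product_def lessThan_Suc using c by (subst C.finprod_insert) (auto simp: Pi_iff)
  moreover have "nrm C (x' (n + i) [^]\<^sub>C count m (n + i) \<otimes>\<^sub>C power_product C (n + i) x' m) <= 1 * B"
   using Suc c small[of i] by (intro C.norm_mult_bound C.power_product_closed) auto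
  ultimately show ?case by simp
 qed
 interpret E': tate_eval K v C "n + q" x' B
  by (intro tate_eval.intro tate_eval_axioms.intro tate_field_axioms alg x' pb B(2)) auto
 have hom': "banach_algebra_hom K (tate (n + q)) C E'.ev" by (rule E'.ev_algebra_hom)
 interpret h: banach_hom "tate (n + q)" gnorm C "nrm C" E'.ev by (rule E'.ev_banach_hom)
 have ext: "E'.ev f = ev f" if f: "f \<in> series n" for f
 proof (rule tate_hom_unique[OF alg tate_hom_restrict[OF hom'] ev_algebra_hom _ f])
  fix i assume i: "i < n"
  thus "E'.ev (monom \<one> {#i#}) = ev (monom \<one> {#i#})" using E'.ev_var[of i] ev_var[of i] by (simp add: x'_def)
 qed simp
 define L where "L = max 1 (v (inv a))"
 have lift: "\<exists>F\<in>series (n + q). E'.ev F = z & gnorm F <= c * L"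
  if "z \<in> combs (tate n) gnorm C ev {\<zero>\<^sub>C} W c" "0 <= c" for z c
  using that(1)
 proof induction
  case (base j)
  have "gnorm \<zero>\<^bsub>tate (n + q)\<^esub> <= c * L" using gnorm_zero that(2) by (simp add: L_def)
  thus ?case using base h.hom_zero by (intro bexI[of _ "\<zero>\<^bsub>tate (n + q)\<^esub>"] T.zero_closed) (simp_all del: tate_simps)
 next
  case (step z w g)
  then obtain F where F: "F \<in> series (n + q)" "E'.ev F = z" "gnorm F <= c * L" by blast
  have "w \<in> e ` {0..<q}" using e step(2) by (simp add: bij_betw_def q_def)
  then obtain i where i: "i < q" "w = e i" by auto
  have g': "g \<in> series (n + q)" by (rule tate_mono[OF step(3)]) simp
  define X where "X = monom (inv a) {#n + i#}"
  have X: "X \<in> series (n + q)" unfolding X_def by (intro monom_closed ai) (use i in auto)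
  have "E'.ev X = inv a \<odot>\<^sub>C x' (n + i)"
   unfolding X_def using tate_hom_monom[OF hom' ai(1), of "{#n + i#}"] E'.ev_var[of "n + i"] i by simp
  also have "\<dots> = w" using i eC[OF i(1)] a(1) ai M.smult_assoc1[of "inv a" a "e i"] by (simp add: x'_def)
  finally have Xw: "E'.ev X = w" .
  have gX: "g *\<^sub>(n + q) X \<in> series (n + q)" by (rule T.m_closed[OF g' X])
  have "E'.ev (F +\<^sub>(n + q) g *\<^sub>(n + q) X) = z \<oplus>\<^sub>C ev g \<otimes>\<^sub>C w"
   unfolding h.hom_add[OF F(1) gX] h.hom_mult[OF g' X] F(2) Xw ext[OF step(3)] ..
  moreover have "gnorm (F +\<^sub>(n + q) g *\<^sub>(n + q) X) <= c * L"
  proof (rule T.norm_add_le[OF F(1) gX F(3)])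
   show "gnorm (g *\<^sub>(n + q) X) <= c * L"
    by (rule T.norm_mult_bound[OF g' X step(4)]) (simp add: X_def gnorm_monom[OF ai(1)] L_def)
  qed
  ultimately show ?case using T.a_closed[OF F(1) gX] by blast
 qed
 have lifts: "\<exists>F\<in>series (n + q). E'.ev F = y & nrm (tate (n + q)) F <= (k * L + 1) * nrm C y" if y: "y \<in> carrier C" for y
 proof -
  have y0: "0 <= nrm C y" by (rule C.norm_nonneg[OF y])
  obtain F where F: "F \<in> series (n + q)" "E'.ev F = y" "gnorm F <= (k * nrm C y) * L"
   using lift[OF gen[OF y]] k y0 by auto
  have "(k * nrm C y) * L <= (k * L + 1) * nrm C y" using y0 by (simp add: algebra_simps)
  hence "gnorm F <= (k * L + 1) * nrm C y" using F(3) by linarith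
  thus ?thesis using F unfolding nrm_tate by blast
 qed
 obtain C' where C': "0 < C'" "!!f. f \<in> series (n + q) ==> nrm C (E'.ev f) <= C' * gnorm f" using h.bound by blast
 have "admissible_surjection (tate (n + q)) C E'.ev"
 proof (rule admissible_surjectionI)
  show "E'.ev ` series (n + q) = carrier C"
  proof
   show "E'.ev ` series (n + q) \<subseteq> carrier C" using h.hom_closed by blast
   show "carrier C \<subseteq> E'.ev ` series (n + q)" using lifts by blast
  qed
  show "0 <= nrm (tate (n + q)) f" if "f \<in> series (n + q)" for f unfolding nrm_tate by (rule gnorm_nonneg[OF that])
  show "0 < C'" by (rule C')
  show "nrm C (E'.ev f) <= C' * nrm (tate (n + q)) f" if "f \<in> series (n + q)" for f unfolding nrm_tate by (rule C'(2)[OF that])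
  show "0 < k * L + 1" using k by (simp add: L_def add_nonneg_pos)
  show "\<exists>x\<in>series (n + q). E'.ev x = y & nrm (tate (n + q)) x <= (k * L + 1) * nrm C y" if "y \<in> carrier C" for y
   by (rule lifts[OF that])
 qed
 thus ?thesis unfolding affinoid_algebra_def using alg hom'
  by (intro conjI exI[of _ "n + q"] exI[of _ "%_. 1"] exI[of _ E'.ev]) auto
qed

end

section \<open>Affinoid fiber products\<close>

lemma fiber_product_projections:
 assumes A: "banach_algebra K v A" and B: "banach_algebra K v B"
 shows "banach_algebra_hom K (fiber_product A B \<phi> \<psi>) A fst" "banach_algebra_hom K (fiber_product A B \<phi> \<psi>) B snd"
proof -
 interpret A: banach_ring A "nrm A" by (rule banach_algebra_imp_banach_ring[OF A])
 interpret B: banach_ring B "nrm B" by (rule banach_algebra_imp_banach_ring[OF B])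
 show "banach_algebra_hom K (fiber_product A B \<phi> \<psi>) A fst" "banach_algebra_hom K (fiber_product A B \<phi> \<psi>) B snd"
  unfolding banach_algebra_hom_def ring_hom_def by (auto intro!: exI[of _ 1])
qed

text \<open>
 Combinations lift along \<open>g\<close> with the same coefficients.
\<close>

lemma (in banach_hom) lc_lift:
 assumes g: "ring_hom_cring C S g" and U: "U \<subseteq> carrier C" and k: "!!x. x \<in> carrier R ==> k x \<in> carrier C & g (k x) = h x"
  and y: "y \<in> lc {\<zero>} (g ` U) c"
 shows "\<exists>x\<in>combs R N C k {\<zero>\<^sub>C} U c. x \<in> carrier C & g x = y"
proof -
 interpret g: ring_hom_cring C S g by (rule g)
 from y show ?thesis
 proof induction
  case (base j)
  thus ?case by (intro bexI[of _ "\<zero>\<^sub>C"] combs.base) auto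
 next
  case (step z w x)
  then obtain z' u where z': "z' \<in> combs R N C k {\<zero>\<^sub>C} U c" "z' \<in> carrier C" "g z' = z" "u \<in> U" "w = g u" by blast
  have "z' \<oplus>\<^sub>C k x \<otimes>\<^sub>C u \<in> combs R N C k {\<zero>\<^sub>C} U c" by (rule combs.step[OF z'(1,4) step(3,4)])
  moreover have "u \<in> carrier C" using z'(4) U by blast
  ultimately show ?case using z' k[OF step(3)] by (intro bexI[of _ "z' \<oplus>\<^sub>C k x \<otimes>\<^sub>C u"]) auto
 qed
qed

context tate_field
begin

lemma strictly_affinoid_presentation:
 assumes "strictly_affinoid_algebra K v A"
 shows "\<exists>n \<sigma> k. banach_algebra_hom K (tate n) A \<sigma> & 0 <= k &
  (\<forall>y\<in>carrier A. \<exists>f\<in>series n. \<sigma> f = y & gnorm f <= k * nrm A y)"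
proof -
 have A: "banach_algebra K v A" using assms by (simp add: strictly_affinoid_algebra_def)
 obtain n \<sigma> where \<sigma>: "banach_algebra_hom K (tate n) A \<sigma>" "admissible_surjection (tate n) A \<sigma>"
  using assms unfolding strictly_affinoid_algebra_def by blast
 interpret s: banach_hom "tate n" gnorm A "nrm A" \<sigma> by (rule tate_hom[OF A \<sigma>(1)])
 have "\<exists>k\<ge>0. \<forall>y\<in>carrier A. \<exists>f\<in>series n. \<sigma> f = y & nrm (tate n) f <= k * nrm A y"
 proof (rule admissible_surjection_lift[OF \<sigma>(2), of "\<zero>\<^bsub>tate n\<^esub>"])
  show "0 <= nrm (tate n) f" if "f \<in> series n" for f unfolding nrm_tate by (rule gnorm_nonneg[OF that])
  show "nrm (tate n) \<zero>\<^bsub>tate n\<^esub> = 0" using gnorm_zero by simp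
  show "y = \<sigma> \<zero>\<^bsub>tate n\<^esub>" if "y \<in> carrier A" "nrm A y <= 0" for y
   using that s.S.norm_nonneg[of y] s.S.norm_eq_0_iff[of y] s.hom_zero by (simp del: tate_simps)
 qed (rule T.zero_closed)
 thus ?thesis unfolding nrm_tate using \<sigma>(1) by blast
qed

text \<open>
 An algebra is finite over a Tate algebra that maps onto it.
\<close>

lemma spectral_power_bounded:
 assumes sA: "strictly_affinoid_algebra K v A" and a: "a \<in> spectral_unit_ball A"
 shows "\<exists>B. \<forall>k::nat. nrm A (a [^]\<^sub>A k) <= B"
proof -
 have A: "banach_algebra K v A" using sA by (simp add: strictly_affinoid_algebra_def)
 interpret A: banach_ring A "nrm A" by (rule banach_algebra_imp_banach_ring[OF A])
 have aA: "a \<in> carrier A" "lim (%n. root n (nrm A (a [^]\<^sub>A n))) <= 1"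
  using a by (auto simp: spectral_unit_ball_def spectral_seminorm_def)
 obtain n \<sigma> k where \<sigma>: "banach_algebra_hom K (tate n) A \<sigma>" "0 <= k"
  "!!y. y \<in> carrier A ==> \<exists>f\<in>series n. \<sigma> f = y & gnorm f <= k * nrm A y"
  using strictly_affinoid_presentation[OF sA] by blast
 interpret s: banach_hom "tate n" gnorm A "nrm A" \<sigma> by (rule tate_hom[OF A \<sigma>(1)])
 have SN: "A.strictly_noetherian" by (rule s.strictly_noetherian_image[OF tate_strictly_noetherian \<sigma>(3,2)])
 have fin: "s.finite_mod {\<zero>\<^sub>A}" unfolding s.finite_mod_def
 proof (intro exI conjI ballI)
  fix y assume y: "y \<in> carrier A"
  obtain f where f: "f \<in> series n" "\<sigma> f = y" "gnorm f <= k * nrm A y" using \<sigma>(3)[OF y] by blast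
  have "\<sigma> f \<otimes>\<^sub>A \<one>\<^sub>A \<in> s.lc {\<zero>\<^sub>A} {\<one>\<^sub>A} (k * nrm A y)"
   by (rule s.lc_single[OF ideal.axioms(1)[OF A.zeroideal] _ _ f(1,3)]) auto
  thus "y \<in> s.lc {\<zero>\<^sub>A} {\<one>\<^sub>A} (k * nrm A y)" using f(2) y by simp
 qed (use \<sigma>(2) in auto)
 have "A.power_bounded_mod {\<zero>\<^sub>A} a"
  using finite_over_tate[OF SN aA(1) tate_hom[OF A \<sigma>(1)] A.zeroideal fin A.growth_of_spectral[OF aA]] by blast
 thus ?thesis unfolding A.power_bounded_mod_def using aA(1) by (auto simp: A.minus_eq)
qed

theorem fiber_product_affinoid:
 fixes A :: "('k, 'a) normed_module" and B :: "('k, 'b) normed_module" and B' :: "('k, 'c) normed_module"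
 assumes nontrivial: "\<exists>c\<in>carrier K. c ~= \<zero> & v c ~= 1"
  and sA: "strictly_affinoid_algebra K v A" and sB: "strictly_affinoid_algebra K v B"
  and sB': "strictly_affinoid_algebra K v B'"
  and \<psi>: "banach_algebra_hom K B' B \<psi>" and \<phi>: "banach_algebra_hom K A B \<phi>"
  and fin: "finite_admissible B' B \<psi>" and surj: "\<phi> ` carrier A = carrier B"
  and ball: "\<psi> ` spectral_unit_ball B' \<subseteq> \<phi> ` spectral_unit_ball A"
 shows "affinoid_algebra K v (fiber_product A B' \<phi> \<psi>)"
proof -
 have bA: "banach_algebra K v A" and bB: "banach_algebra K v B" and bB': "banach_algebra K v B'"
  using sA sB sB' by (auto simp: strictly_affinoid_algebra_def)
 interpret A: banach_ring A "nrm A" by (rule banach_algebra_imp_banach_ring[OF bA])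
 interpret B: banach_ring B "nrm B" by (rule banach_algebra_imp_banach_ring[OF bB])
 interpret B': banach_ring B' "nrm B'" by (rule banach_algebra_imp_banach_ring[OF bB'])
 obtain n \<sigma> kA where \<sigma>: "banach_algebra_hom K (tate n) A \<sigma>" "0 <= kA"
  "!!y. y \<in> carrier A ==> \<exists>f\<in>series n. \<sigma> f = y & gnorm f <= kA * nrm A y"
  using strictly_affinoid_presentation[OF sA] by blast
 obtain m \<sigma>' kB' where \<sigma>': "banach_algebra_hom K (tate m) B' \<sigma>'" "0 <= kB'"
  "!!y. y \<in> carrier B' ==> \<exists>f\<in>series m. \<sigma>' f = y & gnorm f <= kB' * nrm B' y"
  using strictly_affinoid_presentation[OF sB'] by blast
 obtain p \<tau> kB where \<tau>: "banach_algebra_hom K (tate p) B \<tau>" "0 <= kB"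
  "!!y. y \<in> carrier B ==> \<exists>f\<in>series p. \<tau> f = y & gnorm f <= kB * nrm B y"
  using strictly_affinoid_presentation[OF sB] by blast
 interpret s: banach_hom "tate n" gnorm A "nrm A" \<sigma> by (rule tate_hom[OF bA \<sigma>(1)])
 interpret s': banach_hom "tate m" gnorm B' "nrm B'" \<sigma>' by (rule tate_hom[OF bB' \<sigma>'(1)])
 interpret \<phi>: banach_hom A "nrm A" B "nrm B" \<phi> by (rule banach_algebra_hom_imp_banach_hom[OF bA bB \<phi>])
 interpret \<psi>: banach_hom B' "nrm B'" B "nrm B" \<psi> by (rule banach_algebra_hom_imp_banach_hom[OF bB' bB \<psi>])
 have SNA: "A.strictly_noetherian" by (rule s.strictly_noetherian_image[OF tate_strictly_noetherian \<sigma>(3,2)])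
 have SNB: "B.strictly_noetherian"
  by (rule banach_hom.strictly_noetherian_image[OF tate_hom[OF bB \<tau>(1)] tate_strictly_noetherian \<tau>(3,2)])
 define F where "F = fiber_product A B' \<phi> \<psi>"
 have bF: "banach_algebra K v F" unfolding F_def by (rule fiber_product_banach_algebra[OF bA bB' bB \<phi> \<psi>])
 interpret F: banach_ring F "nrm F" by (rule banach_algebra_imp_banach_ring[OF bF])
 have cF: "(a, b) \<in> carrier F \<longleftrightarrow> a \<in> carrier A & b \<in> carrier B' & \<phi> a = \<psi> b" for a b by (simp add: F_def)
 have nF: "nrm F (a, b) = max (nrm A a) (nrm B' b)" for a b by (simp add: F_def)
 have aF: "(a, b) \<oplus>\<^sub>F (a', b') = (a \<oplus>\<^sub>A a', b \<oplus>\<^sub>B' b')" and mF: "(a, b) \<otimes>\<^sub>F (a', b') = (a \<otimes>\<^sub>A a', b \<otimes>\<^sub>B' b')"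
  and oF: "\<one>\<^sub>F = (\<one>\<^sub>A, \<one>\<^sub>B')" and zF: "\<zero>\<^sub>F = (\<zero>\<^sub>A, \<zero>\<^sub>B')" for a b a' b' by (simp_all add: F_def)
 have pr1: "banach_algebra_hom K F A fst" and pr2: "banach_algebra_hom K F B' snd"
  unfolding F_def by (rule fiber_product_projections[OF bA bB'])+
 note zA = ideal.axioms(1)[OF A.zeroideal] and zB = ideal.axioms(1)[OF B.zeroideal]
 have var: "monom \<one> {#i#} \<in> series l" if "i < l" for i l using that by (intro monom_closed one_closed) simp
 have mon: "monom \<one> \<nu> \<in> series l" if "set_mset \<nu> \<subseteq> {..<l}" for \<nu> l by (rule monom_closed[OF one_closed that])
 have var1: "gnorm (monom \<one> a) = 1" for a using gnorm_monom[OF one_closed, of a] by simp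

 \<comment> \<open>lifting the generators of \<open>B'\<close> to power-bounded elements of \<open>A\<close>\<close>
 define b where "b i = \<sigma>' (monom \<one> {#i#})" for i
 have bC: "b i \<in> carrier B'" if "i < m" for i unfolding b_def by (rule s'.hom_closed[OF var[OF that]])
 obtain D' where D': "0 < D'" "!!f. f \<in> series m ==> nrm B' (\<sigma>' f) <= D' * gnorm f" using s'.bound by blast
 have ball_bound: "nrm B' (\<sigma>' f) <= D'" if "f \<in> series m" "gnorm f <= 1" for f
 proof -
  have "D' * gnorm f <= D' * 1" using that(2) D'(1) by (intro mult_left_mono) auto
  thus ?thesis using D'(2)[OF that(1)] by simp
 qed
 have b_pow: "nrm B' (b i [^]\<^sub>B' (l::nat)) <= D'" if i: "i < m" for i l
 proof -
  have "b i [^]\<^sub>B' l = \<sigma>' (monom \<one> {#i#} [^]\<^bsub>tate m\<^esub> l)" unfolding b_def by (rule s'.hom_pow[OF var[OF i], symmetric])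
  moreover have "gnorm (monom \<one> {#i#} [^]\<^bsub>tate m\<^esub> l) <= 1" by (rule T.norm_pow_le_one[OF var[OF i]]) (simp add: var1)
  ultimately show ?thesis using ball_bound[OF T.nat_pow_closed[OF var[OF i]]] by simp
 qed
 have "\<exists>a. \<forall>i\<in>{..<m}. a i \<in> spectral_unit_ball A & \<phi> (a i) = \<psi> (b i)"
 proof (intro bchoice ballI)
  fix i assume "i \<in> {..<m}"
  hence i: "i < m" by simp
  have "b i \<in> spectral_unit_ball B'" unfolding spectral_unit_ball_def spectral_seminorm_def
   using B'.spectral_of_power_bounded[OF bC[OF i] b_pow[OF i]] bC[OF i] by blast
  thus "\<exists>y. y \<in> spectral_unit_ball A & \<phi> y = \<psi> (b i)" using ball by (metis (no_types, lifting) image_iff subsetD imageI)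
 qed
 then obtain a where a: "!!i. i < m ==> a i \<in> spectral_unit_ball A" "!!i. i < m ==> \<phi> (a i) = \<psi> (b i)" by blast
 have aC: "a i \<in> carrier A" if "i < m" for i using a(1)[OF that] by (simp add: spectral_unit_ball_def)
 have abF: "(a i, b i) \<in> carrier F" if "i < m" for i using aC bC a(2) that by (simp add: cF)
 have "\<exists>B1\<ge>1. \<forall>\<mu>. nrm F (power_product F m (%i. (a i, b i)) \<mu>) <= B1"
 proof (rule F.power_product_bounded[OF abF])
  fix i assume i: "i < m"
  have pw: "(a i, b i) [^]\<^sub>F l = (a i [^]\<^sub>A l, b i [^]\<^sub>B' l)" for l :: nat
   by (induction l) (simp_all add: oF mF)
  obtain Ba where "!!l::nat. nrm A (a i [^]\<^sub>A l) <= Ba" using spectral_power_bounded[OF sA a(1)[OF i]] by blast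
  thus "\<exists>B1. \<forall>l::nat. nrm F ((a i, b i) [^]\<^sub>F l) <= B1" unfolding pw nF
   using b_pow[OF i] by (intro exI[of _ "max Ba D'"] allI max.mono)
 qed
 then obtain B1 where B1: "1 <= B1" "!!\<mu>. nrm F (power_product F m (%i. (a i, b i)) \<mu>) <= B1" by blast
 interpret E1: tate_eval K v F m "%i. (a i, b i)" B1
  by (intro tate_eval.intro tate_eval_axioms.intro tate_field_axioms bF abF B1)
 define \<alpha> where "\<alpha> f = fst (E1.ev f)" for f
 have \<alpha>_hom: "banach_algebra_hom K (tate m) A \<alpha>" unfolding \<alpha>_def
  by (rule banach_algebra_hom_comp[OF E1.ev_algebra_hom pr1 F.norm_nonneg])
 interpret \<alpha>: banach_hom "tate m" gnorm A "nrm A" \<alpha> by (rule tate_hom[OF bA \<alpha>_hom])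
 have snd_ev: "snd (E1.ev f) = \<sigma>' f" if f: "f \<in> series m" for f
  by (rule tate_hom_unique[OF bB' banach_algebra_hom_comp[OF E1.ev_algebra_hom pr2 F.norm_nonneg] \<sigma>'(1) _ f])
   (use E1.ev_var in \<open>simp_all add: b_def\<close>)
 have \<alpha>_var: "\<alpha> (monom \<one> {#i#}) = a i" if "i < m" for i using E1.ev_var[OF that] by (simp add: \<alpha>_def)
 define h where "h f = \<psi> (\<sigma>' f)" for f
 have h_hom: "banach_algebra_hom K (tate m) B h" unfolding h_def
  by (rule banach_algebra_hom_comp[OF \<sigma>'(1) \<psi> B'.norm_nonneg])
 interpret h: banach_hom "tate m" gnorm B "nrm B" h by (rule tate_hom[OF bB h_hom])
 have \<phi>\<alpha>: "\<phi> (\<alpha> f) = h f" if f: "f \<in> series m" for f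
 proof -
  have "(fst (E1.ev f), snd (E1.ev f)) \<in> carrier F" using E1.ev_closed[OF f] by simp
  thus ?thesis unfolding snd_ev[OF f] cF \<alpha>_def h_def by blast
 qed
 obtain E k0 where E: "finite E" "E \<subseteq> carrier B" "0 <= k0" "!!y. y \<in> carrier B ==> y \<in> \<psi>.lc {\<zero>\<^sub>B} E (k0 * nrm B y)"
  using finite_admissible_combs[OF B'.banach_ring_axioms B.banach_ring_axioms \<psi>.banach_hom_axioms fin] by blast
 have Eh: "y \<in> h.lc {\<zero>\<^sub>B} E ((kB' * k0) * nrm B y)" if y: "y \<in> carrier B" for y
 proof -
  have "z \<in> h.lc {\<zero>\<^sub>B} E (kB' * c)" if "z \<in> \<psi>.lc {\<zero>\<^sub>B} E c" for z c using that
  proof induction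
   case (base j) thus ?case by (rule combs.base)
  next
   case (step z w x)
   obtain f where f: "f \<in> series m" "\<sigma>' f = x" "gnorm f <= kB' * nrm B' x" using \<sigma>'(3)[OF step(3)] by blast
   have "kB' * nrm B' x <= kB' * c" using step(4) \<sigma>'(2) by (intro mult_left_mono)
   hence "gnorm f <= kB' * c" using f(3) by linarith
   have hf: "h f = \<psi> x" by (simp add: h_def f(2))
   show ?case using combs.step[where h = h, OF step(5) step(2) f(1) \<open>gnorm f <= kB' * c\<close>] unfolding hf .
  qed
  from this[OF E(4)[OF y]] show ?thesis by (simp add: mult_ac)
 qed
 have k00: "0 <= kB' * k0" using \<sigma>'(2) E(3) by simp
 have finB: "h.finite_mod {\<zero>\<^sub>B}" unfolding h.finite_mod_def using E(1,2) k00 Eh by blast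

 \<comment> \<open>monomials in the topological generators of \<open>A\<close>; their images generate \<open>B\<close> over \<open>T\<^sub>m\<close>\<close>
 define sm where "sm \<nu> = \<sigma> (monom \<one> \<nu>)" for \<nu>
 define SM where "SM = sm ` {\<nu>. set_mset \<nu> \<subseteq> {..<n}}"
 have smC: "sm \<nu> \<in> carrier A" if "set_mset \<nu> \<subseteq> {..<n}" for \<nu> unfolding sm_def by (rule s.hom_closed[OF mon[OF that]])
 have SM: "SM \<subseteq> carrier A" using smC by (auto simp: SM_def)
 have sm_add: "sm (\<mu> + \<nu>) = sm \<mu> \<otimes>\<^sub>A sm \<nu>" if "set_mset \<mu> \<subseteq> {..<n}" "set_mset \<nu> \<subseteq> {..<n}" for \<mu> \<nu>
 proof -
  have "monom \<one> \<mu> *\<^sub>n monom \<one> \<nu> = monom \<one> (\<mu> + \<nu>)" using monom_monom_mult[OF one_closed one_closed that(2)] by simp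
  thus ?thesis unfolding sm_def s.hom_mult[OF mon[OF that(1)] mon[OF that(2)], symmetric] by (simp only:)
 qed
 have sm0: "sm {#} = \<one>\<^sub>A"
 proof -
  have "monom \<one> {#} = \<one>\<^bsub>tate n\<^esub>" by (auto simp: monom_def fun_eq_iff)
  thus ?thesis unfolding sm_def using s.hom_one by (simp only:)
 qed
 have sm_rep: "sm (replicate_mset i j) = sm {#j#} [^]\<^sub>A i" if j: "j < n" for i j
 proof (induction i)
  case (Suc i)
  have "sm (replicate_mset i j + {#j#}) = sm (replicate_mset i j) \<otimes>\<^sub>A sm {#j#}"
   by (rule sm_add) (use j in auto)
  thus ?case using Suc by simp
 qed (simp add: sm0)
 have SM1: "\<one>\<^sub>A \<in> SM" unfolding SM_def using sm0 by (intro image_eqI[of _ _ "{#}"]) auto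
 have SM_mult: "u \<otimes>\<^sub>A w \<in> SM" if uw: "u \<in> SM" "w \<in> SM" for u w
 proof -
  obtain \<mu> \<nu> where "set_mset \<mu> \<subseteq> {..<n}" "u = sm \<mu>" "set_mset \<nu> \<subseteq> {..<n}" "w = sm \<nu>" using uw unfolding SM_def by blast
  thus ?thesis unfolding SM_def using sm_add by (intro image_eqI[of _ _ "\<mu> + \<nu>"]) auto
 qed
 have \<phi>SM: "\<phi> ` SM \<subseteq> carrier B" using SM by auto
 have "\<exists>V D. finite V & V \<subseteq> \<phi> ` SM & 0 <= D & (\<forall>y\<in>carrier B. y \<in> h.lc {\<zero>\<^sub>B} V (D * nrm B y))"
 proof (rule h.generators_from_dense_set[OF E(1,2) k00 Eh \<phi>SM])
  fix e r assume e: "e \<in> carrier B" and r: "0 < (r :: real)"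
  obtain x where x: "x \<in> carrier A" "\<phi> x = e" using surj e by (metis (no_types, lifting) image_iff)
  obtain f where f: "f \<in> series n" "\<sigma> f = x" using \<sigma>(3)[OF x(1)] by blast
  have im: "(%\<nu>. \<phi> (\<sigma> (monom \<one> \<nu>))) ` {\<nu>. set_mset \<nu> \<subseteq> {..<n}} = \<phi> ` SM" unfolding SM_def sm_def image_image ..
  from monomials_dense[OF bB h_hom banach_algebra_hom_comp[OF \<sigma>(1) \<phi> A.norm_nonneg] f(1) r, unfolded im f(2) x(2)]
  show "\<exists>c. \<exists>l\<in>h.lc {\<zero>\<^sub>B} (\<phi> ` SM) c. nrm B (e \<ominus>\<^sub>B l) <= r" by blast
 qed
 then obtain V D0 where V: "V \<subseteq> \<phi> ` SM" "0 <= D0" "!!y. y \<in> carrier B ==> y \<in> h.lc {\<zero>\<^sub>B} V (D0 * nrm B y)" by blast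

 have relation: "\<exists>w N l r. 1 <= N & w \<in> carrier A & \<phi> w = \<zero>\<^sub>B & l \<in> \<alpha>.lc {\<zero>\<^sub>A} {sm (replicate_mset i j) | i. i < N} 1 &
   r \<in> \<alpha>.lc {\<zero>\<^sub>A} SM (1 / 2) & sm (replicate_mset N j) = w \<oplus>\<^sub>A l \<oplus>\<^sub>A r" if j: "j < n" for j
 proof -
  define z where "z = sm {#j#}"
  have zA': "z \<in> carrier A" unfolding z_def by (rule smC) (use j in simp)
  define y where "y = \<phi> z"
  have y: "y \<in> carrier B" using zA' by (simp add: y_def)
  obtain Ds where Ds: "0 < Ds" "!!f. f \<in> series n ==> nrm A (\<sigma> f) <= Ds * gnorm f" using s.bound by blast
  obtain D\<phi> where D\<phi>: "0 < D\<phi>" "!!f. f \<in> carrier A ==> nrm B (\<phi> f) <= D\<phi> * nrm A f" using \<phi>.bound by blast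
  have ypow: "nrm B (y [^]\<^sub>B i) <= D\<phi> * Ds" for i :: nat
  proof -
   have r: "set_mset (replicate_mset i j) \<subseteq> {..<n}" using j by auto
   have "y [^]\<^sub>B i = \<phi> (sm (replicate_mset i j))" unfolding sm_rep[OF j] y_def z_def[symmetric]
    by (rule \<phi>.hom_pow[OF zA', symmetric])
   moreover have "nrm A (sm (replicate_mset i j)) <= Ds" using Ds(2)[OF mon[OF r]] by (simp add: sm_def var1)
   hence "D\<phi> * nrm A (sm (replicate_mset i j)) <= D\<phi> * Ds" using D\<phi>(1) by (intro mult_left_mono) auto
   ultimately show ?thesis using D\<phi>(2)[OF smC[OF r]] by simp
  qed
  have gr: "B.growth_le_one_mod {\<zero>\<^sub>B} y"
   by (rule B.growth_of_spectral[OF y B.spectral_of_power_bounded[OF y ypow]])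
  have ai: "h.almost_integral_mod {\<zero>\<^sub>B} y"
   using finite_over_tate[OF SNB y h.banach_hom_axioms B.zeroideal finB gr] by blast
  \<comment> \<open>small enough for the coefficients of \<open>p y\<close>, where \<open>y\<close> makes the degree positive\<close>
  define \<epsilon> where "\<epsilon> = 1 / (2 * (D0 + 1) * (nrm B y + 1))"
  have ny: "0 <= nrm B y" by (rule B.norm_nonneg[OF y])
  have \<epsilon>: "0 < \<epsilon>" using V(2) ny by (simp add: \<epsilon>_def)
  obtain N p where p: "p \<in> h.monic_values y N" "nrm B p <= \<epsilon>"
  proof -
   obtain N p where p: "p \<in> h.monic_values y N" "nrm B (p \<ominus>\<^sub>B \<zero>\<^sub>B) <= \<epsilon>"
    using ai \<epsilon> unfolding h.almost_integral_mod_def by blast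
   thus thesis using that h.monic_closed[OF y p(1)] by (simp add: B.minus_eq)
  qed
  have pB: "p \<in> carrier B" by (rule h.monic_closed[OF y p(1)])
  have "y \<in> h.monic_values y 1"
  proof -
   have "y = y [^]\<^sub>B (1::nat) \<ominus>\<^sub>B \<zero>\<^sub>B" using y by (simp add: B.minus_eq)
   moreover have "\<zero>\<^sub>B \<in> h.lc {\<zero>\<^sub>B} (h.pows y 1) 1" by (rule combs.base) simp
   ultimately show ?thesis unfolding h.monic_values_def by blast
  qed
  from h.monic_mult[OF y p(1) this]
  obtain z' where z': "z' \<in> h.lc {\<zero>\<^sub>B} (h.pows y (Suc N)) 1" "p \<otimes>\<^sub>B y = y [^]\<^sub>B Suc N \<ominus>\<^sub>B z'"
   unfolding h.monic_values_def by auto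
  define q where "q = p \<otimes>\<^sub>B y"
  have qB: "q \<in> carrier B" using pB y by (simp add: q_def)
  have z'B: "z' \<in> carrier B" by (rule h.lc_pows_closed[OF y z'(1)])
  have "nrm B q <= \<epsilon> * nrm B y" unfolding q_def by (rule B.norm_mult_bound[OF pB y p(2)]) simp
  hence "D0 * nrm B q <= D0 * (\<epsilon> * nrm B y)" using V(2) by (intro mult_left_mono)
  also have "\<dots> <= 1 / 2"
  proof -
   have "D0 * nrm B y <= (D0 + 1) * (nrm B y + 1)" using V(2) ny by (intro mult_mono) auto
   moreover have "0 < (D0 + 1) * (nrm B y + 1)" using V(2) ny by simp
   moreover have "D0 * (\<epsilon> * nrm B y) = (D0 * nrm B y) / (2 * ((D0 + 1) * (nrm B y + 1)))" by (simp add: \<epsilon>_def mult_ac) (simp add: algebra_simps)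
   ultimately show ?thesis by (simp add: divide_le_eq)
  qed
  finally have q: "q \<in> h.lc {\<zero>\<^sub>B} (\<phi> ` SM) (1 / 2)" by (rule combs_mono[OF V(3)[OF qB] order_refl V(1)])
  have lift: "\<alpha> f \<in> carrier A & \<phi> (\<alpha> f) = h f" if "f \<in> series m" for f
   using \<phi>\<alpha>[OF that] \<alpha>.hom_closed[OF that] by blast
  obtain r where r: "r \<in> \<alpha>.lc {\<zero>\<^sub>A} SM (1 / 2)" "r \<in> carrier A" "\<phi> r = q"
   using h.lc_lift[OF \<phi>.ring_hom_cring_axioms SM lift q] by blast
  let ?P = "{sm (replicate_mset i j) | i. i < Suc N}"
  have P: "?P \<subseteq> carrier A" using smC j by auto
  have "h.pows y (Suc N) = \<phi> ` ?P"
  proof -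
   have "y [^]\<^sub>B i = \<phi> (sm (replicate_mset i j))" for i :: nat unfolding sm_rep[OF j] y_def z_def[symmetric]
    by (rule \<phi>.hom_pow[OF zA', symmetric])
   thus ?thesis unfolding h.pows_def by auto
  qed
  with z'(1) have "z' \<in> h.lc {\<zero>\<^sub>B} (\<phi> ` ?P) 1" by (simp only:)
  then obtain l where l: "l \<in> \<alpha>.lc {\<zero>\<^sub>A} ?P 1" "l \<in> carrier A" "\<phi> l = z'"
   using h.lc_lift[OF \<phi>.ring_hom_cring_axioms P lift] by blast
  define S where "S = sm (replicate_mset (Suc N) j)"
  have S: "S \<in> carrier A" unfolding S_def by (rule smC) (use j in auto)
  have \<phi>S: "\<phi> S = y [^]\<^sub>B Suc N" unfolding S_def sm_rep[OF j] y_def z_def[symmetric] by (rule \<phi>.hom_pow[OF zA'])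
  define w where "w = (S \<ominus>\<^sub>A l) \<ominus>\<^sub>A r"
  have w: "w \<in> carrier A" using S l r by (simp add: w_def)
  have "\<phi> w = (\<phi> S \<ominus>\<^sub>B z') \<ominus>\<^sub>B q" using S l r by (simp add: w_def A.minus_eq B.minus_eq)
  also have "\<dots> = \<zero>\<^sub>B" using z'(2) qB unfolding \<phi>S q_def[symmetric] by simp
  finally have "\<phi> w = \<zero>\<^sub>B" .
  moreover have "S = w \<oplus>\<^sub>A l \<oplus>\<^sub>A r" unfolding w_def using S l(2) r(2) by algebra
  ultimately show ?thesis using w l(1) r(1) unfolding S_def
   by (intro exI[of _ w] exI[of _ "Suc N"] exI[of _ l] exI[of _ r]) simp
 qed
 have "\<exists>w. \<forall>j\<in>{..<n}. \<exists>N l r. 1 <= N & w j \<in> carrier A & \<phi> (w j) = \<zero>\<^sub>B & l \<in> \<alpha>.lc {\<zero>\<^sub>A} {sm (replicate_mset i j) | i. i < N} 1 &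
   r \<in> \<alpha>.lc {\<zero>\<^sub>A} SM (1 / 2) & sm (replicate_mset N j) = w j \<oplus>\<^sub>A l \<oplus>\<^sub>A r"
  by (intro bchoice ballI) (use relation in blast)
 then obtain w where w: "!!j. j < n ==> \<exists>N l r. 1 <= N & w j \<in> carrier A & \<phi> (w j) = \<zero>\<^sub>B &
   l \<in> \<alpha>.lc {\<zero>\<^sub>A} {sm (replicate_mset i j) | i. i < N} 1 &
   r \<in> \<alpha>.lc {\<zero>\<^sub>A} SM (1 / 2) & sm (replicate_mset N j) = w j \<oplus>\<^sub>A l \<oplus>\<^sub>A r" by blast
 have wC: "w j \<in> carrier A" "\<phi> (w j) = \<zero>\<^sub>B" if "j < n" for j using w[OF that] by blast+

 \<comment> \<open>a bounded multiplicative set that contains all \<open>a i\<close> and \<open>w j\<close>\<close>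
 define X1 where "X1 = \<alpha>.lc {\<zero>\<^sub>A} SM 1"
 have X1C: "X1 \<subseteq> carrier A" using \<alpha>.lc_carrier[OF _ _ SM] by (auto simp: X1_def)
 have wX1: "w j \<in> X1" if j: "j < n" for j
 proof -
  obtain N l r where wl: "l \<in> \<alpha>.lc {\<zero>\<^sub>A} {sm (replicate_mset i j) | i. i < N} 1" "r \<in> \<alpha>.lc {\<zero>\<^sub>A} SM (1 / 2)"
   "sm (replicate_mset N j) = w j \<oplus>\<^sub>A l \<oplus>\<^sub>A r" using w[OF j] by blast
  have rep: "sm (replicate_mset i j) \<in> SM" for i unfolding SM_def by (rule imageI) (use j in auto)
  have sub: "{sm (replicate_mset i j) | i. i < N} \<subseteq> SM" using rep by blast
  have l: "l \<in> X1" unfolding X1_def by (rule combs_mono[OF wl(1) order_refl sub order_refl])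
  have r: "r \<in> X1" unfolding X1_def by (rule combs_mono[OF wl(2) order_refl order_refl]) simp
  have S: "sm (replicate_mset N j) \<in> X1" unfolding X1_def using rep SM by (intro \<alpha>.lc_elem zA) auto
  have "w j = sm (replicate_mset N j) \<ominus>\<^sub>A l \<ominus>\<^sub>A r" unfolding wl(3)
  proof -
   have "l \<in> carrier A" "r \<in> carrier A" "w j \<in> carrier A" using l r X1C wC(1)[OF j] by auto
   thus "w j = w j \<oplus>\<^sub>A l \<oplus>\<^sub>A r \<ominus>\<^sub>A l \<ominus>\<^sub>A r" by algebra
  qed
  thus ?thesis using l r S unfolding X1_def by (metis \<alpha>.lc_diff[OF _ _ zA SM])
 qed
 have X1_mult: "u \<otimes>\<^sub>A u' \<in> X1" if "u \<in> X1" "u' \<in> X1" for u u'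
  using \<alpha>.lc_mult[OF that[unfolded X1_def] A.zeroideal SM SM SM_mult SM] by (simp add: X1_def)
 have X1_one: "\<one>\<^sub>A \<in> X1" unfolding X1_def using SM1 by (intro \<alpha>.lc_elem zA) auto
 obtain Ds where Ds: "0 < Ds" "!!f. f \<in> series n ==> nrm A (\<sigma> f) <= Ds * gnorm f" using s.bound by blast
 have smD: "nrm A (sm \<nu>) <= Ds" if "set_mset \<nu> \<subseteq> {..<n}" for \<nu> using Ds(2)[OF mon[OF that]] by (simp add: sm_def var1)
 obtain D\<alpha> where D\<alpha>: "0 < D\<alpha>" "!!f. f \<in> series m ==> nrm A (\<alpha> f) <= D\<alpha> * gnorm f" using \<alpha>.bound by blast
 have X1_norm: "nrm A u <= D\<alpha> * Ds" if "u \<in> X1" for u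
 proof -
  have "nrm A u <= D\<alpha> * 1 * Ds"
   by (rule \<alpha>.lc_norm[OF that[unfolded X1_def] SM _ _ D\<alpha>(2)]) (use D\<alpha>(1) Ds(1) smD in \<open>auto simp: SM_def\<close>)
  thus ?thesis by simp
 qed
 have \<alpha>X1: "\<alpha> f \<in> X1" if f: "f \<in> series m" "gnorm f <= 1" for f
  using \<alpha>.lc_single[OF zA SM1 A.one_closed f] \<alpha>.hom_closed[OF f(1)] by (simp add: X1_def)
 define Y where "Y = {(u, \<sigma>' f) | u f. (u, \<sigma>' f) \<in> carrier F & u \<in> X1 & f \<in> series m & gnorm f <= 1}"
 define x2 where "x2 i = (if i < m then (a i, b i) else (w (i - m), \<zero>\<^sub>B'))" for i
 have x2Y: "x2 i \<in> Y" if i: "i < m + n" for i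
 proof (cases "i < m")
  case True
  have "a i \<in> X1" using \<alpha>X1[OF var[OF True]] \<alpha>_var[OF True] by (simp add: var1)
  thus ?thesis unfolding Y_def x2_def using True abF[OF True] var[OF True]
   by (auto simp: b_def var1 intro!: exI[of _ "monom \<one> {#i#}"])
 next
  case False
  hence j: "i - m < n" using i by simp
  have "\<sigma>' \<zero>\<^bsub>tate m\<^esub> = \<zero>\<^sub>B'" by (rule s'.hom_zero)
  moreover have "gnorm \<zero>\<^bsub>tate m\<^esub> <= 1" using gnorm_zero by simp
  moreover have "(w (i - m), \<zero>\<^sub>B') \<in> carrier F" using wC[OF j] by (simp add: cF)
  ultimately show ?thesis unfolding Y_def x2_def using False wX1[OF j] T.zero_closed[of m]
   by (intro CollectI exI[of _ "w (i - m)"] exI[of _ "\<zero>\<^bsub>tate m\<^esub>"]) (simp del: tate_simps)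
 qed
 have YC: "Y \<subseteq> carrier F" by (auto simp: Y_def)
 have Y_one: "\<one>\<^sub>F \<in> Y" unfolding Y_def using F.one_closed X1_one s'.hom_one T.norm_one_le[of m] T.one_closed[of m] unfolding oF
  by (intro CollectI exI[of _ "\<one>\<^sub>A"] exI[of _ "\<one>\<^bsub>tate m\<^esub>"]) (simp del: tate_simps)
 have Y_mult: "u \<otimes>\<^sub>F u' \<in> Y" if u: "u \<in> Y" and u': "u' \<in> Y" for u u'
 proof -
  obtain t f where tf: "u = (t, \<sigma>' f)" "u \<in> carrier F" "t \<in> X1" "f \<in> series m" "gnorm f <= 1" using u unfolding Y_def by blast
  obtain t' f' where tf': "u' = (t', \<sigma>' f')" "u' \<in> carrier F" "t' \<in> X1" "f' \<in> series m" "gnorm f' <= 1" using u' unfolding Y_def by blast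
  have "u \<otimes>\<^sub>F u' = (t \<otimes>\<^sub>A t', \<sigma>' (f *\<^sub>m f'))" unfolding s'.hom_mult[OF tf(4) tf'(4)] tf(1) tf'(1) mF ..
  moreover have "gnorm (f *\<^sub>m f') <= 1" using T.norm_mult_bound[OF tf(4) tf'(4) tf(5) tf'(5)] by simp
  ultimately show ?thesis unfolding Y_def using F.m_closed[OF tf(2) tf'(2)] X1_mult[OF tf(3) tf'(3)] T.m_closed[OF tf(4) tf'(4)]
   by (intro CollectI exI[of _ "t \<otimes>\<^sub>A t'"] exI[of _ "f *\<^sub>m f'"]) (simp del: tate_simps)
 qed
 define B2 where "B2 = max 1 (max (D\<alpha> * Ds) D')"
 have Y_norm: "nrm F u <= B2" if "u \<in> Y" for u
 proof -
  obtain t f where tf: "u = (t, \<sigma>' f)" "t \<in> X1" "f \<in> series m" "gnorm f <= 1" using \<open>u \<in> Y\<close> unfolding Y_def by blast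
  have "D\<alpha> * Ds <= B2" "D' <= B2" by (simp_all add: B2_def)
  thus ?thesis unfolding tf(1) nF using X1_norm[OF tf(2)] ball_bound[OF tf(3,4)] by (intro max.boundedI) linarith+
 qed
 interpret E2: tate_eval K v F "m + n" x2 B2
 proof (intro tate_eval.intro tate_eval_axioms.intro tate_field_axioms bF)
  show "x2 i \<in> carrier F" if "i < m + n" for i using x2Y[OF that] YC by blast
  show "nrm F (power_product F (m + n) x2 \<mu>) <= B2" for \<mu>
   by (rule Y_norm[OF F.power_product_in_submonoid[OF YC Y_one Y_mult x2Y]])
 qed (simp add: B2_def)
 interpret e2: banach_hom "tate (m + n)" gnorm F "nrm F" E2.ev by (rule E2.ev_banach_hom)
 have ext: "E2.ev f = E1.ev f" if f: "f \<in> series m" for f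
  by (rule tate_hom_unique[OF bF tate_hom_restrict[OF E2.ev_algebra_hom] E1.ev_algebra_hom _ f])
   (use E2.ev_var E1.ev_var in \<open>simp_all add: x2_def\<close>)
 define \<Theta> where "\<Theta> f = fst (E2.ev f)" for f
 have \<Theta>_hom: "banach_algebra_hom K (tate (m + n)) A \<Theta>" unfolding \<Theta>_def
  by (rule banach_algebra_hom_comp[OF E2.ev_algebra_hom pr1 F.norm_nonneg])
 interpret \<Theta>: banach_hom "tate (m + n)" gnorm A "nrm A" \<Theta> by (rule tate_hom[OF bA \<Theta>_hom])
 have \<alpha>\<Theta>: "z \<in> \<Theta>.lc {\<zero>\<^sub>A} U c" if "z \<in> \<alpha>.lc {\<zero>\<^sub>A} U c" for z U c using that
 proof induction
  case (base j) thus ?case by (rule combs.base)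
 next
  case (step z u f)
  have e: "\<alpha> f = \<Theta> f" unfolding \<alpha>_def \<Theta>_def ext[OF step(3)] ..
  have "f \<in> series (m + n)" by (rule tate_mono[OF step(3)]) simp
  from combs.step[where h = \<Theta>, OF step(5) step(2) this step(4)] show ?case unfolding e .
 qed
 have "\<exists>W kk. finite W & W \<subseteq> carrier A & 0 <= kk & (\<forall>y\<in>carrier A. y \<in> \<Theta>.lc {\<zero>\<^sub>A} W (kk * nrm A y))"
 proof (rule \<Theta>.finite_by_monomial_reduction[of n sm Ds "kA + 1", OF smC smD sm_add])
  fix j assume j: "j < n"
  obtain N l r where wl: "1 <= N" "l \<in> \<alpha>.lc {\<zero>\<^sub>A} {sm (replicate_mset i j) | i. i < N} 1" "r \<in> \<alpha>.lc {\<zero>\<^sub>A} SM (1 / 2)"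
   "sm (replicate_mset N j) = w j \<oplus>\<^sub>A l \<oplus>\<^sub>A r" using w[OF j] by blast
  define t where "t = monom \<one> {#m + j#}"
  have t: "t \<in> series (m + n)" "gnorm t <= 1" unfolding t_def using var[of "m + j" "m + n"] j by (simp_all add: var1)
  have "\<Theta> t = w j" unfolding \<Theta>_def t_def using E2.ev_var[of "m + j"] j by (simp add: x2_def)
  hence e: "sm (replicate_mset N j) = \<Theta> t \<oplus>\<^sub>A l \<oplus>\<^sub>A r" using wl(4) by simp
  show "\<exists>N'\<ge>1. \<exists>t\<in>series (m + n). gnorm t <= 1 & (\<exists>l\<in>\<Theta>.lc {\<zero>\<^sub>A} {sm (replicate_mset i j) | i. i < N'} 1.
   \<exists>r\<in>\<Theta>.lc {\<zero>\<^sub>A} (sm ` {\<nu>. set_mset \<nu> \<subseteq> {..<n}}) (1 / 2). sm (replicate_mset N' j) = \<Theta> t \<oplus>\<^sub>A l \<oplus>\<^sub>A r)"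
   by (rule exI[of _ N], rule conjI, rule wl(1), rule bexI[OF _ t(1)], rule conjI, rule t(2),
     rule bexI[OF _ \<alpha>\<Theta>[OF wl(2)]], rule bexI[OF _ \<alpha>\<Theta>[OF wl(3)[unfolded SM_def]]], rule e)
 next
  fix y r assume y: "y \<in> carrier A" and r: "0 < (r :: real)"
  obtain f where f: "f \<in> series n" "\<sigma> f = y" "gnorm f <= kA * nrm A y" using \<sigma>(3)[OF y] by blast
  have le: "gnorm f <= (kA + 1) * nrm A y" using f(3) A.norm_nonneg[OF y] by (simp add: distrib_right)
  obtain l where l: "l \<in> \<Theta>.lc {\<zero>\<^sub>A} (sm ` {\<nu>. set_mset \<nu> \<subseteq> {..<n}}) (gnorm f)" "nrm A (y \<ominus>\<^sub>A l) <= r"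
   using monomials_dense[OF bA \<Theta>_hom \<sigma>(1) f(1) r] unfolding f(2) sm_def by blast
  show "\<exists>l\<in>\<Theta>.lc {\<zero>\<^sub>A} (sm ` {\<nu>. set_mset \<nu> \<subseteq> {..<n}}) ((kA + 1) * nrm A y). nrm A (y \<ominus>\<^sub>A l) <= r"
   using combs_mono[OF l(1) order_refl order_refl le] l(2) by blast
 qed (use Ds(1) \<sigma>(2) in auto)
 then obtain W kk where W: "finite W" "W \<subseteq> carrier A" "0 <= kk" "!!y. y \<in> carrier A ==> y \<in> \<Theta>.lc {\<zero>\<^sub>A} W (kk * nrm A y)"
  by blast

 \<comment> \<open>the kernel of \<open>\<phi>\<close> is finite over \<open>T\<^sub>m\<^sub>+\<^sub>n\<close>\<close>
 define I where "I = {u \<in> carrier A. \<phi> u = \<zero>\<^sub>B}"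
 have "ring_hom_ring A B \<phi>"
  by (intro ring_hom_ring.intro ring_hom_ring_axioms.intro A.ring_axioms B.ring_axioms \<phi>.homh)
 from ring_hom_ring.kernel_is_ideal[OF this] have I: "ideal I A" unfolding I_def a_kernel_def' .
 obtain G kG where G: "finite G" "G \<subseteq> I" "0 <= kG" "!!x. x \<in> I ==> x \<in> combs A (nrm A) A id {\<zero>\<^sub>A} G (kG * nrm A x)"
  by (rule A.strictly_noetherianE[OF SNA I], rule that) simp_all
 have GA: "G \<subseteq> carrier A" using G(2) by (auto simp: I_def)
 define Z where "Z = (%(g, u). g \<otimes>\<^sub>A u) ` (G \<times> W)"
 have ZI: "Z \<subseteq> I"
 proof
  fix z assume "z \<in> Z"
  then obtain g u where "g \<in> G" "u \<in> W" and z: "z = g \<otimes>\<^sub>A u" unfolding Z_def by auto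
  hence gu: "g \<in> I" "u \<in> carrier A" using G(2) W(2) by (simp_all add: subset_iff)
  show "z \<in> I" unfolding z by (rule ideal.I_r_closed[OF I gu])
 qed
 have ZA: "Z \<subseteq> carrier A" using ZI by (auto simp: I_def)
 have finZ: "finite Z" unfolding Z_def using G(1) W(1) by simp
 have IZ: "x \<in> \<Theta>.lc {\<zero>\<^sub>A} Z ((kk * kG) * nrm A x)" if x: "x \<in> I" for x
 proof -
  have "z \<in> \<Theta>.lc {\<zero>\<^sub>A} Z (kk * c)" if "z \<in> combs A (nrm A) A id {\<zero>\<^sub>A} G c" for z c using that
  proof induction
   case (base j) thus ?case by (rule combs.base)
  next
   case (step z g y)
   have "kk * nrm A y <= kk * c" using step(4) W(3) by (intro mult_left_mono)
   hence y: "y \<in> \<Theta>.lc {\<zero>\<^sub>A} W (kk * c)" by (rule combs_mono[OF W(4)[OF step(3)] order_refl order_refl])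
   have gA: "g \<in> carrier A" using step(2) GA by blast
   have "g \<otimes>\<^sub>A y \<in> \<Theta>.lc {\<zero>\<^sub>A} ((%u. g \<otimes>\<^sub>A u) ` W) (kk * c)" by (rule \<Theta>.lc_mult_right[OF y A.zeroideal W(2) gA])
   hence "g \<otimes>\<^sub>A y \<in> \<Theta>.lc {\<zero>\<^sub>A} Z (kk * c)"
    by (rule combs_mono[OF _ order_refl _ order_refl]) (use step(2) in \<open>auto simp: Z_def\<close>)
   thus ?case using \<Theta>.lc_add[OF step(5) _ zA ZA] A.m_comm[OF gA step(3)] by simp
  qed
  from this[OF G(4)[OF x]] show ?thesis by (simp add: mult_ac)
 qed
 define W' where "W' = insert \<one>\<^sub>F ((%z. (z, \<zero>\<^sub>B')) ` Z)"
 have W': "finite W'" "W' \<subseteq> carrier F" using finZ ZI F.one_closed by (auto simp: W'_def I_def cF)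
 have emb: "z \<in> carrier A & \<phi> z = \<zero>\<^sub>B & (z, \<zero>\<^sub>B') \<in> e2.lc {\<zero>\<^sub>F} W' c" if "z \<in> \<Theta>.lc {\<zero>\<^sub>A} Z c" for z c using that
 proof induction
  case (base j)
  hence "j = \<zero>\<^sub>A" by simp
  moreover have "(\<zero>\<^sub>A, \<zero>\<^sub>B') \<in> e2.lc {\<zero>\<^sub>F} W' c" by (rule combs.base) (simp add: zF)
  ultimately show ?case by simp
 next
  case (step z u f)
  have u: "u \<in> carrier A" "\<phi> u = \<zero>\<^sub>B" using step(2) ZI by (auto simp: I_def)
  have ev: "E2.ev f = (\<Theta> f, snd (E2.ev f))" by (simp add: \<Theta>_def)
  have "snd (E2.ev f) \<in> carrier B'" using E2.ev_closed[OF step(3)] cF[of "\<Theta> f" "snd (E2.ev f)"] ev by simp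
  hence "(z, \<zero>\<^sub>B') \<oplus>\<^sub>F E2.ev f \<otimes>\<^sub>F (u, \<zero>\<^sub>B') = (z \<oplus>\<^sub>A \<Theta> f \<otimes>\<^sub>A u, \<zero>\<^sub>B')"
   by (subst ev) (simp add: aF mF)
  moreover have "(z, \<zero>\<^sub>B') \<oplus>\<^sub>F E2.ev f \<otimes>\<^sub>F (u, \<zero>\<^sub>B') \<in> e2.lc {\<zero>\<^sub>F} W' c"
   using step by (intro combs.step) (auto simp: W'_def)
  ultimately show ?case using step(5) u \<Theta>.hom_closed[OF step(3)] by simp
 qed
 define k1 where "k1 = 1 + D\<alpha> * kB'"
 define k2 where "k2 = kk * kG"
 have k12: "1 <= k1" "0 <= k2" using D\<alpha>(1) \<sigma>'(2) W(3) G(3) by (simp_all add: k1_def k2_def)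
 define kF where "kF = max (k2 * k1) kB'"
 have finF: "y \<in> e2.lc {\<zero>\<^sub>F} W' (kF * nrm F y)" if y: "y \<in> carrier F" for y
 proof -
  obtain u u' where uu: "y = (u, u')" by (cases y)
  have u: "u \<in> carrier A" "u' \<in> carrier B'" "\<phi> u = \<psi> u'" using y by (simp_all add: uu cF)
  have ny: "nrm A u <= nrm F y" "nrm B' u' <= nrm F y" "0 <= nrm F y" using F.norm_nonneg[OF y] by (simp_all add: uu nF)
  obtain f where f: "f \<in> series m" "\<sigma>' f = u'" "gnorm f <= kB' * nrm B' u'" using \<sigma>'(3)[OF u(2)] by blast
  have "kB' * nrm B' u' <= kB' * nrm F y" using ny(2) \<sigma>'(2) by (intro mult_left_mono)
  hence fn: "gnorm f <= kB' * nrm F y" using f(3) by linarith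
  define x where "x = u \<ominus>\<^sub>A \<alpha> f"
  have \<alpha>f: "\<alpha> f \<in> carrier A" by (rule \<alpha>.hom_closed[OF f(1)])
  have "\<phi> x = \<phi> u \<ominus>\<^sub>B \<phi> (\<alpha> f)" using u(1) \<alpha>f by (simp add: x_def A.minus_eq B.minus_eq)
  hence xI: "x \<in> I" using u \<alpha>f \<phi>\<alpha>[OF f(1)] f(2) by (simp add: I_def x_def h_def)
  have "D\<alpha> * gnorm f <= D\<alpha> * (kB' * nrm F y)" using fn D\<alpha>(1) by (intro mult_left_mono) auto
  hence "nrm A (\<alpha> f) <= D\<alpha> * kB' * nrm F y" using D\<alpha>(2)[OF f(1)] by (simp add: mult_ac)
  hence "nrm A x <= k1 * nrm F y" unfolding x_def using ny D\<alpha>(1) \<sigma>'(2) u(1) \<alpha>f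
   by (intro A.norm_diff_le) (auto simp: k1_def distrib_right intro: add_increasing add_increasing2)
  hence "k2 * nrm A x <= k2 * (k1 * nrm F y)" using k12(2) by (intro mult_left_mono)
  also have "\<dots> = (k2 * k1) * nrm F y" by simp
  also have "\<dots> <= kF * nrm F y" using ny(3) by (intro mult_right_mono) (simp_all add: kF_def)
  finally have xl: "x \<in> \<Theta>.lc {\<zero>\<^sub>A} Z (kF * nrm F y)"
   by (rule combs_mono[OF IZ[OF xI] order_refl order_refl, folded k2_def])
  have "kB' * nrm F y <= kF * nrm F y" using ny(3) by (intro mult_right_mono) (simp_all add: kF_def)
  hence fn': "gnorm f <= kF * nrm F y" using fn by linarith
  have fmn: "f \<in> series (m + n)" by (rule tate_mono[OF f(1)]) simp
  have "(x, \<zero>\<^sub>B') \<oplus>\<^sub>F E2.ev f \<otimes>\<^sub>F \<one>\<^sub>F \<in> e2.lc {\<zero>\<^sub>F} W' (kF * nrm F y)"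
   using emb[OF xl] fmn fn' by (intro combs.step) (auto simp: W'_def)
  moreover have "(x, \<zero>\<^sub>B') \<oplus>\<^sub>F E2.ev f \<otimes>\<^sub>F \<one>\<^sub>F = y"
  proof -
   have "E2.ev f = (\<alpha> f, u')" unfolding ext[OF f(1)] using snd_ev[OF f(1)] f(2) by (simp add: \<alpha>_def prod_eq_iff)
   thus ?thesis using u \<alpha>f by (simp add: uu aF mF oF x_def)
  qed
  ultimately show ?thesis by simp
 qed
 have "0 <= kF" using k12 by (simp add: kF_def le_max_iff_disj)
 from E2.affinoid_if_finite[OF nontrivial W' this finF] show ?thesis unfolding F_def .
qed

end

theorem theorem2p2p1:
  fixes K :: "'k ring" and v :: "'k \<Rightarrow> real"
    and A :: "('k, 'a) normed_module" and B :: "('k, 'b) normed_module"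
    and B' :: "('k, 'c) normed_module"
    and \<phi> :: "'a \<Rightarrow> 'b" and \<psi> :: "'c \<Rightarrow> 'b"
  assumes "analytic_field K v"
    and nontrivial: "\<exists>c\<in>carrier K. c \<noteq> \<zero>\<^bsub>K\<^esub> \<and> v c \<noteq> 1"
    and "strictly_affinoid_algebra K v A"
    and "strictly_affinoid_algebra K v B"
    and "strictly_affinoid_algebra K v B'"
    and "banach_algebra_hom K B' B \<psi>"
    and "banach_algebra_hom K A B \<phi>"
    and "finite_admissible B' B \<psi>"
    and "\<phi> ` carrier A = carrier B"
    and "\<psi> ` spectral_unit_ball B' \<subseteq> \<phi> ` spectral_unit_ball A"
  shows "affinoid_algebra K v (fiber_product A B' \<phi> \<psi>)"
proof -
  interpret tate_field K v using assms(1) by (rule tate_field.intro)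
  show ?thesis by (rule fiber_product_affinoid[OF assms(2-10)])
qed

end
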